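(* Assume (A1)--(A4), and let $\phi$ and $\phi_h$ denote the solutions of the weak instationary problem (IP) and of its Galerkin semi-discretization (SD), respectively, with the same data $q$ and $\phi_0$. Then, for $0\le t\le T$, $$\|\phi(t)-\phi_h(t)\|_{L^2(\mathcal{D})}\le C\Big(\inf_{\widehat\psi_h}\|\phi_0-\widehat\psi_h\|_{\mathbb{W}^+\oplus\mathbb{V}^-}+\inf_{\widehat\psi_h}\|\phi(t)-\widehat\psi_h\|_{\mathbb{W}^+\oplus\mathbb{V}^-}+\int_0^t\inf_{\widehat\psi_h}\|\partial_t\phi(t')-\widehat\psi_h\|_{\mathbb{W}^+\oplus\mathbb{V}^-}\,dt'\Big),$$ where each infimum is taken over all $\widehat\psi_h\in\mathbb{W}_h^+\oplus\mathbb{V}_h^-$. The constant $C$ is independent of $\phi$, $q$, $\phi_0$, $t$ and of the choice of the spaces $\mathbb{W}_h^+,\mathbb{V}_h^-$ satisfying (A3)--(A4) (it may depend on $\mathcal{R}$, $T$, $\overline k$, $\underline\sigma_a$, $\overline\sigma_a$).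
   Context: Let $\mathcal{R}\subset\mathbb{R}^3$ be a bounded Lipschitz domain with outward unit normal $n=n(r)$, $\mathcal{S}^2$ the unit sphere in $\mathbb{R}^3$, $\mathcal{D}=\mathcal{R}\times\mathcal{S}^2$, $\partial\mathcal{D}=\partial\mathcal{R}\times\mathcal{S}^2$, and $T>0$. The gradient $\nabla$ acts on $r$; $(\cdot,\cdot)_M$ is the integral over $M$ of the product of two functions. Spaces: $\mathbb{V}=L^2(\mathcal{D})$; $\mathbb{W}=\{v\in L^2(\mathcal{D}): s\cdot\nabla v\in L^2(\mathcal{D}),\ |s\cdot n|^{1/2}v\in L^2(\partial\mathcal{D})\}$ with norm $\|v\|_{\mathbb{W}}^2=\|v\|_{L^2(\mathcal{D})}^2+\|s\cdot\nabla v\|_{L^2(\mathcal{D})}^2+\||s\cdot n|^{1/2}v\|_{L^2(\partial\mathcal{D})}^2$. Even and odd parts are $\phi^\pm(r,s)=\frac12(\phi(r,s)\pm\phi(r,-s))$; $\mathbb{V}^\pm,\mathbb{W}^\pm$ are the subspaces of functions even ($+$) or odd ($-$) in $s$. $\|\phi\|_{\mathbb{W}^+\oplus\mathbb{V}^-}^2=\|\phi^+\|_{\mathbb{W}}^2+\|\phi^-\|_{L^2(\mathcal{D})}^2$. $(\mathbb{W}^+)'$ is the dual of $\mathbb{W}^+$, with $\mathbb{V}^+\subset(\mathbb{W}^+)'$ via the $L^2$ scalar product, and $\langle\cdot,\cdot\rangle_{\mathcal{D}}$ is the duality product. Coefficients: $k\in L^\infty(\mathcal{R}\times[-1,1])$,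 $\sigma_t\in L^\infty(\mathcal{R})$, $\sigma_s(r)=\int_{\mathcal{S}^2}k(r,s\cdot s')\,ds$, $\sigma_a=\sigma_t-\sigma_s$, and $\mathcal{C}\phi(r,s)=\sigma_t(r)\phi(r,s)-\int_{\mathcal{S}^2}k(r,s\cdot s')\phi(r,s')\,ds'$. (A1) $0\le k(r,s\cdot s')\le\overline{k}$ for all $r,s,s'$, with a constant $\overline k$. (A2) $0<\underline{\sigma}_a\le\sigma_a(r)\le\overline{\sigma}_a$ for all $r\in\mathcal{R}$, with constants $\underline{\sigma}_a,\overline{\sigma}_a$. (A3) $\mathbb{W}_h^+\subset\mathbb{W}^+$ and $\mathbb{V}_h^-\subset\mathbb{V}^-$ are finite dimensional subspaces. (A4) $s\cdot\nabla\mathbb{W}_h^+\subset\mathbb{V}_h^-$. Problem (IP), for $q\in L^2(0,T;L^2(\mathcal{D}))$ and $\phi_0\in\mathbb{W}^+\oplus\mathbb{V}^-$: find $\phi=\phi^++\phi^-\in L^2(0,T;\mathbb{W}^+\oplus\mathbb{V}^-)\cap H^1(0,T;(\mathbb{W}^+)'\oplus\mathbb{V}^-)$ with $\phi(0)=\phi_0$ such that for all $\widehat\psi^+\in\mathbb{W}^+$, $\widehat\psi^-\in\mathbb{V}^-$ and almost every $t\in(0,T)$ $$\langle\partial_t\phi^+,\widehat\psi^+\rangle_{\mathcal{D}}-(\phi^-,s\cdot\nabla\widehat\psi^+)_{\mathcal{D}}+(|s\cdot n|\phi^+,\widehat\psi^+)_{\partial\mathcal{D}}+(\mathcal{C}\phi^+,\widehat\psi^+)_{\mathcal{D}}=(q^+,\widehat\psi^+)_{\mathcal{D}},$$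 $$(\partial_t\phi^-,\widehat\psi^-)_{\mathcal{D}}+(s\cdot\nabla\phi^+,\widehat\psi^-)_{\mathcal{D}}+(\mathcal{C}\phi^-,\widehat\psi^-)_{\mathcal{D}}=(q^-,\widehat\psi^-)_{\mathcal{D}}.$$ Bilinear form: $B(\phi;\psi)=(|s\cdot n|\phi^+,\psi^+)_{\partial\mathcal{D}}+(\mathcal{C}\phi,\psi)_{\mathcal{D}}-(\phi^-,s\cdot\nabla\psi^+)_{\mathcal{D}}+(s\cdot\nabla\phi^+,\psi^-)_{\mathcal{D}}$ for $\phi,\psi\in\mathbb{W}^+\oplus\mathbb{V}^-$. The elliptic projection $\Pi_h:\mathbb{W}^+\oplus\mathbb{V}^-\to\mathbb{W}_h^+\oplus\mathbb{V}_h^-$ is defined by $B(\Pi_h\phi;\psi_h)=B(\phi;\psi_h)$ for all $\psi_h\in\mathbb{W}_h^+\oplus\mathbb{V}_h^-$. Problem (SD): find $\phi_h\in H^1(0,T;\mathbb{W}_h^+\oplus\mathbb{V}_h^-)$ with $\phi_h(0)=\Pi_h\phi_0$ such that $(\partial_t\phi_h(t),\widehat\psi_h)_{\mathcal{D}}+B(\phi_h(t);\widehat\psi_h)=(q(t),\widehat\psi_h)_{\mathcal{D}}$ for all $\widehat\psi_h\in\mathbb{W}_h^+\oplus\mathbb{V}_h^-$ and almost every $t\in(0,T)$. Convention: norms $\|\cdot\|_{\mathbb{W}^+\oplus\mathbb{V}^-}$ of elements not in $\mathbb{W}^+\oplus\mathbb{V}^-$ are understood as $+\infty$ (so the estimate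 is meaningful only for sufficiently regular $\phi$). *)

theory Defs
  imports "HOL-Analysis.Analysis" "HOL-Library.Function_Algebras"
begin

text \<open>
  Elements of $L^2$ are rendered as functions. Equality of classes is equality almost everywhere
  and norms are seminorms on functions. Functions (and functionals) form a real vector space
  under the pointwise operations.
\<close>

instantiation "fun" :: (type, scaleR) scaleR
begin
definition scaleR_fun :: "real \<Rightarrow> ('a \<Rightarrow> 'b) \<Rightarrow> 'a \<Rightarrow> 'b" where
  "scaleR_fun c f = (\<lambda>x. c *\<^sub>R f x)"
instance ..
end

instance "fun" :: (type, real_vector) real_vector
  by standard
    (auto simp: scaleR_fun_def fun_eq_iff plus_fun_def scaleR_add_right scaleR_add_left)

section \<open>Smooth functions and test functions\<close>

primrec cont_diff :: "nat \<Rightarrow> ('a::euclidean_space \<Rightarrow> real) \<Rightarrow> bool" where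
  "cont_diff 0 f \<longleftrightarrow> continuous_on UNIV f"
| "cont_diff (Suc m) f \<longleftrightarrow> (\<forall>x. f differentiable (at x)) \<and>
     (\<forall>v. cont_diff m (\<lambda>x. frechet_derivative f (at x) v))"

definition smooth :: "('a::euclidean_space \<Rightarrow> real) \<Rightarrow> bool" where
  "smooth f \<longleftrightarrow> (\<forall>m. cont_diff m f)"

definition test_function :: "'a::euclidean_space set \<Rightarrow> ('a \<Rightarrow> real) \<Rightarrow> bool" where
  "test_function S f \<longleftrightarrow> smooth f \<and> (\<exists>K. compact K \<and> K \<subseteq> S \<and> (\<forall>x. x \<notin> K \<longrightarrow> f x = 0))"

section \<open>Bochner spaces on a time interval\<close>

text \<open>
  The Banach spaces that occur depend on the domain and hence are not types. A space is given by a
  carrier \<open>X\<close> in a real vector space and a seminorm \<open>N\<close>, where two elements are identified when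
  their difference has seminorm zero.
\<close>

definition simple_on :: "real \<Rightarrow> 'a set \<Rightarrow> (real \<Rightarrow> 'a::real_vector) \<Rightarrow> bool" where
  "simple_on T X u \<longleftrightarrow> finite (u ` {0<..<T}) \<and> u ` {0<..<T} \<subseteq> X \<and>
     (\<forall>y. {t \<in> {0<..<T}. u t = y} \<in> sets lebesgue)"

definition simple_integral :: "real \<Rightarrow> (real \<Rightarrow> 'a::real_vector) \<Rightarrow> 'a" where
  "simple_integral T u =
     (\<Sum>y\<in>u ` {0<..<T}. measure lebesgue {t \<in> {0<..<T}. u t = y} *\<^sub>R y)"

definition strongly_measurable ::
    "real \<Rightarrow> 'a set \<Rightarrow> ('a \<Rightarrow> real) \<Rightarrow> (real \<Rightarrow> 'a::real_vector) \<Rightarrow> bool" where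
  "strongly_measurable T X N u \<longleftrightarrow>
     (AE t in lebesgue_on {0<..<T}. u t \<in> X) \<and>
     (\<exists>w. (\<forall>n. simple_on T X (w n)) \<and>
          (AE t in lebesgue_on {0<..<T}. (\<lambda>n::nat. N (u t - w n t)) \<longlonglongrightarrow> 0))"

definition bochner_integral_is ::
    "real \<Rightarrow> 'a set \<Rightarrow> ('a \<Rightarrow> real) \<Rightarrow> (real \<Rightarrow> 'a::real_vector) \<Rightarrow> 'a \<Rightarrow> bool" where
  "bochner_integral_is T X N u y \<longleftrightarrow> y \<in> X \<and> strongly_measurable T X N u \<and>
     (\<exists>w. (\<forall>n. simple_on T X (w n)) \<and>
          (\<lambda>n::nat. \<integral>\<^sup>+ t. ennreal (N (u t - w n t)) \<partial>lebesgue_on {0<..<T}) \<longlonglongrightarrow> 0 \<and>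
          (\<lambda>n. N (simple_integral T (w n) - y)) \<longlonglongrightarrow> 0)"

definition L2_time ::
    "real \<Rightarrow> 'a set \<Rightarrow> ('a \<Rightarrow> real) \<Rightarrow> (real \<Rightarrow> 'a::real_vector) \<Rightarrow> bool" where
  "L2_time T X N u \<longleftrightarrow> strongly_measurable T X N u \<and>
     (\<integral>\<^sup>+ t. ennreal ((N (u t))\<^sup>2) \<partial>lebesgue_on {0<..<T}) < \<infinity>"

definition weak_time_derivative ::
    "real \<Rightarrow> 'a set \<Rightarrow> ('a \<Rightarrow> real) \<Rightarrow> (real \<Rightarrow> 'a::real_vector) \<Rightarrow> (real \<Rightarrow> 'a) \<Rightarrow> bool" where
  "weak_time_derivative T X N u u' \<longleftrightarrow>
     (\<forall>\<eta>. test_function {0<..<T} \<eta> \<longrightarrow>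
        (\<exists>y. bochner_integral_is T X N (\<lambda>t. deriv \<eta> t *\<^sub>R u t) y \<and>
             bochner_integral_is T X N (\<lambda>t. \<eta> t *\<^sub>R u' t) (- y)))"

text \<open>
  Membership of \<open>u\<close> in $H^1(0,T;X)$ with weak derivative \<open>u'\<close>. Values at single times refer to the
  continuous representative, so \<open>u\<close> is required to be that representative on $[0,T]$.
\<close>

definition H1_time ::
    "real \<Rightarrow> 'a set \<Rightarrow> ('a \<Rightarrow> real) \<Rightarrow> (real \<Rightarrow> 'a::real_vector) \<Rightarrow> (real \<Rightarrow> 'a) \<Rightarrow> bool" where
  "H1_time T X N u u' \<longleftrightarrow>
     L2_time T X N u \<and> L2_time T X N u' \<and> weak_time_derivative T X N u u' \<and>
     (\<forall>t\<in>{0..T}. u t \<in> X) \<and>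
     (\<forall>t\<in>{0..T}. ((\<lambda>t'. N (u t' - u t)) \<longlongrightarrow> 0) (at t within {0..T}))"

section \<open>Lipschitz domains, surface measure and outward normal\<close>

type_synonym point = "real ^ 3"
type_synonym phase = "point \<times> point"

text \<open>
  Near every boundary point the domain is the part above the graph of a Lipschitz function over
  the plane orthogonal to some unit vector \<open>e\<close>.
\<close>

definition lipschitz_domain :: "point set \<Rightarrow> bool" where
  "lipschitz_domain R \<longleftrightarrow> open R \<and> connected R \<and> bounded R \<and> R \<noteq> {} \<and>
     (\<forall>x\<in>frontier R. \<exists>e \<rho> L \<gamma>. norm e = 1 \<and> \<rho> > 0 \<and> L-lipschitz_on {z. e \<bullet> z = 0} \<gamma> \<and>
        R \<inter> ball x \<rho> = {y \<in> ball x \<rho>. e \<bullet> y > \<gamma> (y - (e \<bullet> y) *\<^sub>R e)})"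

text \<open>
  Two-dimensional Hausdorff measure. The factor $\pi/4$ normalises it to the usual surface area.
\<close>

definition hausdorff2_delta :: "real \<Rightarrow> point set \<Rightarrow> ennreal" where
  "hausdorff2_delta \<delta> A =
     (INF U\<in>{U::nat \<Rightarrow> point set. A \<subseteq> (\<Union>i. U i) \<and> (\<forall>i. bounded (U i) \<and> diameter (U i) \<le> \<delta>)}.
        \<Sum>i. ennreal (pi / 4 * (diameter (U i))\<^sup>2))"

definition hausdorff2 :: "point set \<Rightarrow> ennreal" where
  "hausdorff2 A = (SUP \<delta>\<in>{0<..}. hausdorff2_delta \<delta> A)"

definition surface_measure :: "point set \<Rightarrow> point measure" where
  "surface_measure S = restrict_space (measure_of UNIV (sets borel) hausdorff2) S"

abbreviation S2 :: "point set" where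
  "S2 \<equiv> sphere 0 1"

definition phase_measure :: "point set \<Rightarrow> phase measure" where
  "phase_measure R = restrict_space lborel R \<Otimes>\<^sub>M surface_measure S2"

definition boundary_measure :: "point set \<Rightarrow> phase measure" where
  "boundary_measure R = surface_measure (frontier R) \<Otimes>\<^sub>M surface_measure S2"

text \<open>
  The plane through \<open>x\<close> orthogonal to \<open>\<nu>\<close> is tangent to the boundary and \<open>\<nu>\<close> points outwards:
  to first order \<open>R\<close> lies on the negative and its complement on the positive side. For a Lipschitz
  domain such a \<open>\<nu>\<close> exists exactly where the local graph functions are differentiable, hence
  almost everywhere on the boundary, and it is then unique.
\<close>

definition is_outward_normal :: "point set \<Rightarrow> point \<Rightarrow> point \<Rightarrow> bool" where
  "is_outward_normal R x \<nu> \<longleftrightarrow> norm \<nu> = 1 \<and>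
     (\<forall>\<epsilon>>0. \<exists>\<delta>>0. \<forall>y\<in>ball x \<delta>.
        (y \<in> R \<longrightarrow> \<nu> \<bullet> (y - x) \<le> \<epsilon> * norm (y - x)) \<and>
        (y \<notin> R \<longrightarrow> \<nu> \<bullet> (y - x) \<ge> - \<epsilon> * norm (y - x)))"

definition outward_normal :: "point set \<Rightarrow> point \<Rightarrow> point" where
  "outward_normal R x =
     (if \<exists>\<nu>. is_outward_normal R x \<nu> then THE \<nu>. is_outward_normal R x \<nu> else 0)"

section \<open>Function spaces on phase space\<close>

definition L2_space :: "'a measure \<Rightarrow> ('a \<Rightarrow> real) set" where
  "L2_space M = {f \<in> borel_measurable M. integrable M (\<lambda>x. (f x)\<^sup>2)}"

definition L2_inner :: "'a measure \<Rightarrow> ('a \<Rightarrow> real) \<Rightarrow> ('a \<Rightarrow> real) \<Rightarrow> real" where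
  "L2_inner M f g = (LINT x|M. f x * g x)"

definition L2_norm :: "'a measure \<Rightarrow> ('a \<Rightarrow> real) \<Rightarrow> real" where
  "L2_norm M f = sqrt (LINT x|M. (f x)\<^sup>2)"

definition Linfty_space :: "'a measure \<Rightarrow> ('a \<Rightarrow> real) set" where
  "Linfty_space M = {f \<in> borel_measurable M. \<exists>b. AE x in M. \<bar>f x\<bar> \<le> b}"

definition transport :: "(phase \<Rightarrow> real) \<Rightarrow> phase \<Rightarrow> real" where
  "transport \<zeta> = (\<lambda>(r, s). frechet_derivative \<zeta> (at (r, s)) (s, 0))"

text \<open>
  \<open>is_transport R v g\<close>: the distributional derivative $s\cdot\nabla v$ is \<open>g\<close>. Test functions on
  $\mathcal{R}\times\mathcal{S}^2$ are restrictions of test functions of both variables.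
\<close>

definition is_transport :: "point set \<Rightarrow> (phase \<Rightarrow> real) \<Rightarrow> (phase \<Rightarrow> real) \<Rightarrow> bool" where
  "is_transport R v g \<longleftrightarrow>
     (\<forall>\<zeta>. test_function (R \<times> UNIV) \<zeta> \<longrightarrow>
        L2_inner (phase_measure R) v (transport \<zeta>) = - L2_inner (phase_measure R) g \<zeta>)"

definition weak_transport :: "point set \<Rightarrow> (phase \<Rightarrow> real) \<Rightarrow> phase \<Rightarrow> real" where
  "weak_transport R v = (SOME g. g \<in> L2_space (phase_measure R) \<and> is_transport R v g)"

text \<open>
  \<open>is_trace R v \<tau>\<close>: the boundary values of \<open>v\<close> are \<open>\<tau>\<close>, with $|s\cdot n|^{1/2}\tau$ in
  $L^2(\partial\mathcal{D})$. Boundary values of functions with $v, s\cdot\nabla v\in L^2$ are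
  understood through Green's formula, which determines them wherever $s\cdot n\neq 0$.
\<close>

definition is_trace :: "point set \<Rightarrow> (phase \<Rightarrow> real) \<Rightarrow> (phase \<Rightarrow> real) \<Rightarrow> bool" where
  "is_trace R v \<tau> \<longleftrightarrow>
     (\<lambda>(r, s). sqrt \<bar>s \<bullet> outward_normal R r\<bar> * \<tau> (r, s)) \<in> L2_space (boundary_measure R) \<and>
     (\<forall>\<zeta>. smooth \<zeta> \<longrightarrow>
        L2_inner (phase_measure R) (weak_transport R v) \<zeta> +
        L2_inner (phase_measure R) v (transport \<zeta>) =
        (LINT (r, s)|boundary_measure R. (s \<bullet> outward_normal R r) * \<tau> (r, s) * \<zeta> (r, s)))"

definition trace_of :: "point set \<Rightarrow> (phase \<Rightarrow> real) \<Rightarrow> phase \<Rightarrow> real" where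
  "trace_of R v = (SOME \<tau>. is_trace R v \<tau>)"

definition boundary_form :: "point set \<Rightarrow> (phase \<Rightarrow> real) \<Rightarrow> (phase \<Rightarrow> real) \<Rightarrow> real" where
  "boundary_form R v w =
     (LINT (r, s)|boundary_measure R.
        \<bar>s \<bullet> outward_normal R r\<bar> * trace_of R v (r, s) * trace_of R w (r, s))"

definition V_space :: "point set \<Rightarrow> (phase \<Rightarrow> real) set" where
  "V_space R = L2_space (phase_measure R)"

definition V_norm :: "point set \<Rightarrow> (phase \<Rightarrow> real) \<Rightarrow> real" where
  "V_norm R = L2_norm (phase_measure R)"

definition W_space :: "point set \<Rightarrow> (phase \<Rightarrow> real) set" where
  "W_space R = {v \<in> L2_space (phase_measure R).
     (\<exists>g\<in>L2_space (phase_measure R). is_transport R v g) \<and> (\<exists>\<tau>. is_trace R v \<tau>)}"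

definition W_norm :: "point set \<Rightarrow> (phase \<Rightarrow> real) \<Rightarrow> real" where
  "W_norm R v = sqrt ((V_norm R v)\<^sup>2 + (V_norm R (weak_transport R v))\<^sup>2 +
     (L2_norm (boundary_measure R)
        (\<lambda>(r, s). sqrt \<bar>s \<bullet> outward_normal R r\<bar> * trace_of R v (r, s)))\<^sup>2)"

definition even_part :: "(phase \<Rightarrow> real) \<Rightarrow> phase \<Rightarrow> real" where
  "even_part \<phi> = (\<lambda>(r, s). (\<phi> (r, s) + \<phi> (r, - s)) / 2)"

definition odd_part :: "(phase \<Rightarrow> real) \<Rightarrow> phase \<Rightarrow> real" where
  "odd_part \<phi> = (\<lambda>(r, s). (\<phi> (r, s) - \<phi> (r, - s)) / 2)"

definition W_plus :: "point set \<Rightarrow> (phase \<Rightarrow> real) set" where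
  "W_plus R = {w \<in> W_space R. AE (r, s) in phase_measure R. w (r, - s) = w (r, s)}"

definition V_minus :: "point set \<Rightarrow> (phase \<Rightarrow> real) set" where
  "V_minus R = {v \<in> V_space R. AE (r, s) in phase_measure R. v (r, - s) = - v (r, s)}"

definition sum_space ::
    "(phase \<Rightarrow> real) set \<Rightarrow> (phase \<Rightarrow> real) set \<Rightarrow> (phase \<Rightarrow> real) set" where
  "sum_space A B = {w + v | w v. w \<in> A \<and> v \<in> B}"

abbreviation WV_space :: "point set \<Rightarrow> (phase \<Rightarrow> real) set" where
  "WV_space R \<equiv> sum_space (W_plus R) (V_minus R)"

definition WV_norm :: "point set \<Rightarrow> (phase \<Rightarrow> real) \<Rightarrow> real" where
  "WV_norm R \<phi> = sqrt ((W_norm R (even_part \<phi>))\<^sup>2 + (V_norm R (odd_part \<phi>))\<^sup>2)"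

section \<open>The dual space and the embedding of functions\<close>

type_synonym functional = "(phase \<Rightarrow> real) \<Rightarrow> real"

definition W_plus_dual :: "point set \<Rightarrow> functional set" where
  "W_plus_dual R = {F.
     (\<forall>v\<in>W_plus R. \<forall>w\<in>W_plus R. \<forall>a b. F (a *\<^sub>R v + b *\<^sub>R w) = a * F v + b * F w) \<and>
     (\<exists>c. \<forall>w\<in>W_plus R. \<bar>F w\<bar> \<le> c * W_norm R w)}"

definition W_plus_dual_norm :: "point set \<Rightarrow> functional \<Rightarrow> real" where
  "W_plus_dual_norm R F = (SUP w\<in>{w \<in> W_plus R. W_norm R w \<le> 1}. \<bar>F w\<bar>)"

text \<open>The space $(\mathbb{W}^+)'\oplus\mathbb{V}^-$, as pairs.\<close>

definition dual_space :: "point set \<Rightarrow> (functional \<times> (phase \<Rightarrow> real)) set" where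
  "dual_space R = W_plus_dual R \<times> V_minus R"

definition dual_norm :: "point set \<Rightarrow> functional \<times> (phase \<Rightarrow> real) \<Rightarrow> real" where
  "dual_norm R p = sqrt ((W_plus_dual_norm R (fst p))\<^sup>2 + (V_norm R (snd p))\<^sup>2)"

definition embed :: "point set \<Rightarrow> (phase \<Rightarrow> real) \<Rightarrow> functional \<times> (phase \<Rightarrow> real)" where
  "embed R \<phi> = (\<lambda>w. L2_inner (phase_measure R) (even_part \<phi>) w, odd_part \<phi>)"

definition dual_eq ::
    "point set \<Rightarrow> functional \<times> (phase \<Rightarrow> real) \<Rightarrow> functional \<times> (phase \<Rightarrow> real) \<Rightarrow> bool" where
  "dual_eq R p p' \<longleftrightarrow> (\<forall>w\<in>W_plus R. fst p w = fst p' w) \<and>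
     (AE x in phase_measure R. snd p x = snd p' x)"

text \<open>
  Extended norms, with value \<open>\<infinity>\<close> outside $\mathbb{W}^+\oplus\mathbb{V}^-$. In the second definition
  the infimum of the empty set is \<open>\<infinity>\<close>, and all \<open>f\<close> representing \<open>p\<close> have the same norm.
\<close>

definition WV_enorm :: "point set \<Rightarrow> (phase \<Rightarrow> real) \<Rightarrow> ennreal" where
  "WV_enorm R \<phi> = (if \<phi> \<in> WV_space R then ennreal (WV_norm R \<phi>) else \<infinity>)"

definition WV_enorm_dual :: "point set \<Rightarrow> functional \<times> (phase \<Rightarrow> real) \<Rightarrow> ennreal" where
  "WV_enorm_dual R p = (INF f\<in>{f \<in> WV_space R. dual_eq R (embed R f) p}. ennreal (WV_norm R f))"

section \<open>Radiative transfer: coefficients, weak problem and Galerkin semi-discretization\<close>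

text \<open>
  By rotation invariance of the surface measure the integral does not depend on the direction
  \<open>s'\<close>, so these are functions of \<open>r\<close> alone.
\<close>

definition sigma_s :: "(point \<Rightarrow> real \<Rightarrow> real) \<Rightarrow> point \<Rightarrow> point \<Rightarrow> real" where
  "sigma_s k r s' = (LINT s|surface_measure S2. k r (s \<bullet> s'))"

definition sigma_a ::
    "(point \<Rightarrow> real \<Rightarrow> real) \<Rightarrow> (point \<Rightarrow> real) \<Rightarrow> point \<Rightarrow> point \<Rightarrow> real" where
  "sigma_a k \<sigma>t r s' = \<sigma>t r - sigma_s k r s'"

definition collision ::
    "(point \<Rightarrow> real \<Rightarrow> real) \<Rightarrow> (point \<Rightarrow> real) \<Rightarrow> (phase \<Rightarrow> real) \<Rightarrow> phase \<Rightarrow> real" where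
  "collision k \<sigma>t \<phi> =
     (\<lambda>(r, s). \<sigma>t r * \<phi> (r, s) - (LINT s'|surface_measure S2. k r (s \<bullet> s') * \<phi> (r, s')))"

definition coefficients :: "point set \<Rightarrow> (point \<Rightarrow> real \<Rightarrow> real) \<Rightarrow> (point \<Rightarrow> real) \<Rightarrow> bool" where
  "coefficients R k \<sigma>t \<longleftrightarrow>
     (\<lambda>(r, \<mu>). k r \<mu>) \<in> Linfty_space (restrict_space lborel (R \<times> {-1..1})) \<and>
     \<sigma>t \<in> Linfty_space (restrict_space lborel R)"

definition assumption_A1 :: "point set \<Rightarrow> (point \<Rightarrow> real \<Rightarrow> real) \<Rightarrow> real \<Rightarrow> bool" where
  "assumption_A1 R k kbar \<longleftrightarrow>
     (\<forall>r\<in>R. \<forall>s\<in>S2. \<forall>s'\<in>S2. 0 \<le> k r (s \<bullet> s') \<and> k r (s \<bullet> s') \<le> kbar)"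

definition assumption_A2 ::
    "point set \<Rightarrow> (point \<Rightarrow> real \<Rightarrow> real) \<Rightarrow> (point \<Rightarrow> real) \<Rightarrow> real \<Rightarrow> real \<Rightarrow> bool" where
  "assumption_A2 R k \<sigma>t a_lo a_up \<longleftrightarrow> 0 < a_lo \<and>
     (\<forall>r\<in>R. \<forall>s'\<in>S2. a_lo \<le> sigma_a k \<sigma>t r s' \<and> sigma_a k \<sigma>t r s' \<le> a_up)"

definition finite_dim_subspace :: "'a::real_vector set \<Rightarrow> bool" where
  "finite_dim_subspace A \<longleftrightarrow> subspace A \<and> (\<exists>B. finite B \<and> A \<subseteq> span B)"

definition assumption_A3 ::
    "point set \<Rightarrow> (phase \<Rightarrow> real) set \<Rightarrow> (phase \<Rightarrow> real) set \<Rightarrow> bool" where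
  "assumption_A3 R Wh Vh \<longleftrightarrow> finite_dim_subspace Wh \<and> Wh \<subseteq> W_plus R \<and>
     finite_dim_subspace Vh \<and> Vh \<subseteq> V_minus R"

definition assumption_A4 ::
    "point set \<Rightarrow> (phase \<Rightarrow> real) set \<Rightarrow> (phase \<Rightarrow> real) set \<Rightarrow> bool" where
  "assumption_A4 R Wh Vh \<longleftrightarrow>
     (\<forall>w\<in>Wh. \<exists>v\<in>Vh. AE x in phase_measure R. weak_transport R w x = v x)"

definition bilinear_B ::
    "point set \<Rightarrow> (point \<Rightarrow> real \<Rightarrow> real) \<Rightarrow> (point \<Rightarrow> real) \<Rightarrow>
     (phase \<Rightarrow> real) \<Rightarrow> (phase \<Rightarrow> real) \<Rightarrow> real" where
  "bilinear_B R k \<sigma>t \<phi> \<psi> =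
     boundary_form R (even_part \<phi>) (even_part \<psi>)
     + L2_inner (phase_measure R) (collision k \<sigma>t \<phi>) \<psi>
     - L2_inner (phase_measure R) (odd_part \<phi>) (weak_transport R (even_part \<psi>))
     + L2_inner (phase_measure R) (weak_transport R (even_part \<phi>)) (odd_part \<psi>)"

definition is_elliptic_projection ::
    "point set \<Rightarrow> (point \<Rightarrow> real \<Rightarrow> real) \<Rightarrow> (point \<Rightarrow> real) \<Rightarrow>
     (phase \<Rightarrow> real) set \<Rightarrow> (phase \<Rightarrow> real) set \<Rightarrow> (phase \<Rightarrow> real) \<Rightarrow> (phase \<Rightarrow> real) \<Rightarrow> bool" where
  "is_elliptic_projection R k \<sigma>t Wh Vh \<phi> p \<longleftrightarrow> p \<in> sum_space Wh Vh \<and>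
     (\<forall>\<psi>\<in>sum_space Wh Vh. bilinear_B R k \<sigma>t p \<psi> = bilinear_B R k \<sigma>t \<phi> \<psi>)"

text \<open>
  \<open>d\<phi>\<close> is the time derivative of \<open>\<phi>\<close>. Its components are the derivative of the even part, a
  functional on $\mathbb{W}^+$, and of the odd part. Pointwise values \<open>\<phi> t\<close> are functions in
  $L^2(\mathcal{D})$, in view of
  $L^2(0,T;\mathbb{W}^+)\cap H^1(0,T;(\mathbb{W}^+)')\subset C([0,T];\mathbb{V}^+)$.
\<close>

definition solves_IP ::
    "point set \<Rightarrow> real \<Rightarrow> (point \<Rightarrow> real \<Rightarrow> real) \<Rightarrow> (point \<Rightarrow> real) \<Rightarrow>
     (real \<Rightarrow> phase \<Rightarrow> real) \<Rightarrow> (phase \<Rightarrow> real) \<Rightarrow>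
     (real \<Rightarrow> phase \<Rightarrow> real) \<Rightarrow> (real \<Rightarrow> functional \<times> (phase \<Rightarrow> real)) \<Rightarrow> bool" where
  "solves_IP R T k \<sigma>t q \<phi>0 \<phi> d\<phi> \<longleftrightarrow>
     (\<forall>t\<in>{0..T}. \<phi> t \<in> V_space R) \<and>
     L2_time T (WV_space R) (WV_norm R) \<phi> \<and>
     H1_time T (dual_space R) (dual_norm R) (\<lambda>t. embed R (\<phi> t)) d\<phi> \<and>
     (AE x in phase_measure R. \<phi> 0 x = \<phi>0 x) \<and>
     (\<forall>\<psi>p\<in>W_plus R. AE t in lebesgue_on {0<..<T}.
        fst (d\<phi> t) \<psi>p
        - L2_inner (phase_measure R) (odd_part (\<phi> t)) (weak_transport R \<psi>p)
        + boundary_form R (even_part (\<phi> t)) \<psi>p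
        + L2_inner (phase_measure R) (collision k \<sigma>t (even_part (\<phi> t))) \<psi>p
        = L2_inner (phase_measure R) (even_part (q t)) \<psi>p) \<and>
     (\<forall>\<psi>m\<in>V_minus R. AE t in lebesgue_on {0<..<T}.
        L2_inner (phase_measure R) (snd (d\<phi> t)) \<psi>m
        + L2_inner (phase_measure R) (weak_transport R (even_part (\<phi> t))) \<psi>m
        + L2_inner (phase_measure R) (collision k \<sigma>t (odd_part (\<phi> t))) \<psi>m
        = L2_inner (phase_measure R) (odd_part (q t)) \<psi>m)"

definition solves_SD ::
    "point set \<Rightarrow> real \<Rightarrow> (point \<Rightarrow> real \<Rightarrow> real) \<Rightarrow> (point \<Rightarrow> real) \<Rightarrow>
     (phase \<Rightarrow> real) set \<Rightarrow> (phase \<Rightarrow> real) set \<Rightarrow>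
     (real \<Rightarrow> phase \<Rightarrow> real) \<Rightarrow> (phase \<Rightarrow> real) \<Rightarrow>
     (real \<Rightarrow> phase \<Rightarrow> real) \<Rightarrow> (real \<Rightarrow> phase \<Rightarrow> real) \<Rightarrow> bool" where
  "solves_SD R T k \<sigma>t Wh Vh q \<phi>0 \<phi>h d\<phi>h \<longleftrightarrow>
     H1_time T (sum_space Wh Vh) (WV_norm R) \<phi>h d\<phi>h \<and>
     is_elliptic_projection R k \<sigma>t Wh Vh \<phi>0 (\<phi>h 0) \<and>
     (\<forall>\<psi>\<in>sum_space Wh Vh. AE t in lebesgue_on {0<..<T}.
        L2_inner (phase_measure R) (d\<phi>h t) \<psi> + bilinear_B R k \<sigma>t (\<phi>h t) \<psi>
        = L2_inner (phase_measure R) (q t) \<psi>)"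

definition best_error ::
    "point set \<Rightarrow> (phase \<Rightarrow> real) set \<Rightarrow> (phase \<Rightarrow> real) set \<Rightarrow> (phase \<Rightarrow> real) \<Rightarrow> ennreal" where
  "best_error R Wh Vh \<phi> = (INF \<psi>\<in>sum_space Wh Vh. WV_enorm R (\<phi> - \<psi>))"

definition best_error_dual ::
    "point set \<Rightarrow> (phase \<Rightarrow> real) set \<Rightarrow> (phase \<Rightarrow> real) set \<Rightarrow>
     functional \<times> (phase \<Rightarrow> real) \<Rightarrow> ennreal" where
  "best_error_dual R Wh Vh p = (INF \<psi>\<in>sum_space Wh Vh. WV_enorm_dual R (p - embed R \<psi>))"

end

theory Submission imports Defs begin

text \<open>
  Write $X = \mathbb{W}^+\oplus\mathbb{V}^-$, $X_h = \mathbb{W}_h^+\oplus\mathbb{V}_h^-$ and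
  $\theta = \Pi_h\phi - \phi_h$. The error is the sum of $\phi - \Pi_h\phi$ and $\theta$.

  The first part is quasi-optimal (\<open>Pi_h_quasi_optimal\<close>). The form \<open>B\<close> is coercive for the $L^2$ norm
  and the trace only, whereas it is bounded by means of the streaming term $s\cdot\nabla\phi^+$ too.
  The gap is closed by the compatibility $s\cdot\nabla\mathbb{W}_h^+\subset\mathbb{V}_h^-$, which
  allows the streaming term of a discrete function to be used as a test function
  (\<open>projection_stable\<close>).

  For the second part, subtracting the two evolution equations gives
  $(\partial_t\theta,\psi) + B(\theta;\psi) = -(\partial_t(\phi - \Pi_h\phi),\psi)$ for $\psi\in X_h$.
  With $\psi=\theta$ and coercivity, $\|\theta\|$ grows at most at the rate
  $\|\partial_t(\phi-\Pi_h\phi)\|$, which quasi-optimality bounds by the best approximation error of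
  $\partial_t\phi$, and $\theta(0)=0$. Two points make this heuristic argument rigorous.

  First, $\partial_t\phi^+$ is a functional on $\mathbb{W}^+$, so that $\Pi_h$ cannot be applied to
  it. For fixed $y\in L^2(\mathcal{D})$ consider the functional $x\mapsto(x-\Pi_h x,y)$ on $X$. By
  duality it equals $(x,y)-B(x;z)$ with some $z\in X_h$, and it vanishes on $X_h$. It contains
  derivatives and traces of $x$, but integration by parts and the density of test functions
  approximate it, in the norm of functionals on $X$, by $L^2$ products with elements of $X$. These
  can be corrected so as to vanish on $X_h$ again (\<open>Pi_error_pairing\<close>), they may be applied
  to $\partial_t\phi$, and the values are bounded by its best approximation error
  (\<open>pairing_best_error_dual\<close>). In the limit, the increments of the projection error are
  bounded by integrals of the best approximation error (\<open>projection_error_control\<close>). The latter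
  need not be a measurable function of time. Its integral is a lower integral, and it is replaced by a
  largest measurable function below it (\<open>maximal_minorant_absorbs\<close>).

  Second, $\phi(t)\in X$ holds for almost every $t$ only, and $\theta(t)$ is meaningful for such $t$
  only. These times are dense and contain the initial time. On them $\theta$ is uniformly
  continuous, so the growth of $\|\theta\|$ is estimated over short time steps between them and
  summed up (\<open>\<theta>_bound\<close>).

  All statements about vector valued functions of time are reduced to real functions by testing with
  bounded functionals, and weak derivatives of real functions are handled by the lemma of du
  Bois-Reymond. The preparatory sections show that the weak streaming term and the weighted trace
  are unique and hence linear almost everywhere. This rests on the density of test functions in
  $L^2$ of finite Borel measures (\<open>test_functions_dense_L2\<close>), and on the facts that the surface
  measures of the sphere and of the boundary are finite and that the outward normal is a Borel
  function.
\<close>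

section \<open>Smooth functions\<close>

lemma differentiable_imp_frechet:
  fixes f :: "'a::euclidean_space \<Rightarrow> real"
  assumes "f differentiable (at x)"
  shows "(f has_derivative frechet_derivative f (at x)) (at x)"
  using assms by (simp add: frechet_derivative_works)

lemma frechet_eq:
  assumes "(f has_derivative f') (at x)"
  shows "frechet_derivative f (at x) = f'"
  using assms frechet_derivative_at by metis

lemma cont_diff_Suc_I:
  assumes "\<And>x. (f has_derivative f' x) (at x)" and "\<And>v. cont_diff m (\<lambda>x. f' x v)"
  shows "cont_diff (Suc m) f"
proof -
  have "frechet_derivative f (at x) = f' x" for x
    using assms(1) by (rule frechet_eq)
  moreover have "f differentiable (at x)" for x
    using assms(1) differentiable_def by blast
  ultimately show ?thesis using assms(2) by simp
qed

lemma cont_diff_imp_continuous: "cont_diff m f \<Longrightarrow> continuous_on UNIV f"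
  by (cases m) (auto simp: differentiable_imp_continuous_within continuous_at_imp_continuous_on)

lemma cont_diff_mono_Suc: "cont_diff (Suc m) f \<Longrightarrow> cont_diff m f"
proof (induction m arbitrary: f)
  case 0
  then have "continuous_on UNIV f" by (rule cont_diff_imp_continuous)
  then show ?case by simp
next
  case (Suc m)
  then show ?case by (metis cont_diff.simps(2))
qed

lemma cont_diff_const: "cont_diff m (\<lambda>x::'a::euclidean_space. c)"
proof (induction m arbitrary: c)
  case (Suc m)
  show ?case by (rule cont_diff_Suc_I[where f'="\<lambda>x v. 0"]) (auto simp: Suc)
qed simp

lemma cont_diff_add:
  "cont_diff m f \<Longrightarrow> cont_diff m g \<Longrightarrow> cont_diff m (\<lambda>x. f x + g x)"
proof (induction m arbitrary: f g)
  case (Suc m)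
  show ?case
    using Suc by (intro cont_diff_Suc_I
      [where f'="\<lambda>x v. frechet_derivative f (at x) v + frechet_derivative g (at x) v"]
      has_derivative_add differentiable_imp_frechet) auto
qed (auto intro: continuous_on_add)

lemma cont_diff_mult:
  "cont_diff m f \<Longrightarrow> cont_diff m g \<Longrightarrow> cont_diff m (\<lambda>x. f x * g x)"
proof (induction m arbitrary: f g)
  case (Suc m)
  have fg: "cont_diff m f" "cont_diff m g"
    using Suc.prems by (auto intro: cont_diff_mono_Suc simp del: cont_diff.simps)
  show ?case
    using Suc fg by (intro cont_diff_Suc_I
      [where f'="\<lambda>x v. f x * frechet_derivative g (at x) v + frechet_derivative f (at x) v * g x"]
      has_derivative_mult differentiable_imp_frechet cont_diff_add) auto
qed (auto intro: continuous_on_mult)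

text \<open>Indexing the successive derivatives of the outer function lets the chain rule reproduce the
  same statement with \<open>n\<close> replaced by \<open>Suc n\<close>, so that one induction suffices.\<close>

lemma cont_diff_compose_outer:
  assumes G: "\<And>n x. (G n has_real_derivative G (Suc n) x) (at x)"
  shows "cont_diff m f \<Longrightarrow> cont_diff m (\<lambda>x. G n (f x))"
proof (induction m arbitrary: f n)
  case 0
  have "continuous_on UNIV (G n)"
    using G DERIV_isCont by (intro continuous_at_imp_continuous_on) blast
  then show ?case using 0 by (auto intro: continuous_on_compose2)
next
  case (Suc m)
  have f: "cont_diff m f"
    using Suc.prems by (auto intro: cont_diff_mono_Suc simp del: cont_diff.simps)
  show ?case
  proof (rule cont_diff_Suc_I[where f'="\<lambda>x v. G (Suc n) (f x) * frechet_derivative f (at x) v"])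
    fix x
    have "(f has_derivative frechet_derivative f (at x)) (at x)"
      using Suc.prems by (auto intro: differentiable_imp_frechet)
    moreover have "(G n has_derivative (*) (G (Suc n) (f x))) (at (f x))"
      using G by (simp add: has_field_derivative_def)
    ultimately show "((\<lambda>x. G n (f x)) has_derivative
        (\<lambda>v. G (Suc n) (f x) * frechet_derivative f (at x) v)) (at x)"
      by (rule has_derivative_compose)
  next
    fix v
    show "cont_diff m (\<lambda>x. G (Suc n) (f x) * frechet_derivative f (at x) v)"
      using Suc.prems f by (intro cont_diff_mult Suc.IH) auto
  qed
qed

lemma cont_diff_compose_affine:
  fixes f :: "'b::euclidean_space \<Rightarrow> real" and A :: "'a::euclidean_space \<Rightarrow> 'b"
  assumes A: "bounded_linear A"
  shows "cont_diff m f \<Longrightarrow> cont_diff m (\<lambda>x. f (A x + c))"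
proof (induction m arbitrary: f)
  case 0
  have "continuous_on UNIV (\<lambda>x. A x + c)"
    by (intro continuous_intros linear_continuous_on A)
  with 0 show ?case by (auto intro: continuous_on_compose2)
next
  case (Suc m)
  show ?case
  proof (rule cont_diff_Suc_I[where f'="\<lambda>x v. frechet_derivative f (at (A x + c)) (A v)"])
    fix x
    have "((\<lambda>x. A x + c) has_derivative A) (at x)"
      by (auto intro!: derivative_eq_intros bounded_linear_imp_has_derivative A)
    moreover have "(f has_derivative frechet_derivative f (at (A x + c))) (at (A x + c))"
      using Suc.prems by (auto intro: differentiable_imp_frechet)
    ultimately show "((\<lambda>x. f (A x + c)) has_derivative
        (\<lambda>v. frechet_derivative f (at (A x + c)) (A v))) (at x)"
      by (rule has_derivative_compose)
  next
    fix v
    show "cont_diff m (\<lambda>x. frechet_derivative f (at (A x + c)) (A v))"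
      using Suc.prems by (intro Suc.IH) auto
  qed
qed

lemma smooth_const: "smooth (\<lambda>x. c)"
  by (simp add: smooth_def cont_diff_const)

lemma smooth_add: "smooth f \<Longrightarrow> smooth g \<Longrightarrow> smooth (\<lambda>x. f x + g x)"
  by (simp add: smooth_def cont_diff_add)

lemma smooth_mult: "smooth f \<Longrightarrow> smooth g \<Longrightarrow> smooth (\<lambda>x. f x * g x)"
  by (simp add: smooth_def cont_diff_mult)

lemma smooth_cmult: "smooth f \<Longrightarrow> smooth (\<lambda>x. c * f x)"
  by (intro smooth_mult smooth_const)

lemma smooth_diff: "smooth f \<Longrightarrow> smooth g \<Longrightarrow> smooth (\<lambda>x. f x - g x)"
  using smooth_add[OF _ smooth_cmult[of g "-1"]] by simp

lemma smooth_sum: "(\<And>i. i \<in> I \<Longrightarrow> smooth (f i)) \<Longrightarrow> smooth (\<lambda>x. \<Sum>i\<in>I. f i x)"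
  by (induction I rule: infinite_finite_induct) (auto intro: smooth_const smooth_add)

lemma smooth_compose_affine:
  fixes A :: "'a::euclidean_space \<Rightarrow> 'b::euclidean_space"
  assumes "bounded_linear A" "smooth f" shows "smooth (\<lambda>x. f (A x + c))"
  using assms by (simp add: smooth_def cont_diff_compose_affine)

lemma smooth_imp_continuous: "smooth f \<Longrightarrow> continuous_on S f"
  using cont_diff_imp_continuous continuous_on_subset unfolding smooth_def by blast

lemma smooth_differentiable: "smooth f \<Longrightarrow> f differentiable (at x)"
  unfolding smooth_def by (metis cont_diff.simps(2))

lemma smooth_has_derivative: "smooth f \<Longrightarrow> (f has_derivative frechet_derivative f (at x)) (at x)"
  by (simp add: smooth_differentiable differentiable_imp_frechet)

lemma smooth_frechet: "smooth f \<Longrightarrow> smooth (\<lambda>x. frechet_derivative f (at x) v)"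
  unfolding smooth_def by (metis cont_diff.simps(2))

lemma smoothI:
  assumes "\<And>x. (f has_derivative f' x) (at x)" and "\<And>v. smooth (\<lambda>x. f' x v)"
  shows "smooth f"
  unfolding smooth_def
proof
  fix m
  have "cont_diff (Suc m) f"
    using assms by (intro cont_diff_Suc_I) (auto simp: smooth_def)
  then show "cont_diff m f" by (rule cont_diff_mono_Suc)
qed

lemma smooth_bounded_linear:
  fixes l :: "'a::euclidean_space \<Rightarrow> real"
  assumes "bounded_linear l" shows "smooth l"
  by (rule smoothI[where f'="\<lambda>x. l"])
    (auto intro: bounded_linear_imp_has_derivative assms smooth_const)

lemma smooth_power2_dist: "smooth (\<lambda>x::'a::euclidean_space. (x - a) \<bullet> (x - a))"
proof (rule smoothI[where f'="\<lambda>x v. 2 * ((x - a) \<bullet> v)"])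
  fix v :: 'a
  have "smooth (\<lambda>x. x \<bullet> v - a \<bullet> v)"
    by (intro smooth_diff smooth_const smooth_bounded_linear bounded_linear_inner_left)
  then show "smooth (\<lambda>x. 2 * ((x - a) \<bullet> v))"
    by (intro smooth_cmult) (simp add: inner_diff_left)
qed (auto intro!: derivative_eq_intros simp: inner_commute)

lemma smooth_compose_outer:
  assumes "\<And>n x. (G n has_real_derivative G (Suc n) x) (at x)" "smooth f"
  shows "smooth (\<lambda>x. G n (f x))"
  using assms cont_diff_compose_outer unfolding smooth_def by blast

lemma smooth_exp: "smooth f \<Longrightarrow> smooth (\<lambda>x. exp (f x))"
  by (rule smooth_compose_outer[where G="\<lambda>n. exp"]) (auto intro: DERIV_exp)

text \<open>The family $p(1/t)\,e^{-1/t}$ for $t>0$, extended by zero, is closed under differentiation. Hence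
  every member, in particular $e^{-1/t}$, is smooth at the origin too.\<close>

definition flat :: "real poly \<Rightarrow> real \<Rightarrow> real" where
  "flat p t = (if t > 0 then poly p (1 / t) * exp (- (1 / t)) else 0)"

definition flat_step :: "real poly \<Rightarrow> real poly" where
  "flat_step p = [:0, 0, 1:] * (p - pderiv p)"

lemma poly_exp_decay: "((\<lambda>x. poly p x * exp (- x)) \<longlongrightarrow> (0::real)) at_top"
proof -
  have "((\<lambda>x. \<Sum>i\<le>degree p. coeff p i * (x ^ i / exp x)) \<longlongrightarrow> (\<Sum>i\<le>degree p. coeff p i * 0)) at_top"
    by (intro tendsto_sum tendsto_mult_left tendsto_power_div_exp_0)
  moreover have "poly p x * exp (- x) = (\<Sum>i\<le>degree p. coeff p i * (x ^ i / exp x))" for x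
    by (simp add: poly_altdef sum_divide_distrib exp_minus divide_inverse sum_distrib_right mult.assoc)
  ultimately show ?thesis by simp
qed

lemma flat_deriv: "(flat p has_real_derivative flat (flat_step p) t) (at t)"
proof -
  consider "t > 0" | "t < 0" | "t = 0" by linarith
  then show ?thesis
  proof cases
    case 1
    have "((\<lambda>t. poly p (1 / t) * exp (- (1 / t))) has_real_derivative
        poly (flat_step p) (1 / t) * exp (- (1 / t))) (at t)"
      using 1 by (auto intro!: derivative_eq_intros DERIV_chain2[OF poly_DERIV]
          simp: flat_step_def power2_eq_square algebra_simps divide_simps)
    moreover have "eventually (\<lambda>t. flat p t = poly p (1 / t) * exp (- (1 / t))) (nhds t)"
      using eventually_nhds_in_open[of "{0<..}" t] 1 by (auto simp: flat_def elim!: eventually_mono)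
    ultimately have "(flat p has_real_derivative poly (flat_step p) (1 / t) * exp (- (1 / t))) (at t)"
      by (subst DERIV_cong_ev[OF refl _ refl])
    then show ?thesis using 1 by (simp add: flat_def)
  next
    case 2
    then have "eventually (\<lambda>t. flat p t = 0) (nhds t)"
      using eventually_nhds_in_open[of "{..<0}" t] by (auto simp: flat_def elim!: eventually_mono)
    then have "(flat p has_real_derivative 0) (at t)"
      by (subst DERIV_cong_ev[OF refl _ refl, where g="\<lambda>t. 0"]) auto
    then show ?thesis using 2 by (simp add: flat_def)
  next
    case 3
    have l: "((\<lambda>h. flat p h / h) \<longlongrightarrow> 0) (at_left 0)"
      by (rule tendsto_eventually)
        (auto simp: flat_def eventually_at_filter)
    have "((\<lambda>x. poly ([:0,1:] * p) x * exp (- x)) \<longlongrightarrow> (0::real)) at_top"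
      by (rule poly_exp_decay)
    then have "((\<lambda>h. poly ([:0,1:] * p) (inverse h) * exp (- inverse h)) \<longlongrightarrow> (0::real)) (at_right 0)"
      by (rule filterlim_compose[OF _ filterlim_inverse_at_top_right])
    then have r: "((\<lambda>h. flat p h / h) \<longlongrightarrow> 0) (at_right 0)"
      by (rule Lim_transform_eventually)
        (auto simp: flat_def eventually_at_filter field_simps)
    from l r have "((\<lambda>h. flat p h / h) \<longlongrightarrow> 0) (at 0)"
      by (simp add: filterlim_split_at)
    then show ?thesis using 3
      by (simp add: DERIV_def flat_def)
  qed
qed

definition bump :: "real \<Rightarrow> real" where
  "bump = flat 1"

lemma bump_eq: "bump t = (if t > 0 then exp (- (1 / t)) else 0)"
  by (simp add: bump_def flat_def)

lemma bump_nonneg: "0 \<le> bump t" and bump_pos: "0 < bump t \<longleftrightarrow> 0 < t"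
  and bump_zero: "bump t = 0 \<longleftrightarrow> t \<le> 0"
  by (auto simp: bump_eq)

lemma bump_mono: "s \<le> t \<Longrightarrow> bump s \<le> bump t"
  by (auto simp: bump_eq frac_le)

lemma smooth_bump: "smooth f \<Longrightarrow> smooth (\<lambda>x. bump (f x))"
  using smooth_compose_outer[where G="\<lambda>n. flat ((flat_step ^^ n) 1)" and n=0, of f] flat_deriv
  by (simp add: bump_def)

section \<open>Square integrable functions\<close>

lemmas fun_ops = plus_fun_def fun_diff_def scaleR_fun_def zero_fun_def fun_Compl_def

lemma L2_spaceI: "f \<in> borel_measurable M \<Longrightarrow> integrable M (\<lambda>x. (f x)\<^sup>2) \<Longrightarrow> f \<in> L2_space M"
  by (simp add: L2_space_def)

lemma L2_measurable: "f \<in> L2_space M \<Longrightarrow> f \<in> borel_measurable M"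
  by (simp add: L2_space_def)

lemma L2_integrable_square: "f \<in> L2_space M \<Longrightarrow> integrable M (\<lambda>x. (f x)\<^sup>2)"
  by (simp add: L2_space_def)

lemma L2_integrable_mult:
  assumes "f \<in> L2_space M" "g \<in> L2_space M"
  shows "integrable M (\<lambda>x. f x * g x)"
proof (rule Bochner_Integration.integrable_bound)
  show "integrable M (\<lambda>x. (f x)\<^sup>2 + (g x)\<^sup>2)"
    using assms by (simp add: L2_space_def)
  show "(\<lambda>x. f x * g x) \<in> borel_measurable M"
    using assms by (auto simp: L2_space_def)
  have "\<bar>f x * g x\<bar> \<le> (f x)\<^sup>2 + (g x)\<^sup>2" for x
  proof -
    have "0 \<le> (\<bar>f x\<bar> - \<bar>g x\<bar>)\<^sup>2" by simp
    then have "2 * (\<bar>f x\<bar> * \<bar>g x\<bar>) \<le> (f x)\<^sup>2 + (g x)\<^sup>2"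
      by (simp add: power2_diff)
    moreover have "0 \<le> \<bar>f x\<bar> * \<bar>g x\<bar>" by simp
    ultimately show ?thesis unfolding abs_mult by linarith
  qed
  then show "AE x in M. norm (f x * g x) \<le> norm ((f x)\<^sup>2 + (g x)\<^sup>2)" by simp
qed

lemma L2_space_add: "f \<in> L2_space M \<Longrightarrow> g \<in> L2_space M \<Longrightarrow> f + g \<in> L2_space M"
proof -
  assume fg: "f \<in> L2_space M" "g \<in> L2_space M"
  have "integrable M (\<lambda>x. (f x)\<^sup>2 + 2 * (f x * g x) + (g x)\<^sup>2)"
    using fg by (intro Bochner_Integration.integrable_add integrable_mult_right L2_integrable_mult L2_integrable_square)
  then show ?thesis
    using fg by (auto simp: L2_space_def plus_fun_def power2_sum algebra_simps)
qed

lemma L2_space_scaleR: "f \<in> L2_space M \<Longrightarrow> c *\<^sub>R f \<in> L2_space M"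
  by (auto simp: L2_space_def scaleR_fun_def power_mult_distrib)

lemma subspace_L2: "subspace (L2_space M)"
proof -
  have "0 \<in> L2_space M" by (simp add: L2_space_def zero_fun_def)
  then show ?thesis unfolding subspace_def by (auto intro: L2_space_add L2_space_scaleR)
qed

lemmas L2_space_diff = subspace_diff[OF subspace_L2]
lemmas L2_space_zero = subspace_0[OF subspace_L2]
lemmas L2_space_sum = subspace_sum[OF subspace_L2]

lemma L2_space_cong_AE:
  assumes "f \<in> L2_space M" "g \<in> borel_measurable M" "AE x in M. f x = g x"
  shows "g \<in> L2_space M"
proof (rule L2_spaceI)
  show "integrable M (\<lambda>x. (g x)\<^sup>2)"
    by (rule integrable_cong_AE_imp[OF L2_integrable_square[OF assms(1)]]) (use assms in auto)
qed fact

lemma L2_inner_cong_AE: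
  assumes "f \<in> borel_measurable M" "f' \<in> borel_measurable M" "g \<in> borel_measurable M" "g' \<in> borel_measurable M"
    "AE x in M. f x = f' x" "AE x in M. g x = g' x"
  shows "L2_inner M f g = L2_inner M f' g'"
  unfolding L2_inner_def using assms by (intro integral_cong_AE) auto

lemma L2_inner_commute: "L2_inner M f g = L2_inner M g f"
  by (simp add: L2_inner_def mult.commute)

lemma L2_inner_add_left:
  "f \<in> L2_space M \<Longrightarrow> f' \<in> L2_space M \<Longrightarrow> g \<in> L2_space M \<Longrightarrow>
    L2_inner M (f + f') g = L2_inner M f g + L2_inner M f' g"
  by (simp add: L2_inner_def plus_fun_def distrib_right L2_integrable_mult)

lemma L2_inner_diff_left:
  "f \<in> L2_space M \<Longrightarrow> f' \<in> L2_space M \<Longrightarrow> g \<in> L2_space M \<Longrightarrow>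
    L2_inner M (f - f') g = L2_inner M f g - L2_inner M f' g"
  by (simp add: L2_inner_def fun_diff_def left_diff_distrib L2_integrable_mult)

lemma L2_inner_scaleR_left: "L2_inner M (c *\<^sub>R f) g = c * L2_inner M f g"
  by (simp add: L2_inner_def scaleR_fun_def mult.assoc)

lemma L2_inner_add_right:
  "f \<in> L2_space M \<Longrightarrow> g \<in> L2_space M \<Longrightarrow> g' \<in> L2_space M \<Longrightarrow>
    L2_inner M f (g + g') = L2_inner M f g + L2_inner M f g'"
  by (simp add: L2_inner_commute[of M f] L2_inner_add_left)

lemma L2_inner_diff_right:
  "f \<in> L2_space M \<Longrightarrow> g \<in> L2_space M \<Longrightarrow> g' \<in> L2_space M \<Longrightarrow>
    L2_inner M f (g - g') = L2_inner M f g - L2_inner M f g'"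
  by (simp add: L2_inner_commute[of M f] L2_inner_diff_left)

lemma L2_inner_scaleR_right: "L2_inner M f (c *\<^sub>R g) = c * L2_inner M f g"
  by (simp add: L2_inner_commute[of M f] L2_inner_scaleR_left)

lemma L2_inner_zero [simp]: "L2_inner M 0 g = 0" "L2_inner M f 0 = 0"
  by (simp_all add: L2_inner_def zero_fun_def)

lemma L2_space_comb: "f \<in> L2_space M \<Longrightarrow> g \<in> L2_space M \<Longrightarrow> a *\<^sub>R f + b *\<^sub>R g \<in> L2_space M"
  by (intro L2_space_add L2_space_scaleR)

lemma L2_inner_comb_left:
  "f \<in> L2_space M \<Longrightarrow> f' \<in> L2_space M \<Longrightarrow> h \<in> L2_space M \<Longrightarrow>
    L2_inner M (a *\<^sub>R f + b *\<^sub>R f') h = a * L2_inner M f h + b * L2_inner M f' h"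
  by (simp add: L2_inner_add_left L2_space_scaleR L2_inner_scaleR_left)

lemma L2_inner_self_nonneg: "0 \<le> L2_inner M f f"
  by (simp add: L2_inner_def)

lemma L2_norm_power2: "(L2_norm M f)\<^sup>2 = L2_inner M f f"
  by (simp add: L2_norm_def L2_inner_def power2_eq_square)

lemma L2_norm_square_integral: "(L2_norm M f)\<^sup>2 = (LINT x|M. (f x)\<^sup>2)"
  by (simp add: L2_norm_def)

lemma L2_norm_nonneg: "0 \<le> L2_norm M f"
  by (simp add: L2_norm_def)

lemma L2_norm_eq_sqrt: "L2_norm M f = sqrt (L2_inner M f f)"
  by (simp add: L2_norm_def L2_inner_def power2_eq_square)

lemma L2_norm_scaleR: "L2_norm M (c *\<^sub>R f) = \<bar>c\<bar> * L2_norm M f"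
  by (simp add: L2_norm_eq_sqrt L2_inner_scaleR_left L2_inner_scaleR_right real_sqrt_mult mult.assoc[symmetric])

lemma L2_norm_cong_AE:
  assumes "f \<in> borel_measurable M" "g \<in> borel_measurable M" "AE x in M. f x = g x"
  shows "L2_norm M f = L2_norm M g"
  unfolding L2_norm_eq_sqrt using assms by (auto intro!: arg_cong[where f=sqrt] L2_inner_cong_AE)

lemma L2_norm_eq_0_iff:
  assumes "f \<in> L2_space M"
  shows "L2_norm M f = 0 \<longleftrightarrow> (AE x in M. f x = 0)"
  using integral_nonneg_eq_0_iff_AE[OF L2_integrable_square[OF assms]] by (simp add: L2_norm_def)

lemma L2_Cauchy_Schwarz:
  assumes f: "f \<in> L2_space M" and g: "g \<in> L2_space M"
  shows "\<bar>L2_inner M f g\<bar> \<le> L2_norm M f * L2_norm M g"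
proof -
  define a b c where "a = L2_inner M f f" and "b = L2_inner M f g" and "c = L2_inner M g g"
  have q: "0 \<le> x * x * a - 2 * x * y * b + y * y * c" for x y
  proof -
    have s: "x *\<^sub>R f \<in> L2_space M" "y *\<^sub>R g \<in> L2_space M"
      using f g by (auto intro: L2_space_scaleR)
    have "0 \<le> L2_inner M (x *\<^sub>R f - y *\<^sub>R g) (x *\<^sub>R f - y *\<^sub>R g)"
      by (rule L2_inner_self_nonneg)
    also have "\<dots> = x * x * a - 2 * x * y * b + y * y * c"
      using s L2_inner_commute[of M g f] L2_space_diff[OF s]
      by (simp add: L2_inner_diff_left L2_inner_diff_right)
        (simp add: L2_inner_scaleR_left L2_inner_scaleR_right a_def b_def c_def algebra_simps)
    finally show ?thesis .
  qed
  have "b\<^sup>2 \<le> a * c"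
  proof (cases "c = 0")
    case True
    have "b = 0"
    proof (rule ccontr)
      assume "b \<noteq> 0"
      moreover have "0 \<le> a" by (simp add: a_def L2_inner_self_nonneg)
      ultimately show False
        using q[of 1 "(a + 1) / b"] True by simp
    qed
    then show ?thesis using True by simp
  next
    case False
    then have c: "c > 0" using L2_inner_self_nonneg[of M g] by (simp add: c_def)
    have "0 \<le> c * (a * c - b\<^sup>2)"
      using q[of c b] by (simp add: power2_eq_square algebra_simps)
    then show ?thesis using c by (simp add: zero_le_mult_iff)
  qed
  then have "sqrt (b\<^sup>2) \<le> sqrt (a * c)" by (rule real_sqrt_le_mono)
  then show ?thesis
    by (simp add: L2_norm_eq_sqrt real_sqrt_mult a_def b_def c_def)
qed

text \<open>The difference of \<open>f\<close> and \<open>g\<close> is orthogonal to functions by which it is approximated, hence to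
  itself.\<close>

lemma L2_eq_by_testing:
  assumes f: "f \<in> L2_space M" "g \<in> L2_space M" and T: "T \<subseteq> L2_space M"
    and dense: "\<And>e. e > 0 \<Longrightarrow> \<exists>\<zeta>\<in>T. L2_norm M (f - g - \<zeta>) < e"
    and eq: "\<And>\<zeta>. \<zeta> \<in> T \<Longrightarrow> L2_inner M f \<zeta> = L2_inner M g \<zeta>"
  shows "AE x in M. f x = g x"
proof -
  let ?d = "f - g"
  have d: "?d \<in> L2_space M" using f by (rule L2_space_diff)
  have "L2_norm M ?d = 0"
  proof (rule ccontr)
    assume "L2_norm M ?d \<noteq> 0"
    then have pos: "L2_norm M ?d > 0" using L2_norm_nonneg[of M ?d] by simp
    obtain \<zeta> where z: "\<zeta> \<in> T" "L2_norm M (?d - \<zeta>) < L2_norm M ?d"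
      using dense[OF pos] by blast
    have zL: "\<zeta> \<in> L2_space M" using z T by blast
    have "(L2_norm M ?d)\<^sup>2 = L2_inner M ?d ?d - L2_inner M ?d \<zeta>"
      using eq[OF z(1)] f zL by (simp add: L2_norm_power2 L2_inner_diff_left)
    also have "\<dots> = L2_inner M ?d (?d - \<zeta>)" using d zL by (simp add: L2_inner_diff_right)
    also have "\<dots> \<le> L2_norm M ?d * L2_norm M (?d - \<zeta>)"
      using L2_Cauchy_Schwarz[OF d L2_space_diff[OF d zL]] by linarith
    also have "\<dots> < L2_norm M ?d * L2_norm M ?d" using z pos by (intro mult_strict_left_mono)
    finally show False by (simp add: power2_eq_square)
  qed
  then show ?thesis using L2_norm_eq_0_iff[OF d] by (simp add: fun_diff_def)
qed

lemma L2_norm_zero [simp]: "L2_norm M 0 = 0"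
  by (simp add: L2_norm_def zero_fun_def)

lemma L2_norm_triangle:
  assumes f: "f \<in> L2_space M" and g: "g \<in> L2_space M"
  shows "L2_norm M (f + g) \<le> L2_norm M f + L2_norm M g"
proof (rule power2_le_imp_le)
  have "(L2_norm M (f + g))\<^sup>2 = (L2_norm M f)\<^sup>2 + 2 * L2_inner M f g + (L2_norm M g)\<^sup>2"
    using f g L2_inner_commute[of M g f]
    by (simp add: L2_norm_power2 L2_inner_add_left L2_inner_add_right L2_space_add)
  also have "\<dots> \<le> (L2_norm M f + L2_norm M g)\<^sup>2"
    using L2_Cauchy_Schwarz[OF f g] by (simp add: power2_sum)
  finally show "(L2_norm M (f + g))\<^sup>2 \<le> (L2_norm M f + L2_norm M g)\<^sup>2" .
qed (simp add: L2_norm_nonneg)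

lemma L2_norm_minus_commute: "L2_norm M (f - g) = L2_norm M (g - f)"
  by (simp add: L2_norm_def fun_diff_def power2_commute)

lemma L2_norm_triangle_diff:
  assumes f: "f \<in> L2_space M" and g: "g \<in> L2_space M" and h: "h \<in> L2_space M"
  shows "L2_norm M (f - h) \<le> L2_norm M (f - g) + L2_norm M (g - h)"
  using L2_norm_triangle[of "f - g" M "g - h"] f g h by (simp add: L2_space_diff)

lemma L2_norm_triangle_minus:
  assumes f: "f \<in> L2_space M" and g: "g \<in> L2_space M"
  shows "L2_norm M (f - g) \<le> L2_norm M f + L2_norm M g"
  using L2_norm_triangle_diff[OF f L2_space_zero g] L2_norm_minus_commute[of M 0 g] by simp

lemma L2_space_bounded:
  assumes "finite_measure M" "f \<in> borel_measurable M" "\<And>x. x \<in> space M \<Longrightarrow> \<bar>f x\<bar> \<le> c"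
  shows "f \<in> L2_space M"
proof (rule L2_spaceI)
  have "(f x)\<^sup>2 \<le> c\<^sup>2" if "x \<in> space M" for x
    using assms(3)[OF that] by (simp add: abs_le_square_iff[symmetric])
  then show "integrable M (\<lambda>x. (f x)\<^sup>2)"
    using assms by (intro finite_measure.integrable_const_bound[where B="c\<^sup>2"]) auto
qed (use assms in auto)

section \<open>Density of test functions\<close>

lemma test_function_zero: "test_function U (\<lambda>x. 0)"
  unfolding test_function_def by (intro conjI smooth_const exI[of _ "{}"]) auto

lemma test_function_smooth: "test_function U f \<Longrightarrow> smooth f"
  by (simp add: test_function_def)

lemma test_function_add:
  assumes "test_function U f" "test_function U g"
  shows "test_function U (\<lambda>x. f x + g x)"
proof -
  obtain K L where "compact K" "K \<subseteq> U" "\<forall>x. x \<notin> K \<longrightarrow> f x = 0"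
    "compact L" "L \<subseteq> U" "\<forall>x. x \<notin> L \<longrightarrow> g x = 0"
    using assms unfolding test_function_def by blast
  then have "compact (K \<union> L) \<and> K \<union> L \<subseteq> U \<and> (\<forall>x. x \<notin> K \<union> L \<longrightarrow> f x + g x = 0)"
    by auto
  moreover have "smooth (\<lambda>x. f x + g x)"
    using assms by (intro smooth_add) (auto simp: test_function_def)
  ultimately show ?thesis
    unfolding test_function_def by (intro conjI exI[of _ "K \<union> L"]) auto
qed

lemma test_function_mult:
  assumes "test_function U f" "smooth g"
  shows "test_function U (\<lambda>x. f x * g x)"
proof -
  obtain K where "compact K" "K \<subseteq> U" "\<forall>x. x \<notin> K \<longrightarrow> f x = 0"
    using assms unfolding test_function_def by blast
  moreover have "smooth (\<lambda>x. f x * g x)"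
    using assms by (intro smooth_mult) (auto simp: test_function_def)
  ultimately show ?thesis
    unfolding test_function_def by (intro conjI exI[of _ K]) auto
qed

lemma test_function_cmult: "test_function U f \<Longrightarrow> test_function U (\<lambda>x. c * f x)"
  using test_function_mult[OF _ smooth_const, of U f c] by (simp add: mult.commute)

lemma test_function_mono: "test_function U f \<Longrightarrow> U \<subseteq> V \<Longrightarrow> test_function V f"
  unfolding test_function_def by blast

lemma test_function_bounded:
  assumes "test_function U f"
  obtains c where "\<And>x. \<bar>f x\<bar> \<le> c"
proof -
  obtain K where K: "compact K" "\<forall>x. x \<notin> K \<longrightarrow> f x = 0" and f: "smooth f"
    using assms unfolding test_function_def by blast
  have "compact (f ` K)"
    using f K by (intro compact_continuous_image smooth_imp_continuous)
  then obtain c where c: "\<forall>x\<in>K. \<bar>f x\<bar> \<le> c"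
    using compact_imp_bounded by (force simp: bounded_iff)
  have "\<bar>f x\<bar> \<le> max c 0" for x
    using c K(2) by (cases "x \<in> K") (auto intro: order_trans[OF _ max.cobounded1])
  then show ?thesis by (rule that)
qed

text \<open>Cover \<open>U\<close> by countably many balls whose closures lie in \<open>U\<close> and take bumps \<open>b i\<close> that are positive
  exactly on these balls. Then $1 - \exp(-n\sum_{i<n} b_i)$ vanishes off finitely many of the closed
  balls and increases to one at every point where some bump is positive, that is, on \<open>U\<close>.\<close>

lemma open_indicator_limit_of_test_functions:
  fixes U :: "'a::euclidean_space set"
  assumes "open U"
  obtains \<zeta> where "\<And>n::nat. test_function U (\<zeta> n)" "\<And>n x. 0 \<le> \<zeta> n x" "\<And>n x. \<zeta> n x \<le> 1"
    "\<And>x. (\<lambda>n. \<zeta> n x) \<longlonglongrightarrow> indicator U x"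
proof (cases "U = {}")
  case True
  show ?thesis
    by (rule that[of "\<lambda>n x. 0"]) (auto simp: True test_function_zero)
next
  case False
  define F where "F = {ball x r | x r. 0 < r \<and> cball x r \<subseteq> U}"
  have UF: "\<Union>F = U"
  proof
    show "U \<subseteq> \<Union>F"
    proof
      fix x assume "x \<in> U"
      then obtain r where "r > 0" "cball x r \<subseteq> U"
        using \<open>open U\<close> open_contains_cball by blast
      then have "ball x r \<in> F" "x \<in> ball x r" unfolding F_def by auto
      then show "x \<in> \<Union>F" by blast
    qed
    show "\<Union>F \<subseteq> U"
    proof (rule Union_least)
      fix B assume "B \<in> F"
      then obtain x r where "B = ball x r" "cball x r \<subseteq> U" unfolding F_def by auto
      then show "B \<subseteq> U" using ball_subset_cball[of x r] by (metis order_trans)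
    qed
  qed
  have "open B" if "B \<in> F" for B
    using that by (auto simp: F_def)
  then obtain F' where F': "F' \<subseteq> F" "countable F'" "\<Union>F' = U"
    using Lindelof[of F] unfolding UF by metis
  have ne: "F' \<noteq> {}" using F' False by auto
  have "\<forall>n. \<exists>x r. from_nat_into F' n = ball x r \<and> 0 < r \<and> cball x r \<subseteq> U"
  proof
    fix n
    have "from_nat_into F' n \<in> F" using from_nat_into[OF ne, of n] F'(1) by (rule rev_subsetD)
    then show "\<exists>x r. from_nat_into F' n = ball x r \<and> 0 < r \<and> cball x r \<subseteq> U"
      by (simp add: F_def)
  qed
  then obtain a r where ar: "\<And>n. from_nat_into F' n = ball (a n) (r n)" "\<And>n. 0 < r n" "\<And>n. cball (a n) (r n) \<subseteq> U"
    by metis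
  define b where "b n x = bump ((r n)\<^sup>2 - (x - a n) \<bullet> (x - a n))" for n x
  have b0: "b n x > 0 \<longleftrightarrow> x \<in> ball (a n) (r n)" for n x
  proof -
    have "b n x > 0 \<longleftrightarrow> (norm (x - a n))\<^sup>2 < (r n)\<^sup>2"
      by (simp add: b_def bump_pos dot_square_norm)
    also have "\<dots> \<longleftrightarrow> norm (x - a n) < r n"
      using ar(2)[of n] power_less_imp_less_base[of "norm (x - a n)" 2 "r n"] power_strict_mono[of "norm (x - a n)" "r n" 2]
      by (meson less_imp_le norm_ge_zero pos2)
    finally show ?thesis by (simp add: dist_norm norm_minus_commute)
  qed
  have bnn: "b n x \<ge> 0" for n x by (simp add: b_def bump_nonneg)
  have bs: "smooth (b n)" for n
    unfolding b_def by (intro smooth_bump smooth_diff smooth_const smooth_power2_dist)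
  define S where "S n x = (\<Sum>i<n. b i x)" for n x
  define \<zeta> where "\<zeta> n x = 1 - exp (- (real n * S n x))" for n x
  have Snn: "S n x \<ge> 0" for n x unfolding S_def by (simp add: bnn sum_nonneg)
  show ?thesis
  proof (rule that[of \<zeta>])
    fix n x
    show "0 \<le> \<zeta> n x" "\<zeta> n x \<le> 1" using Snn by (simp_all add: \<zeta>_def)
  next
    fix n
    have sS: "smooth (S n)" unfolding S_def by (intro smooth_sum bs)
    have "smooth (\<lambda>x. 1 - exp ((- real n) * S n x))"
      by (intro smooth_diff smooth_const smooth_exp smooth_cmult sS)
    then have "smooth (\<zeta> n)" by (simp add: \<zeta>_def[abs_def])
    moreover have "\<zeta> n x = 0" if "x \<notin> (\<Union>i<n. cball (a i) (r i))" for x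
    proof -
      have "b i x = 0" if "i < n" for i
      proof -
        have "x \<notin> ball (a i) (r i)" using \<open>x \<notin> _\<close> that ball_subset_cball[of "a i" "r i"] by (meson UN_I lessThan_iff subsetD)
        then show ?thesis using b0[of i x] bnn[of i x] by auto
      qed
      then show ?thesis by (simp add: \<zeta>_def S_def)
    qed
    moreover have "compact (\<Union>i<n. cball (a i) (r i))" by auto
    moreover have "(\<Union>i<n. cball (a i) (r i)) \<subseteq> U" using ar(3) by (intro UN_least)
    ultimately show "test_function U (\<zeta> n)" unfolding test_function_def by blast
  next
    fix x
    show "(\<lambda>n. \<zeta> n x) \<longlonglongrightarrow> indicator U x"
    proof (cases "x \<in> U")
      case False
      have "b i x = 0" for i
        using b0[of i x] bnn[of i x] False ar(3)[of i] ball_subset_cball[of "a i" "r i"] by force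
      then show ?thesis using False by (simp add: \<zeta>_def S_def)
    next
      case True
      then obtain B where "B \<in> F'" "x \<in> B" using F' by blast
      then obtain i where i: "x \<in> ball (a i) (r i)"
        using from_nat_into_surj[OF F'(2)] ar(1) by metis
      define c where "c = b i x"
      have c: "c > 0" using i b0 by (simp add: c_def)
      have "((\<lambda>n. exp (- (real n * c))) \<longlongrightarrow> 0) sequentially"
      proof (intro filterlim_compose[OF exp_at_bot] filterlim_compose[OF filterlim_uminus_at_bot_at_top])
        show "filterlim (\<lambda>n. real n * c) at_top sequentially"
          using filterlim_tendsto_pos_mult_at_top[OF tendsto_const c filterlim_real_sequentially]
          by (simp add: mult.commute)
      qed
      then have "(\<lambda>n. 1 - exp (- (real n * c))) \<longlonglongrightarrow> 1 - 0"
        by (intro tendsto_diff tendsto_const)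
      moreover have "eventually (\<lambda>n. 1 - exp (- (real n * c)) \<le> \<zeta> n x) sequentially"
      proof (rule eventually_mono[OF eventually_gt_at_top[of i]])
        fix n assume "i < n"
        then have "c \<le> S n x" unfolding S_def c_def by (intro member_le_sum) (auto simp: bnn)
        then show "1 - exp (- (real n * c)) \<le> \<zeta> n x"
          by (simp add: \<zeta>_def mult_left_mono)
      qed
      moreover have "eventually (\<lambda>n. \<zeta> n x \<le> 1) sequentially"
        by (simp add: \<zeta>_def)
      ultimately have "(\<lambda>n. \<zeta> n x) \<longlonglongrightarrow> 1"
        using tendsto_sandwich[of "\<lambda>n. 1 - exp (- (real n * c))" "\<lambda>n. \<zeta> n x" sequentially "\<lambda>n. 1" 1] by simp
      then show ?thesis using True by simp
    qed
  qed
qed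

text \<open>The functions that can be approximated form a closed subspace \<open>D\<close>. It contains the indicators of
  open sets by the preceding construction, those of Borel sets by outer regularity of finite Borel
  measures, and therefore simple functions and their limits. Measures on Borel subsets of the space
  are included with a view to surface measures.\<close>

lemma test_functions_dense_L2:
  fixes N :: "'a::euclidean_space measure"
  assumes fin: "finite_measure N" and id: "(\<lambda>x. x) \<in> borel_measurable N"
    and sub: "\<And>A. A \<in> sets N \<Longrightarrow> A \<in> sets borel"
    and U: "open U" "space N \<subseteq> U" and f: "f \<in> L2_space N" and e: "e > 0"
  shows "\<exists>\<zeta>. test_function U \<zeta> \<and> \<zeta> \<in> L2_space N \<and> L2_norm N (f - \<zeta>) < e"
proof -
  interpret finite_measure N by fact
  have tL2: "\<zeta> \<in> L2_space N" if "test_function U \<zeta>" for \<zeta>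
  proof -
    obtain c where "\<And>x. \<bar>\<zeta> x\<bar> \<le> c" using test_function_bounded[OF \<open>test_function U \<zeta>\<close>] by blast
    moreover have "\<zeta> \<in> borel_measurable borel"
      using that by (intro borel_measurable_continuous_onI smooth_imp_continuous test_function_smooth)
    ultimately show ?thesis
      using measurable_compose[OF id] by (intro L2_space_bounded[OF fin]) auto
  qed
  define D where "D = {f \<in> L2_space N. \<forall>e>0. \<exists>\<zeta>. test_function U \<zeta> \<and> L2_norm N (f - \<zeta>) < e}"
  have DD: "\<exists>\<zeta>. test_function U \<zeta> \<and> L2_norm N (f - \<zeta>) < e" if "f \<in> D" "e > 0" for f e
    using that by (simp add: D_def)
  have D0: "0 \<in> D"
    using test_function_zero[of U] L2_space_zero[of N] unfolding D_def
    by (auto simp: zero_fun_def[symmetric] intro!: exI[of _ 0])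
  have Dadd: "f + g \<in> D" if fD: "f \<in> D" and gD: "g \<in> D" for f g
    unfolding D_def
  proof (clarsimp, intro conjI allI impI)
    show "f + g \<in> L2_space N" using that by (auto simp: D_def L2_space_add)
    fix e :: real assume "e > 0"
    then have "e / 2 > 0" by simp
    obtain \<zeta> where z1: "test_function U \<zeta>" "L2_norm N (f - \<zeta>) < e/2"
      using DD[OF fD \<open>e / 2 > 0\<close>] by blast
    obtain \<eta> where z2: "test_function U \<eta>" "L2_norm N (g - \<eta>) < e/2"
      using DD[OF gD \<open>e / 2 > 0\<close>] by blast
    note z = z1 z2
    have "L2_norm N (f + g - (\<zeta> + \<eta>)) = L2_norm N ((f - \<zeta>) + (g - \<eta>))"
      by (simp only: add_diff_add)
    also have "\<dots> \<le> L2_norm N (f - \<zeta>) + L2_norm N (g - \<eta>)"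
      using that z by (intro L2_norm_triangle L2_space_diff) (auto simp: D_def tL2)
    also have "\<dots> < e" using z by simp
    finally have "L2_norm N (f + g - (\<zeta> + \<eta>)) < e" .
    moreover have "test_function U (\<zeta> + \<eta>)"
      using test_function_add[OF z(1,3)] by (simp add: plus_fun_def)
    ultimately show "\<exists>\<zeta>. test_function U \<zeta> \<and> L2_norm N (f + g - \<zeta>) < e" by blast
  qed
  have Dscale: "c *\<^sub>R f \<in> D" if fD: "f \<in> D" for c f
    unfolding D_def
  proof (clarsimp, intro conjI allI impI)
    show "c *\<^sub>R f \<in> L2_space N" using that by (auto simp: D_def L2_space_scaleR)
    fix e :: real assume "e > 0"
    then have "e / (\<bar>c\<bar> + 1) > 0" by simp
    then obtain \<zeta> where z: "test_function U \<zeta>" "L2_norm N (f - \<zeta>) < e / (\<bar>c\<bar> + 1)"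
      using DD[OF fD] by blast
    have "L2_norm N (c *\<^sub>R f - c *\<^sub>R \<zeta>) = \<bar>c\<bar> * L2_norm N (f - \<zeta>)"
      by (simp add: L2_norm_scaleR flip: scaleR_diff_right)
    also have "\<dots> \<le> (\<bar>c\<bar> + 1) * L2_norm N (f - \<zeta>)"
      by (simp add: mult_right_mono L2_norm_nonneg)
    also have "\<dots> < e" using z(2) pos_less_divide_eq[of "\<bar>c\<bar> + 1" "L2_norm N (f - \<zeta>)" e]
      by (simp add: mult.commute)
    finally have "L2_norm N (c *\<^sub>R f - c *\<^sub>R \<zeta>) < e" .
    moreover have "test_function U (c *\<^sub>R \<zeta>)"
      using test_function_cmult[OF z(1), of c] by (simp add: scaleR_fun_def)
    ultimately show "\<exists>\<zeta>. test_function U \<zeta> \<and> L2_norm N (c *\<^sub>R f - \<zeta>) < e" by blast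
  qed
  have Dlim: "f \<in> D" if f: "f \<in> L2_space N" and g: "\<And>n::nat. g n \<in> D" and l: "(\<lambda>n. L2_norm N (f - g n)) \<longlonglongrightarrow> 0" for f g
    unfolding D_def
  proof (clarsimp, intro conjI allI impI)
    show "f \<in> L2_space N" by fact
    fix e :: real assume "e > 0"
    then obtain n where n: "L2_norm N (f - g n) < e/2"
      using order_tendstoD(2)[OF l, of "e/2"] by (auto dest: eventually_happens)
    obtain \<zeta> where z: "test_function U \<zeta>" "L2_norm N (g n - \<zeta>) < e/2"
      using DD[OF g, of "e/2" n] \<open>e > 0\<close> by auto
    have "L2_norm N (f - \<zeta>) \<le> L2_norm N (f - g n) + L2_norm N (g n - \<zeta>)"
      using f g z by (intro L2_norm_triangle_diff) (auto simp: D_def tL2)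
    then show "\<exists>\<zeta>. test_function U \<zeta> \<and> L2_norm N (f - \<zeta>) < e"
      using n z by (intro exI[of _ \<zeta>]) auto
  qed
  have Dtest: "\<zeta> \<in> D" if "test_function U \<zeta>" for \<zeta>
    using that tL2 unfolding D_def by (auto intro!: exI[of _ \<zeta>])
  have Vsets: "V \<inter> space N \<in> sets N" if "V \<in> sets borel" for V
    using measurable_sets[OF id that] by simp
  have Vmeas: "indicat_real V \<in> borel_measurable N" if "V \<in> sets borel" for V
    using measurable_compose[OF id borel_measurable_indicator[OF that]] .
  have VL2: "indicat_real V \<in> L2_space N" if "V \<in> sets borel" for V
    by (rule L2_space_bounded[OF fin, where c=1]) (auto simp: that Vmeas indicator_def)
  have Dopen: "indicat_real V \<in> D" if V: "open V" for V
  proof -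
    obtain \<zeta> where z: "\<And>n::nat. test_function (V \<inter> U) (\<zeta> n)" "\<And>n x. 0 \<le> \<zeta> n x" "\<And>n x. \<zeta> n x \<le> 1"
      "\<And>x. (\<lambda>n. \<zeta> n x) \<longlonglongrightarrow> indicator (V \<inter> U) x"
      using open_indicator_limit_of_test_functions[of "V \<inter> U"] V U by blast
    have zt: "test_function U (\<zeta> n)" for n using test_function_mono[OF z(1)] by blast
    have "(\<lambda>n. LINT x|N. (indicat_real V x - \<zeta> n x)\<^sup>2) \<longlonglongrightarrow> (LINT x|N. 0)"
    proof (rule integral_dominated_convergence[where w="\<lambda>x. 1"])
      show "AE x in N. (\<lambda>n. (indicat_real V x - \<zeta> n x)\<^sup>2) \<longlonglongrightarrow> 0"
      proof (rule AE_I2)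
        fix x assume "x \<in> space N"
        then have "indicat_real (V \<inter> U) x = indicat_real V x" using U by (auto simp: indicator_def)
        then have "(\<lambda>n. (indicat_real V x - \<zeta> n x)\<^sup>2) \<longlonglongrightarrow> (indicat_real V x - indicat_real V x)\<^sup>2"
          using z(4)[of x] by (intro tendsto_intros) auto
        then show "(\<lambda>n. (indicat_real V x - \<zeta> n x)\<^sup>2) \<longlonglongrightarrow> 0" by simp
      qed
      show "AE x in N. norm ((indicat_real V x - \<zeta> n x)\<^sup>2) \<le> 1" for n
      proof (rule AE_I2)
        fix x
        have "\<bar>indicat_real V x - \<zeta> n x\<bar> \<le> 1" using z(2)[of n x] z(3)[of n x] by (auto simp: indicator_def)
        then show "norm ((indicat_real V x - \<zeta> n x)\<^sup>2) \<le> 1" by (simp add: abs_square_le_1)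
      qed
      show "(\<lambda>x. (indicat_real V x - \<zeta> n x)\<^sup>2) \<in> borel_measurable N" for n
        using Vmeas[of V] V tL2[OF zt[of n]] by (auto simp: L2_space_def)
    qed simp_all
    then have "(\<lambda>n. sqrt (LINT x|N. (indicat_real V x - \<zeta> n x)\<^sup>2)) \<longlonglongrightarrow> sqrt 0"
      by (intro tendsto_real_sqrt) simp
    then have "(\<lambda>n. L2_norm N (indicat_real V - \<zeta> n)) \<longlonglongrightarrow> 0"
      by (simp add: L2_norm_def fun_diff_def)
    with Dlim[of "indicat_real V" \<zeta>, OF VL2 Dtest[OF zt]] V show ?thesis by simp
  qed
  define N' where "N' = distr N borel (\<lambda>x. x)"
  have N': "emeasure N' A = emeasure N (A \<inter> space N)" if "A \<in> sets borel" for A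
    unfolding N'_def using id that by (simp add: emeasure_distr)
  have N'fin: "emeasure N' (space N') \<noteq> \<infinity>"
    by (simp add: N' N'_def[THEN arg_cong[where f=space]])
  have Dset: "indicat_real A \<in> D" if A: "A \<in> sets borel" for A
  proof -
    \<comment> \<open>an open set exceeding \<open>A\<close> by measure \<open>d\<^sup>2\<close> is within \<open>d\<close> of it in the norm\<close>
    have "\<exists>V. open V \<and> L2_norm N (indicat_real A - indicat_real V) < 1 / real (Suc n)" for n
    proof -
      define d where "d = 1 / real (Suc n)"
      have d: "d > 0" by (simp add: d_def)
      have "emeasure N' A = (INF U \<in> {U. A \<subseteq> U \<and> open U}. emeasure N' U)"
        using N'fin A by (intro outer_regular) (auto simp: N'_def)
      moreover have "emeasure N' A < emeasure N' A + ennreal (d\<^sup>2)"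
        using d N'[OF A] emeasure_finite[of "A \<inter> space N"]
        by (metis ennreal_add_left_cancel_less add.right_neutral ennreal_less_zero_iff infinity_ennreal_def top.not_eq_extremum zero_less_power)
      ultimately have "(INF U \<in> {U. A \<subseteq> U \<and> open U}. emeasure N' U) < emeasure N' A + ennreal (d\<^sup>2)"
        by simp
      then obtain V where V: "A \<subseteq> V" "open V" "emeasure N' V < emeasure N' A + ennreal (d\<^sup>2)"
        unfolding INF_less_iff by blast
      have Vb: "V \<in> sets borel" using V by simp
      have "emeasure N (V \<inter> space N) < emeasure N (A \<inter> space N) + ennreal (d\<^sup>2)"
        using V N'[OF A] N'[OF Vb] by simp
      then have "measure N (V \<inter> space N) < measure N (A \<inter> space N) + d\<^sup>2"
        by (simp add: emeasure_eq_measure ennreal_less_iff flip: ennreal_plus)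
      moreover have "measure N (V \<inter> space N - A \<inter> space N) = measure N (V \<inter> space N) - measure N (A \<inter> space N)"
        using V(1) by (intro finite_measure_Diff[OF Vsets[OF Vb] Vsets[OF A]]) blast
      ultimately have m: "measure N (V \<inter> space N - A \<inter> space N) < d\<^sup>2" by simp
      have "(LINT x|N. (indicat_real A x - indicat_real V x)\<^sup>2) = (LINT x|N. indicat_real (V \<inter> space N - A \<inter> space N) x)"
        using V by (intro Bochner_Integration.integral_cong) (auto simp: indicator_def)
      also have "\<dots> = measure N (V \<inter> space N - A \<inter> space N)"
      proof -
        have "(V \<inter> space N - A \<inter> space N) \<inter> space N = V \<inter> space N - A \<inter> space N" by blast
        then show ?thesis by (simp only: Bochner_Integration.integral_indicator)
      qed
      finally have "L2_norm N (indicat_real A - indicat_real V) = sqrt (measure N (V \<inter> space N - A \<inter> space N))"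
        by (simp add: L2_norm_def fun_diff_def)
      also have "\<dots> < sqrt (d\<^sup>2)" using m by (rule real_sqrt_less_mono)
      also have "\<dots> = 1 / real (Suc n)" using d by (simp add: d_def)
      finally show ?thesis using V(2) by blast
    qed
    then obtain V where V: "\<And>n. open (V n)" "\<And>n. L2_norm N (indicat_real A - indicat_real (V n)) < 1 / real (Suc n)"
      by metis
    have "(\<lambda>n. L2_norm N (indicat_real A - indicat_real (V n))) \<longlonglongrightarrow> 0"
    proof (rule tendsto_sandwich[OF _ _ tendsto_const LIMSEQ_Suc[OF lim_1_over_n]])
      show "\<forall>\<^sub>F n in sequentially. 0 \<le> L2_norm N (indicat_real A - indicat_real (V n))"
        by (simp add: L2_norm_nonneg)
      show "\<forall>\<^sub>F n in sequentially. L2_norm N (indicat_real A - indicat_real (V n)) \<le> 1 / real (Suc n)"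
        using less_imp_le[OF V(2)] by (rule always_eventually[rule_format])
    qed
    with Dlim[of "indicat_real A" "\<lambda>n. indicat_real (V n)", OF VL2[OF A] Dopen[OF V(1)]]
    show ?thesis by simp
  qed
  have Dcong: "g \<in> D" if "f \<in> D" "\<And>x. x \<in> space N \<Longrightarrow> f x = g x" for f g
  proof -
    have "L2_norm N (g - h) = L2_norm N (f - h)" for h
      unfolding L2_norm_def using that(2) by (auto simp: fun_diff_def intro!: arg_cong[where f=sqrt] Bochner_Integration.integral_cong)
    moreover have "g \<in> borel_measurable N"
      using that measurable_cong[of N f g] by (auto simp: D_def L2_space_def)
    ultimately show ?thesis using that(1) L2_space_cong_AE[of f N g] that(2) by (auto simp: D_def)
  qed
  have Dsum: "sum F I \<in> D" if "finite I" "\<And>y. F y \<in> D" for F :: "real \<Rightarrow> 'a \<Rightarrow> real" and I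
    using that(1)
  proof induction
    case empty
    show ?case by (simp only: sum.empty D0)
  next
    case (insert y I)
    show ?case unfolding sum.insert[OF insert(1,2)] by (rule Dadd[OF that(2) insert(3)])
  qed
  have Dsimple: "g \<in> D" if g: "simple_function N g" for g
  proof -
    have "(\<Sum>y\<in>g ` space N. y *\<^sub>R indicat_real (g -` {y} \<inter> space N)) \<in> D"
    proof -
      have "finite (g ` space N)" using g by (simp add: simple_function_def)
      moreover have "g -` {y} \<inter> space N \<in> sets borel" for y
        by (rule sub) (use g in \<open>auto intro: simple_functionD\<close>)
      ultimately show ?thesis
        by (intro Dsum Dscale Dset)
    qed
    then show ?thesis
    proof (rule Dcong)
      fix x assume "x \<in> space N"
      have sum_app: "(\<Sum>y\<in>I. F y) x = (\<Sum>y\<in>I. F y x)" for I and F :: "real \<Rightarrow> 'a \<Rightarrow> real"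
        by (induction I rule: infinite_finite_induct) (simp_all add: fun_ops)
      show "(\<Sum>y\<in>g ` space N. y *\<^sub>R indicat_real (g -` {y} \<inter> space N)) x = g x"
        unfolding sum_app simple_function_indicator_representation_banach[OF g \<open>x \<in> space N\<close>]
        by (rule sum.cong) (auto simp: scaleR_fun_def)
    qed
  qed
  obtain s where s: "\<And>i. simple_function N (s i)" "\<And>x. x \<in> space N \<Longrightarrow> (\<lambda>i. s i x) \<longlonglongrightarrow> f x"
     "\<And>i x. x \<in> space N \<Longrightarrow> dist (s i x) 0 \<le> 2 * dist (f x) 0"
    using borel_measurable_implies_sequence_metric[OF L2_measurable[OF f], of 0] by blast
  \<comment> \<open>the factor 9 comes from \<open>\<bar>s n x\<bar> \<le> 2 * \<bar>f x\<bar>\<close>\<close>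
  have "(\<lambda>n. LINT x|N. (f x - s n x)\<^sup>2) \<longlonglongrightarrow> (LINT x|N. 0)"
  proof (rule integral_dominated_convergence[where w="\<lambda>x. 9 * (f x)\<^sup>2"])
    show "AE x in N. (\<lambda>n. (f x - s n x)\<^sup>2) \<longlonglongrightarrow> 0"
    proof (rule AE_I2)
      fix x assume "x \<in> space N"
      then have "(\<lambda>n. (f x - s n x)\<^sup>2) \<longlonglongrightarrow> (f x - f x)\<^sup>2" by (intro tendsto_intros s)
      then show "(\<lambda>n. (f x - s n x)\<^sup>2) \<longlonglongrightarrow> 0" by simp
    qed
    show "AE x in N. norm ((f x - s n x)\<^sup>2) \<le> 9 * (f x)\<^sup>2" for n
    proof (rule AE_I2)
      fix x assume "x \<in> space N"
      then have "\<bar>f x - s n x\<bar> \<le> \<bar>3 * f x\<bar>" using s(3)[of x n] by (simp add: abs_mult)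
      then have "(f x - s n x)\<^sup>2 \<le> (3 * f x)\<^sup>2" by (simp add: abs_le_square_iff)
      then show "norm ((f x - s n x)\<^sup>2) \<le> 9 * (f x)\<^sup>2" by (simp add: power_mult_distrib)
    qed
    show "(\<lambda>x. (f x - s n x)\<^sup>2) \<in> borel_measurable N" for n
      using L2_measurable[OF f] borel_measurable_simple_function[OF s(1)] by auto
    show "integrable N (\<lambda>x. 9 * (f x)\<^sup>2)" using L2_integrable_square[OF f] by simp
  qed simp_all
  then have "(\<lambda>n. sqrt (LINT x|N. (f x - s n x)\<^sup>2)) \<longlonglongrightarrow> sqrt 0"
    by (intro tendsto_real_sqrt) simp
  then have "(\<lambda>n. L2_norm N (f - s n)) \<longlonglongrightarrow> 0"
    by (simp add: L2_norm_def fun_diff_def)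
  with Dlim[of f s, OF f Dsimple[OF s(1)]] have "f \<in> D" by simp
  from DD[OF this e] obtain \<zeta> where "test_function U \<zeta>" "L2_norm N (f - \<zeta>) < e" by blast
  then show ?thesis using tL2[of \<zeta>] by blast
qed

section \<open>Surface measures\<close>

definition hausdorff_borel :: "point measure" where
  "hausdorff_borel = measure_of UNIV (sets borel) hausdorff2"

lemma surface_measure_eq: "surface_measure S = restrict_space hausdorff_borel S"
  by (simp add: surface_measure_def hausdorff_borel_def)

lemma space_hausdorff_borel [simp]: "space hausdorff_borel = UNIV"
  by (simp add: hausdorff_borel_def space_measure_of_conv)

lemma sigma_sets_borel: "sigma_sets UNIV (sets borel) = sets (borel :: point measure)"
  by (metis sets.sigma_sets_eq space_borel)

lemma sets_hausdorff_borel [simp]: "sets hausdorff_borel = sets borel"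
  by (simp add: hausdorff_borel_def sets_measure_of_conv sigma_sets_borel)

text \<open>By convention the measure generated by a set function is zero unless the set function is
  countably additive. Finiteness on the sphere and on the boundary and invariance under reflection
  hold in either case.\<close>

lemma emeasure_hausdorff_borel:
  "(\<forall>A. emeasure hausdorff_borel A = 0) \<or> (\<forall>A\<in>sets borel. emeasure hausdorff_borel A = hausdorff2 A)"
  by (auto simp: hausdorff_borel_def emeasure_measure_of_conv sigma_sets_borel)

text \<open>Cutting the square into \<open>n * n\<close> equal squares of side \<open>2 * M / n\<close> gives covering sets of diameter
  $O(1/n)$, and the sum of the squares of their diameters is bounded independently of \<open>n\<close>.\<close>

lemma hausdorff2_lipschitz_image_finite:
  fixes F :: "real \<times> real \<Rightarrow> point"
  assumes F: "\<And>p q. norm (F p - F q) \<le> K * norm (p - q)" and K: "K \<ge> 0" and M: "M \<ge> 0"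
    and A: "A \<subseteq> F ` ({-M..M} \<times> {-M..M})"
  shows "hausdorff2 A < \<infinity>"
proof -
  define C where "C = ennreal (pi / 4 * (4 * M * K)\<^sup>2)"
  have "hausdorff2_delta \<delta> A \<le> C" if \<delta>: "\<delta> > 0" for \<delta>
  proof -
    obtain n0 :: nat where "4 * M * K / \<delta> < real n0" using reals_Archimedean2 by blast
    define n where "n = Suc n0"
    have n: "real n > 0" "4 * M * K / real n \<le> \<delta>"
    proof -
      have "4 * M * K \<le> real n * \<delta>"
        using \<open>4 * M * K / \<delta> < real n0\<close> \<delta> by (simp add: n_def field_simps)
      then show "4 * M * K / real n \<le> \<delta>" by (simp add: n_def field_simps)
    qed (simp add: n_def)
    \<comment> \<open>the small squares are numbered row by row, the remaining covering sets are empty\<close>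
    define I where "I j = {-M + 2 * M * real j / real n .. -M + 2 * M * (real j + 1) / real n}" for j :: nat
    define U where "U i = (if i < n * n then F ` (I (i div n) \<times> I (i mod n)) else {})" for i
    have dI: "\<bar>x - y\<bar> \<le> 2 * M / real n" if "x \<in> I j" "y \<in> I j" for x y j
    proof -
      have "2 * M * (real j + 1) / real n = 2 * M * real j / real n + 2 * M / real n"
        by (simp add: add_divide_distrib distrib_left)
      then show ?thesis using that unfolding I_def by (simp only: atLeastAtMost_iff) linarith
    qed
    have dU: "norm (x - y) \<le> 4 * M * K / real n" if "x \<in> U i" "y \<in> U i" for x y i
    proof -
      have "i < n * n" using that(1) by (auto simp: U_def split: if_splits)
      then have "x \<in> F ` (I (i div n) \<times> I (i mod n))" "y \<in> F ` (I (i div n) \<times> I (i mod n))"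
        using that by (simp_all add: U_def)
      then obtain p q where pq: "x = F p" "y = F q" "p \<in> I (i div n) \<times> I (i mod n)" "q \<in> I (i div n) \<times> I (i mod n)"
        by (elim imageE) metis
      have "norm (p - q) \<le> norm (fst p - fst q) + norm (snd p - snd q)"
        using norm_Pair_le[of "fst p - fst q" "snd p - snd q"] by (simp add: minus_prod_def)
      also have "\<dots> \<le> 2 * M / real n + 2 * M / real n"
        using pq by (intro add_mono) (auto intro!: dI simp: mem_Times_iff)
      finally have "K * norm (p - q) \<le> K * (4 * M / real n)" using K by (intro mult_left_mono) auto
      then show ?thesis using F[of p q] pq by (simp add: mult_ac)
    qed
    have diam: "diameter (U i) \<le> 4 * M * K / real n" for i
      using M K by (intro diameter_le dU) auto
    have bdd: "bounded (U i)" for i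
    proof (cases "U i = {}")
      case False
      then obtain y where "y \<in> U i" by auto
      then have "\<forall>x\<in>U i. dist y x \<le> 4 * M * K / real n"
        using dU[of y i] by (auto simp: dist_norm)
      then show ?thesis unfolding bounded_def by blast
    qed simp
    have cover: "A \<subseteq> (\<Union>i. U i)"
    proof
      have J: "\<exists>j<n. x \<in> I j" if "x \<in> {-M..M}" for x
      \<comment> \<open>the right end point belongs to the last interval, and for \<open>M = 0\<close> all intervals coincide\<close>
      proof (cases "x = M \<or> M = 0")
        case True
        then have "x \<in> I n0" using that n by (auto simp: I_def n_def field_simps)
        then show ?thesis by (auto simp: n_def)
      next
        case False
        with that M have M0: "M > 0" "x < M" by auto
        define z where "z = (x + M) * real n / (2 * M)"
        have "0 \<le> z"
          unfolding z_def using that M0 by (intro divide_nonneg_pos mult_nonneg_nonneg) auto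
        moreover have "z < real n"
          using mult_strict_right_mono[of "x + M" "2 * M" "real n"] M0 n(1)
          by (simp add: z_def pos_divide_less_eq mult.commute)
        ultimately have z: "0 \<le> z" "z < real n" by auto
        define j where "j = nat \<lfloor>z\<rfloor>"
        have j: "real j \<le> z" "z < real j + 1" "j < n"
          using z by (auto simp: j_def floor_less_iff) linarith+
        have x: "x = -M + 2 * M * z / real n" using M0 n by (simp add: z_def field_simps)
        have "x \<in> I j" unfolding I_def x using j M0 n by (auto simp: divide_right_mono mult_left_mono)
        then show ?thesis using j by blast
      qed
      fix a assume "a \<in> A"
      then obtain x y where xy: "a = F (x, y)" "x \<in> {-M..M}" "y \<in> {-M..M}" using A by blast
      obtain j k where jk: "j < n" "x \<in> I j" "k < n" "y \<in> I k" using J xy by metis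
      have "j * n + k < n * n"
      proof -
        have "j * n + k < j * n + n" using jk by simp
        also have "\<dots> = Suc j * n" by simp
        also have "\<dots> \<le> n * n" using jk by (intro mult_le_mono1) simp
        finally show ?thesis .
      qed
      moreover have "(j * n + k) div n = j" "(j * n + k) mod n = k" using jk by auto
      ultimately have "a \<in> U (j * n + k)" using xy jk by (auto simp: U_def)
      then show "a \<in> (\<Union>i. U i)" by blast
    qed
    have "hausdorff2_delta \<delta> A \<le> (\<Sum>i. ennreal (pi / 4 * (diameter (U i))\<^sup>2))"
      unfolding hausdorff2_delta_def
      by (rule INF_lower) (use cover bdd diam n order_trans in blast)
    also have "\<dots> = (\<Sum>i<n * n. ennreal (pi / 4 * (diameter (U i))\<^sup>2))"
      by (rule suminf_finite) (auto simp: U_def)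
    also have "\<dots> \<le> (\<Sum>i<n * n. ennreal (pi / 4 * (4 * M * K / real n)\<^sup>2))"
      by (intro sum_mono ennreal_leI mult_left_mono power_mono diam diameter_ge_0 bdd) auto
    also have "\<dots> = ennreal (\<Sum>i<n * n. pi / 4 * (4 * M * K / real n)\<^sup>2)"
      by (rule sum_ennreal) auto
    also have "(\<Sum>i<n * n. pi / 4 * (4 * M * K / real n)\<^sup>2) = pi / 4 * (4 * M * K)\<^sup>2"
      using n by (simp add: power2_eq_square field_simps)
    finally show ?thesis by (simp add: C_def)
  qed
  then have "hausdorff2 A \<le> C" unfolding hausdorff2_def by (intro SUP_least) auto
  also have "C < \<infinity>" by (simp add: C_def)
  finally show ?thesis .
qed

text \<open>The measure of a set that is not a Borel set is zero by convention.\<close>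

lemma emeasure_lipschitz_image_finite:
  fixes F :: "real \<times> real \<Rightarrow> point"
  assumes F: "\<And>p q. norm (F p - F q) \<le> K * norm (p - q)" and K: "K \<ge> 0" and M: "M \<ge> 0"
    and A: "A \<subseteq> F ` ({-M..M} \<times> {-M..M})"
  shows "emeasure hausdorff_borel A < \<infinity>"
proof (cases "A \<in> sets borel")
  case True
  then show ?thesis
    using emeasure_hausdorff_borel hausdorff2_lipschitz_image_finite[OF F K M A] by force
qed (simp add: emeasure_notin_sets)

text \<open>Spherical coordinates parametrize the sphere and are Lipschitz continuous.\<close>

lemma emeasure_sphere_finite: "emeasure hausdorff_borel S2 < \<infinity>"
proof -
  define F :: "real \<times> real \<Rightarrow> point" where
    "F p = vector [cos (fst p) * cos (snd p), sin (fst p) * cos (snd p), sin (snd p)]" for p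
  have c: "\<bar>cos x - cos y\<bar> \<le> \<bar>x - y\<bar>" and s: "\<bar>sin x - sin y\<bar> \<le> \<bar>x - y\<bar>" for x y :: real
  proof -
    have "\<bar>cos x - cos y\<bar> = 2 * \<bar>sin ((x + y) / 2)\<bar> * \<bar>sin ((y - x) / 2)\<bar>"
      by (simp add: cos_diff_cos abs_mult)
    also have "\<dots> \<le> 2 * 1 * \<bar>(y - x) / 2\<bar>"
      by (intro mult_mono abs_sin_x_le_abs_x) auto
    finally show "\<bar>cos x - cos y\<bar> \<le> \<bar>x - y\<bar>" by simp
    have "\<bar>sin x - sin y\<bar> = 2 * \<bar>sin ((x - y) / 2)\<bar> * \<bar>cos ((x + y) / 2)\<bar>"
      by (simp add: sin_diff_sin abs_mult)
    also have "\<dots> \<le> 2 * \<bar>(x - y) / 2\<bar> * 1"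
      by (intro mult_mono abs_sin_x_le_abs_x) auto
    finally show "\<bar>sin x - sin y\<bar> \<le> \<bar>x - y\<bar>" by simp
  qed
  have pr: "\<bar>a * b - a' * b'\<bar> \<le> \<bar>a - a'\<bar> + \<bar>b - b'\<bar>" if "\<bar>a'\<bar> \<le> 1" "\<bar>b\<bar> \<le> 1" for a a' b b' :: real
  proof -
    have "a * b - a' * b' = (a - a') * b + a' * (b - b')" by (simp add: algebra_simps)
    then have "\<bar>a * b - a' * b'\<bar> \<le> \<bar>a - a'\<bar> * \<bar>b\<bar> + \<bar>a'\<bar> * \<bar>b - b'\<bar>"
      using abs_triangle_ineq[of "(a - a') * b" "a' * (b - b')"] by (simp add: abs_mult)
    also have "\<dots> \<le> \<bar>a - a'\<bar> * 1 + 1 * \<bar>b - b'\<bar>"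
      using that by (intro add_mono mult_mono) auto
    finally show ?thesis by simp
  qed
  have L: "norm (F p - F q) \<le> 6 * norm (p - q)" for p q
  proof -
    obtain a b a' b' where pq: "p = (a, b)" "q = (a', b')" by (cases p, cases q) auto
    have n: "\<bar>a - a'\<bar> \<le> norm (p - q)" "\<bar>b - b'\<bar> \<le> norm (p - q)"
      using norm_fst_le[of "a - a'" "b - b'"] norm_snd_le[of "b - b'" "a - a'"] by (auto simp: pq)
    have "norm (F p - F q) \<le> (\<Sum>i\<in>UNIV. \<bar>(F p - F q) $ i\<bar>)" by (rule norm_le_l1_cart)
    also have "\<dots> = \<bar>cos a * cos b - cos a' * cos b'\<bar> + \<bar>sin a * cos b - sin a' * cos b'\<bar> + \<bar>sin b - sin b'\<bar>"
      by (simp add: sum_3 F_def pq)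
    also have "\<dots> \<le> (\<bar>cos a - cos a'\<bar> + \<bar>cos b - cos b'\<bar>) + (\<bar>sin a - sin a'\<bar> + \<bar>cos b - cos b'\<bar>) + \<bar>sin b - sin b'\<bar>"
      by (intro add_mono pr) auto
    also have "\<dots> \<le> (norm (p - q) + norm (p - q)) + (norm (p - q) + norm (p - q)) + norm (p - q)"
      by (intro add_mono order_trans[OF c n(1)] order_trans[OF c n(2)] order_trans[OF s n(1)] order_trans[OF s n(2)])
    also have "\<dots> \<le> 6 * norm (p - q)" by simp
    finally show ?thesis .
  qed
  have "S2 \<subseteq> F ` ({-7..7} \<times> {-7..7})"
  proof
    fix x :: point assume "x \<in> S2"
    then have "x \<bullet> x = 1" by (simp add: norm_eq_1[symmetric])
    then have x: "(x $ 1)\<^sup>2 + (x $ 2)\<^sup>2 + (x $ 3)\<^sup>2 = 1"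
      by (simp add: inner_vec_def sum_3 power2_eq_square)
    define r where "r = sqrt ((x $ 1)\<^sup>2 + (x $ 2)\<^sup>2)"
    have r2: "r\<^sup>2 = (x $ 1)\<^sup>2 + (x $ 2)\<^sup>2" by (simp add: r_def)
    with x have "r\<^sup>2 + (x $ 3)\<^sup>2 = 1" by simp
    from sincos_total_2pi[OF this] obtain b where b: "0 \<le> b" "b < 2 * pi" "r = cos b" "x $ 3 = sin b" by metis
    obtain a where a: "0 \<le> a" "a < 2 * pi" "x $ 1 = r * cos a" "x $ 2 = r * sin a"
    proof (cases "r = 0")
      case True
      then have "x $ 1 = 0" "x $ 2 = 0" using r2 by (simp_all add: sum_power2_eq_zero_iff)
      then show ?thesis using that[of 0] True by simp
    next
      case False
      have "(x $ 1 / r)\<^sup>2 + (x $ 2 / r)\<^sup>2 = r\<^sup>2 / r\<^sup>2"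
        by (simp only: power_divide add_divide_distrib[symmetric] r2[symmetric])
      then have "(x $ 1 / r)\<^sup>2 + (x $ 2 / r)\<^sup>2 = 1" using False by simp
      from sincos_total_2pi[OF this] obtain a where a: "0 \<le> a" "a < 2 * pi" "x $ 1 / r = cos a" "x $ 2 / r = sin a"
        by metis
      then show ?thesis using that[of a] False by (simp add: field_simps)
    qed
    have "x = F (a, b)"
      using a b by (simp add: vec_eq_iff forall_3 F_def mult.commute)
    moreover have "2 * pi \<le> 7" using pi_approx by simp
    then have "(a, b) \<in> {-7..7} \<times> {-7..7}" using a b by auto
    ultimately show "x \<in> F ` ({-7..7} \<times> {-7..7})" by blast
  qed
  with L show ?thesis by (intro emeasure_lipschitz_image_finite[where F=F and K=6 and M=7]) auto
qed

text \<open>Solve the equation of the plane for a coordinate in which the normal \<open>e\<close> does not vanish. The two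
  parameters are the other coordinates, hence bounded by the norm of the point.\<close>

lemma plane_parametrization:
  fixes e :: point
  assumes "e \<noteq> 0"
  obtains A :: "real \<times> real \<Rightarrow> point" where "bounded_linear A" "\<And>p. e \<bullet> A p = 0"
    "\<And>p. e \<bullet> p = 0 \<Longrightarrow> \<exists>a b. \<bar>a\<bar> \<le> norm p \<and> \<bar>b\<bar> \<le> norm p \<and> p = A (a, b)"
proof -
  have "e $ 1 \<noteq> 0 \<or> e $ 2 \<noteq> 0 \<or> e $ 3 \<noteq> 0"
    using assms by (auto simp: vec_eq_iff forall_3)
  then consider "e $ 1 \<noteq> 0" | "e $ 2 \<noteq> 0" | "e $ 3 \<noteq> 0" by blast
  then show ?thesis
  proof cases
    case 1
    show ?thesis
    proof (rule that[of "\<lambda>p. vector [- (e $ 2 * fst p + e $ 3 * snd p) / e $ 1, fst p, snd p]"])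
      show "bounded_linear (\<lambda>p. vector [- (e $ 2 * fst p + e $ 3 * snd p) / e $ 1, fst p, snd p] :: point)"
        unfolding linear_conv_bounded_linear[symmetric]
        by (rule linearI) (use 1 in \<open>simp_all add: vec_eq_iff forall_3 field_simps\<close>)
      fix p :: "real \<times> real"
      show "e \<bullet> vector [- (e $ 2 * fst p + e $ 3 * snd p) / e $ 1, fst p, snd p] = 0"
        using 1 by (simp add: inner_vec_def sum_3 field_simps)
    next
      fix p assume "e \<bullet> p = 0"
      then have "p $ 1 = - (e $ 2 * p $ 2 + e $ 3 * p $ 3) / e $ 1"
        using 1 by (simp add: inner_vec_def sum_3 field_simps)
      then show "\<exists>a b. \<bar>a\<bar> \<le> norm p \<and> \<bar>b\<bar> \<le> norm p \<and>
         p = vector [- (e $ 2 * fst (a, b) + e $ 3 * snd (a, b)) / e $ 1, fst (a, b), snd (a, b)]"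
        by (intro exI[of _ "p $ 2"] exI[of _ "p $ 3"]) (auto simp: component_le_norm_cart vec_eq_iff forall_3)
    qed
  next
    case 2
    show ?thesis
    proof (rule that[of "\<lambda>p. vector [fst p, - (e $ 1 * fst p + e $ 3 * snd p) / e $ 2, snd p]"])
      show "bounded_linear (\<lambda>p. vector [fst p, - (e $ 1 * fst p + e $ 3 * snd p) / e $ 2, snd p] :: point)"
        unfolding linear_conv_bounded_linear[symmetric]
        by (rule linearI) (use 2 in \<open>auto simp: vec_eq_iff forall_3 field_simps\<close>)
      fix p :: "real \<times> real"
      show "e \<bullet> vector [fst p, - (e $ 1 * fst p + e $ 3 * snd p) / e $ 2, snd p] = 0"
        using 2 by (simp add: inner_vec_def sum_3 field_simps)
    next
      fix p assume "e \<bullet> p = 0"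
      then have "p $ 2 = - (e $ 1 * p $ 1 + e $ 3 * p $ 3) / e $ 2"
        using 2 by (simp add: inner_vec_def sum_3 field_simps)
      then show "\<exists>a b. \<bar>a\<bar> \<le> norm p \<and> \<bar>b\<bar> \<le> norm p \<and>
         p = vector [fst (a, b), - (e $ 1 * fst (a, b) + e $ 3 * snd (a, b)) / e $ 2, snd (a, b)]"
        by (intro exI[of _ "p $ 1"] exI[of _ "p $ 3"]) (auto simp: component_le_norm_cart vec_eq_iff forall_3)
    qed
  next
    case 3
    show ?thesis
    proof (rule that[of "\<lambda>p. vector [fst p, snd p, - (e $ 1 * fst p + e $ 2 * snd p) / e $ 3]"])
      show "bounded_linear (\<lambda>p. vector [fst p, snd p, - (e $ 1 * fst p + e $ 2 * snd p) / e $ 3] :: point)"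
        unfolding linear_conv_bounded_linear[symmetric]
        by (rule linearI) (use 3 in \<open>auto simp: vec_eq_iff forall_3 field_simps\<close>)
      fix p :: "real \<times> real"
      show "e \<bullet> vector [fst p, snd p, - (e $ 1 * fst p + e $ 2 * snd p) / e $ 3] = 0"
        using 3 by (simp add: inner_vec_def sum_3 field_simps)
    next
      fix p assume "e \<bullet> p = 0"
      then have "p $ 3 = - (e $ 1 * p $ 1 + e $ 2 * p $ 2) / e $ 3"
        using 3 by (simp add: inner_vec_def sum_3 field_simps)
      then show "\<exists>a b. \<bar>a\<bar> \<le> norm p \<and> \<bar>b\<bar> \<le> norm p \<and>
         p = vector [fst (a, b), snd (a, b), - (e $ 1 * fst (a, b) + e $ 2 * snd (a, b)) / e $ 3]"
        by (intro exI[of _ "p $ 1"] exI[of _ "p $ 2"]) (auto simp: component_le_norm_cart vec_eq_iff forall_3)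
    qed
  qed
qed

text \<open>Points strictly below the graph have a neighbourhood that misses \<open>R\<close>, and points strictly above
  belong to the open set \<open>R\<close>.\<close>

lemma lipschitz_frontier_on_graph:
  assumes op: "open R" and graph: "R \<inter> ball x \<rho> = {y \<in> ball x \<rho>. e \<bullet> y > \<gamma> (y - (e \<bullet> y) *\<^sub>R e)}"
    and e: "norm e = 1" and \<gamma>: "continuous_on {z::point. e \<bullet> z = 0} \<gamma>"
    and y: "y \<in> frontier R" "y \<in> ball x \<rho>"
  shows "e \<bullet> y = \<gamma> (y - (e \<bullet> y) *\<^sub>R e)"
proof (rule ccontr)
  define g where "g y = \<gamma> (y - (e \<bullet> y) *\<^sub>R e) - e \<bullet> y" for y
  have graph': "z \<in> R \<longleftrightarrow> g z < 0" if "z \<in> ball x \<rho>" for z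
  proof -
    have "z \<in> R \<inter> ball x \<rho> \<longleftrightarrow> z \<in> {y \<in> ball x \<rho>. e \<bullet> y > \<gamma> (y - (e \<bullet> y) *\<^sub>R e)}"
      by (simp only: graph)
    then show ?thesis using that by (simp add: g_def)
  qed
  have ee: "e \<bullet> e = 1" using e by (simp add: dot_square_norm)
  have "continuous_on UNIV (\<lambda>y. \<gamma> (y - (e \<bullet> y) *\<^sub>R e))"
    by (rule continuous_on_compose2[OF \<gamma>]) (auto intro!: continuous_intros simp: ee algebra_simps inner_simps)
  then have "continuous_on UNIV g" unfolding g_def by (intro continuous_intros)
  then have "open {y. 0 < g y}" by (intro open_Collect_less) auto
  then have op': "open ({y. 0 < g y} \<inter> ball x \<rho>)" by (intro open_Int open_ball)
  assume "\<not> ?thesis"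
  then have "g y \<noteq> 0" by (simp add: g_def)
  moreover have "y \<notin> R" using y(1) op by (simp add: frontier_def interior_open)
  ultimately have "0 < g y" using graph'[OF y(2)] by linarith
  then have "y \<in> {y. 0 < g y} \<inter> ball x \<rho>" using y(2) by simp
  moreover have "y \<in> closure R" using y(1) by (simp add: frontier_def)
  ultimately have "({y. 0 < g y} \<inter> ball x \<rho>) \<inter> R \<noteq> {}"
    using open_Int_closure_eq_empty[OF op', of R] by blast
  then obtain z where "0 < g z" "z \<in> ball x \<rho>" "z \<in> R" by blast
  then show False using graph'[of z] by simp
qed

text \<open>Finitely many charts cover the compact boundary, and in each of them the boundary is contained in
  the Lipschitz image of a square.\<close>

lemma emeasure_frontier_finite:
  assumes "lipschitz_domain R"
  shows "emeasure hausdorff_borel (frontier R) < \<infinity>"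
proof -
  have op: "open R" and bd: "bounded R" using assms by (auto simp: lipschitz_domain_def)
  have cf: "compact (frontier R)" using bd by (rule compact_frontier_bounded)
  obtain B where B: "B \<ge> 0" "\<And>y. y \<in> frontier R \<Longrightarrow> norm y \<le> B"
    using compact_imp_bounded[OF cf] unfolding bounded_pos by (meson less_imp_le)
  have "\<forall>x\<in>frontier R. \<exists>d>0. emeasure hausdorff_borel (frontier R \<inter> cball x d) < \<infinity>"
  proof
    fix x assume "x \<in> frontier R"
    then obtain e \<rho> L \<gamma> where e: "norm e = 1" and \<rho>: "\<rho> > 0" and L: "L-lipschitz_on {z. e \<bullet> z = 0} \<gamma>"
      and graph: "R \<inter> ball x \<rho> = {y \<in> ball x \<rho>. e \<bullet> y > \<gamma> (y - (e \<bullet> y) *\<^sub>R e)}"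
      using assms unfolding lipschitz_domain_def by meson
    have ee: "e \<bullet> e = 1" using e by (simp add: dot_square_norm)
    obtain A :: "real \<times> real \<Rightarrow> point" where A: "bounded_linear A" "\<And>p. e \<bullet> A p = 0"
      "\<And>p. e \<bullet> p = 0 \<Longrightarrow> \<exists>a b. \<bar>a\<bar> \<le> norm p \<and> \<bar>b\<bar> \<le> norm p \<and> p = A (a, b)"
      using plane_parametrization[of e] e by (metis norm_zero zero_neq_one)
    obtain KA where KA: "KA > 0" "\<And>p. norm (A p) \<le> norm p * KA"
      using bounded_linear.pos_bounded[OF A(1)] by blast
    define F where "F p = A p + \<gamma> (A p) *\<^sub>R e" for p
    have L0: "L \<ge> 0" using L by (rule lipschitz_on_nonneg)
    have FL: "norm (F p - F q) \<le> (KA + L * KA) * norm (p - q)" for p q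
    proof -
      have Ad: "norm (A p - A q) \<le> KA * norm (p - q)"
        using KA(2)[of "p - q"] by (simp add: linear_diff[OF bounded_linear.linear[OF A(1)]] mult.commute)
      have "\<bar>\<gamma> (A p) - \<gamma> (A q)\<bar> \<le> L * norm (A p - A q)"
        using lipschitz_onD[OF L, of "A p" "A q"] A(2) by (simp add: dist_norm)
      also have "\<dots> \<le> L * (KA * norm (p - q))" using Ad L0 by (rule mult_left_mono)
      finally have g: "\<bar>\<gamma> (A p) - \<gamma> (A q)\<bar> \<le> L * KA * norm (p - q)" by (simp add: mult_ac)
      have "F p - F q = (A p - A q) + (\<gamma> (A p) - \<gamma> (A q)) *\<^sub>R e"
        by (simp add: F_def algebra_simps)
      then have "norm (F p - F q) \<le> norm (A p - A q) + norm ((\<gamma> (A p) - \<gamma> (A q)) *\<^sub>R e)"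
        by (metis norm_triangle_ineq)
      moreover have "norm ((\<gamma> (A p) - \<gamma> (A q)) *\<^sub>R e) = \<bar>\<gamma> (A p) - \<gamma> (A q)\<bar>"
        using e by (simp only: norm_scaleR mult_1_right)
      ultimately have "norm (F p - F q) \<le> norm (A p - A q) + \<bar>\<gamma> (A p) - \<gamma> (A q)\<bar>" by argo
      then show ?thesis using Ad g unfolding distrib_right by linarith
    qed
    have sub: "frontier R \<inter> cball x (\<rho>/2) \<subseteq> F ` ({-(2*B)..2*B} \<times> {-(2*B)..2*B})"
    proof
      fix y assume "y \<in> frontier R \<inter> cball x (\<rho>/2)"
      then have y: "y \<in> frontier R" "y \<in> ball x \<rho>" using \<rho> by auto
      have g: "e \<bullet> y = \<gamma> (y - (e \<bullet> y) *\<^sub>R e)"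
        using lipschitz_frontier_on_graph[OF op graph e lipschitz_on_continuous_on[OF L] y] .
      define p where "p = y - (e \<bullet> y) *\<^sub>R e"
      have "e \<bullet> p = 0" by (simp add: p_def inner_diff_right ee)
      then obtain a b where ab: "\<bar>a\<bar> \<le> norm p" "\<bar>b\<bar> \<le> norm p" "p = A (a, b)" using A(3) by blast
      have "norm p \<le> norm y + norm ((e \<bullet> y) *\<^sub>R e)" unfolding p_def by (rule norm_triangle_ineq4)
      also have "\<dots> \<le> norm y + norm y" using Cauchy_Schwarz_ineq2[of e y] e by simp
      finally have "norm p \<le> 2 * B" using B(2)[OF y(1)] by simp
      then have "(a, b) \<in> {-(2*B)..2*B} \<times> {-(2*B)..2*B}" using ab by auto
      moreover have "y = F (a, b)" unfolding F_def ab(3)[symmetric] using g by (simp add: p_def)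
      ultimately show "y \<in> F ` ({-(2*B)..2*B} \<times> {-(2*B)..2*B})" by blast
    qed
    have "emeasure hausdorff_borel (frontier R \<inter> cball x (\<rho>/2)) < \<infinity>"
      by (rule emeasure_lipschitz_image_finite[OF FL _ _ sub]) (use KA L0 B in auto)
    then show "\<exists>d>0. emeasure hausdorff_borel (frontier R \<inter> cball x d) < \<infinity>"
      using \<rho> by (intro exI[of _ "\<rho>/2"]) auto
  qed
  then obtain d where d: "\<And>x. x \<in> frontier R \<Longrightarrow> d x > 0"
      "\<And>x. x \<in> frontier R \<Longrightarrow> emeasure hausdorff_borel (frontier R \<inter> cball x (d x)) < \<infinity>"
    by metis
  have "frontier R \<subseteq> (\<Union>x\<in>frontier R. ball x (d x))" using d by force
  then obtain D where D: "D \<subseteq> frontier R" "finite D" "frontier R \<subseteq> (\<Union>x\<in>D. ball x (d x))"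
    using compactE_image[OF cf, of "frontier R" "\<lambda>x. ball x (d x)"] by blast
  have eq: "frontier R = (\<Union>x\<in>D. frontier R \<inter> cball x (d x))"
  proof (intro equalityI subsetI)
    fix y assume y: "y \<in> frontier R"
    then obtain x where "x \<in> D" "y \<in> ball x (d x)" using D(3) by blast
    then show "y \<in> (\<Union>x\<in>D. frontier R \<inter> cball x (d x))"
      using y ball_subset_cball[of x "d x"] by blast
  qed blast
  have "emeasure hausdorff_borel (\<Union>x\<in>D. frontier R \<inter> cball x (d x)) \<le> (\<Sum>x\<in>D. emeasure hausdorff_borel (frontier R \<inter> cball x (d x)))"
    by (rule emeasure_subadditive_finite[OF D(2)]) (auto intro!: borel_closed)
  also have "\<dots> < \<infinity>" using D(1,2) d(2) by (auto simp: less_top[symmetric] ennreal_sum_less_top subset_iff)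
  finally show ?thesis by (simp only: eq[symmetric])
qed

text \<open>Reflecting the sets of a covering changes no diameter.\<close>

lemma hausdorff2_uminus_le: "hausdorff2 (uminus ` A) \<le> hausdorff2 A"
proof -
  have "hausdorff2_delta \<delta> (uminus ` A) \<le> hausdorff2_delta \<delta> A" for \<delta>
    unfolding hausdorff2_delta_def
  proof (rule INF_mono)
    fix U assume U: "U \<in> {U::nat \<Rightarrow> point set. A \<subseteq> (\<Union>i. U i) \<and> (\<forall>i. bounded (U i) \<and> diameter (U i) \<le> \<delta>)}"
    define V where "V i = uminus ` U i" for i
    have d: "diameter (V i) \<le> diameter (U i)" for i
    proof (rule diameter_le)
      fix x y assume "x \<in> V i" "y \<in> V i"
      then obtain a b where "x = - a" "y = - b" "a \<in> U i" "b \<in> U i" by (auto simp: V_def)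
      then show "norm (x - y) \<le> diameter (U i)"
        using diameter_bounded_bound[of "U i" a b] U by (simp add: dist_norm norm_minus_commute)
    qed (use U diameter_ge_0 in auto)
    have "V \<in> {U. uminus ` A \<subseteq> (\<Union>i. U i) \<and> (\<forall>i. bounded (U i) \<and> diameter (U i) \<le> \<delta>)}"
    proof (intro CollectI conjI allI)
      show "uminus ` A \<subseteq> (\<Union>i. V i)" using U by (force simp: V_def)
      fix i
      show "bounded (V i)" unfolding V_def using U by (intro bounded_linear_image bounded_linear_minus) auto
      show "diameter (V i) \<le> \<delta>" using d[of i] U by (auto intro: order_trans)
    qed
    moreover have "(\<Sum>i. ennreal (pi / 4 * (diameter (V i))\<^sup>2)) \<le> (\<Sum>i. ennreal (pi / 4 * (diameter (U i))\<^sup>2))"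
      using U d by (intro suminf_le summableI ennreal_leI mult_left_mono power_mono)
        (auto simp: V_def intro!: diameter_ge_0 bounded_linear_image bounded_linear_minus bounded_linear_ident)
    ultimately show "\<exists>V\<in>{U. uminus ` A \<subseteq> (\<Union>i. U i) \<and> (\<forall>i. bounded (U i) \<and> diameter (U i) \<le> \<delta>)}.
        (\<Sum>i. ennreal (pi / 4 * (diameter (V i))\<^sup>2)) \<le> (\<Sum>i. ennreal (pi / 4 * (diameter (U i))\<^sup>2))"
      by blast
  qed
  then show ?thesis unfolding hausdorff2_def by (intro SUP_mono) blast
qed

lemma emeasure_hausdorff_uminus:
  assumes "A \<in> sets borel"
  shows "emeasure hausdorff_borel (uminus ` A) = emeasure hausdorff_borel A"
proof -
  have "uminus ` A = uminus -` A" by force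
  moreover have "uminus -` A \<in> sets (borel :: point measure)"
    by (rule measurable_sets_borel[OF _ assms]) simp
  ultimately have "uminus ` A \<in> sets borel" by simp
  moreover have "hausdorff2 (uminus ` A) = hausdorff2 A"
    using hausdorff2_uminus_le[of A] hausdorff2_uminus_le[of "uminus ` A"]
    by (simp add: image_image antisym)
  ultimately show ?thesis using emeasure_hausdorff_borel assms by metis
qed

lemma space_surface [simp]: "space (surface_measure S) = S"
  by (simp add: surface_measure_eq space_restrict_space)

lemma sets_surface: "sets (surface_measure S) = sets (restrict_space borel S)"
  unfolding surface_measure_eq by (rule sets_restrict_space_cong) simp

lemma sets_surface_closed: "closed S \<Longrightarrow> A \<in> sets (surface_measure S) \<longleftrightarrow> A \<subseteq> S \<and> A \<in> sets borel"
  by (simp add: sets_surface sets_restrict_space_iff)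

lemma emeasure_surface: "closed S \<Longrightarrow> A \<subseteq> S \<Longrightarrow> emeasure (surface_measure S) A = emeasure hausdorff_borel A"
  unfolding surface_measure_eq by (rule emeasure_restrict_space) auto

lemma finite_sphere_measure: "finite_measure (surface_measure S2)"
  by (rule finite_measureI) (use emeasure_sphere_finite in \<open>auto simp: emeasure_surface\<close>)

lemma finite_frontier_measure: "lipschitz_domain R \<Longrightarrow> finite_measure (surface_measure (frontier R))"
  by (rule finite_measureI) (use emeasure_frontier_finite[of R] in \<open>auto simp: emeasure_surface\<close>)

lemma measurable_ident_surface: "(\<lambda>x. x) \<in> borel_measurable (surface_measure S)"
  using measurable_cong_sets[OF sets_surface refl] measurable_restrict_space1[OF measurable_ident_sets[OF refl]]
  by blast

lemma uminus_sphere_measurable: "uminus \<in> measurable (surface_measure S2) (surface_measure S2)"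
proof -
  have "uminus \<in> measurable (restrict_space borel S2) (restrict_space borel S2)"
    by (rule measurable_restrict_space2[OF _ measurable_restrict_space1])
      (auto simp: space_restrict_space)
  then show ?thesis using measurable_cong_sets[OF sets_surface sets_surface] by blast
qed

lemma sphere_uminus: "distr (surface_measure S2) (surface_measure S2) uminus = surface_measure S2"
proof (rule measure_eqI)
  note m = uminus_sphere_measurable
  fix A assume "A \<in> sets (distr (surface_measure S2) (surface_measure S2) uminus)"
  then have A: "A \<in> sets (surface_measure S2)" "A \<subseteq> S2" "A \<in> sets borel" by (auto simp: sets_surface_closed)
  have "uminus -` A \<inter> S2 = uminus ` A"
  proof (intro equalityI subsetI)
    fix x assume "x \<in> uminus -` A \<inter> S2"
    then have "- (- x) \<in> uminus ` A" by (intro imageI) simp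
    then show "x \<in> uminus ` A" by simp
  next
    fix x assume "x \<in> uminus ` A"
    then show "x \<in> uminus -` A \<inter> S2" using A(2) by auto
  qed
  moreover have "uminus ` A \<subseteq> S2" using A(2) by auto
  ultimately show "emeasure (distr (surface_measure S2) (surface_measure S2) uminus) A = emeasure (surface_measure S2) A"
    using A m by (simp add: emeasure_distr emeasure_surface emeasure_hausdorff_uminus
        image_subset_iff subset_iff)
qed simp

section \<open>The outward normal is a Borel function\<close>

definition almost_normal :: "point set \<Rightarrow> real \<Rightarrow> real \<Rightarrow> point \<Rightarrow> point \<Rightarrow> bool" where
  "almost_normal R \<epsilon> \<delta> x \<nu> \<longleftrightarrow> (\<forall>y\<in>ball x \<delta>.
        (y \<in> R \<longrightarrow> \<nu> \<bullet> (y - x) \<le> \<epsilon> * norm (y - x)) \<and>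
        (y \<notin> R \<longrightarrow> \<nu> \<bullet> (y - x) \<ge> - \<epsilon> * norm (y - x)))"

lemma is_outward_normal_iff:
  "is_outward_normal R x \<nu> \<longleftrightarrow> norm \<nu> = 1 \<and> (\<forall>\<epsilon>>0. \<exists>\<delta>>0. almost_normal R \<epsilon> \<delta> x \<nu>)"
  by (simp add: is_outward_normal_def almost_normal_def)

lemma almost_normal_mono:
  assumes "almost_normal R \<epsilon> \<delta> x \<nu>" "\<delta>' \<le> \<delta>" "\<epsilon> + norm (\<nu> - \<nu>') \<le> \<epsilon>'"
  shows "almost_normal R \<epsilon>' \<delta>' x \<nu>'"
  unfolding almost_normal_def
proof (intro ballI conjI impI)
  fix y assume "y \<in> ball x \<delta>'"
  then have y: "y \<in> ball x \<delta>" using assms(2) by auto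
  have d: "\<bar>\<nu> \<bullet> (y - x) - \<nu>' \<bullet> (y - x)\<bar> \<le> norm (\<nu> - \<nu>') * norm (y - x)"
    using Cauchy_Schwarz_ineq2[of "\<nu> - \<nu>'" "y - x"] by (simp add: inner_diff_left)
  have m: "\<epsilon> * norm (y - x) + norm (\<nu> - \<nu>') * norm (y - x) \<le> \<epsilon>' * norm (y - x)"
    using mult_right_mono[OF assms(3), of "norm (y - x)"] by (simp add: distrib_right)
  show "\<nu>' \<bullet> (y - x) \<le> \<epsilon>' * norm (y - x)" if "y \<in> R"
  proof -
    have "\<nu> \<bullet> (y - x) \<le> \<epsilon> * norm (y - x)" using assms(1) y that by (auto simp: almost_normal_def)
    then show ?thesis using d m by linarith
  qed
  show "- \<epsilon>' * norm (y - x) \<le> \<nu>' \<bullet> (y - x)" if "y \<notin> R"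
  proof -
    have "- \<epsilon> * norm (y - x) \<le> \<nu> \<bullet> (y - x)" using assms(1) y that by (auto simp: almost_normal_def)
    then show ?thesis using d m by (simp add: abs_le_iff)
  qed
qed

text \<open>Let \<open>d\<close> be the difference of two outward normals. A point \<open>x + t *\<^sub>R d\<close> with small \<open>t\<close> would have to
  lie outside \<open>R\<close> on account of the first normal and inside on account of the second.\<close>

lemma outward_normal_unique:
  assumes "is_outward_normal R x \<nu>" "is_outward_normal R x \<nu>'"
  shows "\<nu> = \<nu>'"
proof (rule ccontr)
  assume ne: "\<nu> \<noteq> \<nu>'"
  have n: "norm \<nu> = 1" "norm \<nu>' = 1" using assms by (auto simp: is_outward_normal_iff)
  define d where "d = \<nu> - \<nu>'"
  define c where "c = \<nu> \<bullet> d"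
  have dn: "norm d > 0" using ne by (simp add: d_def)
  have "(norm d)\<^sup>2 = 2 * c"
    using n by (simp add: d_def c_def power2_norm_eq_inner inner_diff_left inner_diff_right
        norm_eq_1 inner_commute)
  then have c: "c > 0" using dn by (metis zero_less_power zero_less_mult_iff zero_less_numeral not_numeral_less_zero)
  have c': "\<nu>' \<bullet> d = - c"
    using n by (simp add: d_def c_def inner_diff_left inner_diff_right norm_eq_1 inner_commute)
  define \<epsilon> where "\<epsilon> = c / (2 * norm d)"
  have e: "\<epsilon> > 0" using c dn by (simp add: \<epsilon>_def)
  obtain \<delta>1 where d1: "\<delta>1 > 0" "almost_normal R \<epsilon> \<delta>1 x \<nu>" using assms(1) e is_outward_normal_iff by blast
  obtain \<delta>2 where d2: "\<delta>2 > 0" "almost_normal R \<epsilon> \<delta>2 x \<nu>'" using assms(2) e is_outward_normal_iff by blast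
  define t where "t = min \<delta>1 \<delta>2 / (2 * norm d)"
  have t: "t > 0" using d1 d2 dn by (simp add: t_def)
  define y where "y = x + t *\<^sub>R d"
  have td: "t * norm d = min \<delta>1 \<delta>2 / 2" using dn by (simp add: t_def)
  have y: "y \<in> ball x \<delta>1" "y \<in> ball x \<delta>2"
    using t td d1 d2 by (auto simp: y_def dist_norm)
  have yx: "\<nu> \<bullet> (y - x) = t * c" "\<nu>' \<bullet> (y - x) = - (t * c)" "\<epsilon> * norm (y - x) = t * c / 2"
    using t dn by (auto simp: y_def c_def[symmetric] c' \<epsilon>_def)
  have tc: "t * c > 0" using t c by simp
  show False
  proof (cases "y \<in> R")
    case True
    then have "t * c \<le> t * c / 2" using d1(2) y(1) yx unfolding almost_normal_def by metis
    then show False using tc by linarith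
  next
    case False
    then have "- (t * c / 2) \<le> - (t * c)" using d2(2) y(2) yx unfolding almost_normal_def
      by (metis mult_minus_left)
    then show False using tc by linarith
  qed
qed

lemma outward_normal_eqI: "is_outward_normal R x \<nu> \<Longrightarrow> outward_normal R x = \<nu>"
  unfolding outward_normal_def using outward_normal_unique by (auto intro!: the_equality)

text \<open>In the definition of a normal, the direction is chosen before the radius. Over a compact set of
  directions it may be chosen after it: a limit point of the directions that work up to errors
  \<open>1 / real (Suc m)\<close> is a normal. The right hand side is a countable combination of projections of
  closed sets along a compact set, whence the measurability of the normal.\<close>

lemma normal_in_compact_iff:
  assumes C: "compact C" "C \<subseteq> S2"
  shows "(\<exists>\<nu>\<in>C. is_outward_normal R x \<nu>) \<longleftrightarrow>
    (\<forall>m. \<exists>k. \<exists>\<nu>. \<nu> \<in> C \<and> almost_normal R (1 / real (Suc m)) (1 / real (Suc k)) x \<nu>)"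
proof
  assume "\<exists>\<nu>\<in>C. is_outward_normal R x \<nu>"
  then obtain \<nu> where \<nu>: "\<nu> \<in> C" "is_outward_normal R x \<nu>" by blast
  show "\<forall>m. \<exists>k. \<exists>\<nu>. \<nu> \<in> C \<and> almost_normal R (1 / real (Suc m)) (1 / real (Suc k)) x \<nu>"
  proof
    fix m
    have "1 / real (Suc m) > 0" by simp
    then obtain \<delta> where \<delta>: "\<delta> > 0" "almost_normal R (1 / real (Suc m)) \<delta> x \<nu>"
      using \<nu>(2) unfolding is_outward_normal_iff by meson
    obtain k where "1 / real (Suc k) < \<delta>" using \<delta>(1) nat_approx_posE by metis
    then show "\<exists>k. \<exists>\<nu>. \<nu> \<in> C \<and> almost_normal R (1 / real (Suc m)) (1 / real (Suc k)) x \<nu>"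
      using almost_normal_mono[OF \<delta>(2), of "1 / real (Suc k)" \<nu>] \<nu>(1) by auto
  qed
next
  assume "\<forall>m. \<exists>k. \<exists>\<nu>. \<nu> \<in> C \<and> almost_normal R (1 / real (Suc m)) (1 / real (Suc k)) x \<nu>"
  then obtain k \<mu> where k: "\<And>m. \<mu> m \<in> C" "\<And>m. almost_normal R (1 / real (Suc m)) (1 / real (Suc (k m))) x (\<mu> m)"
    by metis
  obtain \<nu> r where \<nu>: "\<nu> \<in> C" "strict_mono r" "(\<mu> \<circ> r) \<longlonglongrightarrow> \<nu>"
    using C(1) k(1) unfolding compact_eq_seq_compact_metric seq_compact_def by metis
  have "\<exists>\<delta>>0. almost_normal R \<epsilon> \<delta> x \<nu>" if "\<epsilon> > 0" for \<epsilon>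
  proof -
    have "(\<lambda>n. 1 / real (Suc (r n)) + norm ((\<mu> \<circ> r) n - \<nu>)) \<longlonglongrightarrow> 0 + norm (\<nu> - \<nu>)"
      by (intro tendsto_intros \<nu> LIMSEQ_subseq_LIMSEQ[OF LIMSEQ_Suc[OF lim_1_over_n] \<nu>(2), unfolded o_def])
    then have "\<forall>\<^sub>F n in sequentially. 1 / real (Suc (r n)) + norm ((\<mu> \<circ> r) n - \<nu>) < \<epsilon>"
      using that by (auto dest: order_tendstoD(2))
    then obtain n where n: "1 / real (Suc (r n)) + norm (\<mu> (r n) - \<nu>) < \<epsilon>"
      by (auto dest: eventually_happens)
    show ?thesis
      using almost_normal_mono[OF k(2)[of "r n"] order_refl less_imp_le[OF n]]
      by (intro exI[of _ "1 / real (Suc (k (r n)))"]) auto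
  qed
  moreover have "norm \<nu> = 1" using \<nu>(1) C(2) by auto
  ultimately show "\<exists>\<nu>\<in>C. is_outward_normal R x \<nu>" using \<nu>(1) is_outward_normal_iff by blast
qed

lemma closed_almost_normal: "closed {p. almost_normal R \<epsilon> \<delta> (snd p) (fst p)}"
proof -
  have "{p. almost_normal R \<epsilon> \<delta> (snd p) (fst p)} =
    (\<Inter>y. {p. \<delta> \<le> dist (snd p) y \<or> (if y \<in> R then fst p \<bullet> (y - snd p) \<le> \<epsilon> * norm (y - snd p)
        else - \<epsilon> * norm (y - snd p) \<le> fst p \<bullet> (y - snd p))})"
    by (auto simp: almost_normal_def split: if_splits; metis not_le)
  moreover have "closed {p. \<delta> \<le> dist (snd p) y \<or> (if y \<in> R then fst p \<bullet> (y - snd p) \<le> \<epsilon> * norm (y - snd p)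
        else - \<epsilon> * norm (y - snd p) \<le> fst p \<bullet> (y - snd p))}" for y
    by (cases "y \<in> R") (auto intro!: closed_Collect_disj closed_Collect_le continuous_intros)
  ultimately show ?thesis by (simp add: closed_INT)
qed

lemma normal_in_compact_borel:
  assumes C: "compact C" "C \<subseteq> S2"
  shows "{x. \<exists>\<nu>\<in>C. is_outward_normal R x \<nu>} \<in> sets borel"
proof -
  have "{x. \<exists>\<nu>\<in>C. is_outward_normal R x \<nu>} =
    (\<Inter>m. \<Union>k. {x. \<exists>\<nu>. \<nu> \<in> C \<and> (\<nu>, x) \<in> {p. almost_normal R (1 / real (Suc m)) (1 / real (Suc k)) (snd p) (fst p)}})"
    using normal_in_compact_iff[OF C] by auto
  moreover have "{x. \<exists>\<nu>. \<nu> \<in> C \<and> (\<nu>, x) \<in> {p. almost_normal R (1 / real (Suc m)) (1 / real (Suc k)) (snd p) (fst p)}} \<in> sets borel" for m k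
    by (rule borel_closed[OF closed_compact_projection[OF C(1) closed_almost_normal]])
  ultimately show ?thesis by simp
qed

lemma outward_normal_borel: "outward_normal R \<in> borel_measurable borel"
proof -
  have closed_case: "outward_normal R -` S \<inter> space borel \<in> sets borel" if "closed S" for S :: "point set"
  proof -
    from that have C: "compact (S \<inter> S2)" "S \<inter> S2 \<subseteq> S2" by (auto intro: closed_Int_compact)
    have Cs: "compact S2" "S2 \<subseteq> S2" by auto
    have 1: "(\<exists>\<nu>\<in>S \<inter> S2. is_outward_normal R x \<nu>) \<longleftrightarrow> outward_normal R x \<in> S \<and> (\<exists>\<nu>\<in>S2. is_outward_normal R x \<nu>)" for x
      using outward_normal_eqI by blast
    have 2: "\<not> (\<exists>\<nu>\<in>S2. is_outward_normal R x \<nu>) \<Longrightarrow> outward_normal R x = 0" for x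
    proof -
      assume "\<not> (\<exists>\<nu>\<in>S2. is_outward_normal R x \<nu>)"
      then have "\<not> (\<exists>\<nu>. is_outward_normal R x \<nu>)" by (auto simp: is_outward_normal_iff)
      then show ?thesis by (simp only: outward_normal_def if_False)
    qed
    have "outward_normal R -` S \<inter> space borel = {x. \<exists>\<nu>\<in>S \<inter> S2. is_outward_normal R x \<nu>} \<union>
       (if 0 \<in> S then - {x. \<exists>\<nu>\<in>S2. is_outward_normal R x \<nu>} else {})"
      using 1 2 by (auto split: if_splits; metis)
    then show ?thesis
      using normal_in_compact_borel[OF C, of R] normal_in_compact_borel[OF Cs, of R] by auto
  qed
  show ?thesis
  proof (rule borel_measurableI)
    fix S :: "point set" assume "open S"
    then have "outward_normal R -` (- S) \<in> sets borel" using closed_case[of "- S"] by (simp add: closed_Compl)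
    then have "- (outward_normal R -` (- S)) \<in> sets borel" by (rule borel_comp)
    moreover have "- (outward_normal R -` (- S)) = outward_normal R -` S" by auto
    ultimately show "outward_normal R -` S \<inter> space borel \<in> sets borel" by simp
  qed
qed

section \<open>Phase space\<close>

definition reflect :: "phase \<Rightarrow> phase" where
  "reflect = (\<lambda>(r, s). (r, - s))"

lemma reflect_reflect [simp]: "reflect (reflect p) = p"
  by (cases p) (simp add: reflect_def)

definition normal_flux :: "point set \<Rightarrow> phase \<Rightarrow> real" where
  "normal_flux R = (\<lambda>(r, s). s \<bullet> outward_normal R r)"

lemma normal_flux_borel [measurable]: "normal_flux R \<in> borel_measurable borel"
proof -
  have [measurable]: "outward_normal R \<in> borel_measurable borel" by (rule outward_normal_borel)
  have "(\<lambda>p. snd p \<bullet> outward_normal R (fst p)) \<in> borel_measurable (borel \<Otimes>\<^sub>M borel)"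
    by measurable
  then show ?thesis by (simp add: normal_flux_def case_prod_unfold borel_prod)
qed

lemma sets_pair_subset_borel:
  assumes "\<And>A. A \<in> sets M \<Longrightarrow> A \<in> sets borel" "\<And>A. A \<in> sets N \<Longrightarrow> A \<in> sets borel"
    and "A \<in> sets (M \<Otimes>\<^sub>M N)"
  shows "A \<in> sets (borel :: ('a::second_countable_topology \<times> 'b::second_countable_topology) measure)"
  using assms(3) unfolding sets_pair_measure
proof (induction rule: sigma_sets.induct)
  case (Basic a)
  then show ?case using assms(1,2) by (auto intro!: borel_Times)
next
  case (Compl a)
  have "space M \<times> space N \<in> sets borel" using assms(1,2) by (intro borel_Times) auto
  then show ?case using Compl.IH by (rule sets.Diff)
qed auto

locale lipschitz_phase =
  fixes R :: "point set"
  assumes lip: "lipschitz_domain R"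
begin

abbreviation "D \<equiv> phase_measure R"
abbreviation "dD \<equiv> boundary_measure R"

lemma open_R: "open R" and bounded_R: "bounded R" and R_ne: "R \<noteq> {}"
  using lip by (auto simp: lipschitz_domain_def)

lemma finite_R: "finite_measure (restrict_space lborel R)"
proof (rule finite_measureI)
  have "emeasure lborel R < \<infinity>" using bounded_R by (rule emeasure_bounded_finite)
  then show "emeasure (restrict_space lborel R) (space (restrict_space lborel R)) \<noteq> \<infinity>"
    using open_R by (simp add: emeasure_restrict_space)
qed

lemma space_D: "space D = R \<times> S2"
  using open_R by (simp add: phase_measure_def space_pair_measure)

lemma space_dD: "space dD = frontier R \<times> S2"
  by (simp add: boundary_measure_def space_pair_measure)

sublocale S2: finite_measure "surface_measure S2" by (rule finite_sphere_measure)

sublocale D: finite_measure D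
  unfolding phase_measure_def using finite_sphere_measure finite_R by (rule finite_measure_pair_measure)

sublocale dD: finite_measure dD
  unfolding boundary_measure_def using finite_sphere_measure finite_frontier_measure[OF lip] by (rule finite_measure_pair_measure)

lemma sets_D_borel: "A \<in> sets D \<Longrightarrow> A \<in> sets borel"
  unfolding phase_measure_def
proof (erule sets_pair_subset_borel[rotated 2])
  show "A \<in> sets (restrict_space lborel R) \<Longrightarrow> A \<in> sets borel" for A
    using open_R by (simp add: sets_restrict_space_iff)
  show "A \<in> sets (surface_measure S2) \<Longrightarrow> A \<in> sets borel" for A
    by (simp add: sets_surface_closed)
qed

lemma sets_dD_borel: "A \<in> sets dD \<Longrightarrow> A \<in> sets borel"
  unfolding boundary_measure_def
proof (erule sets_pair_subset_borel[rotated 2])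
  show "A \<in> sets (surface_measure (frontier R)) \<Longrightarrow> A \<in> sets borel" for A
    by (simp add: sets_surface_closed)
  show "A \<in> sets (surface_measure S2) \<Longrightarrow> A \<in> sets borel" for A
    by (simp add: sets_surface_closed)
qed

lemma ident_D: "(\<lambda>x. x) \<in> borel_measurable D"
proof -
  have "(\<lambda>x. x) \<in> borel_measurable (restrict_space lborel R)"
    by (rule measurable_restrict_space1) simp
  then have "(\<lambda>p. (fst p, snd p)) \<in> measurable D (borel \<Otimes>\<^sub>M borel)"
    unfolding phase_measure_def
    using measurable_ident_surface[of S2] measurable_compose[OF measurable_fst] measurable_compose[OF measurable_snd]
    by (intro measurable_Pair) blast+
  then show ?thesis by (simp add: borel_prod)
qed

lemma ident_dD: "(\<lambda>x. x) \<in> borel_measurable dD"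
proof -
  have "(\<lambda>p. (fst p, snd p)) \<in> measurable dD (borel \<Otimes>\<^sub>M borel)"
    unfolding boundary_measure_def
    using measurable_ident_surface measurable_compose[OF measurable_fst] measurable_compose[OF measurable_snd]
    by (intro measurable_Pair) blast+
  then show ?thesis by (simp add: borel_prod)
qed

lemma borel_D: "f \<in> borel_measurable borel \<Longrightarrow> f \<in> borel_measurable D"
  using measurable_compose[OF ident_D] .

lemma borel_dD: "f \<in> borel_measurable borel \<Longrightarrow> f \<in> borel_measurable dD"
  using measurable_compose[OF ident_dD] .

lemma reflect_measurable: "reflect \<in> measurable D D"
  unfolding phase_measure_def reflect_def case_prod_unfold
  by (intro measurable_Pair measurable_fst measurable_compose[OF measurable_snd uminus_sphere_measurable])

lemma distr_reflect: "distr D D reflect = D"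
proof -
  have "distr (restrict_space lborel R) (restrict_space lborel R) (\<lambda>x. x) \<Otimes>\<^sub>M
      distr (surface_measure S2) (surface_measure S2) uminus
    = distr D D (\<lambda>(x, y). (x, - y))"
    unfolding phase_measure_def
    by (rule pair_measure_distr)
      (auto simp: uminus_sphere_measurable sphere_uminus S2.sigma_finite_measure_axioms)
  then show ?thesis
    by (simp add: reflect_def sphere_uminus phase_measure_def[symmetric])
qed

lemma integral_reflect:
  fixes f :: "phase \<Rightarrow> real"
  assumes "f \<in> borel_measurable D"
  shows "(LINT x|D. f (reflect x)) = (LINT x|D. f x)"
  using integral_distr[OF reflect_measurable assms] distr_reflect by simp

lemma integrable_reflect:
  fixes f :: "phase \<Rightarrow> real"
  assumes "integrable D f"
  shows "integrable D (\<lambda>x. f (reflect x))"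
  using integrable_distr[OF reflect_measurable, of f] assms distr_reflect by simp

lemma AE_reflect:
  assumes "AE x in D. P x" shows "AE x in D. P (reflect x)"
proof -
  have "AE x in distr D D reflect. P x" using assms unfolding distr_reflect .
  then show ?thesis by (rule AE_distrD[OF reflect_measurable])
qed

end

section \<open>Integration by parts for test functions\<close>

lemma lborel_integral_translate:
  fixes f :: "'a::euclidean_space \<Rightarrow> real"
  assumes "f \<in> borel_measurable borel"
  shows "(LINT x|lborel. f (c + x)) = (LINT x|lborel. f x)"
proof -
  have "(LINT x|distr lborel borel ((+) c). f x) = (LINT x|lborel. f (c + x))"
    by (rule integral_distr) (use assms in auto)
  then show ?thesis by (simp only: lborel_distr_plus)
qed

text \<open>Averaging the translates of \<open>g\<close> by \<open>h *\<^sub>R v\<close> over \<open>h\<close> in the unit interval does not change the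
  integral. By the fundamental theorem of calculus the average is \<open>G (v + x) - G x\<close>, whose integral
  vanishes by translation invariance again.\<close>

lemma integral_directional_derivative_zero:
  fixes G g :: "'a::euclidean_space \<Rightarrow> real"
  assumes G: "\<And>x h. ((\<lambda>h. G (x + h *\<^sub>R v)) has_real_derivative g (x + h *\<^sub>R v)) (at h)"
    and cG: "continuous_on UNIV G" and cg: "continuous_on UNIV g"
    and K: "compact K" "\<And>x. x \<notin> K \<Longrightarrow> G x = 0" "\<And>x. x \<notin> K \<Longrightarrow> g x = 0"
  shows "(LINT x|lborel. g x) = 0"
proof -
  have [measurable]: "g \<in> borel_measurable borel" "G \<in> borel_measurable borel"
    using cG cg by (auto intro: borel_measurable_continuous_onI)
  obtain b where b: "b > 0" "\<And>x. x \<in> K \<Longrightarrow> norm x \<le> b"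
    using compact_imp_bounded[OF K(1)] unfolding bounded_pos by blast
  have "compact (g ` K)" by (intro compact_continuous_image continuous_on_subset[OF cg] K) auto
  then have "bounded (g ` K)" by (rule compact_imp_bounded)
  then obtain B where B: "B > 0" "\<forall>y\<in>g ` K. norm y \<le> B" unfolding bounded_pos by blast
  then have B: "B > 0" "\<And>x. x \<in> K \<Longrightarrow> \<bar>g x\<bar> \<le> B" by auto
  define f where "f h x = indicator {0..1} h * g (x + h *\<^sub>R v)" for h :: real and x
  have fm: "case_prod f \<in> borel_measurable (lborel \<Otimes>\<^sub>M lborel)"
    unfolding f_def case_prod_unfold by measurable
  define E where "E = {0..1::real} \<times> cball (0::'a) (b + norm v)"
  have E: "E \<in> sets (lborel \<Otimes>\<^sub>M lborel)" "emeasure (lborel \<Otimes>\<^sub>M lborel) E < \<infinity>"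
    unfolding E_def using emeasure_bounded_finite[OF bounded_cball, of "0::'a" "b + norm v"]
    by (auto simp: lborel.emeasure_pair_measure_Times ennreal_mult_less_top)
  have fb: "\<bar>f h x\<bar> \<le> B * indicator E (h, x)" for h x
  proof (cases "h \<in> {0..1} \<and> x + h *\<^sub>R v \<in> K")
    case True
    then have "norm (x + h *\<^sub>R v) \<le> b" using b by blast
    moreover have "norm (h *\<^sub>R v) \<le> norm v" using True mult_right_mono[of h 1 "norm v"] by simp
    ultimately have "norm x \<le> b + norm v"
      using norm_triangle_ineq4[of "x + h *\<^sub>R v" "h *\<^sub>R v"] by simp
    then show ?thesis using True B(2) by (auto simp: f_def E_def)
  next
    case False
    then have "f h x = 0" using K(3) by (auto simp: f_def indicator_def)
    then show ?thesis using B(1) by simp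
  qed
  have fi: "integrable (lborel \<Otimes>\<^sub>M lborel) (case_prod f)"
  proof (rule Bochner_Integration.integrable_bound[OF _ fm])
    show "integrable (lborel \<Otimes>\<^sub>M lborel) (\<lambda>p. B * indicat_real E p)"
      using E by (intro integrable_mult_right integrable_real_indicator)
    show "AE p in lborel \<Otimes>\<^sub>M lborel. norm (case_prod f p) \<le> norm (B * indicat_real E p)"
      using fb B(1) by (auto simp: case_prod_unfold)
  qed
  have "(LINT x|lborel. LINT h|lborel. f h x) = (LINT h|lborel. LINT x|lborel. f h x)"
    by (rule lborel_pair.Fubini_integral[OF fi])
  also have "\<dots> = (LINT h|lborel. indicat_real {0..1::real} h * (LINT x|lborel. g x))"
  proof -
    have "(LINT x|lborel. g (x + h *\<^sub>R v)) = (LINT x|lborel. g x)" for h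
      using lborel_integral_translate[of g "h *\<^sub>R v"] by (simp add: add.commute)
    then have "(LINT x|lborel. f h x) = indicator {0..1} h * (LINT x|lborel. g x)" for h
      unfolding f_def by simp
    then show ?thesis by (simp only:)
  qed
  also have "\<dots> = (LINT h|lborel. indicat_real {0..1::real} h) * (LINT x|lborel. g x)" by simp
  also have "(LINT h|lborel. indicat_real {0..1::real} h) = 1"
    by (subst Bochner_Integration.integral_indicator) (simp add: measure_def)
  also have "1 * (LINT x|lborel. g x) = (LINT x|lborel. g x)" by simp
  finally have 1: "(LINT x|lborel. LINT h|lborel. f h x) = (LINT x|lborel. g x)" .
  have "(LINT h|lborel. f h x) = G (v + x) - G x" for x
  proof -
    have "(LINT h|lborel. indicator {0..1} h *\<^sub>R g (x + h *\<^sub>R v)) = G (x + 1 *\<^sub>R v) - G (x + 0 *\<^sub>R v)"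
    proof (rule integral_FTC_atLeastAtMost)
      show "((\<lambda>h. G (x + h *\<^sub>R v)) has_vector_derivative g (x + h *\<^sub>R v)) (at h within {0..1})" for h
        using G[of x h] has_real_derivative_iff_has_vector_derivative
          has_field_derivative_at_within by blast
      show "continuous_on {0..1} (\<lambda>h. g (x + h *\<^sub>R v))"
        by (rule continuous_on_compose2[OF cg]) (auto intro!: continuous_intros)
    qed simp
    then show ?thesis by (simp add: f_def add.commute)
  qed
  then have "(LINT x|lborel. LINT h|lborel. f h x) = (LINT x|lborel. G (v + x) - G x)" by simp
  also have "\<dots> = (LINT x|lborel. G (v + x)) - (LINT x|lborel. G x)"
  proof -
    have Gi: "integrable lborel G"
    proof -
      have "integrable lborel (\<lambda>x. indicator K x *\<^sub>R G x)"
        by (rule borel_integrable_compact[OF K(1) continuous_on_subset[OF cG]]) auto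
      moreover have "(\<lambda>x. indicator K x *\<^sub>R G x) = G" using K(2) by (auto simp: indicator_def fun_eq_iff)
      ultimately show ?thesis by (simp only:)
    qed
    have "integrable (distr lborel borel ((+) v)) G" using Gi by (simp only: lborel_distr_plus)
    then have "integrable lborel (\<lambda>x. G (v + x))" by (simp add: integrable_distr_eq)
    then show ?thesis using Gi by simp
  qed
  also have "\<dots> = 0" using lborel_integral_translate[of G v] by simp
  finally show ?thesis using 1 by simp
qed

section \<open>Smooth functions on phase space\<close>

lemma transport_alt: "transport \<zeta> p = frechet_derivative \<zeta> (at p) (snd p, 0)"
  by (cases p) (simp add: transport_def)

text \<open>In coordinates, $s\cdot\nabla\zeta$ is a sum of products of linear functions and partial
  derivatives.\<close>

lemma transport_smooth:
  assumes "smooth \<zeta>" shows "smooth (transport \<zeta>)"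
proof -
  have "transport \<zeta> p = (\<Sum>b\<in>Basis. (snd p \<bullet> b) * frechet_derivative \<zeta> (at p) (b, 0))" for p
  proof -
    have l: "linear (frechet_derivative \<zeta> (at p))"
      using smooth_has_derivative[OF assms] has_derivative_linear by blast
    have eq: "(snd p, 0::point) = (\<Sum>b\<in>Basis. (snd p \<bullet> b) *\<^sub>R (b, 0))"
    proof -
      have "(\<Sum>b\<in>Basis. (snd p \<bullet> b) *\<^sub>R (b, 0::point)) = (\<Sum>b\<in>Basis. ((snd p \<bullet> b) *\<^sub>R b, 0))"
        by simp
      also have "\<dots> = (\<Sum>b\<in>Basis. (snd p \<bullet> b) *\<^sub>R b, (\<Sum>b\<in>(Basis::point set). 0))"
        by (rule sum_prod)
      finally show ?thesis by (simp add: euclidean_representation)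
    qed
    then show ?thesis
      unfolding transport_alt eq by (simp only: linear_sum[OF l] linear_scale[OF l] real_scaleR_def)
  qed
  then have "transport \<zeta> = (\<lambda>p. \<Sum>b\<in>Basis. (snd p \<bullet> b) * frechet_derivative \<zeta> (at p) (b, 0))" by blast
  moreover have "smooth (\<lambda>p. \<Sum>b\<in>Basis. (snd p \<bullet> b) * frechet_derivative \<zeta> (at p) (b, 0))"
  proof (intro smooth_sum smooth_mult smooth_frechet assms)
    fix b :: point
    show "smooth (\<lambda>p::phase. snd p \<bullet> b)"
      by (intro smooth_bounded_linear bounded_linear_compose[OF bounded_linear_inner_left bounded_linear_snd])
  qed
  ultimately show ?thesis by simp
qed

lemma transport_mult:
  assumes "smooth \<zeta>" "smooth \<eta>"
  shows "transport (\<lambda>p. \<zeta> p * \<eta> p) p = \<zeta> p * transport \<eta> p + transport \<zeta> p * \<eta> p"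
  unfolding transport_alt
  using frechet_eq[OF has_derivative_mult[OF smooth_has_derivative[OF assms(1)] smooth_has_derivative[OF assms(2)]]]
  by simp

lemma transport_along_line:
  assumes "smooth \<zeta>"
  shows "((\<lambda>h. \<zeta> (r + h *\<^sub>R s, s)) has_real_derivative transport \<zeta> (r + h *\<^sub>R s, s)) (at h)"
proof -
  have "((\<lambda>h. (r + h *\<^sub>R s, s)) has_derivative (\<lambda>t. (t *\<^sub>R s, 0))) (at h)"
    by (auto intro!: derivative_eq_intros)
  from has_derivative_compose[OF this smooth_has_derivative[OF assms]]
  have "((\<lambda>h. \<zeta> (r + h *\<^sub>R s, s)) has_derivative
      (\<lambda>t. frechet_derivative \<zeta> (at (r + h *\<^sub>R s, s)) (t *\<^sub>R s, 0))) (at h)" .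
  moreover have "frechet_derivative \<zeta> (at p) (t *\<^sub>R s, 0) = frechet_derivative \<zeta> (at p) (s, 0) * t" for p t
  proof -
    have "linear (frechet_derivative \<zeta> (at p))"
      using smooth_has_derivative[OF assms] has_derivative_linear by blast
    from linear_scale[OF this, of t "(s, 0)"] show ?thesis by (simp add: mult.commute)
  qed
  ultimately show ?thesis by (simp add: has_field_derivative_def transport_alt)
qed

lemma transport_zero_outside:
  assumes "closed K" "\<And>p. p \<notin> K \<Longrightarrow> \<zeta> p = 0" "p \<notin> K"
  shows "transport \<zeta> p = 0"
proof -
  have "open (- K)" using assms by (simp add: open_Compl)
  then have "eventually (\<lambda>q. q \<in> - K) (nhds p)"
    using assms(3) by (intro eventually_nhds_in_open) auto
  then have "eventually (\<lambda>q. \<zeta> q = 0) (nhds p)"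
    using assms(2) by (auto elim: eventually_mono)
  then have "(\<zeta> has_derivative (\<lambda>v. 0)) (at p)"
    using has_derivative_transform_eventually[of "\<lambda>q. 0" "\<lambda>v. 0" p UNIV \<zeta>] assms(2,3)
    by (auto simp: eventually_nhds_conv_at elim!: eventually_mono)
  then show ?thesis by (simp add: transport_alt frechet_eq)
qed

lemma test_function_reflect:
  assumes "test_function (R \<times> UNIV) \<zeta>"
  shows "test_function (R \<times> UNIV) (\<lambda>p. \<zeta> (reflect p))"
proof -
  obtain K where K: "compact K" "K \<subseteq> R \<times> UNIV" "\<forall>p. p \<notin> K \<longrightarrow> \<zeta> p = 0"
    using assms unfolding test_function_def by blast
  have bl: "bounded_linear (reflect :: phase \<Rightarrow> phase)"
    unfolding linear_conv_bounded_linear[symmetric] reflect_def by (rule linearI) auto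
  have "smooth (\<lambda>p. \<zeta> (reflect p + 0))"
    using assms by (intro smooth_compose_affine bl test_function_smooth)
  moreover have "compact (reflect ` K)"
    using K(1) by (intro compact_continuous_image linear_continuous_on bl)
  moreover have "reflect ` K \<subseteq> R \<times> UNIV" using K(2) by (auto simp: reflect_def)
  moreover have "\<zeta> (reflect p) = 0" if "p \<notin> reflect ` K" for p
  proof -
    have "reflect p \<notin> K" using that by (metis imageI reflect_reflect)
    then show ?thesis using K(3) by blast
  qed
  ultimately show ?thesis unfolding test_function_def by auto
qed

context lipschitz_phase
begin

lemma smooth_L2:
  assumes "smooth \<zeta>"
  shows smooth_L2_D: "\<zeta> \<in> L2_space D" and smooth_L2_dD: "\<zeta> \<in> L2_space dD"
    and smooth_bounded_dD: "\<exists>c. \<forall>p\<in>space dD. \<bar>\<zeta> p\<bar> \<le> c"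
proof -
  have "compact (closure R \<times> S2)" using bounded_R by (intro compact_Times) (auto simp: compact_closure)
  then have "compact (\<zeta> ` (closure R \<times> S2))"
    by (intro compact_continuous_image smooth_imp_continuous assms)
  then have "bounded (\<zeta> ` (closure R \<times> S2))" by (rule compact_imp_bounded)
  then obtain c where "\<forall>y\<in>\<zeta> ` (closure R \<times> S2). norm y \<le> c" unfolding bounded_iff ..
  then have c: "\<bar>\<zeta> p\<bar> \<le> c" if "p \<in> closure R \<times> S2" for p
    using that by (simp only: ball_simps real_norm_def)
  have m: "\<zeta> \<in> borel_measurable borel"
    by (intro borel_measurable_continuous_onI smooth_imp_continuous assms)
  show "\<zeta> \<in> L2_space D"
  proof (rule L2_space_bounded[OF D.finite_measure_axioms borel_D[OF m]])
    fix p assume "p \<in> space D"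
    then show "\<bar>\<zeta> p\<bar> \<le> c" using closure_subset[of R] by (intro c) (auto simp: space_D)
  qed
  show "\<zeta> \<in> L2_space dD" "\<exists>c. \<forall>p\<in>space dD. \<bar>\<zeta> p\<bar> \<le> c"
  proof -
    have c': "\<bar>\<zeta> p\<bar> \<le> c" if "p \<in> space dD" for p
      using that by (intro c) (auto simp: space_dD frontier_def)
    then show "\<zeta> \<in> L2_space dD" by (rule L2_space_bounded[OF dD.finite_measure_axioms borel_dD[OF m]])
    show "\<exists>c. \<forall>p\<in>space dD. \<bar>\<zeta> p\<bar> \<le> c" using c' by blast
  qed
qed

text \<open>For each direction \<open>s\<close> this is the vanishing integral of a directional derivative of a compactly
  supported function of the position.\<close>

lemma integral_transport_zero:
  assumes F: "test_function (R \<times> UNIV) F"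
  shows "(LINT p|D. transport F p) = 0"
proof -
  obtain K where K: "compact K" "K \<subseteq> R \<times> UNIV" "\<And>p. p \<notin> K \<Longrightarrow> F p = 0" and sm: "smooth F"
    using F unfolding test_function_def by blast
  interpret R: finite_measure "restrict_space lborel R" by (rule finite_R)
  interpret P: pair_sigma_finite "restrict_space lborel R" "surface_measure S2" ..
  have L2: "transport F \<in> L2_space D" by (rule smooth_L2_D[OF transport_smooth[OF sm]])
  have "integrable D (\<lambda>p. transport F p * (\<lambda>p. 1) p)"
    by (rule L2_integrable_mult[OF L2 smooth_L2_D[OF smooth_const]])
  then have "integrable (restrict_space lborel R \<Otimes>\<^sub>M surface_measure S2) (case_prod (\<lambda>r s. transport F (r, s)))"
    by (simp add: phase_measure_def case_prod_unfold)
  from P.integral_snd[OF this]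
  have "(LINT p|D. transport F p) = (LINT s|surface_measure S2. LINT r|restrict_space lborel R. transport F (r, s))"
    by (simp add: phase_measure_def case_prod_unfold)
  moreover have "(LINT r|restrict_space lborel R. transport F (r, s)) = 0" for s
  proof -
    have zero: "transport F p = 0" if "p \<notin> K" for p
      by (rule transport_zero_outside[OF compact_imp_closed[OF K(1)] K(3) that])
    have "(LINT r|restrict_space lborel R. transport F (r, s)) = (LINT r|lborel. indicator R r *\<^sub>R transport F (r, s))"
      using open_R by (intro integral_restrict_space) auto
    also have "\<dots> = (LINT r|lborel. transport F (r, s))"
    proof (rule Bochner_Integration.integral_cong[OF refl])
      fix r show "indicator R r *\<^sub>R transport F (r, s) = transport F (r, s)"
        using zero[of "(r, s)"] K(2) by (cases "r \<in> R") auto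
    qed
    also have "\<dots> = 0"
    proof (rule integral_directional_derivative_zero[where G="\<lambda>r. F (r, s)" and v=s and K="fst ` K"])
      show "((\<lambda>h. F (x + h *\<^sub>R s, s)) has_real_derivative transport F (x + h *\<^sub>R s, s)) (at h)" for x h
        by (rule transport_along_line[OF sm])
      show "continuous_on UNIV (\<lambda>r. F (r, s))"
        by (rule continuous_on_compose2[OF smooth_imp_continuous[OF sm, of UNIV]]) (auto intro!: continuous_intros)
      show "continuous_on UNIV (\<lambda>r. transport F (r, s))"
        by (rule continuous_on_compose2[OF smooth_imp_continuous[OF transport_smooth[OF sm], of UNIV]])
          (auto intro!: continuous_intros)
      show "compact (fst ` K)" using K(1) by (intro compact_continuous_image continuous_intros)
      fix x assume "x \<notin> fst ` K"
      then have "(x, s) \<notin> K" by (metis fst_conv imageI)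
      then show "F (x, s) = 0" "transport F (x, s) = 0" using K(3) zero by auto
    qed
    finally show ?thesis .
  qed
  ultimately show ?thesis by simp
qed

lemma transport_parts:
  assumes \<zeta>: "test_function (R \<times> UNIV) \<zeta>" and \<eta>: "smooth \<eta>"
  shows "L2_inner D \<zeta> (transport \<eta>) = - L2_inner D (transport \<zeta>) \<eta>"
proof -
  have s: "smooth \<zeta>" using \<zeta> by (rule test_function_smooth)
  have i: "integrable D (\<lambda>p. \<zeta> p * transport \<eta> p)" "integrable D (\<lambda>p. transport \<zeta> p * \<eta> p)"
    by (auto intro!: L2_integrable_mult smooth_L2_D transport_smooth s \<eta>)
  have "0 = (LINT p|D. transport (\<lambda>p. \<zeta> p * \<eta> p) p)"
    using integral_transport_zero[OF test_function_mult[OF \<zeta> \<eta>]] by simp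
  also have "\<dots> = (LINT p|D. \<zeta> p * transport \<eta> p + transport \<zeta> p * \<eta> p)"
    by (simp add: transport_mult[OF s \<eta>])
  also have "\<dots> = L2_inner D \<zeta> (transport \<eta>) + L2_inner D (transport \<zeta>) \<eta>"
    using i by (simp add: L2_inner_def)
  finally show ?thesis by simp
qed

lemma test_dense_D:
  assumes "f \<in> L2_space D" "e > 0"
  obtains \<zeta> where "test_function (R \<times> UNIV) \<zeta>" "L2_norm D (f - \<zeta>) < e"
  using test_functions_dense_L2[OF D.finite_measure_axioms ident_D sets_D_borel, of "R \<times> UNIV" f e]
    assms open_R by (auto simp: space_D open_Times)

lemma phase_eq_by_testing:
  assumes f: "f \<in> L2_space D" "g \<in> L2_space D"
    and eq: "\<And>\<zeta>. test_function (R \<times> UNIV) \<zeta> \<Longrightarrow> L2_inner D f \<zeta> = L2_inner D g \<zeta>"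
  shows "AE x in D. f x = g x"
proof (rule L2_eq_by_testing[OF f, where T="Collect (test_function (R \<times> UNIV))"])
  show "\<exists>\<zeta>\<in>Collect (test_function (R \<times> UNIV)). L2_norm D (f - g - \<zeta>) < e" if "e > 0" for e
    using test_dense_D[OF L2_space_diff[OF f] that] by blast
qed (use smooth_L2_D test_function_smooth eq in auto)

section \<open>Weak transport and traces\<close>

abbreviation "wt \<equiv> weak_transport R"

lemma weak_transport_props:
  assumes "g \<in> L2_space D" "is_transport R v g"
  shows "wt v \<in> L2_space D" "is_transport R v (wt v)"
  using someI_ex[of "\<lambda>g. g \<in> L2_space D \<and> is_transport R v g"] assms
  unfolding weak_transport_def by auto

lemma weak_transport_eq:
  assumes g: "g \<in> L2_space D" "is_transport R v g"
  shows "AE x in D. wt v x = g x"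
proof (rule phase_eq_by_testing)
  fix \<zeta> :: "phase \<Rightarrow> real" assume "test_function (R \<times> UNIV) \<zeta>"
  then show "L2_inner D (wt v) \<zeta> = L2_inner D g \<zeta>"
    using g(2) weak_transport_props(2)[OF g] unfolding is_transport_def by (metis minus_equation_iff)
qed (use g weak_transport_props(1)[OF g] in auto)

text \<open>Green's formula pairs $(s\cdot n)\tau$ with smooth functions. Splitting $s\cdot n$ into this signed
  root and $|s\cdot n|^{1/2}$ expresses it through the weighted trace $|s\cdot n|^{1/2}\tau$, which
  lies in \<open>L2_space dD\<close> and in terms of which the boundary form is an ordinary inner product.\<close>

definition flux_root :: "phase \<Rightarrow> real" where
  "flux_root p = sgn (normal_flux R p) * sqrt \<bar>normal_flux R p\<bar>"

definition weight_trace :: "(phase \<Rightarrow> real) \<Rightarrow> phase \<Rightarrow> real" where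
  "weight_trace \<tau> p = sqrt \<bar>normal_flux R p\<bar> * \<tau> p"

lemma flux_root_borel: "flux_root \<in> borel_measurable borel"
  unfolding flux_root_def by measurable

lemma flux_root_square: "flux_root p * flux_root p = \<bar>normal_flux R p\<bar>"
  by (simp add: flux_root_def sgn_if)

lemma abs_flux_root: "\<bar>flux_root p\<bar> = sqrt \<bar>normal_flux R p\<bar>"
  by (simp add: flux_root_def sgn_if abs_mult)

lemma norm_outward_normal_le: "norm (outward_normal R x) \<le> 1"
proof (cases "\<exists>\<nu>. is_outward_normal R x \<nu>")
  case True
  then obtain \<nu> where "is_outward_normal R x \<nu>" by blast
  then show ?thesis using outward_normal_eqI[of R x \<nu>] by (simp add: is_outward_normal_def)
qed (simp add: outward_normal_def)

lemma abs_normal_flux_le: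
  assumes "p \<in> space dD" shows "\<bar>normal_flux R p\<bar> \<le> 1"
proof -
  obtain r s where p: "p = (r, s)" "norm s = 1" using assms by (cases p) (auto simp: space_dD)
  have "\<bar>s \<bullet> outward_normal R r\<bar> \<le> norm s * norm (outward_normal R r)" by (rule Cauchy_Schwarz_ineq2)
  also have "\<dots> \<le> 1" using p norm_outward_normal_le by simp
  finally show ?thesis by (simp add: normal_flux_def p)
qed

lemma flux_root_mult_L2:
  assumes "smooth \<zeta>" shows "(\<lambda>p. flux_root p * \<zeta> p) \<in> L2_space dD"
proof -
  obtain c where c: "\<And>p. p \<in> space dD \<Longrightarrow> \<bar>\<zeta> p\<bar> \<le> c" using smooth_bounded_dD[OF assms] by blast
  have m: "(\<lambda>p. flux_root p * \<zeta> p) \<in> borel_measurable dD"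
    by (intro borel_measurable_times borel_dD flux_root_borel borel_measurable_continuous_onI
        smooth_imp_continuous assms)
  show ?thesis
  proof (rule L2_space_bounded[OF dD.finite_measure_axioms m])
    fix p assume p: "p \<in> space dD"
    have "\<bar>flux_root p * \<zeta> p\<bar> \<le> 1 * c"
      unfolding abs_mult using abs_normal_flux_le[OF p] c[OF p]
      by (intro mult_mono) (auto simp: abs_flux_root)
    then show "\<bar>flux_root p * \<zeta> p\<bar> \<le> c" by simp
  qed
qed

lemma is_trace_iff:
  "is_trace R v \<tau> \<longleftrightarrow> weight_trace \<tau> \<in> L2_space dD \<and>
    (\<forall>\<zeta>. smooth \<zeta> \<longrightarrow> L2_inner D (wt v) \<zeta> + L2_inner D v (transport \<zeta>) =
        L2_inner dD (weight_trace \<tau>) (\<lambda>p. flux_root p * \<zeta> p))"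
proof -
  have 1: "(\<lambda>(r, s). sqrt \<bar>s \<bullet> outward_normal R r\<bar> * \<tau> (r, s)) = weight_trace \<tau>"
    by (auto simp: weight_trace_def normal_flux_def)
  have 2: "(\<lambda>(r, s). (s \<bullet> outward_normal R r) * \<tau> (r, s) * \<zeta> (r, s))
      = (\<lambda>p. weight_trace \<tau> p * (flux_root p * \<zeta> p))" for \<zeta> :: "phase \<Rightarrow> real"
  proof
    fix p :: phase
    have "sqrt \<bar>normal_flux R p\<bar> * flux_root p = normal_flux R p"
      by (simp add: flux_root_def sgn_if)
    then have "weight_trace \<tau> p * (flux_root p * \<zeta> p) = normal_flux R p * \<tau> p * \<zeta> p"
      by (simp add: weight_trace_def mult_ac)
    then show "(case p of (r, s) \<Rightarrow> (s \<bullet> outward_normal R r) * \<tau> (r, s) * \<zeta> (r, s))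
        = weight_trace \<tau> p * (flux_root p * \<zeta> p)"
      by (cases p) (simp only: normal_flux_def prod.case)
  qed
  show ?thesis unfolding is_trace_def 1 2 L2_inner_def ..
qed

lemma weight_trace_eq_0: "flux_root p = 0 \<Longrightarrow> weight_trace \<tau> p = 0"
  by (auto simp: flux_root_def weight_trace_def sgn_if split: if_splits)

text \<open>Density of smooth functions in $L^2$ of the boundary measure with density $|s\cdot n|$, applied to
  the quotient of \<open>g\<close> and the signed root.\<close>

lemma flux_smooth_dense:
  assumes g: "g \<in> L2_space dD" "\<And>p. p \<in> space dD \<Longrightarrow> flux_root p = 0 \<Longrightarrow> g p = 0" and e: "e > 0"
  obtains \<zeta> where "smooth \<zeta>" "L2_norm dD (g - (\<lambda>p. flux_root p * \<zeta> p)) < e"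
proof -
  have nf: "(\<lambda>p. \<bar>normal_flux R p\<bar>) \<in> borel_measurable dD" by (intro borel_dD) measurable
  have fr: "flux_root \<in> borel_measurable dD" by (rule borel_dD[OF flux_root_borel])
  define N where "N = density dD (\<lambda>p. ennreal \<bar>normal_flux R p\<bar>)"
  have Nfin: "finite_measure N"
  proof (rule finite_measureI)
    have "emeasure N (space N) = (\<integral>\<^sup>+p. ennreal \<bar>normal_flux R p\<bar> * indicator (space dD) p \<partial>dD)"
      unfolding N_def using nf by (subst emeasure_density) auto
    also have "\<dots> \<le> (\<integral>\<^sup>+p. 1 \<partial>dD)"
      by (rule nn_integral_mono) (auto simp: abs_normal_flux_le indicator_def intro: ennreal_leI[of _ 1, simplified])
    also have "\<dots> < \<infinity>" using dD.emeasure_finite[of "space dD"] by (simp add: less_top[symmetric])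
    finally show "emeasure N (space N) \<noteq> \<infinity>" by simp
  qed
  have inN: "integrable N f \<longleftrightarrow> integrable dD (\<lambda>p. \<bar>normal_flux R p\<bar> * f p)" if "f \<in> borel_measurable dD" for f :: "phase \<Rightarrow> real"
    unfolding N_def using integrable_density[OF that nf] by simp
  have intN: "(LINT p|N. f p) = (LINT p|dD. \<bar>normal_flux R p\<bar> * f p)" if "f \<in> borel_measurable dD" for f :: "phase \<Rightarrow> real"
    unfolding N_def using integral_density[OF that nf] by simp
  define u where "u p = g p / flux_root p" for p
  have um: "u \<in> borel_measurable dD"
    unfolding u_def using L2_measurable[OF g(1)] fr by measurable
  have gu: "g p = flux_root p * u p" if "p \<in> space dD" for p
    using g(2)[OF that] by (cases "flux_root p = 0") (auto simp: u_def)
  have "integrable dD (\<lambda>p. \<bar>normal_flux R p\<bar> * (u p)\<^sup>2)"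
    using L2_integrable_square[OF g(1)]
    by (rule Bochner_Integration.integrable_cong[THEN iffD1, rotated 2])
      (auto simp: gu power2_eq_square flux_root_square[symmetric] mult_ac)
  then have uN: "u \<in> L2_space N"
    using inN[of "\<lambda>p. (u p)\<^sup>2"] um by (auto simp: L2_space_def N_def)
  have "\<exists>\<zeta>. test_function UNIV \<zeta> \<and> \<zeta> \<in> L2_space N \<and> L2_norm N (u - \<zeta>) < e"
    using ident_dD sets_dD_borel
    by (intro test_functions_dense_L2[OF Nfin] uN e) (auto simp: N_def)
  then obtain \<zeta> where z: "test_function UNIV \<zeta>" "L2_norm N (u - \<zeta>) < e" by blast
  have s: "smooth \<zeta>" using z(1) by (rule test_function_smooth)
  have zm: "\<zeta> \<in> borel_measurable dD" using L2_measurable[OF smooth_L2_dD[OF s]] .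
  have "(LINT p|N. (u p - \<zeta> p)\<^sup>2) = (LINT p|dD. \<bar>normal_flux R p\<bar> * (u p - \<zeta> p)\<^sup>2)"
    using um zm by (intro intN) measurable
  also have "\<dots> = (LINT p|dD. (g p - flux_root p * \<zeta> p)\<^sup>2)"
    by (rule Bochner_Integration.integral_cong)
      (auto simp: gu flux_root_square[symmetric] power2_eq_square algebra_simps)
  finally have "L2_norm dD (g - (\<lambda>p. flux_root p * \<zeta> p)) < e"
    using z(2) by (simp add: L2_norm_def fun_diff_def)
  then show ?thesis using that s by blast
qed

definition wtrace :: "(phase \<Rightarrow> real) \<Rightarrow> phase \<Rightarrow> real" where
  "wtrace v = weight_trace (trace_of R v)"

lemma boundary_form_eq: "boundary_form R v w = L2_inner dD (wtrace v) (wtrace w)"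
proof -
  have "(\<lambda>(r, s). \<bar>s \<bullet> outward_normal R r\<bar> * trace_of R v (r, s) * trace_of R w (r, s))
    = (\<lambda>p. wtrace v p * wtrace w p)"
  proof
    fix p :: phase
    have "wtrace v p * wtrace w p = (sqrt \<bar>normal_flux R p\<bar> * sqrt \<bar>normal_flux R p\<bar>) * trace_of R v p * trace_of R w p"
      by (simp only: wtrace_def weight_trace_def mult_ac)
    then show "(case p of (r, s) \<Rightarrow> \<bar>s \<bullet> outward_normal R r\<bar> * trace_of R v (r, s) * trace_of R w (r, s))
        = wtrace v p * wtrace w p"
      by (cases p) (simp add: normal_flux_def)
  qed
  then show ?thesis by (simp add: boundary_form_def L2_inner_def)
qed

lemma W_norm_eq: "W_norm R v = sqrt ((L2_norm D v)\<^sup>2 + (L2_norm D (wt v))\<^sup>2 + (L2_norm dD (wtrace v))\<^sup>2)"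
proof -
  have "(\<lambda>(r, s). sqrt \<bar>s \<bullet> outward_normal R r\<bar> * trace_of R v (r, s)) = wtrace v"
    by (auto simp: wtrace_def weight_trace_def normal_flux_def)
  then show ?thesis by (simp add: W_norm_def V_norm_def)
qed

lemma W_spaceD:
  assumes "v \<in> W_space R"
  shows "v \<in> L2_space D" "wt v \<in> L2_space D" "is_transport R v (wt v)" "wtrace v \<in> L2_space dD"
    and W_Green: "smooth \<zeta> \<Longrightarrow> L2_inner D (wt v) \<zeta> + L2_inner D v (transport \<zeta>) =
        L2_inner dD (wtrace v) (\<lambda>p. flux_root p * \<zeta> p)"
proof -
  from assms obtain g \<tau> where g: "g \<in> L2_space D" "is_transport R v g" and \<tau>: "is_trace R v \<tau>"
    by (auto simp: W_space_def)
  show "v \<in> L2_space D" using assms by (simp add: W_space_def)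
  show "wt v \<in> L2_space D" "is_transport R v (wt v)" using weak_transport_props[OF g] by auto
  have "is_trace R v (trace_of R v)" unfolding trace_of_def using \<tau> by (rule someI[of "is_trace R v"])
  then show "wtrace v \<in> L2_space dD" "smooth \<zeta> \<Longrightarrow> L2_inner D (wt v) \<zeta> + L2_inner D v (transport \<zeta>) =
        L2_inner dD (wtrace v) (\<lambda>p. flux_root p * \<zeta> p)"
    by (auto simp: is_trace_iff wtrace_def)
qed

lemma wtrace_zero: "flux_root p = 0 \<Longrightarrow> wtrace v p = 0"
  by (simp add: wtrace_def weight_trace_eq_0)

text \<open>Weighted traces vanish wherever $s\cdot n=0$, so that Green's formula determines them almost
  everywhere.\<close>

lemma trace_eq_by_testing:
  assumes f: "f \<in> L2_space dD" "g \<in> L2_space dD"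
    and z: "\<And>p. flux_root p = 0 \<Longrightarrow> f p = 0" "\<And>p. flux_root p = 0 \<Longrightarrow> g p = 0"
    and eq: "\<And>\<zeta>. smooth \<zeta> \<Longrightarrow> L2_inner dD f (\<lambda>p. flux_root p * \<zeta> p) = L2_inner dD g (\<lambda>p. flux_root p * \<zeta> p)"
  shows "AE x in dD. f x = g x"
proof (rule L2_eq_by_testing[OF f, where T="{\<lambda>p. flux_root p * \<zeta> p | \<zeta>. smooth \<zeta>}"])
  fix e :: real assume "e > 0"
  then obtain \<zeta> where "smooth \<zeta>" "L2_norm dD (f - g - (\<lambda>p. flux_root p * \<zeta> p)) < e"
    by (rule flux_smooth_dense[OF L2_space_diff[OF f], rotated]) (auto simp: z fun_diff_def)
  then show "\<exists>\<xi>\<in>{\<lambda>p. flux_root p * \<zeta> p | \<zeta>. smooth \<zeta>}. L2_norm dD (f - g - \<xi>) < e" by blast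
qed (use flux_root_mult_L2 eq in auto)

text \<open>The weak derivative and the weighted trace of a function are selected by choice, so linearity holds
  almost everywhere only, as a consequence of uniqueness.\<close>

lemma W_space_lincomb:
  assumes v: "v \<in> W_space R" and w: "w \<in> W_space R"
  shows W_space_comb: "a *\<^sub>R v + b *\<^sub>R w \<in> W_space R"
    and wt_comb: "AE x in D. wt (a *\<^sub>R v + b *\<^sub>R w) x = (a *\<^sub>R wt v + b *\<^sub>R wt w) x"
    and wtrace_comb: "AE x in dD. wtrace (a *\<^sub>R v + b *\<^sub>R w) x = (a *\<^sub>R wtrace v + b *\<^sub>R wtrace w) x"
proof -
  note V = W_spaceD[OF v] and W = W_spaceD[OF w]
  define u where "u = a *\<^sub>R v + b *\<^sub>R w"
  define g where "g = a *\<^sub>R wt v + b *\<^sub>R wt w"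
  have uL: "u \<in> L2_space D" and gL: "g \<in> L2_space D"
    unfolding u_def g_def using V W by (auto intro!: L2_space_add L2_space_scaleR)
  note inn = L2_inner_comb_left[of _ _ _ _ a b]
  have gt: "is_transport R u g"
    unfolding is_transport_def
  proof (intro allI impI)
    fix \<zeta> :: "phase \<Rightarrow> real" assume t: "test_function (R \<times> UNIV) \<zeta>"
    then have s: "\<zeta> \<in> L2_space D" "transport \<zeta> \<in> L2_space D"
      using smooth_L2_D transport_smooth test_function_smooth by metis+
    show "L2_inner D u (transport \<zeta>) = - L2_inner D g \<zeta>"
      using V(3) W(3) t V W s unfolding u_def g_def is_transport_def by (simp add: inn)
  qed
  have wu: "AE x in D. wt u x = g x" by (rule weak_transport_eq[OF gL gt])
  have wuL: "wt u \<in> L2_space D" by (rule weak_transport_props(1)[OF gL gt])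
  define \<tau> where "\<tau> = a *\<^sub>R trace_of R v + b *\<^sub>R trace_of R w"
  have w\<tau>: "weight_trace \<tau> = a *\<^sub>R wtrace v + b *\<^sub>R wtrace w"
    by (auto simp: \<tau>_def wtrace_def weight_trace_def scaleR_fun_def algebra_simps fun_eq_iff)
  have w\<tau>L: "weight_trace \<tau> \<in> L2_space dD"
    unfolding w\<tau> using V W by (auto intro!: L2_space_add L2_space_scaleR)
  have tr: "is_trace R u \<tau>"
    unfolding is_trace_iff
  proof (intro conjI allI impI w\<tau>L)
    fix \<zeta> :: "phase \<Rightarrow> real" assume s: "smooth \<zeta>"
    have sL: "\<zeta> \<in> L2_space D" "transport \<zeta> \<in> L2_space D" "(\<lambda>p. flux_root p * \<zeta> p) \<in> L2_space dD"
      using s by (auto intro!: smooth_L2_D transport_smooth flux_root_mult_L2)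
    have "L2_inner D (wt u) \<zeta> = L2_inner D g \<zeta>"
      using wu wuL gL sL by (intro L2_inner_cong_AE) (auto simp: L2_measurable)
    then show "L2_inner D (wt u) \<zeta> + L2_inner D u (transport \<zeta>) =
        L2_inner dD (weight_trace \<tau>) (\<lambda>p. flux_root p * \<zeta> p)"
      unfolding w\<tau> g_def u_def inn[OF V(2) W(2) sL(1)] inn[OF V(1) W(1) sL(2)] inn[OF V(4) W(4) sL(3)]
        V(5)[OF s, symmetric] W(5)[OF s, symmetric] by (simp add: algebra_simps)
  qed
  show uW: "a *\<^sub>R v + b *\<^sub>R w \<in> W_space R"
    using uL gL gt tr unfolding W_space_def u_def by auto
  show "AE x in D. wt (a *\<^sub>R v + b *\<^sub>R w) x = (a *\<^sub>R wt v + b *\<^sub>R wt w) x"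
    using wu unfolding u_def g_def .
  show "AE x in dD. wtrace (a *\<^sub>R v + b *\<^sub>R w) x = (a *\<^sub>R wtrace v + b *\<^sub>R wtrace w) x"
  proof (rule trace_eq_by_testing)
    show "L2_inner dD (wtrace (a *\<^sub>R v + b *\<^sub>R w)) (\<lambda>p. flux_root p * \<zeta> p)
        = L2_inner dD (a *\<^sub>R wtrace v + b *\<^sub>R wtrace w) (\<lambda>p. flux_root p * \<zeta> p)"
      if s: "smooth \<zeta>" for \<zeta>
      using W_Green[OF uW s] tr s unfolding w\<tau>[symmetric] is_trace_iff u_def by simp
    show "wtrace (a *\<^sub>R v + b *\<^sub>R w) \<in> L2_space dD" by (rule W_spaceD(4)[OF uW])
    show "a *\<^sub>R wtrace v + b *\<^sub>R wtrace w \<in> L2_space dD" by (rule w\<tau>L[unfolded w\<tau>])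
  qed (auto simp: wtrace_zero scaleR_fun_def)
qed

lemma W_space_cong:
  assumes w: "w \<in> W_space R" and w': "w' \<in> borel_measurable D" and eq: "AE x in D. w x = w' x"
  shows "w' \<in> W_space R" "wt w' = wt w" "wtrace w' = wtrace w"
proof -
  have L: "w \<in> L2_space D" using W_spaceD(1)[OF w] .
  have L': "w' \<in> L2_space D" by (rule L2_space_cong_AE[OF L w' eq])
  have inn: "L2_inner D w' \<zeta> = L2_inner D w \<zeta>" if "\<zeta> \<in> L2_space D" for \<zeta>
    using that eq L L' by (intro L2_inner_cong_AE) (auto simp: L2_measurable)
  have t: "is_transport R w' = is_transport R w"
  proof -
    have "L2_inner D w' (transport \<zeta>) = L2_inner D w (transport \<zeta>)" if "test_function (R \<times> UNIV) \<zeta>" for \<zeta>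
      by (rule inn[OF smooth_L2_D[OF transport_smooth[OF test_function_smooth[OF that]]]])
    then show ?thesis unfolding is_transport_def fun_eq_iff by (metis (no_types))
  qed
  then show wt: "wt w' = wt w" by (simp add: weak_transport_def)
  have tr: "is_trace R w' = is_trace R w"
  proof -
    have "L2_inner D w' (transport \<zeta>) = L2_inner D w (transport \<zeta>)" if "smooth \<zeta>" for \<zeta>
      by (rule inn[OF smooth_L2_D[OF transport_smooth[OF that]]])
    then show ?thesis unfolding is_trace_iff fun_eq_iff wt by (metis (no_types))
  qed
  then show "wtrace w' = wtrace w" by (simp add: wtrace_def trace_of_def)
  show "w' \<in> W_space R"
  proof -
    from w obtain g \<tau> where g: "g \<in> L2_space D" "is_transport R w g" "is_trace R w \<tau>"
      by (auto simp: W_space_def)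
    then have "is_transport R w' g" "is_trace R w' \<tau>" by (simp_all add: t tr)
    then show ?thesis unfolding W_space_def using L' g(1) by blast
  qed
qed

text \<open>Integration by parts shows that the classical derivative is the weak one and that the trace is zero.\<close>

lemma test_function_in_W:
  assumes t: "test_function (R \<times> UNIV) \<zeta>"
  shows "\<zeta> \<in> W_space R"
proof -
  have s: "smooth \<zeta>" using t by (rule test_function_smooth)
  have L: "\<zeta> \<in> L2_space D" "transport \<zeta> \<in> L2_space D" by (auto intro!: smooth_L2_D transport_smooth s)
  have tr: "is_transport R \<zeta> (transport \<zeta>)"
    unfolding is_transport_def using transport_parts[OF t] test_function_smooth by blast
  have "is_trace R \<zeta> (\<lambda>_. 0)"
    unfolding is_trace_iff
  proof (intro conjI allI impI)
    have "weight_trace (\<lambda>_. 0) = 0" by (auto simp: weight_trace_def)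
    then show "weight_trace (\<lambda>_. 0) \<in> L2_space dD" by (simp add: L2_space_zero)
    fix \<eta> :: "phase \<Rightarrow> real" assume \<eta>: "smooth \<eta>"
    have "L2_inner D (wt \<zeta>) \<eta> = L2_inner D (transport \<zeta>) \<eta>"
      using weak_transport_eq[OF L(2) tr] weak_transport_props(1)[OF L(2) tr] L smooth_L2_D[OF \<eta>]
      by (intro L2_inner_cong_AE) (auto simp: L2_measurable)
    then show "L2_inner D (wt \<zeta>) \<eta> + L2_inner D \<zeta> (transport \<eta>) =
        L2_inner dD (weight_trace (\<lambda>_. 0)) (\<lambda>p. flux_root p * \<eta> p)"
      using transport_parts[OF t \<eta>] by (simp add: L2_inner_def weight_trace_def)
  qed
  then show ?thesis using L tr unfolding W_space_def by blast
qed

end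

section \<open>Even and odd parts\<close>

lemma even_part_eq: "even_part \<phi> p = (\<phi> p + \<phi> (reflect p)) / 2"
  by (cases p) (simp add: even_part_def reflect_def)

lemma odd_part_eq: "odd_part \<phi> p = (\<phi> p - \<phi> (reflect p)) / 2"
  by (cases p) (simp add: odd_part_def reflect_def)

lemma even_plus_odd: "even_part \<phi> + odd_part \<phi> = \<phi>"
  by (auto simp: even_part_eq odd_part_eq fun_eq_iff field_simps)

lemma even_part_reflect: "even_part \<phi> (reflect p) = even_part \<phi> p"
  by (simp add: even_part_eq add.commute)

lemma odd_part_reflect: "odd_part \<phi> (reflect p) = - odd_part \<phi> p"
  by (simp add: odd_part_eq field_simps)

lemma even_part_comb: "even_part (a *\<^sub>R x + b *\<^sub>R y) = a *\<^sub>R even_part x + b *\<^sub>R even_part y"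
  by (auto simp: even_part_eq scaleR_fun_def fun_eq_iff field_simps)

lemma odd_part_comb: "odd_part (a *\<^sub>R x + b *\<^sub>R y) = a *\<^sub>R odd_part x + b *\<^sub>R odd_part y"
  by (auto simp: odd_part_eq scaleR_fun_def fun_eq_iff field_simps)

lemma square_le_mult:
  fixes x a b :: real
  assumes "\<bar>x\<bar> \<le> a * b" shows "x\<^sup>2 \<le> a\<^sup>2 * b\<^sup>2"
proof -
  have "\<bar>x\<bar>\<^sup>2 \<le> (a * b)\<^sup>2" by (rule power_mono[OF assms]) simp
  then show ?thesis by (simp add: power_mult_distrib)
qed

context lipschitz_phase
begin

lemma L2_reflect: "\<phi> \<in> L2_space D \<Longrightarrow> (\<lambda>p. \<phi> (reflect p)) \<in> L2_space D"
  using measurable_compose[OF reflect_measurable] integrable_reflect[of "\<lambda>p. (\<phi> p)\<^sup>2"]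
  by (auto simp: L2_space_def)

lemma even_part_alt: "even_part \<phi> = (1/2) *\<^sub>R \<phi> + (1/2) *\<^sub>R (\<lambda>p. \<phi> (reflect p))"
  and odd_part_alt: "odd_part \<phi> = (1/2) *\<^sub>R \<phi> + (- 1/2) *\<^sub>R (\<lambda>p. \<phi> (reflect p))"
  by (auto simp: even_part_eq odd_part_eq scaleR_fun_def fun_eq_iff field_simps)

lemma even_part_L2: "\<phi> \<in> L2_space D \<Longrightarrow> even_part \<phi> \<in> L2_space D"
  unfolding even_part_alt by (intro L2_space_comb L2_reflect)

lemma odd_part_L2: "\<phi> \<in> L2_space D \<Longrightarrow> odd_part \<phi> \<in> L2_space D"
  unfolding odd_part_alt by (intro L2_space_comb L2_reflect)

text \<open>The reflection of the directions preserves the measure and changes the sign of the product.\<close>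

lemma L2_inner_symmetric_antisymmetric:
  assumes "f \<in> L2_space D" "g \<in> L2_space D"
    and "\<And>p. p \<in> space D \<Longrightarrow> f (reflect p) = f p" "\<And>p. p \<in> space D \<Longrightarrow> g (reflect p) = - g p"
  shows "L2_inner D f g = 0"
proof -
  have "L2_inner D f g = (LINT p|D. f (reflect p) * g (reflect p))"
    unfolding L2_inner_def
    by (rule integral_reflect[symmetric]) (intro borel_measurable_times L2_measurable assms)
  also have "\<dots> = (LINT p|D. - (f p * g p))"
    by (rule Bochner_Integration.integral_cong) (auto simp: assms)
  also have "\<dots> = - L2_inner D f g" by (simp add: L2_inner_def)
  finally show ?thesis by simp
qed

lemma L2_inner_even_odd: "f \<in> L2_space D \<Longrightarrow> g \<in> L2_space D \<Longrightarrow> L2_inner D (even_part f) (odd_part g) = 0"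
  by (intro L2_inner_symmetric_antisymmetric even_part_L2 odd_part_L2)
    (auto simp: even_part_reflect odd_part_reflect)

lemma L2_inner_parts:
  assumes "f \<in> L2_space D" "g \<in> L2_space D"
  shows "L2_inner D f g = L2_inner D (even_part f) (even_part g) + L2_inner D (odd_part f) (odd_part g)"
proof -
  have "L2_inner D f g = L2_inner D (even_part f + odd_part f) (even_part g + odd_part g)"
    by (simp only: even_plus_odd)
  also have "\<dots> = L2_inner D (even_part f) (even_part g) + L2_inner D (odd_part f) (odd_part g)"
    using assms L2_inner_even_odd[of f g] L2_inner_even_odd[of g f] L2_inner_commute[of D "odd_part f" "even_part g"]
    by (simp add: L2_inner_add_left L2_inner_add_right even_part_L2 odd_part_L2 L2_space_add)
  finally show ?thesis .
qed

lemma L2_inner_even_left: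
  assumes "f \<in> L2_space D" "g \<in> L2_space D"
  shows "L2_inner D (even_part f) g = L2_inner D (even_part f) (even_part g)"
  using L2_inner_even_odd[OF assms] L2_inner_add_right[of "even_part f" D "even_part g" "odd_part g"] assms
  by (simp add: even_plus_odd even_part_L2 odd_part_L2)

lemma L2_inner_odd_left:
  assumes "f \<in> L2_space D" "g \<in> L2_space D"
  shows "L2_inner D (odd_part f) g = L2_inner D (odd_part f) (odd_part g)"
  using L2_inner_even_odd[OF assms(2,1)] L2_inner_add_right[of "odd_part f" D "even_part g" "odd_part g"] assms
  by (simp add: even_plus_odd even_part_L2 odd_part_L2 L2_inner_commute[of D "odd_part f" "even_part g"])

lemma W_plus_reflect: "w \<in> W_plus R \<longleftrightarrow> w \<in> W_space R \<and> (AE p in D. w (reflect p) = w p)"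
  by (simp add: W_plus_def reflect_def case_prod_unfold)

lemma V_minus_reflect: "v \<in> V_minus R \<longleftrightarrow> v \<in> L2_space D \<and> (AE p in D. v (reflect p) = - v p)"
  by (simp add: V_minus_def V_space_def reflect_def case_prod_unfold)

lemma W_zero: "0 \<in> W_space R" and wt_zero: "AE p in D. wt 0 p = 0" and wtrace_zero_fun: "AE p in dD. wtrace 0 p = 0"
proof -
  have w: "(\<lambda>x. 0) \<in> W_space R" by (rule test_function_in_W[OF test_function_zero])
  have z: "(0::real) *\<^sub>R (\<lambda>x. 0) + (0::real) *\<^sub>R (\<lambda>x. 0) = (0 :: phase \<Rightarrow> real)" by simp
  show "0 \<in> W_space R" using W_space_comb[OF w w, of 0 0] unfolding z .
  show "AE p in D. wt 0 p = 0" using wt_comb[OF w w, of 0 0] unfolding z by (simp add: zero_fun_def)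
  show "AE p in dD. wtrace 0 p = 0" using wtrace_comb[OF w w, of 0 0] unfolding z by (simp add: zero_fun_def)
qed

section \<open>The space of functions with regular even part\<close>

text \<open>This carrier of $\mathbb{W}^+\oplus\mathbb{V}^-$ imposes the regularity on the even part directly
  and thereby avoids a choice of the two summands, which are unique almost everywhere only.\<close>

definition WV :: "(phase \<Rightarrow> real) set" where
  "WV = {x \<in> L2_space D. even_part x \<in> W_space R}"

text \<open>The streaming term $s\cdot\nabla\phi^+$.\<close>

definition St :: "(phase \<Rightarrow> real) \<Rightarrow> phase \<Rightarrow> real" where
  "St x = wt (even_part x)"

definition Tr :: "(phase \<Rightarrow> real) \<Rightarrow> phase \<Rightarrow> real" where
  "Tr x = wtrace (even_part x)"

lemma even_part_W_plus: "x \<in> WV \<Longrightarrow> even_part x \<in> W_plus R"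
  by (simp add: WV_def W_plus_reflect even_part_reflect)

lemma odd_part_V_minus: "x \<in> L2_space D \<Longrightarrow> odd_part x \<in> V_minus R"
  by (simp add: V_minus_reflect odd_part_reflect odd_part_L2)

lemma even_part_sum:
  assumes "w \<in> W_plus R" "v \<in> V_minus R"
  shows "AE p in D. w p = even_part (w + v) p"
proof -
  have "AE p in D. w (reflect p) = w p" "AE p in D. v (reflect p) = - v p"
    using assms by (auto simp: W_plus_reflect V_minus_reflect)
  then show ?thesis by eventually_elim (simp add: even_part_eq)
qed

lemma W_plus_L2: "w \<in> W_plus R \<Longrightarrow> w \<in> L2_space D"
  by (simp add: W_plus_reflect W_spaceD)

lemma V_minus_L2: "v \<in> V_minus R \<Longrightarrow> v \<in> L2_space D"
  by (simp add: V_minus_reflect)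

lemma sum_in_WV:
  assumes w: "w \<in> W_plus R" and v: "v \<in> V_minus R"
  shows "w + v \<in> WV" "St (w + v) = wt w" "Tr (w + v) = wtrace w"
proof -
  have L: "w + v \<in> L2_space D" using w v by (intro L2_space_add W_plus_L2 V_minus_L2)
  have wW: "w \<in> W_space R" using w by (simp add: W_plus_reflect)
  note c = W_space_cong[OF wW L2_measurable[OF even_part_L2[OF L]] even_part_sum[OF w v]]
  show "w + v \<in> WV" "St (w + v) = wt w" "Tr (w + v) = wtrace w"
    using L c by (auto simp: WV_def St_def Tr_def)
qed

lemma WV_space_eq: "WV_space R = WV"
proof (intro equalityI subsetI)
  fix x assume "x \<in> WV_space R"
  then show "x \<in> WV" using sum_in_WV by (auto simp: sum_space_def)
next
  fix x assume "x \<in> WV"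
  then have "even_part x \<in> W_plus R" "odd_part x \<in> V_minus R" "x = even_part x + odd_part x"
    by (auto simp: even_part_W_plus even_plus_odd WV_def intro: odd_part_V_minus)
  then show "x \<in> WV_space R" unfolding sum_space_def by blast
qed

lemma W_plus_zero: "0 \<in> W_plus R" and V_minus_zero: "0 \<in> V_minus R"
  using W_zero L2_space_zero[of D] by (auto simp: W_plus_reflect V_minus_reflect)

lemma V_minus_WV: "v \<in> V_minus R \<Longrightarrow> v \<in> WV"
  using sum_in_WV(1)[OF W_plus_zero] by simp

lemma St_V_minus: "v \<in> V_minus R \<Longrightarrow> AE p in D. St v p = 0"
  using sum_in_WV(2)[OF W_plus_zero, of v] wt_zero by simp

lemma Tr_V_minus: "v \<in> V_minus R \<Longrightarrow> AE p in dD. Tr v p = 0"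
  using sum_in_WV(3)[OF W_plus_zero, of v] wtrace_zero_fun by simp

lemma odd_part_V_minus_eq: "v \<in> V_minus R \<Longrightarrow> AE p in D. odd_part v p = v p"
  unfolding V_minus_reflect by (elim conjE, erule eventually_mono) (simp add: odd_part_eq)

lemma WV_L2:
  assumes "x \<in> WV"
  shows "x \<in> L2_space D" "even_part x \<in> L2_space D" "odd_part x \<in> L2_space D"
    "St x \<in> L2_space D" "Tr x \<in> L2_space dD" "even_part x \<in> W_space R"
  using assms W_spaceD[of "even_part x"] by (auto simp: WV_def St_def Tr_def even_part_L2 odd_part_L2)

lemma WV_comb:
  assumes x: "x \<in> WV" and y: "y \<in> WV"
  shows WV_combI: "a *\<^sub>R x + b *\<^sub>R y \<in> WV"
    and St_comb: "AE p in D. St (a *\<^sub>R x + b *\<^sub>R y) p = (a *\<^sub>R St x + b *\<^sub>R St y) p"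
    and Tr_comb: "AE p in dD. Tr (a *\<^sub>R x + b *\<^sub>R y) p = (a *\<^sub>R Tr x + b *\<^sub>R Tr y) p"
proof -
  have e: "even_part x \<in> W_space R" "even_part y \<in> W_space R" using x y by (auto simp: WV_def)
  show "a *\<^sub>R x + b *\<^sub>R y \<in> WV"
    using W_space_comb[OF e, of a b] L2_space_comb[of x D y a b] x y by (auto simp: WV_def even_part_comb)
  show "AE p in D. St (a *\<^sub>R x + b *\<^sub>R y) p = (a *\<^sub>R St x + b *\<^sub>R St y) p"
    unfolding St_def even_part_comb by (rule wt_comb[OF e])
  show "AE p in dD. Tr (a *\<^sub>R x + b *\<^sub>R y) p = (a *\<^sub>R Tr x + b *\<^sub>R Tr y) p"
    unfolding Tr_def even_part_comb by (rule wtrace_comb[OF e])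
qed

lemma subspace_WV: "subspace WV"
proof (rule subspaceI)
  show z: "0 \<in> WV" by (rule V_minus_WV[OF V_minus_zero])
  show "x + y \<in> WV" if "x \<in> WV" "y \<in> WV" for x y using WV_combI[OF that, of 1 1] by simp
  show "c *\<^sub>R x \<in> WV" if "x \<in> WV" for c x
    using WV_combI[OF that that, of c 0] unfolding scaleR_zero_left add_0_right .
qed

lemma inner_St_comb:
  assumes "x \<in> WV" "y \<in> WV" "g \<in> L2_space D"
  shows "L2_inner D (St (a *\<^sub>R x + b *\<^sub>R y)) g = a * L2_inner D (St x) g + b * L2_inner D (St y) g"
proof -
  have "L2_inner D (St (a *\<^sub>R x + b *\<^sub>R y)) g = L2_inner D (a *\<^sub>R St x + b *\<^sub>R St y) g"
    using assms WV_L2(4)[OF WV_combI[OF assms(1,2)]] L2_space_comb[OF WV_L2(4)[OF assms(1)] WV_L2(4)[OF assms(2)]]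
    by (intro L2_inner_cong_AE St_comb AE_I2 L2_measurable) auto
  then show ?thesis using assms by (simp add: L2_inner_comb_left WV_L2)
qed

lemma inner_Tr_comb:
  assumes "x \<in> WV" "y \<in> WV" "g \<in> L2_space dD"
  shows "L2_inner dD (Tr (a *\<^sub>R x + b *\<^sub>R y)) g = a * L2_inner dD (Tr x) g + b * L2_inner dD (Tr y) g"
proof -
  have "L2_inner dD (Tr (a *\<^sub>R x + b *\<^sub>R y)) g = L2_inner dD (a *\<^sub>R Tr x + b *\<^sub>R Tr y) g"
    using assms WV_L2(5)[OF WV_combI[OF assms(1,2)]] L2_space_comb[OF WV_L2(5)[OF assms(1)] WV_L2(5)[OF assms(2)]]
    by (intro L2_inner_cong_AE Tr_comb AE_I2 L2_measurable) auto
  then show ?thesis using assms by (simp add: L2_inner_comb_left WV_L2)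
qed

lemma WV_norm_square:
  "(WV_norm R x)\<^sup>2 = (L2_norm D (even_part x))\<^sup>2 + (L2_norm D (St x))\<^sup>2 + (L2_norm dD (Tr x))\<^sup>2 + (L2_norm D (odd_part x))\<^sup>2"
  by (simp add: WV_norm_def W_norm_eq V_norm_def St_def Tr_def)

lemma WV_norm_nonneg: "0 \<le> WV_norm R x"
  by (simp add: WV_norm_def)

lemma WV_norm_bounds:
  shows "L2_norm D (even_part x) \<le> WV_norm R x" "L2_norm D (St x) \<le> WV_norm R x"
    "L2_norm dD (Tr x) \<le> WV_norm R x" "L2_norm D (odd_part x) \<le> WV_norm R x"
  by (rule power2_le_imp_le[OF _ WV_norm_nonneg]; simp add: WV_norm_square)+

lemma L2_norm_le_WV_norm:
  assumes "x \<in> L2_space D" shows "L2_norm D x \<le> WV_norm R x"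
proof (rule power2_le_imp_le[OF _ WV_norm_nonneg])
  have "(L2_norm D x)\<^sup>2 = (L2_norm D (even_part x))\<^sup>2 + (L2_norm D (odd_part x))\<^sup>2"
    using L2_inner_parts[OF assms assms] by (simp add: L2_norm_power2)
  then show "(L2_norm D x)\<^sup>2 \<le> (WV_norm R x)\<^sup>2" by (simp add: WV_norm_square)
qed

end

section \<open>The collision operator\<close>

locale rte = lipschitz_phase +
  fixes k :: "point \<Rightarrow> real \<Rightarrow> real" and \<sigma>t :: "point \<Rightarrow> real" and kbar a_lo a_up :: real
  assumes coeff: "coefficients R k \<sigma>t" and A1: "assumption_A1 R k kbar" and A2: "assumption_A2 R k \<sigma>t a_lo a_up"
begin

abbreviation "\<sigma> \<equiv> surface_measure S2"
abbreviation "C \<equiv> collision k \<sigma>t"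
abbreviation "B \<equiv> bilinear_B R k \<sigma>t"

definition area :: real where "area = measure \<sigma> S2"

text \<open>A bound of the collision operator. The absolute values make it nonnegative even if one of the
  upper bounds is not.\<close>

definition Mc :: real where "Mc = \<bar>a_up\<bar> + 2 * \<bar>kbar\<bar> * area"

text \<open>Triples of a position and two directions. The interchange \<open>exch\<close> of the directions preserves this
  measure and the scattering kernel \<open>\<kappa>\<close>, which yields the symmetry of the collision operator.\<close>

definition PM :: "(phase \<times> point) measure" where "PM = D \<Otimes>\<^sub>M \<sigma>"

definition \<kappa> :: "phase \<times> point \<Rightarrow> real" where "\<kappa> q = k (fst (fst q)) (snd (fst q) \<bullet> snd q)"

definition exch :: "phase \<times> point \<Rightarrow> phase \<times> point" where
  "exch q = ((fst (fst q), snd q), snd (fst q))"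

lemma area_nonneg: "0 \<le> area" by (simp add: area_def)

lemma Mc_nonneg: "0 \<le> Mc" by (simp add: Mc_def area_nonneg)

lemma a_lo_pos: "0 < a_lo" using A2 by (simp add: assumption_A2_def)

lemma space_PM: "space PM = (R \<times> S2) \<times> S2"
  by (simp add: PM_def space_pair_measure space_D)

sublocale PP: pair_sigma_finite D \<sigma> ..

lemma exch_measurable: "exch \<in> measurable PM PM"
  unfolding exch_def PM_def phase_measure_def by measurable

lemma nn_integral_exch:
  assumes [measurable]: "f \<in> borel_measurable PM"
  shows "(\<integral>\<^sup>+q. f (exch q) \<partial>PM) = (\<integral>\<^sup>+q. f q \<partial>PM)"
proof -
  interpret R: finite_measure "restrict_space lborel R" by (rule finite_R)
  interpret SS: pair_sigma_finite \<sigma> \<sigma> ..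
  have e: "f \<circ> exch \<in> borel_measurable PM" using exch_measurable by measurable
  have split: "(\<integral>\<^sup>+q. g q \<partial>PM) = (\<integral>\<^sup>+r. \<integral>\<^sup>+s. \<integral>\<^sup>+s'. g ((r, s), s') \<partial>\<sigma> \<partial>\<sigma> \<partial>restrict_space lborel R)"
    if [measurable]: "g \<in> borel_measurable PM" for g
  proof -
    have g: "g \<in> borel_measurable (D \<Otimes>\<^sub>M \<sigma>)" using that by (simp add: PM_def)
    have "(\<integral>\<^sup>+q. g q \<partial>PM) = (\<integral>\<^sup>+p. \<integral>\<^sup>+s'. g (p, s') \<partial>\<sigma> \<partial>D)"
      unfolding PM_def using S2.nn_integral_fst[OF g] by simp
    also have "\<dots> = (\<integral>\<^sup>+r. \<integral>\<^sup>+s. \<integral>\<^sup>+s'. g ((r, s), s') \<partial>\<sigma> \<partial>\<sigma> \<partial>restrict_space lborel R)"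
      unfolding phase_measure_def
      by (rule S2.nn_integral_fst[symmetric])
        (use S2.borel_measurable_nn_integral_fst[OF g] in \<open>simp add: phase_measure_def\<close>)
    finally show ?thesis .
  qed
  have "(\<integral>\<^sup>+q. (f \<circ> exch) q \<partial>PM) = (\<integral>\<^sup>+r. \<integral>\<^sup>+s. \<integral>\<^sup>+s'. f ((r, s'), s) \<partial>\<sigma> \<partial>\<sigma> \<partial>restrict_space lborel R)"
    unfolding split[OF e] by (simp add: exch_def)
  also have "\<dots> = (\<integral>\<^sup>+r. \<integral>\<^sup>+s. \<integral>\<^sup>+s'. f ((r, s), s') \<partial>\<sigma> \<partial>\<sigma> \<partial>restrict_space lborel R)"
  proof (rule nn_integral_cong)
    fix r assume r: "r \<in> space (restrict_space lborel R)"
    have "(\<lambda>q. ((r, fst q), snd q)) \<in> measurable (\<sigma> \<Otimes>\<^sub>M \<sigma>) PM"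
      unfolding PM_def phase_measure_def using r by measurable
    from measurable_compose[OF this assms]
    have "(\<lambda>(s, s'). f ((r, s), s')) \<in> borel_measurable (\<sigma> \<Otimes>\<^sub>M \<sigma>)" by (simp add: case_prod_unfold)
    from SS.Fubini'[OF this]
    show "(\<integral>\<^sup>+s. \<integral>\<^sup>+s'. f ((r, s'), s) \<partial>\<sigma> \<partial>\<sigma>) = (\<integral>\<^sup>+s. \<integral>\<^sup>+s'. f ((r, s), s') \<partial>\<sigma> \<partial>\<sigma>)" .
  qed
  also have "\<dots> = (\<integral>\<^sup>+q. f q \<partial>PM)" by (rule split[symmetric]) measurable
  finally show ?thesis by simp
qed

lemma distr_exch: "distr PM PM exch = PM"
proof (rule measure_eqI)
  fix A assume "A \<in> sets (distr PM PM exch)"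
  then have A: "A \<in> sets PM" by simp
  have "emeasure (distr PM PM exch) A = (\<integral>\<^sup>+q. indicator A q \<partial>distr PM PM exch)" using A by simp
  also have "\<dots> = (\<integral>\<^sup>+q. indicator A (exch q) \<partial>PM)"
    using A by (intro nn_integral_distr exch_measurable) auto
  also have "\<dots> = (\<integral>\<^sup>+q. indicator A q \<partial>PM)" using A by (intro nn_integral_exch) auto
  also have "\<dots> = emeasure PM A" using A by simp
  finally show "emeasure (distr PM PM exch) A = emeasure PM A" .
qed simp

lemma integral_exch: "f \<in> borel_measurable PM \<Longrightarrow> (LINT q|PM. f (exch q)) = (LINT q|PM. f q)" for f :: "_ \<Rightarrow> real"
  using integral_distr[OF exch_measurable, of f] by (simp add: distr_exch)

lemma integrable_exch: "integrable PM f \<Longrightarrow> integrable PM (\<lambda>q. f (exch q))" for f :: "_ \<Rightarrow> real"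
  using integrable_distr[OF exch_measurable, of f] by (simp add: distr_exch)

lemma fst_PM: "fst \<in> measurable PM D"
  by (simp add: PM_def)

lemma integrable_fst_PM:
  fixes f :: "phase \<Rightarrow> real"
  assumes "integrable D f"
  shows "integrable PM (\<lambda>q. f (fst q))" "(LINT q|PM. f (fst q)) = area * (LINT p|D. f p)"
proof -
  have m: "f \<in> borel_measurable D" using assms by auto
  have m': "(\<lambda>q. f (fst q)) \<in> borel_measurable (D \<Otimes>\<^sub>M \<sigma>)" using measurable_compose[OF measurable_fst m] .
  have "integrable (D \<Otimes>\<^sub>M \<sigma>) (\<lambda>q. f (fst q))"
  proof (rule PP.Fubini_integrable[OF m'])
    show "integrable D (\<lambda>x. LINT y|\<sigma>. norm (f (fst (x, y))))" using assms by simp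
    show "AE x in D. integrable \<sigma> (\<lambda>y. f (fst (x, y)))" by simp
  qed
  then show i: "integrable PM (\<lambda>q. f (fst q))" by (simp add: PM_def)
  from PP.integral_fst'[OF i[unfolded PM_def]]
  show "(LINT q|PM. f (fst q)) = area * (LINT p|D. f p)" by (simp add: PM_def area_def)
qed

lemma \<kappa>_bounds: "q \<in> space PM \<Longrightarrow> 0 \<le> \<kappa> q \<and> \<kappa> q \<le> \<bar>kbar\<bar>"
  using A1 unfolding assumption_A1_def \<kappa>_def space_PM by (fastforce simp: mem_Times_iff)

lemma \<kappa>_exch: "\<kappa> (exch q) = \<kappa> q"
  by (simp add: \<kappa>_def exch_def inner_commute)

lemma \<kappa>_measurable: "\<kappa> \<in> borel_measurable PM"
proof -
  have k: "(\<lambda>p. k (fst p) (snd p)) \<in> borel_measurable (restrict_space lborel (R \<times> {-1..1}))"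
    using coeff by (simp add: coefficients_def Linfty_space_def case_prod_unfold)
  have "(\<lambda>q. (fst (fst q), snd (fst q) \<bullet> snd q)) \<in> measurable PM (restrict_space lborel (R \<times> {-1..1}))"
  proof (rule measurable_restrict_space2)
    show "(\<lambda>q. (fst (fst q), snd (fst q) \<bullet> snd q)) \<in> space PM \<rightarrow> R \<times> {-1..1}"
    proof (rule funcsetI)
      fix q assume "q \<in> space PM"
      then have n: "norm (snd (fst q)) = 1" "norm (snd q) = 1" "fst (fst q) \<in> R"
        by (auto simp: space_PM)
      have "\<bar>snd (fst q) \<bullet> snd q\<bar> \<le> 1" using Cauchy_Schwarz_ineq2[of "snd (fst q)" "snd q"] n by simp
      then show "(fst (fst q), snd (fst q) \<bullet> snd q) \<in> R \<times> {-1..1}" using n by (auto simp: abs_le_iff)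
    qed
    have s: "(\<lambda>q. snd q) \<in> borel_measurable PM"
      unfolding PM_def using measurable_compose[OF measurable_snd measurable_ident_surface] .
    have p: "(\<lambda>q. fst q) \<in> borel_measurable PM"
      unfolding PM_def using measurable_compose[OF measurable_fst ident_D] .
    have "(\<lambda>q. (fst (fst q), snd (fst q) \<bullet> snd q)) \<in> borel_measurable PM"
      using borel_measurable_continuous_on[OF continuous_on_fst[OF continuous_on_id] p]
        borel_measurable_inner[OF borel_measurable_continuous_on[OF continuous_on_snd[OF continuous_on_id] p] s]
      by (intro borel_measurable_Pair) auto
    then show "(\<lambda>q. (fst (fst q), snd (fst q) \<bullet> snd q)) \<in> measurable PM lborel" by simp
  qed
  from measurable_compose[OF this k] show ?thesis by (simp add: \<kappa>_def[abs_def])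
qed

lemma \<kappa>_integrable_mult:
  assumes "integrable PM f" shows "integrable PM (\<lambda>q. \<kappa> q * f q)"
proof (rule Bochner_Integration.integrable_bound[of _ "\<lambda>q. \<bar>kbar\<bar> * f q"])
  show "AE q in PM. norm (\<kappa> q * f q) \<le> norm (\<bar>kbar\<bar> * f q)"
    using \<kappa>_bounds by (intro AE_I2) (auto simp: abs_mult intro!: mult_right_mono)
qed (use assms \<kappa>_measurable in auto)

definition swapped :: "(phase \<Rightarrow> real) \<Rightarrow> phase \<times> point \<Rightarrow> real" where
  "swapped \<phi> q = \<phi> (fst (exch q))"

lemma swapped_L2:
  assumes "\<phi> \<in> L2_space D"
  shows "(\<lambda>q. \<phi> (fst q)) \<in> L2_space PM" "swapped \<phi> \<in> L2_space PM"
    "(LINT q|PM. (swapped \<phi> q)\<^sup>2) = area * (L2_norm D \<phi>)\<^sup>2"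
proof -
  note i = integrable_fst_PM[OF L2_integrable_square[OF assms]]
  show L: "(\<lambda>q. \<phi> (fst q)) \<in> L2_space PM"
    using i measurable_compose[OF fst_PM L2_measurable[OF assms]] by (simp add: L2_space_def)
  show "swapped \<phi> \<in> L2_space PM"
    unfolding swapped_def
    using integrable_exch[OF i(1)] measurable_compose[OF exch_measurable L2_measurable[OF L]]
    by (simp add: L2_space_def)
  have "(LINT q|PM. (swapped \<phi> q)\<^sup>2) = (LINT q|PM. (\<phi> (fst q))\<^sup>2)"
    unfolding swapped_def by (rule integral_exch[where f="\<lambda>q. (\<phi> (fst q))\<^sup>2"]) (use i in auto)
  then show "(LINT q|PM. (swapped \<phi> q)\<^sup>2) = area * (L2_norm D \<phi>)\<^sup>2"
    using i(2) by (simp add: L2_norm_square_integral)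
qed

definition scatter :: "(phase \<Rightarrow> real) \<Rightarrow> phase \<Rightarrow> real" where
  "scatter \<phi> p = (LINT s'|\<sigma>. \<kappa> (p, s') * swapped \<phi> (p, s'))"

lemma C_eq: "C \<phi> p = \<sigma>t (fst p) * \<phi> p - scatter \<phi> p"
  by (cases p) (simp add: collision_def scatter_def \<kappa>_def swapped_def exch_def)

text \<open>Cauchy-Schwarz in the second direction, then integration over the first one.\<close>

lemma scatter_L2:
  assumes \<phi>: "\<phi> \<in> L2_space D"
  shows "scatter \<phi> \<in> L2_space D" "L2_norm D (scatter \<phi>) \<le> \<bar>kbar\<bar> * area * L2_norm D \<phi>"
proof -
  note sw = swapped_L2[OF \<phi>]
  have m: "(\<lambda>q. \<kappa> q * swapped \<phi> q) \<in> borel_measurable (D \<Otimes>\<^sub>M \<sigma>)"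
    using \<kappa>_measurable L2_measurable[OF sw(2)] unfolding PM_def[symmetric] by simp
  have sm: "scatter \<phi> \<in> borel_measurable D"
    unfolding scatter_def by (rule S2.borel_measurable_lebesgue_integral) (use m in \<open>simp add: case_prod_unfold\<close>)
  have sq: "integrable (D \<Otimes>\<^sub>M \<sigma>) (\<lambda>q. (swapped \<phi> q)\<^sup>2)"
    using L2_integrable_square[OF sw(2)] by (simp add: PM_def)
  define h where "h p = (LINT s'|\<sigma>. (swapped \<phi> (p, s'))\<^sup>2)" for p
  have hi: "integrable D h" unfolding h_def by (rule PP.integrable_fst'[OF sq])
  have h: "(LINT p|D. h p) = area * (L2_norm D \<phi>)\<^sup>2"
    unfolding h_def using PP.integral_fst'[OF sq] sw(3) by (simp add: PM_def)
  have b: "AE p in D. (scatter \<phi> p)\<^sup>2 \<le> (\<bar>kbar\<bar>\<^sup>2 * area) * h p"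
    using PP.AE_integrable_fst'[OF sq]
  proof (rule AE_mp, intro AE_I2 impI)
    fix p assume p: "p \<in> space D" and i: "integrable \<sigma> (\<lambda>y. (swapped \<phi> (p, y))\<^sup>2)"
    have pr: "Pair p \<in> measurable \<sigma> PM" unfolding PM_def using p by simp
    have f: "(\<lambda>s'. swapped \<phi> (p, s')) \<in> L2_space \<sigma>"
      using i measurable_compose[OF pr L2_measurable[OF sw(2)]] by (simp add: L2_space_def)
    have kb: "\<bar>\<kappa> (p, s')\<bar> \<le> \<bar>kbar\<bar>" if "s' \<in> space \<sigma>" for s'
      using \<kappa>_bounds[of "(p, s')"] p that by (auto simp: space_PM space_D)
    have g: "(\<lambda>s'. \<kappa> (p, s')) \<in> L2_space \<sigma>"
      by (rule L2_space_bounded[OF S2.finite_measure_axioms measurable_compose[OF pr \<kappa>_measurable] kb])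
    have n: "(L2_norm \<sigma> (\<lambda>s'. \<kappa> (p, s')))\<^sup>2 \<le> \<bar>kbar\<bar>\<^sup>2 * area"
    proof -
      have "(LINT s'|\<sigma>. (\<kappa> (p, s'))\<^sup>2) \<le> (LINT s'|\<sigma>. \<bar>kbar\<bar>\<^sup>2)"
      proof (rule integral_mono)
        fix s' assume "s' \<in> space \<sigma>"
        then show "(\<kappa> (p, s'))\<^sup>2 \<le> \<bar>kbar\<bar>\<^sup>2" using kb by (metis abs_ge_zero power2_abs power_mono)
      qed (use L2_integrable_square[OF g] in auto)
      then show ?thesis unfolding L2_norm_square_integral by (simp add: area_def mult.commute)
    qed
    have "\<bar>scatter \<phi> p\<bar> \<le> L2_norm \<sigma> (\<lambda>s'. \<kappa> (p, s')) * L2_norm \<sigma> (\<lambda>s'. swapped \<phi> (p, s'))"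
      using L2_Cauchy_Schwarz[OF g f] by (simp add: scatter_def L2_inner_def)
    then have "(scatter \<phi> p)\<^sup>2 \<le> (L2_norm \<sigma> (\<lambda>s'. \<kappa> (p, s')))\<^sup>2 * (L2_norm \<sigma> (\<lambda>s'. swapped \<phi> (p, s')))\<^sup>2"
      by (rule square_le_mult)
    also have "\<dots> \<le> (\<bar>kbar\<bar>\<^sup>2 * area) * (L2_norm \<sigma> (\<lambda>s'. swapped \<phi> (p, s')))\<^sup>2"
      using n by (rule mult_right_mono) simp
    also have "(L2_norm \<sigma> (\<lambda>s'. swapped \<phi> (p, s')))\<^sup>2 = h p"
      by (simp add: L2_norm_square_integral h_def)
    finally show "(scatter \<phi> p)\<^sup>2 \<le> (\<bar>kbar\<bar>\<^sup>2 * area) * h p" .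
  qed
  have si: "integrable D (\<lambda>p. (scatter \<phi> p)\<^sup>2)"
  proof (rule Bochner_Integration.integrable_bound)
    show "integrable D (\<lambda>p. (\<bar>kbar\<bar>\<^sup>2 * area) * h p)" using hi by simp
    show "AE p in D. norm ((scatter \<phi> p)\<^sup>2) \<le> norm ((\<bar>kbar\<bar>\<^sup>2 * area) * h p)"
      using b by eventually_elim simp
  qed (use sm in auto)
  then show "scatter \<phi> \<in> L2_space D" using sm by (simp add: L2_space_def)
  have "(L2_norm D (scatter \<phi>))\<^sup>2 \<le> (LINT p|D. (\<bar>kbar\<bar>\<^sup>2 * area) * h p)"
    using integral_mono_AE[OF si _ b] hi by (simp add: L2_norm_def)
  also have "\<dots> = (\<bar>kbar\<bar> * area * L2_norm D \<phi>)\<^sup>2"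
    by (simp add: h power2_eq_square)
  finally show "L2_norm D (scatter \<phi>) \<le> \<bar>kbar\<bar> * area * L2_norm D \<phi>"
    by (rule power2_le_imp_le) (simp add: area_nonneg L2_norm_nonneg)
qed

lemma inner_scatter:
  assumes \<phi>: "\<phi> \<in> L2_space D" and \<psi>: "\<psi> \<in> L2_space D"
  shows "integrable PM (\<lambda>q. \<kappa> q * (swapped \<phi> q * \<psi> (fst q)))"
    "L2_inner D (scatter \<phi>) \<psi> = (LINT q|PM. \<kappa> q * (swapped \<phi> q * \<psi> (fst q)))"
proof -
  show i: "integrable PM (\<lambda>q. \<kappa> q * (swapped \<phi> q * \<psi> (fst q)))"
    by (intro \<kappa>_integrable_mult L2_integrable_mult swapped_L2 \<phi> \<psi>)
  have "L2_inner D (scatter \<phi>) \<psi> = (LINT p|D. LINT s'|\<sigma>. \<kappa> (p, s') * (swapped \<phi> (p, s') * \<psi> (fst (p, s'))))"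
    unfolding L2_inner_def scatter_def by (simp flip: mult.assoc)
  also have "\<dots> = (LINT q|PM. \<kappa> q * (swapped \<phi> q * \<psi> (fst q)))"
    using PP.integral_fst'[OF i[unfolded PM_def]] by (simp add: PM_def)
  finally show "L2_inner D (scatter \<phi>) \<psi> = (LINT q|PM. \<kappa> q * (swapped \<phi> q * \<psi> (fst q)))" .
qed

lemma scatter_symmetric:
  assumes \<phi>: "\<phi> \<in> L2_space D" and \<psi>: "\<psi> \<in> L2_space D"
  shows "L2_inner D (scatter \<phi>) \<psi> = L2_inner D (scatter \<psi>) \<phi>"
proof -
  note i = inner_scatter[OF \<phi> \<psi>]
  have "(LINT q|PM. \<kappa> q * (swapped \<phi> q * \<psi> (fst q))) = (LINT q|PM. \<kappa> (exch q) * (swapped \<phi> (exch q) * \<psi> (fst (exch q))))"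
    using i(1) by (intro integral_exch[symmetric]) auto
  also have "\<dots> = (LINT q|PM. \<kappa> q * (swapped \<psi> q * \<phi> (fst q)))"
    by (simp add: \<kappa>_exch) (simp add: swapped_def exch_def mult.commute)
  finally show ?thesis using i(2) inner_scatter(2)[OF \<psi> \<phi>] by simp
qed

lemma sigma_s_eq: "sigma_s k (fst p) (snd p) = (LINT s'|\<sigma>. \<kappa> (p, s'))"
  by (simp add: sigma_s_def \<kappa>_def inner_commute)

lemma sigma_s_bounds:
  assumes "p \<in> space D" shows "0 \<le> sigma_s k (fst p) (snd p)" "sigma_s k (fst p) (snd p) \<le> \<bar>kbar\<bar> * area"
proof -
  have kb: "0 \<le> \<kappa> (p, s') \<and> \<kappa> (p, s') \<le> \<bar>kbar\<bar>" if "s' \<in> space \<sigma>" for s'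
    using \<kappa>_bounds[of "(p, s')"] assms that by (auto simp: space_PM space_D)
  have pr: "Pair p \<in> measurable \<sigma> PM" unfolding PM_def using assms by simp
  have i: "integrable \<sigma> (\<lambda>s'. \<kappa> (p, s'))"
    by (rule S2.integrable_const_bound[where B="\<bar>kbar\<bar>"])
      (use kb measurable_compose[OF pr \<kappa>_measurable] in auto)
  show "0 \<le> sigma_s k (fst p) (snd p)"
    unfolding sigma_s_eq by (rule integral_nonneg_AE) (use kb in auto)
  have "(LINT s'|\<sigma>. \<kappa> (p, s')) \<le> (LINT s'|\<sigma>. \<bar>kbar\<bar>)"
    by (rule integral_mono[OF i]) (use kb in auto)
  then show "sigma_s k (fst p) (snd p) \<le> \<bar>kbar\<bar> * area"
    unfolding sigma_s_eq by (simp add: area_def mult.commute)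
qed

lemma \<sigma>t_bounds:
  assumes "p \<in> space D"
  shows "\<bar>\<sigma>t (fst p)\<bar> \<le> \<bar>a_up\<bar> + \<bar>kbar\<bar> * area" "a_lo + sigma_s k (fst p) (snd p) \<le> \<sigma>t (fst p)"
proof -
  have "fst p \<in> R" "snd p \<in> S2" using assms by (auto simp: space_D)
  then have "a_lo \<le> sigma_a k \<sigma>t (fst p) (snd p)" "sigma_a k \<sigma>t (fst p) (snd p) \<le> a_up"
    using A2 by (auto simp: assumption_A2_def)
  then show "\<bar>\<sigma>t (fst p)\<bar> \<le> \<bar>a_up\<bar> + \<bar>kbar\<bar> * area" "a_lo + sigma_s k (fst p) (snd p) \<le> \<sigma>t (fst p)"
    using sigma_s_bounds[OF assms] a_lo_pos by (auto simp: sigma_a_def)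
qed

lemma \<sigma>t_L2:
  assumes \<phi>: "\<phi> \<in> L2_space D"
  shows "(\<lambda>p. \<sigma>t (fst p) * \<phi> p) \<in> L2_space D"
    "L2_norm D (\<lambda>p. \<sigma>t (fst p) * \<phi> p) \<le> (\<bar>a_up\<bar> + \<bar>kbar\<bar> * area) * L2_norm D \<phi>"
proof -
  define c where "c = \<bar>a_up\<bar> + \<bar>kbar\<bar> * area"
  have c0: "0 \<le> c" by (simp add: c_def area_nonneg)
  have "\<sigma>t \<in> borel_measurable (restrict_space lborel R)"
    using coeff by (simp add: coefficients_def Linfty_space_def)
  then have "(\<lambda>p. \<sigma>t (fst p)) \<in> borel_measurable D"
    unfolding phase_measure_def using measurable_compose[OF measurable_fst] by blast
  then have m: "(\<lambda>p. \<sigma>t (fst p) * \<phi> p) \<in> borel_measurable D" using L2_measurable[OF \<phi>] by simp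
  have b: "(\<sigma>t (fst p) * \<phi> p)\<^sup>2 \<le> c\<^sup>2 * (\<phi> p)\<^sup>2" if "p \<in> space D" for p
  proof -
    have "(\<sigma>t (fst p))\<^sup>2 \<le> c\<^sup>2" using \<sigma>t_bounds(1)[OF that] unfolding c_def[symmetric]
      by (metis abs_ge_zero power2_abs power_mono)
    then show ?thesis unfolding power_mult_distrib by (rule mult_right_mono) simp
  qed
  have i: "integrable D (\<lambda>p. (\<sigma>t (fst p) * \<phi> p)\<^sup>2)"
  proof (rule Bochner_Integration.integrable_bound)
    show "integrable D (\<lambda>p. c\<^sup>2 * (\<phi> p)\<^sup>2)" using L2_integrable_square[OF \<phi>] by simp
    show "AE p in D. norm ((\<sigma>t (fst p) * \<phi> p)\<^sup>2) \<le> norm (c\<^sup>2 * (\<phi> p)\<^sup>2)"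
      using b by (intro AE_I2) simp
  qed (use m in auto)
  then show "(\<lambda>p. \<sigma>t (fst p) * \<phi> p) \<in> L2_space D" using m by (simp add: L2_space_def)
  have "(L2_norm D (\<lambda>p. \<sigma>t (fst p) * \<phi> p))\<^sup>2 \<le> (LINT p|D. c\<^sup>2 * (\<phi> p)\<^sup>2)"
    using integral_mono[OF i _ b] L2_integrable_square[OF \<phi>] by (simp add: L2_norm_def)
  also have "\<dots> = (c * L2_norm D \<phi>)\<^sup>2" by (simp add: L2_norm_def power_mult_distrib)
  finally show "L2_norm D (\<lambda>p. \<sigma>t (fst p) * \<phi> p) \<le> (\<bar>a_up\<bar> + \<bar>kbar\<bar> * area) * L2_norm D \<phi>"
    unfolding c_def[symmetric] by (rule power2_le_imp_le) (simp add: c0 L2_norm_nonneg)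
qed

lemma C_alt: "C \<phi> = (\<lambda>p. \<sigma>t (fst p) * \<phi> p) - scatter \<phi>"
  by (auto simp: C_eq)

lemma C_L2: "\<phi> \<in> L2_space D \<Longrightarrow> C \<phi> \<in> L2_space D"
  unfolding C_alt by (intro L2_space_diff \<sigma>t_L2 scatter_L2)

lemma C_bounded:
  assumes "\<phi> \<in> L2_space D" shows "L2_norm D (C \<phi>) \<le> Mc * L2_norm D \<phi>"
proof -
  have "L2_norm D (C \<phi>) \<le> L2_norm D (\<lambda>p. \<sigma>t (fst p) * \<phi> p) + L2_norm D (scatter \<phi>)"
    unfolding C_alt using assms by (intro L2_norm_triangle_minus \<sigma>t_L2 scatter_L2)
  then show ?thesis using \<sigma>t_L2(2)[OF assms] scatter_L2(2)[OF assms] by (simp add: Mc_def algebra_simps)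
qed

lemma inner_C: "\<phi> \<in> L2_space D \<Longrightarrow> \<psi> \<in> L2_space D \<Longrightarrow>
    L2_inner D (C \<phi>) \<psi> = L2_inner D (\<lambda>p. \<sigma>t (fst p) * \<phi> p) \<psi> - L2_inner D (scatter \<phi>) \<psi>"
  unfolding C_alt by (intro L2_inner_diff_left \<sigma>t_L2 scatter_L2)

lemma C_symmetric:
  assumes "\<phi> \<in> L2_space D" "\<psi> \<in> L2_space D"
  shows "L2_inner D (C \<phi>) \<psi> = L2_inner D (C \<psi>) \<phi>"
proof -
  have "L2_inner D (\<lambda>p. \<sigma>t (fst p) * \<phi> p) \<psi> = L2_inner D (\<lambda>p. \<sigma>t (fst p) * \<psi> p) \<phi>"
    by (simp add: L2_inner_def mult_ac)
  then show ?thesis using inner_C[OF assms] inner_C[OF assms(2,1)] scatter_symmetric[OF assms] by simp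
qed

text \<open>By symmetry of the kernel and $2xy\le x^2+y^2$, the scattering term is at most
  $\int\sigma_s\phi^2$, which leaves $\int\sigma_a\phi^2$.\<close>

lemma C_coercive:
  assumes \<phi>: "\<phi> \<in> L2_space D"
  shows "a_lo * (L2_norm D \<phi>)\<^sup>2 \<le> L2_inner D (C \<phi>) \<phi>"
proof -
  note sw = swapped_L2[OF \<phi>]
  have i1: "integrable PM (\<lambda>q. \<kappa> q * (\<phi> (fst q))\<^sup>2)" by (intro \<kappa>_integrable_mult L2_integrable_square sw)
  have i2: "integrable PM (\<lambda>q. \<kappa> q * (swapped \<phi> q)\<^sup>2)" by (intro \<kappa>_integrable_mult L2_integrable_square sw)
  have e: "(LINT q|PM. \<kappa> q * (swapped \<phi> q)\<^sup>2) = (LINT q|PM. \<kappa> q * (\<phi> (fst q))\<^sup>2)"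
    using integral_exch[of "\<lambda>q. \<kappa> q * (\<phi> (fst q))\<^sup>2"] i1 by (simp add: \<kappa>_exch swapped_def)
  have "2 * L2_inner D (scatter \<phi>) \<phi> = (LINT q|PM. 2 * (\<kappa> q * (swapped \<phi> q * \<phi> (fst q))))"
    using inner_scatter(2)[OF \<phi> \<phi>] by simp
  also have "\<dots> \<le> (LINT q|PM. \<kappa> q * (swapped \<phi> q)\<^sup>2 + \<kappa> q * (\<phi> (fst q))\<^sup>2)"
  proof (rule integral_mono)
    fix q assume "q \<in> space PM"
    then have "0 \<le> \<kappa> q * (swapped \<phi> q - \<phi> (fst q))\<^sup>2" using \<kappa>_bounds by simp
    then show "2 * (\<kappa> q * (swapped \<phi> q * \<phi> (fst q))) \<le> \<kappa> q * (swapped \<phi> q)\<^sup>2 + \<kappa> q * (\<phi> (fst q))\<^sup>2"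
      by (simp add: power2_eq_square algebra_simps)
  qed (use inner_scatter(1)[OF \<phi> \<phi>] i1 i2 in auto)
  also have "\<dots> = 2 * (LINT q|PM. \<kappa> q * (\<phi> (fst q))\<^sup>2)" using i1 i2 e by simp
  also have "(LINT q|PM. \<kappa> q * (\<phi> (fst q))\<^sup>2) = (LINT p|D. sigma_s k (fst p) (snd p) * (\<phi> p)\<^sup>2)"
    using PP.integral_fst'[OF i1[unfolded PM_def]] by (simp add: PM_def sigma_s_eq)
  finally have s: "L2_inner D (scatter \<phi>) \<phi> \<le> (LINT p|D. sigma_s k (fst p) (snd p) * (\<phi> p)\<^sup>2)" by simp
  have si: "integrable D (\<lambda>p. sigma_s k (fst p) (snd p) * (\<phi> p)\<^sup>2)"
    using PP.integrable_fst'[OF i1[unfolded PM_def]] by (simp add: sigma_s_eq)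
  have ti: "integrable D (\<lambda>p. (\<sigma>t (fst p) * \<phi> p) * \<phi> p)" by (intro L2_integrable_mult \<sigma>t_L2 \<phi>)
  have "a_lo * (L2_norm D \<phi>)\<^sup>2 = (LINT p|D. a_lo * (\<phi> p)\<^sup>2)"
    by (simp add: L2_norm_def)
  also have "\<dots> \<le> (LINT p|D. (\<sigma>t (fst p) * \<phi> p) * \<phi> p - sigma_s k (fst p) (snd p) * (\<phi> p)\<^sup>2)"
  proof (rule integral_mono)
    fix p assume "p \<in> space D"
    then have "a_lo * (\<phi> p)\<^sup>2 \<le> (\<sigma>t (fst p) - sigma_s k (fst p) (snd p)) * (\<phi> p)\<^sup>2"
      using \<sigma>t_bounds(2) by (intro mult_right_mono) (auto simp: algebra_simps)
    then show "a_lo * (\<phi> p)\<^sup>2 \<le> (\<sigma>t (fst p) * \<phi> p) * \<phi> p - sigma_s k (fst p) (snd p) * (\<phi> p)\<^sup>2"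
      by (simp add: power2_eq_square algebra_simps)
  qed (use L2_integrable_square[OF \<phi>] si ti in auto)
  also have "\<dots> \<le> L2_inner D (C \<phi>) \<phi>"
    using s ti si by (simp add: inner_C[OF \<phi> \<phi>] L2_inner_def[of D "\<lambda>p. \<sigma>t (fst p) * \<phi> p"])
  finally show ?thesis .
qed

text \<open>The kernel depends on $s\cdot s'$ only, so scattering commutes with the reflection of directions.\<close>

lemma C_reflect:
  assumes \<phi>: "\<phi> \<in> L2_space D" and inv: "\<And>p. \<phi> (reflect p) = c * \<phi> p" and p: "p \<in> space D"
  shows "C \<phi> (reflect p) = c * C \<phi> p"
proof -
  have rp: "reflect p \<in> space D" using p by (auto simp: space_D reflect_def)
  have pr: "Pair (reflect p) \<in> measurable \<sigma> PM" unfolding PM_def using rp by simp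
  define f where "f s' = \<kappa> (reflect p, s') * swapped \<phi> (reflect p, s')" for s'
  have fm: "f \<in> borel_measurable \<sigma>"
    unfolding f_def using measurable_compose[OF pr L2_measurable[OF swapped_L2(2)[OF \<phi>]]]
      measurable_compose[OF pr \<kappa>_measurable] by simp
  have "scatter \<phi> (reflect p) = (LINT s'|distr \<sigma> \<sigma> uminus. f s')"
    by (simp add: scatter_def f_def sphere_uminus)
  also have "\<dots> = (LINT s'|\<sigma>. f (- s'))" by (rule integral_distr[OF uminus_sphere_measurable fm])
  also have "\<dots> = (LINT s'|\<sigma>. c * (\<kappa> (p, s') * swapped \<phi> (p, s')))"
  proof (rule Bochner_Integration.integral_cong[OF refl])
    fix s'
    obtain r s where "p = (r, s)" by (cases p)
    then show "f (- s') = c * (\<kappa> (p, s') * swapped \<phi> (p, s'))"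
      using inv[of "(r, s')"] by (simp add: f_def \<kappa>_def swapped_def exch_def reflect_def)
  qed
  also have "\<dots> = c * scatter \<phi> p" by (simp add: scatter_def)
  finally show ?thesis using inv[of p] by (simp add: C_eq reflect_def case_prod_unfold algebra_simps)
qed

lemma C_even_odd:
  assumes "f \<in> L2_space D" "g \<in> L2_space D"
  shows "L2_inner D (C (even_part f)) (odd_part g) = 0"
  using assms C_reflect[OF even_part_L2, of f 1]
  by (intro L2_inner_symmetric_antisymmetric C_L2 even_part_L2 odd_part_L2)
    (auto simp: even_part_reflect odd_part_reflect)

lemma C_comb_left:
  assumes "f \<in> L2_space D" "g \<in> L2_space D" "h \<in> L2_space D"
  shows "L2_inner D (C (a *\<^sub>R f + b *\<^sub>R g)) h = a * L2_inner D (C f) h + b * L2_inner D (C g) h"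
proof -
  have "L2_inner D (C (a *\<^sub>R f + b *\<^sub>R g)) h = L2_inner D (a *\<^sub>R f + b *\<^sub>R g) (C h)"
    using C_symmetric[OF L2_space_comb[OF assms(1,2)] assms(3)] by (simp add: L2_inner_commute)
  also have "\<dots> = a * L2_inner D (C h) f + b * L2_inner D (C h) g"
    using L2_inner_comb_left[OF assms(1,2) C_L2[OF assms(3)]] by (simp add: L2_inner_commute[of D "C h"])
  finally show ?thesis using C_symmetric[of h] assms by simp
qed

lemma C_parts:
  assumes f: "f \<in> L2_space D" and g: "g \<in> L2_space D"
  shows "L2_inner D (C f) g = L2_inner D (C (even_part f)) (even_part g) + L2_inner D (C (odd_part f)) (odd_part g)"
proof -
  note L = even_part_L2[OF f] odd_part_L2[OF f] even_part_L2[OF g] odd_part_L2[OF g]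
  have "L2_inner D (C f) h = L2_inner D (C (even_part f)) h + L2_inner D (C (odd_part f)) h" if "h \<in> L2_space D" for h
    using C_comb_left[OF L(1,2) that, of 1 1] by (simp add: even_plus_odd)
  moreover have "L2_inner D (C f) g = L2_inner D (C f) (even_part g) + L2_inner D (C f) (odd_part g)"
    using L2_inner_add_right[OF C_L2[OF f] L(3,4)] by (simp add: even_plus_odd)
  moreover have "L2_inner D (C (even_part f)) (odd_part g) = 0" by (rule C_even_odd[OF f g])
  moreover have "L2_inner D (C (odd_part f)) (even_part g) = 0"
    using C_symmetric[OF L(2,3)] C_even_odd[OF g f] by simp
  ultimately show ?thesis using L by simp
qed

section \<open>The bilinear form\<close>

lemma B_eq: "B x y = L2_inner dD (Tr x) (Tr y) + L2_inner D (C x) y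
    - L2_inner D (odd_part x) (St y) + L2_inner D (St x) (odd_part y)"
  by (simp add: bilinear_B_def boundary_form_eq St_def Tr_def)

lemma B_comb_left:
  assumes "x \<in> WV" "y \<in> WV" "z \<in> WV"
  shows "B (a *\<^sub>R x + b *\<^sub>R y) z = a * B x z + b * B y z"
  unfolding B_eq odd_part_comb
  using assms by (simp add: inner_St_comb inner_Tr_comb C_comb_left L2_inner_comb_left WV_L2 algebra_simps)

lemma B_comb_right:
  assumes "x \<in> WV" "y \<in> WV" "z \<in> WV"
  shows "B z (a *\<^sub>R x + b *\<^sub>R y) = a * B z x + b * B z y"
proof -
  have 1: "L2_inner dD (Tr z) (Tr (a *\<^sub>R x + b *\<^sub>R y)) = a * L2_inner dD (Tr z) (Tr x) + b * L2_inner dD (Tr z) (Tr y)"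
    using inner_Tr_comb[OF assms(1,2) WV_L2(5)[OF assms(3)]] by (simp add: L2_inner_commute)
  have 2: "L2_inner D (C z) (a *\<^sub>R x + b *\<^sub>R y) = a * L2_inner D (C z) x + b * L2_inner D (C z) y"
    using L2_inner_comb_left[of x D y "C z" a b] assms by (simp add: L2_inner_commute WV_L2 C_L2)
  have 3: "L2_inner D (odd_part z) (St (a *\<^sub>R x + b *\<^sub>R y)) = a * L2_inner D (odd_part z) (St x) + b * L2_inner D (odd_part z) (St y)"
    using inner_St_comb[OF assms(1,2) WV_L2(3)[OF assms(3)]] by (simp add: L2_inner_commute)
  have 4: "L2_inner D (St z) (odd_part (a *\<^sub>R x + b *\<^sub>R y)) = a * L2_inner D (St z) (odd_part x) + b * L2_inner D (St z) (odd_part y)"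
    unfolding odd_part_comb using L2_inner_comb_left[of "odd_part x" D "odd_part y" "St z" a b] assms
    by (simp add: L2_inner_commute WV_L2)
  show ?thesis unfolding B_eq 1 2 3 4 by (simp add: algebra_simps)
qed

lemma B_bounded:
  assumes x: "x \<in> WV" and y: "y \<in> WV"
  shows "\<bar>B x y\<bar> \<le> (3 + Mc) * WV_norm R x * WV_norm R y"
proof -
  note X = WV_L2[OF x] and Y = WV_L2[OF y]
  let ?n = "WV_norm R x * WV_norm R y"
  have m: "\<bar>L2_inner M f g\<bar> \<le> ?n" if "f \<in> L2_space M" "g \<in> L2_space M" "L2_norm M f \<le> WV_norm R x" "L2_norm M g \<le> WV_norm R y"
    for f g :: "phase \<Rightarrow> real" and M
    using L2_Cauchy_Schwarz[OF that(1,2)] mult_mono[OF that(3,4) WV_norm_nonneg L2_norm_nonneg] by linarith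
  have 1: "\<bar>L2_inner dD (Tr x) (Tr y)\<bar> \<le> ?n" by (intro m X Y WV_norm_bounds)
  have 3: "\<bar>L2_inner D (odd_part x) (St y)\<bar> \<le> ?n" by (intro m X Y WV_norm_bounds)
  have 4: "\<bar>L2_inner D (St x) (odd_part y)\<bar> \<le> ?n" by (intro m X Y WV_norm_bounds)
  have "\<bar>L2_inner D (C x) y\<bar> \<le> L2_norm D (C x) * L2_norm D y" by (intro L2_Cauchy_Schwarz C_L2 X Y)
  also have "\<dots> \<le> (Mc * WV_norm R x) * WV_norm R y"
    using C_bounded[OF X(1)] L2_norm_le_WV_norm[OF X(1)] L2_norm_le_WV_norm[OF Y(1)] Mc_nonneg
    by (intro mult_mono order_trans[OF C_bounded[OF X(1)]] mult_left_mono) (auto simp: L2_norm_nonneg WV_norm_nonneg)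
  finally have 2: "\<bar>L2_inner D (C x) y\<bar> \<le> Mc * ?n" by (simp add: mult_ac)
  have "\<bar>B x y\<bar> \<le> 3 * ?n + Mc * ?n" unfolding B_eq using 1 2 3 4 by linarith
  then show ?thesis by (simp add: algebra_simps)
qed

text \<open>The two streaming terms cancel.\<close>

lemma B_diagonal:
  assumes "x \<in> WV" shows "a_lo * (L2_norm D x)\<^sup>2 + (L2_norm dD (Tr x))\<^sup>2 \<le> B x x"
  using C_coercive[OF WV_L2(1)[OF assms]] L2_inner_commute[of D "odd_part x" "St x"]
  by (simp add: B_eq L2_norm_power2)

end

section \<open>Finite dimensional spaces\<close>

lemma linear_on_sum:
  fixes L :: "'a::real_vector \<Rightarrow> real"
  assumes V: "subspace V" and L: "\<And>x y a b. x \<in> V \<Longrightarrow> y \<in> V \<Longrightarrow> L (a *\<^sub>R x + b *\<^sub>R y) = a * L x + b * L y"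
    and I: "finite I" "\<And>i. i \<in> I \<Longrightarrow> f i \<in> V"
  shows "L (\<Sum>i\<in>I. c i *\<^sub>R f i) = (\<Sum>i\<in>I. c i * L (f i))"
  using I
proof (induction I rule: finite_induct)
  case empty
  have "0 \<in> V" using V by (rule subspace_0)
  from L[OF this this, of 0 0] show ?case by simp
next
  case (insert i I)
  have "(\<Sum>j\<in>I. c j *\<^sub>R f j) \<in> V" using V insert.prems by (intro subspace_sum subspace_scale) auto
  then show ?case
    using L[of "f i" "\<Sum>j\<in>I. c j *\<^sub>R f j" "c i" 1] insert by simp
qed

lemma finite_dim_subspace_span:
  assumes "finite_dim_subspace A"
  obtains S where "finite S" "span S = A"
proof -
  obtain T where T: "subspace A" "finite T" "A \<subseteq> span T"
    using assms unfolding finite_dim_subspace_def by blast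
  obtain S where S: "S \<subseteq> A" "independent S" "A \<subseteq> span S"
    using maximal_independent_subset by blast
  have "finite S" using independent_span_bound[OF T(2) S(2)] S(1) T(3) by blast
  moreover have "span S = A" using S T span_subspace by blast
  ultimately show ?thesis using that by blast
qed

text \<open>On finite dimensional spaces only nondegeneracy matters, namely that elements with \<open>b x x = 0\<close>
  are negligible for the form and for the functional. The proof is by induction on the number of
  generators: a new generator is first made orthogonal, with respect to the form, to the span of the
  previous ones.\<close>

lemma lax_milgram_finite_dim:
  fixes b :: "'a::real_vector \<Rightarrow> 'a \<Rightarrow> real" and l :: "'a \<Rightarrow> real"
  assumes V: "subspace V"
    and b1: "\<And>x y z a c. x \<in> V \<Longrightarrow> y \<in> V \<Longrightarrow> z \<in> V \<Longrightarrow> b (a *\<^sub>R x + c *\<^sub>R y) z = a * b x z + c * b y z"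
    and b2: "\<And>x y z a c. x \<in> V \<Longrightarrow> y \<in> V \<Longrightarrow> z \<in> V \<Longrightarrow> b z (a *\<^sub>R x + c *\<^sub>R y) = a * b z x + c * b z y"
    and nd: "\<And>x y. x \<in> V \<Longrightarrow> y \<in> V \<Longrightarrow> b x x = 0 \<Longrightarrow> b y x = 0"
    and S: "finite S" "S \<subseteq> V"
    and l: "\<And>x y a c. x \<in> V \<Longrightarrow> y \<in> V \<Longrightarrow> l (a *\<^sub>R x + c *\<^sub>R y) = a * l x + c * l y"
    and l0: "\<And>x. x \<in> V \<Longrightarrow> b x x = 0 \<Longrightarrow> l x = 0"
  shows "\<exists>p\<in>span S. \<forall>y\<in>span S. b p y = l y"
  using S l l0
proof (induction S arbitrary: l rule: finite_induct)
  case empty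
  have 0: "0 \<in> V" using V by (rule subspace_0)
  have "b 0 0 = 0" using b1[OF 0 0 0, of 0 0] by simp
  moreover have "l 0 = 0" using empty.prems(2)[OF 0 0, of 0 0] by simp
  ultimately show ?case by simp
next
  case (insert e S)
  have e: "e \<in> V" and SV: "S \<subseteq> V" using insert.prems by auto
  have spV: "span S \<subseteq> V" using SV V by (rule span_minimal)
  have "\<exists>p\<in>span S. \<forall>y\<in>span S. b p y = b e y"
    by (rule insert.IH[OF SV]) (use e b2 nd in auto)
  then obtain u where u: "u \<in> span S" "\<And>y. y \<in> span S \<Longrightarrow> b u y = b e y" by blast
  obtain p where p: "p \<in> span S" "\<And>y. y \<in> span S \<Longrightarrow> b p y = l y"
    using insert.IH[OF SV insert.prems(2,3)] by blast
  define e' where "e' = e - u"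
  have uV: "u \<in> V" and pV: "p \<in> V" using u p spV by auto
  have e'V: "e' \<in> V" unfolding e'_def using V e uV by (rule subspace_diff)
  have e'0: "b e' y = 0" if "y \<in> span S" for y
    using b1[of e u y 1 "-1"] u(2)[OF that] e uV that spV by (auto simp: e'_def)
  define c where "c = (l e' - b p e') / b e' e'"
  have c: "c * b e' e' = l e' - b p e'"
  proof (cases "b e' e' = 0")
    case True
    then show ?thesis using nd[OF e'V pV True] insert.prems(3)[OF e'V True] by simp
  qed (simp add: c_def)
  define p' where "p' = p + c *\<^sub>R e'"
  have "p' \<in> span (insert e S)"
    unfolding p'_def e'_def using p(1) u(1)
    by (intro span_add span_scale span_diff) (auto intro: span_base span_mono[THEN subsetD, of S])
  moreover have "b p' z = l z" if "z \<in> span (insert e S)" for z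
  proof -
    obtain t where t: "z - t *\<^sub>R e \<in> span S"
      using \<open>z \<in> span (insert e S)\<close> span_breakdown_eq by blast
    define y where "y = (z - t *\<^sub>R e) + t *\<^sub>R u"
    have y: "y \<in> span S" unfolding y_def using t u(1) by (intro span_add span_scale)
    have yV: "y \<in> V" using y spV by auto
    have z: "z = t *\<^sub>R e' + 1 *\<^sub>R y" by (simp add: y_def e'_def algebra_simps)
    have "b p' z = t * b p' e' + b p' y"
      unfolding z using b2[OF e'V yV, of p' t 1] pV e'V V
      by (simp add: p'_def subspace_add subspace_scale)
    also have "b p' e' = l e'" using b1[OF pV e'V e'V, of 1 c] c by (simp add: p'_def)
    also have "b p' y = l y" using b1[OF pV e'V yV, of 1 c] e'0[OF y] p(2)[OF y] by (simp add: p'_def)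
    also have "t * l e' + l y = l z" unfolding z using insert.prems(2)[OF e'V yV, of t 1] by simp
    finally show ?thesis .
  qed
  ultimately show ?case by blast
qed

text \<open>Gram-Schmidt for a seminorm: vectors whose orthogonal residual has norm zero are dropped, so that
  elements of the span are reproduced up to norm zero only.\<close>

lemma L2_orthonormal_family:
  assumes "finite S" "S \<subseteq> L2_space M"
  shows "\<exists>E. finite E \<and> E \<subseteq> span S \<and> (\<forall>e\<in>E. \<forall>e'\<in>E. L2_inner M e e' = (if e = e' then 1 else 0)) \<and>
    (\<forall>x\<in>span S. L2_norm M (x - (\<Sum>e\<in>E. L2_inner M x e *\<^sub>R e)) = 0)"
  using assms
proof (induction S rule: finite_induct)
  case empty
  show ?case by (rule exI[of _ "{}"]) (simp add: L2_norm_def)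
next
  case (insert a S)
  then have "S \<subseteq> L2_space M" by auto
  from insert.IH[OF this] obtain E where E: "finite E" "E \<subseteq> span S" "\<forall>e\<in>E. \<forall>e'\<in>E. L2_inner M e e' = (if e = e' then 1 else 0)"
    "\<forall>x\<in>span S. L2_norm M (x - (\<Sum>e\<in>E. L2_inner M x e *\<^sub>R e)) = 0"
    by (elim exE conjE) (rule that)
  have a: "a \<in> L2_space M" using insert.prems by auto
  have sp: "span S \<subseteq> L2_space M" using insert.prems by (intro span_minimal subspace_L2) auto
  have EL: "e \<in> L2_space M" if "e \<in> E" for e using that E sp by auto
  define Q where "Q x = (\<Sum>e\<in>E. L2_inner M x e *\<^sub>R e)" for x
  have QL: "Q x \<in> L2_space M" for x unfolding Q_def by (intro L2_space_sum L2_space_scaleR EL)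
  have Qs: "Q x \<in> span S" for x unfolding Q_def using E(2) by (intro span_sum span_scale) auto
  have inner_Q: "L2_inner M (Q x) h = (\<Sum>e\<in>E. L2_inner M x e * L2_inner M e h)" if "h \<in> L2_space M" for x h
    unfolding Q_def by (rule linear_on_sum[OF subspace_L2 L2_inner_comb_left E(1) EL]) (use that in auto)
  have Qcomb: "Q (c *\<^sub>R x + d *\<^sub>R y) = c *\<^sub>R Q x + d *\<^sub>R Q y" if "x \<in> L2_space M" "y \<in> L2_space M" for c d x y
    unfolding Q_def using that EL
    by (simp add: L2_inner_comb_left scaleR_left_distrib sum.distrib scaleR_right.sum)
  define r where "r = a - Q a"
  have rL: "r \<in> L2_space M" unfolding r_def using a QL by (intro L2_space_diff)
  have r0: "L2_inner M r e = 0" if "e \<in> E" for e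
  proof -
    have "L2_inner M (Q a) e = (\<Sum>e'\<in>E. L2_inner M a e' * (if e' = e then 1 else 0))"
      unfolding inner_Q[OF EL[OF that]] using E(3) that by (intro sum.cong) auto
    also have "\<dots> = L2_inner M a e" using E(1) that by (simp add: if_distrib cong: if_cong)
    finally show ?thesis unfolding r_def using a QL EL[OF that] by (simp add: L2_inner_diff_left)
  qed
  have decomp: "\<exists>c y. y \<in> span S \<and> x = c *\<^sub>R a + 1 *\<^sub>R y" if "x \<in> span (insert a S)" for x
  proof -
    obtain c where "x - c *\<^sub>R a \<in> span S"
      using \<open>x \<in> span (insert a S)\<close> span_breakdown_eq by blast
    then show ?thesis by (intro exI[of _ c] exI[of _ "x - c *\<^sub>R a"]) simp
  qed
  have mono: "span S \<subseteq> span (insert a S)" by (rule span_mono) auto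
  show ?case
  proof (cases "L2_norm M r = 0")
    case True
    have "L2_norm M (x - Q x) = 0" if "x \<in> span (insert a S)" for x
    proof -
      obtain c y where y: "y \<in> span S" and x: "x = c *\<^sub>R a + 1 *\<^sub>R y" using decomp[OF \<open>x \<in> span (insert a S)\<close>] by blast
      have yL: "y \<in> L2_space M" using y sp by auto
      have "x - Q x = c *\<^sub>R r + (y - Q y)"
        unfolding x Qcomb[OF a yL] r_def by (simp add: algebra_simps)
      then have "L2_norm M (x - Q x) \<le> L2_norm M (c *\<^sub>R r) + L2_norm M (y - Q y)"
        using L2_norm_triangle[of "c *\<^sub>R r" M "y - Q y"] rL yL QL by (simp add: L2_space_scaleR L2_space_diff)
      also have "\<dots> = 0" using True E(4) y by (simp add: L2_norm_scaleR Q_def)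
      finally show ?thesis using L2_norm_nonneg[of M "x - Q x"] by simp
    qed
    then have "\<forall>x\<in>span (insert a S). L2_norm M (x - (\<Sum>e\<in>E. L2_inner M x e *\<^sub>R e)) = 0"
      unfolding Q_def by (rule ballI)
    then show ?thesis by (intro exI[of _ E] conjI E(1,3) order_trans[OF E(2) mono])
  next
    case False
    then have n: "L2_norm M r > 0" using L2_norm_nonneg[of M r] by simp
    define r' where "r' = (1 / L2_norm M r) *\<^sub>R r"
    have r'L: "r' \<in> L2_space M" unfolding r'_def using rL by (rule L2_space_scaleR)
    have rr: "L2_inner M r r = L2_norm M r * L2_norm M r" using L2_norm_power2[of M r] by (simp add: power2_eq_square)
    have r'r': "L2_inner M r' r' = 1" using n by (simp add: r'_def L2_inner_scaleR_left L2_inner_scaleR_right rr)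
    have r'0: "L2_inner M r' e = 0" "L2_inner M e r' = 0" if "e \<in> E" for e
      using r0[OF that] L2_inner_commute[of M e r'] by (simp_all add: r'_def L2_inner_scaleR_left)
    have r'E: "r' \<notin> E" using r'0 r'r' by fastforce
    have inner_Q0: "L2_inner M (Q x) r' = 0" for x using r'0(2) by (simp add: inner_Q[OF r'L])
    have r's: "r' \<in> span (insert a S)"
      unfolding r'_def r_def using Qs[of a] mono by (intro span_scale span_diff) (auto intro: span_base)
    have "L2_norm M (x - (\<Sum>e\<in>insert r' E. L2_inner M x e *\<^sub>R e)) = 0" if "x \<in> span (insert a S)" for x
    proof -
      obtain c y where y: "y \<in> span S" and x: "x = c *\<^sub>R a + 1 *\<^sub>R y" using decomp[OF \<open>x \<in> span (insert a S)\<close>] by blast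
      have yL: "y \<in> L2_space M" using y sp by auto
      have y0: "L2_norm M (y - Q y) = 0" using E(4) y by (simp add: Q_def)
      have "\<bar>L2_inner M (y - Q y) r'\<bar> \<le> L2_norm M (y - Q y) * L2_norm M r'"
        using yL QL r'L by (intro L2_Cauchy_Schwarz L2_space_diff)
      then have yr: "L2_inner M y r' = 0" using y0 inner_Q0[of y] yL QL r'L by (simp add: L2_inner_diff_left)
      have "L2_inner M a r' = L2_inner M r r'"
        using inner_Q0[of a] a QL r'L by (simp add: r_def L2_inner_diff_left)
      also have "\<dots> = L2_norm M r" using n by (simp add: r'_def L2_inner_scaleR_right rr)
      finally have xr: "L2_inner M x r' = c * L2_norm M r"
        unfolding x L2_inner_comb_left[OF a yL r'L] yr by simp
      have "(\<Sum>e\<in>insert r' E. L2_inner M x e *\<^sub>R e) = L2_inner M x r' *\<^sub>R r' + Q x"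
        using E(1) r'E by (simp add: Q_def)
      also have "L2_inner M x r' *\<^sub>R r' = c *\<^sub>R r" unfolding xr using n by (simp add: r'_def)
      finally have "x - (\<Sum>e\<in>insert r' E. L2_inner M x e *\<^sub>R e) = x - (c *\<^sub>R r + Q x)" by (simp only:)
      also have "\<dots> = y - Q y"
        unfolding x Qcomb[OF a yL] r_def by (simp add: algebra_simps)
      finally show ?thesis using y0 by (simp only:)
    qed
    moreover have "L2_inner M e e' = (if e = e' then 1 else 0)" if "e \<in> insert r' E" "e' \<in> insert r' E" for e e'
      using that E(3) r'0 r'r' r'E by auto
    moreover have "finite (insert r' E)" "insert r' E \<subseteq> span (insert a S)" using E(1,2) r's mono by auto
    ultimately show ?thesis by (intro exI[of _ "insert r' E"] conjI ballI)
  qed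
qed

section \<open>The elliptic projection\<close>

context rte
begin

text \<open>The form and its ingredients depend only on the equivalence class of their arguments.\<close>

lemma WV_null:
  assumes x: "x \<in> WV" and n: "L2_norm D x = 0" and y: "y \<in> WV"
  shows "B x y = 0" "B y x = 0"
proof -
  note X = WV_L2[OF x] and Y = WV_L2[OF y]
  have x0: "AE p in D. x p = 0" using n L2_norm_eq_0_iff[OF X(1)] by simp
  have "AE p in D. even_part x p = 0 \<and> odd_part x p = 0"
    using x0 AE_reflect[OF x0] by eventually_elim (simp add: even_part_eq odd_part_eq)
  then have e0: "AE p in D. 0 = even_part x p" and o0: "AE p in D. odd_part x p = 0" by (auto elim: eventually_mono)
  have c: "wt (even_part x) = wt 0" "wtrace (even_part x) = wtrace 0"
    using W_space_cong[OF W_zero L2_measurable[OF X(2)]] e0 by (simp_all add: zero_fun_def)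
  have i: "L2_inner M f g = 0" "L2_inner M g f = 0" if "f \<in> L2_space M" "AE p in M. f p = 0" for f g :: "phase \<Rightarrow> real" and M
  proof -
    have "L2_inner M f g = (LINT p|M. 0)"
      unfolding L2_inner_def using that(2) by (intro integral_eq_zero_AE[THEN trans]) (auto elim: eventually_mono)
    then show "L2_inner M f g = 0" "L2_inner M g f = 0" by (simp_all add: L2_inner_commute[of M g f])
  qed
  have S0: "AE p in D. St x p = 0" and T0: "AE p in dD. Tr x p = 0"
    using wt_zero wtrace_zero_fun by (simp_all add: St_def Tr_def c)
  have C0: "L2_inner D (C x) y = 0" "L2_inner D (C y) x = 0"
    using i(2)[OF X(1) x0, of "C y"] C_symmetric[OF X(1) Y(1)] by simp_all
  show "B x y = 0" "B y x = 0"
    unfolding B_eq by (simp_all add: i[OF X(5) T0] i[OF X(4) S0] i[OF X(3) o0] C0)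
qed

text \<open>The stability constant of the elliptic projection, as produced by the elementary estimate below.\<close>

definition stab :: real where
  "stab = sqrt ((2 * Mc + 1)\<^sup>2 / a_lo\<^sup>2 + (2 * Mc + 3) / a_lo)"

definition Cq :: real where "Cq = 1 + stab"

lemma stab_nonneg: "0 \<le> stab"
  unfolding stab_def using Mc_nonneg a_lo_pos by (intro real_sqrt_ge_zero) auto

end

text \<open>In the application \<open>P\<close>, \<open>s\<close> and \<open>\<tau>\<close> are the norms of the projection, of its streaming term and of
  its trace, and \<open>N\<close> is the norm of the projected function. Eliminating \<open>s\<close> and absorbing \<open>\<tau>\<close> leaves
  a quadratic inequality for \<open>P\<close>, solved by another application of Young's inequality.\<close>

lemma quadratic_stability:
  fixes a M N P s \<tau> :: real
  assumes a: "a > 0" and nn: "0 \<le> M" "0 \<le> N" "0 \<le> P"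
    and s: "s \<le> M * P + (M + 1) * N" and q: "a * P\<^sup>2 + \<tau>\<^sup>2 \<le> N * \<tau> + M * N * P + N * s + N * P"
  shows "P \<le> sqrt ((2 * M + 1)\<^sup>2 / a\<^sup>2 + (2 * M + 3) / a) * N"
proof -
  have "N * s \<le> N * (M * P + (M + 1) * N)" using s nn by (intro mult_left_mono)
  moreover have "N * \<tau> \<le> N\<^sup>2 / 4 + \<tau>\<^sup>2"
    using zero_le_power2[of "N / 2 - \<tau>"] by (simp add: power2_eq_square algebra_simps)
  ultimately have 1: "a * P\<^sup>2 \<le> (2 * M + 1) * N * P + (M + 5 / 4) * N\<^sup>2"
    using q by (simp add: power2_eq_square algebra_simps)
  have "0 \<le> (a * P - (2 * M + 1) * N)\<^sup>2" by simp
  then have "2 * a * ((2 * M + 1) * N * P) \<le> a\<^sup>2 * P\<^sup>2 + (2 * M + 1)\<^sup>2 * N\<^sup>2"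
    by (simp add: power2_eq_square algebra_simps)
  moreover have "2 * a * (a * P\<^sup>2) \<le> 2 * a * ((2 * M + 1) * N * P + (M + 5 / 4) * N\<^sup>2)"
    using 1 a by (intro mult_left_mono) auto
  ultimately have 2: "a\<^sup>2 * P\<^sup>2 \<le> (2 * M + 1)\<^sup>2 * N\<^sup>2 + a * (2 * M + 5 / 2) * N\<^sup>2"
    by (simp add: power2_eq_square algebra_simps)
  also have "\<dots> \<le> (2 * M + 1)\<^sup>2 * N\<^sup>2 + a * (2 * M + 3) * N\<^sup>2"
    using a by (intro add_left_mono mult_right_mono mult_left_mono) auto
  also have "\<dots> = a\<^sup>2 * (((2 * M + 1)\<^sup>2 / a\<^sup>2 + (2 * M + 3) / a) * N\<^sup>2)"
    using a by (simp add: field_simps power2_eq_square)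
  finally have "P\<^sup>2 \<le> ((2 * M + 1)\<^sup>2 / a\<^sup>2 + (2 * M + 3) / a) * N\<^sup>2"
    using a by simp
  then have "sqrt (P\<^sup>2) \<le> sqrt (((2 * M + 1)\<^sup>2 / a\<^sup>2 + (2 * M + 3) / a) * N\<^sup>2)"
    by (rule real_sqrt_le_mono)
  then show ?thesis using nn by (simp only: real_sqrt_mult real_sqrt_abs abs_of_nonneg)
qed

locale galerkin = rte +
  fixes Wh Vh :: "(phase \<Rightarrow> real) set"
  assumes A3: "assumption_A3 R Wh Vh" and A4: "assumption_A4 R Wh Vh"
begin

abbreviation "Xh \<equiv> sum_space Wh Vh"

lemma Wh_sub: "Wh \<subseteq> W_plus R" and Vh_sub: "Vh \<subseteq> V_minus R"
  using A3 by (auto simp: assumption_A3_def)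

lemma subspace_Wh: "subspace Wh" and subspace_Vh: "subspace Vh"
  using A3 by (auto simp: assumption_A3_def finite_dim_subspace_def)

lemma Xh_span: "\<exists>S. finite S \<and> span S = Xh"
proof -
  obtain S1 where S1: "finite S1" "span S1 = Wh"
    using A3 by (auto simp: assumption_A3_def elim: finite_dim_subspace_span)
  obtain S2 where S2: "finite S2" "span S2 = Vh"
    using A3 by (auto simp: assumption_A3_def elim: finite_dim_subspace_span)
  have "span (S1 \<union> S2) = Xh"
    unfolding span_Un S1(2) S2(2) sum_space_def by auto
  then show ?thesis using S1(1) S2(1) by (intro exI[of _ "S1 \<union> S2"]) auto
qed

lemma subspace_Xh: "subspace Xh"
  using Xh_span subspace_span by metis

lemma Xh_WV: "Xh \<subseteq> WV"
  using Wh_sub Vh_sub sum_in_WV(1) by (auto simp: sum_space_def)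

lemma in_WV: "x \<in> Xh \<Longrightarrow> x \<in> WV"
  using Xh_WV by blast

lemma Vh_Xh: "v \<in> Vh \<Longrightarrow> v \<in> Xh"
  using subspace_0[OF subspace_Wh] unfolding sum_space_def by force

lemma Xh_transport:
  assumes "p \<in> Xh" obtains v where "v \<in> Vh" "AE q in D. St p q = v q"
proof -
  obtain w v where p: "p = w + v" "w \<in> Wh" "v \<in> Vh" using assms by (auto simp: sum_space_def)
  have "St p = wt w" unfolding p(1) using p Wh_sub Vh_sub by (intro sum_in_WV(2)) auto
  then show ?thesis using A4 p(2) that unfolding assumption_A4_def by metis
qed

text \<open>Coercivity controls the $L^2$ norm and the trace of \<open>p\<close>, but the right hand side also contains
  \<open>St p\<close>. Here the compatibility of the discrete spaces enters: \<open>St p\<close> is represented by an element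
  \<open>v\<close> of \<open>Vh\<close>, and testing with \<open>v\<close> bounds its norm.\<close>

lemma projection_stable:
  assumes p: "p \<in> Xh" and x: "x \<in> WV" and eq: "\<And>\<psi>. \<psi> \<in> Xh \<Longrightarrow> B p \<psi> = B x \<psi>"
  shows "L2_norm D p \<le> stab * WV_norm R x"
proof -
  have pW: "p \<in> WV" using p Xh_WV by auto
  note P = WV_L2[OF pW] and X = WV_L2[OF x]
  define N where "N = WV_norm R x"
  define s where "s = L2_norm D (St p)"
  obtain v where v: "v \<in> Vh" "AE q in D. St p q = v q" using Xh_transport[OF p] .
  have vV: "v \<in> V_minus R" using v(1) Vh_sub by auto
  have vL: "v \<in> L2_space D" by (rule V_minus_L2[OF vV])
  have ov: "AE q in D. odd_part v q = St p q"
    using odd_part_V_minus_eq[OF vV] v(2) by eventually_elim simp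
  have v1: "L2_inner D f v = L2_inner D f (St p)" if "f \<in> L2_space D" for f
    using that v(2) vL P by (intro L2_inner_cong_AE) (auto simp: L2_measurable)
  have v2: "L2_inner D f (odd_part v) = L2_inner D f (St p)" if "f \<in> L2_space D" for f
    using that ov odd_part_L2[OF vL] P by (intro L2_inner_cong_AE) (auto simp: L2_measurable)
  have v3: "L2_inner D f (St v) = 0" if "f \<in> L2_space D" for f
  proof -
    have "L2_inner D f (St v) = L2_inner D f 0"
      using that St_V_minus[OF vV] WV_L2(4)[OF V_minus_WV[OF vV]]
      by (intro L2_inner_cong_AE) (auto simp: L2_measurable L2_space_zero zero_fun_def)
    then show ?thesis by simp
  qed
  have v4: "L2_inner dD f (Tr v) = 0" if "f \<in> L2_space dD" for f
  proof -
    have "L2_inner dD f (Tr v) = L2_inner dD f 0"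
      using that Tr_V_minus[OF vV] WV_L2(5)[OF V_minus_WV[OF vV]]
      by (intro L2_inner_cong_AE) (auto simp: L2_measurable L2_space_zero zero_fun_def)
    then show ?thesis by simp
  qed
  have test_v: "B y v = L2_inner D (C y) (St p) + L2_inner D (St y) (St p)" if "y \<in> WV" for y
    unfolding B_eq using WV_L2[OF that] by (simp add: v1 v2 v3 v4 C_L2)
  have cs: "L2_inner M f g \<le> L2_norm M f * L2_norm M g" "- L2_inner M f g \<le> L2_norm M f * L2_norm M g"
    if "f \<in> L2_space M" "g \<in> L2_space M" for f g :: "phase \<Rightarrow> real" and M
    using L2_Cauchy_Schwarz[OF that] by auto
  have nb: "L2_norm D x \<le> N" "L2_norm D (St x) \<le> N" "L2_norm dD (Tr x) \<le> N" "L2_norm D (odd_part x) \<le> N"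
    using WV_norm_bounds L2_norm_le_WV_norm[OF X(1)] by (auto simp: N_def)
  have N0: "0 \<le> N" by (simp add: N_def WV_norm_nonneg)
  have Cx: "L2_norm D (C x) \<le> Mc * N"
    using C_bounded[OF X(1)] mult_left_mono[OF nb(1) Mc_nonneg] by linarith
  have s_bound: "s \<le> Mc * L2_norm D p + (Mc + 1) * N"
  proof (cases "s = 0")
    case True
    then show ?thesis using Mc_nonneg N0 L2_norm_nonneg[of D p] by simp
  next
    case False
    then have s0: "s > 0" using L2_norm_nonneg by (simp add: s_def less_le)
    have "s * s = L2_inner D (St p) (St p)" by (simp add: s_def L2_norm_power2[symmetric] power2_eq_square)
    also have "\<dots> = L2_inner D (C x) (St p) + L2_inner D (St x) (St p) - L2_inner D (C p) (St p)"
      using eq[OF Vh_Xh[OF v(1)]] test_v[OF pW] test_v[OF x] by simp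
    also have "\<dots> \<le> L2_norm D (C x) * s + L2_norm D (St x) * s + L2_norm D (C p) * s"
      unfolding s_def using cs(1)[OF C_L2[OF X(1)] P(4)] cs(1)[OF X(4) P(4)] cs(2)[OF C_L2[OF P(1)] P(4)] by linarith
    also have "\<dots> \<le> (Mc * N) * s + N * s + (Mc * L2_norm D p) * s"
      by (intro add_mono mult_right_mono Cx nb(2) C_bounded[OF P(1)] less_imp_le[OF s0])
    also have "\<dots> = (Mc * L2_norm D p + (Mc + 1) * N) * s" by (simp add: algebra_simps)
    finally show ?thesis using s0 by simp
  qed
  have "a_lo * (L2_norm D p)\<^sup>2 + (L2_norm dD (Tr p))\<^sup>2 \<le> B x p"
    using B_diagonal[OF pW] eq[OF p] by simp
  also have "\<dots> \<le> L2_norm dD (Tr x) * L2_norm dD (Tr p) + L2_norm D (C x) * L2_norm D p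
      + L2_norm D (odd_part x) * s + L2_norm D (St x) * L2_norm D (odd_part p)"
    unfolding B_eq s_def using cs(1)[OF X(5) P(5)] cs(1)[OF C_L2[OF X(1)] P(1)] cs(2)[OF X(3) P(4)] cs(1)[OF X(4) P(3)]
    by linarith
  also have "\<dots> \<le> N * L2_norm dD (Tr p) + (Mc * N) * L2_norm D p + N * s + N * L2_norm D p"
  proof -
    have "L2_norm D (odd_part p) \<le> L2_norm D p"
    proof (rule power2_le_imp_le[OF _ L2_norm_nonneg])
      show "(L2_norm D (odd_part p))\<^sup>2 \<le> (L2_norm D p)\<^sup>2"
        using L2_inner_parts[OF P(1) P(1)] L2_inner_self_nonneg[of D "even_part p"] by (simp add: L2_norm_power2)
    qed
    then have "L2_norm D (St x) * L2_norm D (odd_part p) \<le> N * L2_norm D p"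
      by (rule mult_mono[OF nb(2) _ N0 L2_norm_nonneg])
    moreover have "L2_norm dD (Tr x) * L2_norm dD (Tr p) \<le> N * L2_norm dD (Tr p)"
      by (rule mult_right_mono[OF nb(3) L2_norm_nonneg])
    moreover have "L2_norm D (C x) * L2_norm D p \<le> (Mc * N) * L2_norm D p"
      by (rule mult_right_mono[OF Cx L2_norm_nonneg])
    moreover have "L2_norm D (odd_part x) * s \<le> N * s"
      unfolding s_def by (rule mult_right_mono[OF nb(4) L2_norm_nonneg])
    ultimately show ?thesis by linarith
  qed
  finally have "a_lo * (L2_norm D p)\<^sup>2 + (L2_norm dD (Tr p))\<^sup>2 \<le> N * L2_norm dD (Tr p) + Mc * N * L2_norm D p + N * s + N * L2_norm D p"
    by simp
  from quadratic_stability[OF a_lo_pos Mc_nonneg N0 L2_norm_nonneg s_bound this]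
  show ?thesis by (simp add: stab_def N_def)
qed

lemma B_null:
  assumes "x \<in> WV" "B x x = 0"
  shows "L2_norm D x = 0"
proof -
  have "a_lo * (L2_norm D x)\<^sup>2 \<le> 0"
    using B_diagonal[OF assms(1)] assms(2) zero_le_power2[of "L2_norm dD (Tr x)"] by linarith
  then have "(L2_norm D x)\<^sup>2 \<le> 0" using a_lo_pos by (simp add: mult_le_0_iff)
  then show ?thesis by simp
qed

lemma projection_exists:
  assumes x: "x \<in> WV" shows "\<exists>p\<in>Xh. \<forall>\<psi>\<in>Xh. B p \<psi> = B x \<psi>"
proof -
  obtain S where S: "finite S" "span S = Xh" using Xh_span by blast
  have "\<exists>p\<in>span S. \<forall>y\<in>span S. B p y = B x y"
  proof (rule lax_milgram_finite_dim[where V=Xh])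
    show "S \<subseteq> Xh" unfolding S(2)[symmetric] by (rule span_superset)
    show "B (a *\<^sub>R u + c *\<^sub>R v) w = a * B u w + c * B v w" if "u \<in> Xh" "v \<in> Xh" "w \<in> Xh" for a c u v w
      by (intro B_comb_left in_WV that)
    show "B w (a *\<^sub>R u + c *\<^sub>R v) = a * B w u + c * B w v" if "u \<in> Xh" "v \<in> Xh" "w \<in> Xh" for a c u v w
      by (intro B_comb_right in_WV that)
    show "B v u = 0" if "u \<in> Xh" "v \<in> Xh" "B u u = 0" for u v
      by (rule WV_null(2)[OF in_WV[OF that(1)] B_null[OF in_WV[OF that(1)] that(3)] in_WV[OF that(2)]])
    show "B x (a *\<^sub>R u + c *\<^sub>R v) = a * B x u + c * B x v" if "u \<in> Xh" "v \<in> Xh" for a c u v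
      by (intro B_comb_right in_WV that x)
    show "B x u = 0" if "u \<in> Xh" "B u u = 0" for u
      by (rule WV_null(2)[OF in_WV[OF that(1)] B_null[OF in_WV[OF that(1)] that(2)] x])
  qed (rule subspace_Xh S(1))+
  then show ?thesis unfolding S(2) .
qed

definition Pi_h :: "(phase \<Rightarrow> real) \<Rightarrow> phase \<Rightarrow> real" where
  "Pi_h x = (SOME p. p \<in> Xh \<and> (\<forall>\<psi>\<in>Xh. B p \<psi> = B x \<psi>))"

lemma Pi_h:
  assumes x: "x \<in> WV"
  shows "Pi_h x \<in> Xh" "\<psi> \<in> Xh \<Longrightarrow> B (Pi_h x) \<psi> = B x \<psi>"
  using someI_ex[of "\<lambda>p. p \<in> Xh \<and> (\<forall>\<psi>\<in>Xh. B p \<psi> = B x \<psi>)"] projection_exists[OF x]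
  unfolding Pi_h_def by auto

text \<open>Stability applied to \<open>x - \<psi>\<close>, whose projection is \<open>Pi_h x - \<psi>\<close>.\<close>

lemma Pi_h_quasi_optimal:
  assumes x: "x \<in> WV" and \<psi>: "\<psi> \<in> Xh"
  shows "L2_norm D (x - Pi_h x) \<le> Cq * WV_norm R (x - \<psi>)"
proof -
  note p = Pi_h[OF x]
  have xw: "x - \<psi> \<in> WV" "\<psi> \<in> WV" "Pi_h x \<in> WV" using x \<psi> p(1) Xh_WV subspace_diff[OF subspace_WV] by auto
  have d: "Pi_h x - \<psi> \<in> Xh" using subspace_diff[OF subspace_Xh p(1) \<psi>] .
  have "B (Pi_h x - \<psi>) y = B (x - \<psi>) y" if "y \<in> Xh" for y
    using p(2)[OF that] B_comb_left[OF xw(3,2), of y 1 "-1"] B_comb_left[OF x xw(2), of y 1 "-1"] that Xh_WV by auto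
  from projection_stable[OF d xw(1) this]
  have 1: "L2_norm D (Pi_h x - \<psi>) \<le> stab * WV_norm R (x - \<psi>)" .
  have "L2_norm D (x - Pi_h x) \<le> L2_norm D (x - \<psi>) + L2_norm D (\<psi> - Pi_h x)"
    using x xw by (intro L2_norm_triangle_diff WV_L2)
  also have "\<dots> \<le> WV_norm R (x - \<psi>) + stab * WV_norm R (x - \<psi>)"
    using 1 L2_norm_minus_commute[of D \<psi> "Pi_h x"] L2_norm_le_WV_norm[OF WV_L2(1)[OF xw(1)]] by simp
  finally show ?thesis by (simp add: Cq_def algebra_simps)
qed

lemma Cq_pos: "0 < Cq"
  using stab_nonneg by (simp add: Cq_def)

text \<open>The discrete adjoint problem is governed by the transposed form, which is nondegenerate as well.\<close>

lemma dual_exists: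
  assumes y: "y \<in> L2_space D" shows "\<exists>z\<in>Xh. \<forall>x\<in>Xh. B x z = L2_inner D x y"
proof -
  obtain S where S: "finite S" "span S = Xh" using Xh_span by blast
  have "\<exists>z\<in>span S. \<forall>x\<in>span S. B x z = L2_inner D x y"
  proof (rule lax_milgram_finite_dim[where V=Xh and b="\<lambda>x y. B y x"])
    show "S \<subseteq> Xh" unfolding S(2)[symmetric] by (rule span_superset)
    show "B w (a *\<^sub>R u + c *\<^sub>R v) = a * B w u + c * B w v" if "u \<in> Xh" "v \<in> Xh" "w \<in> Xh" for a c u v w
      by (intro B_comb_right in_WV that)
    show "B (a *\<^sub>R u + c *\<^sub>R v) w = a * B u w + c * B v w" if "u \<in> Xh" "v \<in> Xh" "w \<in> Xh" for a c u v w
      by (intro B_comb_left in_WV that)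
    show "B u v = 0" if "u \<in> Xh" "v \<in> Xh" "B u u = 0" for u v
      by (rule WV_null(1)[OF in_WV[OF that(1)] B_null[OF in_WV[OF that(1)] that(3)] in_WV[OF that(2)]])
    fix x assume x: "x \<in> Xh" "B x x = 0"
    then have xW: "x \<in> WV" using Xh_WV by auto
    have "\<bar>L2_inner D x y\<bar> \<le> L2_norm D x * L2_norm D y" by (intro L2_Cauchy_Schwarz y WV_L2 xW)
    then show "L2_inner D x y = 0" using B_null[OF xW x(2)] by simp
  next
    fix x x' :: "phase \<Rightarrow> real" and a c assume "x \<in> Xh" "x' \<in> Xh"
    then have "x \<in> L2_space D" "x' \<in> L2_space D" using Xh_WV by (auto intro: WV_L2)
    then show "L2_inner D (a *\<^sub>R x + c *\<^sub>R x') y = a * L2_inner D x y + c * L2_inner D x' y"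
      using y by (rule L2_inner_comb_left)
  qed (rule subspace_Xh S(1))+
  then show ?thesis unfolding S(2) .
qed

lemma Xh_orthonormal: "\<exists>E. finite E \<and> E \<subseteq> Xh \<and> (\<forall>e\<in>E. L2_norm D e = 1) \<and>
    (\<forall>x\<in>Xh. L2_norm D (x - (\<Sum>e\<in>E. L2_inner D x e *\<^sub>R e)) = 0)"
proof -
  obtain S where S: "finite S" "span S = Xh" using Xh_span by blast
  have "S \<subseteq> Xh" unfolding S(2)[symmetric] by (rule span_superset)
  then have "S \<subseteq> L2_space D" using Xh_WV WV_L2(1) by blast
  from L2_orthonormal_family[OF S(1) this] obtain E where E: "finite E" "E \<subseteq> Xh"
    "\<forall>e\<in>E. \<forall>e'\<in>E. L2_inner D e e' = (if e = e' then 1 else 0)"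
    "\<forall>x\<in>Xh. L2_norm D (x - (\<Sum>e\<in>E. L2_inner D x e *\<^sub>R e)) = 0" unfolding S(2) by blast
  have "\<forall>e\<in>E. L2_norm D e = 1" using E(3) by (simp add: L2_norm_eq_sqrt)
  then show ?thesis using E by blast
qed

end

section \<open>Bochner integrals tested by functionals\<close>

lemma finite_interval_measure: "finite_measure (lebesgue_on {0<..<T::real})"
  by (rule finite_measureI) (cases "0 \<le> T", auto simp: emeasure_restrict_space)

lemma simple_on_simple_function:
  assumes "simple_on T X w" shows "simple_function (lebesgue_on {0<..<T}) w"
  unfolding simple_function_def
proof (intro conjI ballI)
  show "finite (w ` space (lebesgue_on {0<..<T}))" using assms by (simp add: simple_on_def)
  fix y
  have "w -` {y} \<inter> space (lebesgue_on {0<..<T}) = {t \<in> {0<..<T}. w t = y}" by auto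
  then show "w -` {y} \<inter> space (lebesgue_on {0<..<T}) \<in> sets (lebesgue_on {0<..<T})"
    using assms by (auto simp: simple_on_def sets_restrict_space_iff)
qed

text \<open>A bounded linear functional on a seminormed space turns statements about Bochner integrals and weak
  derivatives into statements about real functions. The strict positivity of \<open>c\<close> permits division
  by it.\<close>

locale tested_space =
  fixes X :: "'a::real_vector set" and N :: "'a \<Rightarrow> real" and L :: "'a \<Rightarrow> real" and c T :: real
  assumes X: "subspace X"
    and L: "\<And>x y a b. x \<in> X \<Longrightarrow> y \<in> X \<Longrightarrow> L (a *\<^sub>R x + b *\<^sub>R y) = a * L x + b * L y"
    and c: "c > 0" and bound: "\<And>x. x \<in> X \<Longrightarrow> \<bar>L x\<bar> \<le> c * N x"
begin

abbreviation "I \<equiv> lebesgue_on {0<..<T}"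

sublocale I: finite_measure I by (rule finite_interval_measure)

lemma L_diff: "x \<in> X \<Longrightarrow> y \<in> X \<Longrightarrow> L (x - y) = L x - L y"
  using L[of x y 1 "-1"] by simp

lemma L_scale: "x \<in> X \<Longrightarrow> L (a *\<^sub>R x) = a * L x"
  using L[of x x a 0] by simp

lemma L_diff_bound: "x \<in> X \<Longrightarrow> y \<in> X \<Longrightarrow> \<bar>L x - L y\<bar> \<le> c * N (x - y)"
  using bound[OF subspace_diff[OF X, of x y]] L_diff by simp

lemma simple_in_X: "simple_on T X w \<Longrightarrow> t \<in> {0<..<T} \<Longrightarrow> w t \<in> X"
  by (auto simp: simple_on_def)

lemma L_measurable:
  assumes "strongly_measurable T X N u"
  shows "(\<lambda>t. L (u t)) \<in> borel_measurable I"
proof -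
  obtain w where uX: "AE t in I. u t \<in> X" and w: "\<And>n::nat. simple_on T X (w n)"
    and l: "AE t in I. (\<lambda>n. N (u t - w n t)) \<longlonglongrightarrow> 0"
    using assms unfolding strongly_measurable_def by blast
  have lim: "AE t in I. (\<lambda>n. L (w n t)) \<longlonglongrightarrow> L (u t)"
    using l uX AE_space
  proof eventually_elim
    fix t assume t: "(\<lambda>n. N (u t - w n t)) \<longlonglongrightarrow> 0" "u t \<in> X" "t \<in> space I"
    have wX: "w n t \<in> X" for n using simple_in_X[OF w] t(3) by simp
    have "(\<lambda>n. L (u t) - L (w n t)) \<longlonglongrightarrow> 0"
    proof (rule tendsto_rabs_zero_cancel, rule tendsto_sandwich[OF _ _ tendsto_const])
      show "(\<lambda>n. c * N (u t - w n t)) \<longlonglongrightarrow> 0" using tendsto_mult_left[OF t(1), of c] by simp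
      show "\<forall>\<^sub>F n in sequentially. \<bar>L (u t) - L (w n t)\<bar> \<le> c * N (u t - w n t)"
        using L_diff_bound[OF t(2) wX] by (intro always_eventually allI)
    qed (intro always_eventually allI abs_ge_zero)
    from tendsto_diff[OF tendsto_const[of "L (u t)"] this]
    show "(\<lambda>n. L (w n t)) \<longlonglongrightarrow> L (u t)" by simp
  qed
  define g where "g t = lim (\<lambda>n. L (w n t))" for t
  have wm: "(\<lambda>t. L (w n t)) \<in> borel_measurable I" for n
    by (rule borel_measurable_simple_function[OF simple_function_compose1[OF simple_on_simple_function[OF w]]])
  have gm: "g \<in> borel_measurable I"
    unfolding g_def using wm by (rule borel_measurable_lim_metric)
  have gu: "AE t in I. g t = L (u t)"
    using lim by eventually_elim (simp add: g_def limI)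
  have "(\<lambda>t. if t \<in> {0<..<T} then g t else 0) \<in> borel_measurable lebesgue"
    using gm by (subst measurable_restrict_space_iff[symmetric]) auto
  moreover have "AE t in lebesgue. (if t \<in> {0<..<T} then g t else 0) = (if t \<in> {0<..<T} then L (u t) else 0)"
    using gu by (subst (asm) AE_restrict_space_iff) (auto elim: eventually_mono)
  ultimately have "(\<lambda>t. if t \<in> {0<..<T} then L (u t) else 0) \<in> borel_measurable lebesgue"
    by (rule borel_measurable_AE)
  then show ?thesis by (subst measurable_restrict_space_iff[where c=0]) auto
qed

lemma integral_simple:
  assumes w: "simple_on T X w"
  shows "integrable I (\<lambda>t. L (w t))" "(LINT t|I. L (w t)) = L (simple_integral T w)" "simple_integral T w \<in> X"
proof -
  have fin: "finite (w ` {0<..<T})" and wX: "w ` {0<..<T} \<subseteq> X" using w by (auto simp: simple_on_def)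
  define A where "A y = {t \<in> {0<..<T}. w t = y}" for y
  have A: "A y \<in> sets lebesgue" for y using w by (simp add: A_def simple_on_def)
  have AI: "A y \<in> sets I" for y using A[of y] by (auto simp: sets_restrict_space_iff A_def)
  have m: "measure I (A y) = measure lebesgue (A y)" for y
    by (rule measure_restrict_space) (auto simp: A_def)
  have rep: "L (w t) = (\<Sum>y\<in>w ` {0<..<T}. indicat_real (A y) t * L y)" if "t \<in> space I" for t
  proof -
    have "(\<Sum>y\<in>w ` {0<..<T}. indicat_real (A y) t * L y) = (\<Sum>y\<in>w ` {0<..<T}. if y = w t then L y else 0)"
      using that by (intro sum.cong) (auto simp: A_def)
    also have "\<dots> = L (w t)" using fin that by simp
    finally show ?thesis by simp
  qed
  have ind: "integrable I (\<lambda>t. indicat_real (A y) t * L y)" for y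
    using AI by (intro integrable_mult_left integrable_real_indicator) (auto simp: I.emeasure_eq_measure)
  have "integrable I (\<lambda>t. \<Sum>y\<in>w ` {0<..<T}. indicat_real (A y) t * L y)"
    by (intro Bochner_Integration.integrable_sum ind)
  then show "integrable I (\<lambda>t. L (w t))"
    by (rule Bochner_Integration.integrable_cong[THEN iffD1, rotated 2]) (auto simp: rep)
  have "(LINT t|I. L (w t)) = (LINT t|I. (\<Sum>y\<in>w ` {0<..<T}. indicat_real (A y) t * L y))"
    by (rule Bochner_Integration.integral_cong[OF refl rep])
  also have "\<dots> = (\<Sum>y\<in>w ` {0<..<T}. (LINT t|I. indicat_real (A y) t * L y))"
    by (rule Bochner_Integration.integral_sum[OF ind])
  also have "\<dots> = (\<Sum>y\<in>w ` {0<..<T}. measure lebesgue (A y) * L y)"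
  proof (rule sum.cong[OF refl])
    fix y
    have "A y \<inter> space I = A y" by (auto simp: A_def)
    then show "(LINT t|I. indicat_real (A y) t * L y) = measure lebesgue (A y) * L y"
      by (simp add: Bochner_Integration.integral_indicator m)
  qed
  also have "\<dots> = L (\<Sum>y\<in>w ` {0<..<T}. measure lebesgue (A y) *\<^sub>R y)"
    using wX by (intro linear_on_sum[OF X L fin, symmetric]) auto
  finally show "(LINT t|I. L (w t)) = L (simple_integral T w)"
    by (simp add: simple_integral_def A_def)
  show "simple_integral T w \<in> X"
    unfolding simple_integral_def using wX by (intro subspace_sum subspace_scale X) auto
qed

lemma L_bochner_integral:
  assumes "bochner_integral_is T X N u y"
  shows "integrable I (\<lambda>t. L (u t))" "(LINT t|I. L (u t)) = L y"
proof -
  from assms obtain w where y: "y \<in> X" and sm: "strongly_measurable T X N u" and w: "\<And>n::nat. simple_on T X (w n)"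
    and l: "(\<lambda>n. \<integral>\<^sup>+ t. ennreal (N (u t - w n t)) \<partial>I) \<longlonglongrightarrow> 0"
    and ly: "(\<lambda>n. N (simple_integral T (w n) - y)) \<longlonglongrightarrow> 0"
    unfolding bochner_integral_is_def by blast
  have um: "(\<lambda>t. L (u t)) \<in> borel_measurable I" by (rule L_measurable[OF sm])
  note ws = integral_simple[OF w]
  have uX: "AE t in I. u t \<in> X" using sm by (simp add: strongly_measurable_def)
  have b: "(\<integral>\<^sup>+t. ennreal \<bar>L (w n t) - L (u t)\<bar> \<partial>I) \<le> ennreal c * (\<integral>\<^sup>+ t. ennreal (N (u t - w n t)) \<partial>I)" for n
  proof -
    have "(\<integral>\<^sup>+t. ennreal \<bar>L (w n t) - L (u t)\<bar> \<partial>I) = (\<integral>\<^sup>+t. ennreal c * ennreal (\<bar>L (w n t) - L (u t)\<bar> / c) \<partial>I)"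
      using c by (intro nn_integral_cong) (simp add: ennreal_mult[symmetric])
    also have "\<dots> = ennreal c * (\<integral>\<^sup>+t. ennreal (\<bar>L (w n t) - L (u t)\<bar> / c) \<partial>I)"
      using um ws(1)[of n] by (intro nn_integral_cmult) auto
    also have "(\<integral>\<^sup>+t. ennreal (\<bar>L (w n t) - L (u t)\<bar> / c) \<partial>I) \<le> (\<integral>\<^sup>+ t. ennreal (N (u t - w n t)) \<partial>I)"
    proof (rule nn_integral_mono_AE)
      show "AE t in I. ennreal (\<bar>L (w n t) - L (u t)\<bar> / c) \<le> ennreal (N (u t - w n t))"
        using uX AE_space
      proof eventually_elim
        fix t assume "u t \<in> X" "t \<in> space I"
        then have "\<bar>L (u t) - L (w n t)\<bar> \<le> c * N (u t - w n t)"
          using simple_in_X[OF w] by (intro L_diff_bound) auto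
        then show "ennreal (\<bar>L (w n t) - L (u t)\<bar> / c) \<le> ennreal (N (u t - w n t))"
          using c by (intro ennreal_leI) (simp add: pos_divide_le_eq abs_minus_commute mult.commute)
      qed
    qed
    finally show ?thesis by (simp add: mult_left_mono)
  qed
  have l': "(\<lambda>n. \<integral>\<^sup>+t. ennreal (norm (L (w n t) - L (u t))) \<partial>I) \<longlonglongrightarrow> 0"
  proof (rule tendsto_sandwich[OF _ _ tendsto_const])
    have "(\<lambda>n. ennreal c * (\<integral>\<^sup>+ t. ennreal (N (u t - w n t)) \<partial>I)) \<longlonglongrightarrow> ennreal c * 0"
      by (intro ennreal_tendsto_cmult l) simp
    then show "(\<lambda>n. ennreal c * (\<integral>\<^sup>+ t. ennreal (N (u t - w n t)) \<partial>I)) \<longlonglongrightarrow> 0" by simp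
  qed (use b in \<open>auto intro!: always_eventually\<close>)
  then have "\<forall>\<^sub>F n in sequentially. (\<integral>\<^sup>+t. ennreal (norm (L (w n t) - L (u t))) \<partial>I) < 1"
    by (rule order_tendstoD) simp
  then obtain n where n: "(\<integral>\<^sup>+t. ennreal (norm (L (w n t) - L (u t))) \<partial>I) < 1"
    by (auto dest: eventually_happens)
  have "integrable I (\<lambda>t. L (w n t) - L (u t))"
  proof (rule integrableI_bounded)
    show "(\<lambda>t. L (w n t) - L (u t)) \<in> borel_measurable I" using um ws(1)[of n] by auto
    show "(\<integral>\<^sup>+t. ennreal (norm (L (w n t) - L (u t))) \<partial>I) < \<infinity>" using n order.strict_trans by fastforce
  qed
  from Bochner_Integration.integrable_diff[OF ws(1)[of n] this]
  show ui: "integrable I (\<lambda>t. L (u t))" by simp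
  have "(\<lambda>n. LINT t|I. L (w n t)) \<longlonglongrightarrow> (LINT t|I. L (u t))"
    by (rule tendsto_L1_int[OF ws(1) ui l'])
  moreover have "(\<lambda>n. L (simple_integral T (w n)) - L y) \<longlonglongrightarrow> 0"
  proof (rule tendsto_rabs_zero_cancel, rule tendsto_sandwich[OF _ _ tendsto_const])
    show "(\<lambda>n. c * N (simple_integral T (w n) - y)) \<longlonglongrightarrow> 0" using tendsto_mult_left[OF ly, of c] by simp
    show "\<forall>\<^sub>F n in sequentially. \<bar>L (simple_integral T (w n)) - L y\<bar> \<le> c * N (simple_integral T (w n) - y)"
      using L_diff_bound[OF ws(3) y] by (intro always_eventually allI)
  qed (intro always_eventually allI abs_ge_zero)
  then have "(\<lambda>n. LINT t|I. L (w n t)) \<longlonglongrightarrow> L y"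
    unfolding ws(2) by (rule LIM_zero_cancel)
  ultimately show "(LINT t|I. L (u t)) = L y" by (rule LIMSEQ_unique)
qed

lemma L_L2_time:
  assumes "L2_time T X N u"
  shows "integrable I (\<lambda>t. L (u t))"
proof -
  have sm: "strongly_measurable T X N u" and fin: "(\<integral>\<^sup>+ t. ennreal ((N (u t))\<^sup>2) \<partial>I) < \<infinity>"
    using assms by (auto simp: L2_time_def)
  have um: "(\<lambda>t. L (u t)) \<in> borel_measurable I" by (rule L_measurable[OF sm])
  have uX: "AE t in I. u t \<in> X" using sm by (simp add: strongly_measurable_def)
  have "(\<integral>\<^sup>+t. ennreal ((L (u t) / c)\<^sup>2) \<partial>I) \<le> (\<integral>\<^sup>+ t. ennreal ((N (u t))\<^sup>2) \<partial>I)"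
  proof (rule nn_integral_mono_AE)
    show "AE t in I. ennreal ((L (u t) / c)\<^sup>2) \<le> ennreal ((N (u t))\<^sup>2)"
      using uX
    proof eventually_elim
      fix t assume "u t \<in> X"
      then have "\<bar>L (u t) / c\<bar> \<le> N (u t)"
        using bound[of "u t"] c by (simp add: abs_divide pos_divide_le_eq mult.commute)
      then have "\<bar>L (u t) / c\<bar>\<^sup>2 \<le> (N (u t))\<^sup>2" by (rule power_mono) simp
      then show "ennreal ((L (u t) / c)\<^sup>2) \<le> ennreal ((N (u t))\<^sup>2)"
        by (intro ennreal_leI) (simp only: power2_abs)
    qed
  qed
  then have "(\<integral>\<^sup>+t. ennreal (norm ((L (u t) / c)\<^sup>2)) \<partial>I) < \<infinity>" using fin by auto
  then have sq: "integrable I (\<lambda>t. (L (u t) / c)\<^sup>2)"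
    using um by (intro integrableI_bounded) auto
  have "integrable I (\<lambda>t. c * (1 + (L (u t) / c)\<^sup>2))" using sq by simp
  then show ?thesis
  proof (rule Bochner_Integration.integrable_bound[OF _ um], intro AE_I2)
    fix t
    define x where "x = \<bar>L (u t) / c\<bar>"
    have "0 \<le> (x - 1)\<^sup>2" by simp
    then have "2 * x \<le> 1 + x\<^sup>2" by (simp add: power2_eq_square algebra_simps)
    moreover have "0 \<le> x" by (simp add: x_def)
    ultimately have "x \<le> 1 + x\<^sup>2" by linarith
    then have "c * x \<le> c * (1 + x\<^sup>2)" using c by simp
    moreover have "c * x = norm (L (u t))" using c by (simp add: x_def abs_divide)
    moreover have "x\<^sup>2 = (L (u t) / c)\<^sup>2" by (simp add: x_def power_divide)
    ultimately show "norm (L (u t)) \<le> norm (c * (1 + (L (u t) / c)\<^sup>2))" using c by simp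
  qed
qed

end

section \<open>Weak derivatives of scalar functions\<close>

text \<open>A smooth monotone step: zero on the left of \<open>-1\<close> and one on the right of \<open>1\<close>. The outer bump
  vanishes as long as \<open>bump (1 - x)\<close> is at least \<open>bump 2\<close>, and the inner one vanishes from \<open>1\<close> on.\<close>

definition ramp :: "real \<Rightarrow> real" where
  "ramp x = bump (bump 2 - bump (1 - x)) / bump (bump 2)"

lemma bump_2_pos: "bump 2 > 0" "bump (bump 2) > 0"
  by (simp_all add: bump_pos)

lemma ramp_smooth: "smooth f \<Longrightarrow> smooth (\<lambda>x. ramp (f x))"
proof -
  assume "smooth f"
  then have "smooth (\<lambda>x. (1 / bump (bump 2)) * bump (bump 2 - bump (1 - f x)))"
    by (intro smooth_cmult smooth_bump smooth_diff smooth_const)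
  then show ?thesis by (simp add: ramp_def)
qed

lemma ramp_left: "x \<le> -1 \<Longrightarrow> ramp x = 0"
  using bump_mono[of 2 "1 - x"] by (simp add: ramp_def bump_zero)

lemma ramp_right: "1 \<le> x \<Longrightarrow> ramp x = 1"
  using bump_2_pos bump_zero[of "1 - x"] by (simp add: ramp_def)

lemma ramp_mono: "x \<le> y \<Longrightarrow> ramp x \<le> ramp y"
  unfolding ramp_def using bump_2_pos by (intro divide_right_mono bump_mono diff_left_mono) auto

lemma ramp_bounds: "0 \<le> ramp x" "ramp x \<le> 1"
  using ramp_mono[of "min x (-1)" x] ramp_left[of "min x (-1)"] ramp_mono[of x "max x 1"] ramp_right[of "max x 1"]
  by auto

lemma indicator_measurable_interval:
  "(\<lambda>t::real. indicat_real {a<..<b} t) \<in> borel_measurable (lebesgue_on {0<..<T})"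
  by (rule measurable_restrict_space1, rule borel_measurable_indicator) simp

lemma indicator_integrable_mult:
  fixes f :: "real \<Rightarrow> real"
  assumes "integrable (lebesgue_on {0<..<T}) f"
  shows "integrable (lebesgue_on {0<..<T}) (\<lambda>t. indicator {a<..<b} t * f t)"
proof (rule Bochner_Integration.integrable_bound[OF assms])
  show "(\<lambda>t. indicator {a<..<b} t * f t) \<in> borel_measurable (lebesgue_on {0<..<T})"
    using assms indicator_measurable_interval by auto
qed (auto simp: indicator_def)

lemma indicator_integral_diff:
  fixes G :: "real \<Rightarrow> real"
  assumes G: "integrable (lebesgue_on {0<..<T}) G" and ab: "0 \<le> a" "a \<le> b"
  shows "(LINT t|lebesgue_on {0<..<T}. indicator {a<..<b} t * G t) =
    (LINT t|lebesgue_on {0<..<T}. indicator {0<..<b} t * G t) -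
    (LINT t|lebesgue_on {0<..<T}. indicator {0<..<a} t * G t)"
proof -
  let ?I = "lebesgue_on {0<..<T}"
  have "(LINT t|?I. indicator {0<..<b} t * G t) - (LINT t|?I. indicator {0<..<a} t * G t)
      = (LINT t|?I. indicator {0<..<b} t * G t - indicator {0<..<a} t * G t)"
    by (rule Bochner_Integration.integral_diff[symmetric]) (intro indicator_integrable_mult G)+
  also have "\<dots> = (LINT t|?I. indicator {a<..<b} t * G t)"
  proof (rule integral_cong_AE)
    have "AE x in lebesgue. x \<noteq> a" by (rule AE_completion[OF AE_lborel_singleton])
    then have "AE x in ?I. x \<noteq> a" by (subst AE_restrict_space_iff) (auto elim: eventually_mono)
    then show "AE t in ?I. indicator {0<..<b} t * G t - indicator {0<..<a} t * G t = indicator {a<..<b} t * G t"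
      by eventually_elim (use ab in \<open>auto simp: indicator_def\<close>)
    show "(\<lambda>t. indicator {0<..<b} t * G t - indicator {0<..<a} t * G t) \<in> borel_measurable ?I"
      using indicator_integrable_mult[OF G] by (intro borel_measurable_diff) auto
    show "(\<lambda>t. indicator {a<..<b} t * G t) \<in> borel_measurable ?I"
      using indicator_integrable_mult[OF G] by auto
  qed
  finally show ?thesis by simp
qed

lemma smooth_real_deriv:
  fixes f :: "real \<Rightarrow> real"
  assumes "smooth f"
  shows "(f has_real_derivative deriv f x) (at x)" "continuous_on UNIV (deriv f)"
proof -
  have d: "(f has_real_derivative frechet_derivative f (at x) 1) (at x)" for x
  proof -
    have D: "(f has_derivative frechet_derivative f (at x)) (at x)" by (rule smooth_has_derivative[OF assms])
    have "frechet_derivative f (at x) (h *\<^sub>R 1) = h *\<^sub>R frechet_derivative f (at x) 1" for h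
      by (rule linear_scale[OF has_derivative_linear[OF D]])
    then have "frechet_derivative f (at x) = (*) (frechet_derivative f (at x) 1)"
      unfolding real_scaleR_def mult_1_right by (intro ext) (metis mult.commute)
    with D show ?thesis by (simp only: has_field_derivative_def)
  qed
  then have e: "deriv f = (\<lambda>x. frechet_derivative f (at x) 1)" by (auto intro!: DERIV_imp_deriv)
  show "(f has_real_derivative deriv f x) (at x)" using d e by simp
  show "continuous_on UNIV (deriv f)" unfolding e by (rule smooth_imp_continuous[OF smooth_frechet[OF assms]])
qed

lemma integral_deriv_interval:
  fixes f :: "real \<Rightarrow> real"
  assumes f: "smooth f" and T: "0 \<le> T"
  shows "(LINT t|lebesgue_on {0<..<T}. deriv f t) = f T - f 0" "integrable (lebesgue_on {0<..<T}) (deriv f)"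
proof -
  note d = smooth_real_deriv[OF f]
  have m [measurable]: "deriv f \<in> borel_measurable borel" by (rule borel_measurable_continuous_onI[OF d(2)])
  have "(LINT t|lebesgue_on {0<..<T}. deriv f t) = (LINT t|lebesgue. indicator {0<..<T} t *\<^sub>R deriv f t)"
    by (rule integral_restrict_space) simp
  also have "\<dots> = (LINT t|lborel. indicator {0<..<T} t *\<^sub>R deriv f t)"
    by (rule integral_completion) simp
  also have "\<dots> = (LINT t|lborel. deriv f t * indicator {0..T} t)"
  proof (rule integral_cong_AE)
    show "AE t in lborel. indicator {0<..<T} t *\<^sub>R deriv f t = deriv f t * indicator {0..T} t"
      using AE_lborel_singleton[of 0] AE_lborel_singleton[of T]
      by eventually_elim (auto simp: indicator_def)
  qed auto
  also have "\<dots> = f T - f 0"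
    by (rule integral_FTC_Icc_real[OF T]) (use d in \<open>auto simp: continuous_on_eq_continuous_at\<close>)
  finally show "(LINT t|lebesgue_on {0<..<T}. deriv f t) = f T - f 0" .
  have "integrable lborel (\<lambda>t. indicator {0..T} t *\<^sub>R deriv f t)"
    by (rule borel_integrable_compact[OF compact_Icc continuous_on_subset[OF d(2)]]) auto
  then have "integrable lborel (\<lambda>t. indicator {0<..<T} t *\<^sub>R deriv f t)"
    by (rule Bochner_Integration.integrable_bound) (auto simp: indicator_def)
  then have "integrable lebesgue (\<lambda>t. indicator {0<..<T} t *\<^sub>R deriv f t)"
    by (subst integrable_completion) auto
  then show "integrable (lebesgue_on {0<..<T}) (deriv f)"
    by (subst integrable_restrict_space) auto
qed

text \<open>A rescaled step has the derivative of an approximate identity.\<close>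

lemma ramp_derivative_approximates_point_value:
  fixes u :: "real \<Rightarrow> real"
  assumes u: "continuous_on {0..T} u" and a: "0 < a" "a < T"
  shows "(\<lambda>n. LINT t|lebesgue_on {0<..<T}. deriv (\<lambda>x. ramp (real n * (x - a))) t * u t) \<longlonglongrightarrow> u a"
proof (rule LIMSEQ_I)
  fix r :: real assume "r > 0"
  define e where "e = r / 2"
  have e: "e > 0" using \<open>r > 0\<close> by (simp add: e_def)
  have "continuous (at a within {0..T}) u" using u a by (auto simp: continuous_on_eq_continuous_within)
  then obtain d where d: "d > 0" "\<And>x. x \<in> {0..T} \<Longrightarrow> dist x a < d \<Longrightarrow> dist (u x) (u a) < e"
    using e unfolding continuous_within_eps_delta by metis
  define d' where "d' = min (d / 2) (min a (T - a))"
  have d': "d' > 0" using d a by (simp add: d'_def)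
  obtain n0 :: nat where n0: "1 / d' < real n0" using reals_Archimedean2 by blast
  have um: "u \<in> borel_measurable (lebesgue_on {0<..<T})"
    by (rule continuous_imp_measurable_on_sets_lebesgue[OF continuous_on_subset[OF u]]) auto
  obtain b where "\<forall>y\<in>u ` {0..T}. norm y \<le> b"
    using compact_imp_bounded[OF compact_continuous_image[OF u compact_Icc]] unfolding bounded_iff by blast
  then have b: "\<bar>u x\<bar> \<le> b" if "x \<in> {0..T}" for x using that by simp
  interpret finite_measure "lebesgue_on {0<..<T}" by (rule finite_interval_measure)
  show "\<exists>no. \<forall>n\<ge>no. norm ((LINT t|lebesgue_on {0<..<T}. deriv (\<lambda>x. ramp (real n * (x - a))) t * u t) - u a) < r"
  proof (intro exI allI impI)
    fix n assume "n0 \<le> n"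
    then have n: "1 / d' < real n" using n0 by linarith
    then have n0: "real n > 0" using d' by (smt (verit) divide_pos_pos)
    define p where "p x = ramp (real n * (x - a))" for x
    have ps: "smooth p"
      unfolding p_def
      by (intro ramp_smooth smooth_cmult smooth_diff smooth_const smooth_bounded_linear bounded_linear_ident)
    note pd = smooth_real_deriv[OF ps]
    have nd: "1 < real n * d'" using n d' by (simp add: field_simps)
    have p0: "p 0 = 0" "p T = 1"
    proof -
      have "real n * d' \<le> real n * a" "real n * d' \<le> real n * (T - a)" using n0 by (auto simp: d'_def)
      then show "p 0 = 0" "p T = 1" using nd by (auto simp: p_def intro!: ramp_left ramp_right)
    qed
    have pos: "deriv p x \<ge> 0" for x
    proof (rule ccontr)
      assume "\<not> deriv p x \<ge> 0"
      then obtain \<delta> where "\<delta> > 0" "\<forall>h>0. h < \<delta> \<longrightarrow> p (x + h) < p x"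
        using DERIV_neg_dec_right[OF pd(1)[of x]] by auto
      then have "p (x + \<delta> / 2) < p x" by simp
      moreover have "p x \<le> p (x + \<delta> / 2)" unfolding p_def using n0 \<open>\<delta> > 0\<close> by (intro ramp_mono mult_left_mono) auto
      ultimately show False by simp
    qed
    have zero: "deriv p x = 0" if "\<bar>x - a\<bar> > d'" for x
    proof -
      have op: "open {x. \<bar>x - a\<bar> > d'}" by (intro open_Collect_less continuous_intros)
      have "p y = (if y > a then 1 else 0)" if "\<bar>y - a\<bar> > d'" for y
      proof (cases "y > a")
        case True
        then have "real n * d' \<le> real n * (y - a)" using that n0 by (intro mult_left_mono) auto
        then show ?thesis using True nd by (simp add: p_def ramp_right)
      next
        case False
        then have "real n * (y - a) \<le> real n * (- d')" using that n0 by (intro mult_left_mono) auto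
        then show ?thesis using False nd by (simp add: p_def ramp_left)
      qed
      note pc = this
      have "\<exists>k. \<forall>\<^sub>F y in nhds x. p y = k"
      proof (cases "x > a")
        case True
        have "open ({x. \<bar>x - a\<bar> > d'} \<inter> {a<..})" using op by auto
        then have "\<forall>\<^sub>F y in nhds x. y \<in> {x. \<bar>x - a\<bar> > d'} \<inter> {a<..}"
          using True that by (intro eventually_nhds_in_open) auto
        then have "\<forall>\<^sub>F y in nhds x. p y = 1" by eventually_elim (use pc in auto)
        then show ?thesis by blast
      next
        case False
        have "open ({x. \<bar>x - a\<bar> > d'} \<inter> {..<a})" using op by auto
        moreover have "x < a" using False that d' by (cases "x = a") auto
        ultimately have "\<forall>\<^sub>F y in nhds x. y \<in> {x. \<bar>x - a\<bar> > d'} \<inter> {..<a}"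
          using that by (intro eventually_nhds_in_open) auto
        then have "\<forall>\<^sub>F y in nhds x. p y = 0" by eventually_elim (use pc in auto)
        then show ?thesis by blast
      qed
      then obtain k where "\<forall>\<^sub>F y in nhds x. p y = k" ..
      then have "(p has_real_derivative 0) (at x)"
        by (subst DERIV_cong_ev[OF refl _ refl, of p "\<lambda>y. k"]) auto
      then show ?thesis by (rule DERIV_imp_deriv)
    qed
    note pint = integral_deriv_interval[OF ps, of T]
    have pi: "integrable (lebesgue_on {0<..<T}) (deriv p)" and pv: "(LINT t|lebesgue_on {0<..<T}. deriv p t) = 1"
      using pint a p0 by auto
    have pu: "integrable (lebesgue_on {0<..<T}) (\<lambda>t. deriv p t * u t)"
    proof (rule Bochner_Integration.integrable_bound)
      show "integrable (lebesgue_on {0<..<T}) (\<lambda>t. deriv p t * b)" using pi by simp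
      show "(\<lambda>t. deriv p t * u t) \<in> borel_measurable (lebesgue_on {0<..<T})" using pi um by auto
      show "AE t in lebesgue_on {0<..<T}. norm (deriv p t * u t) \<le> norm (deriv p t * b)"
      proof (intro AE_I2)
        fix t assume "t \<in> space (lebesgue_on {0<..<T})"
        then have "\<bar>u t\<bar> \<le> b" using b by auto
        then show "norm (deriv p t * u t) \<le> norm (deriv p t * b)" by (auto simp: abs_mult intro!: mult_left_mono)
      qed
    qed
    have "(LINT t|lebesgue_on {0<..<T}. deriv p t * u t) - u a = (LINT t|lebesgue_on {0<..<T}. deriv p t * u t - deriv p t * u a)"
      using pu pi pv by simp
    also have "\<bar>\<dots>\<bar> \<le> (LINT t|lebesgue_on {0<..<T}. deriv p t * e)"
    proof (rule order_trans[OF integral_abs_bound], rule integral_mono)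
      show "integrable (lebesgue_on {0<..<T}) (\<lambda>t. \<bar>deriv p t * u t - deriv p t * u a\<bar>)" using pu pi by auto
      show "integrable (lebesgue_on {0<..<T}) (\<lambda>t. deriv p t * e)" using pi by auto
      fix t assume t: "t \<in> space (lebesgue_on {0<..<T})"
      show "\<bar>deriv p t * u t - deriv p t * u a\<bar> \<le> deriv p t * e"
      proof (cases "\<bar>t - a\<bar> > d'")
        case True
        then show ?thesis using zero by simp
      next
        case False
        then have "\<bar>t - a\<bar> < d" using d(1) by (simp add: d'_def)
        then have "\<bar>u t - u a\<bar> \<le> e" using d(2)[of t] t by (auto simp: dist_real_def)
        then have "deriv p t * \<bar>u t - u a\<bar> \<le> deriv p t * e" using pos by (intro mult_left_mono)
        then show ?thesis using pos[of t] by (simp add: right_diff_distrib[symmetric] abs_mult)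
      qed
    qed
    also have "\<dots> = e" using pv by simp
    finally show "norm ((LINT t|lebesgue_on {0<..<T}. deriv (\<lambda>x. ramp (real n * (x - a))) t * u t) - u a) < r"
      using e by (simp add: p_def[abs_def, symmetric] e_def)
  qed
qed

text \<open>Test with \<open>\<eta>\<close> a smooth approximation of the indicator of the interval, namely the difference of two
  steepening ramps. The integral against \<open>\<eta>\<close> converges to that of \<open>v\<close> over the interval, and the
  integral against the derivative of \<open>\<eta>\<close> picks the values of \<open>u\<close> at the end points. End points on the
  boundary are reached by continuity.\<close>

lemma du_bois_reymond:
  fixes u v :: "real \<Rightarrow> real"
  assumes u: "continuous_on {0..T} u" and v: "integrable (lebesgue_on {0<..<T}) v"
    and w: "\<And>\<eta>. test_function {0<..<T} \<eta> \<Longrightarrow>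
      (LINT t|lebesgue_on {0<..<T}. deriv \<eta> t * u t) = - (LINT t|lebesgue_on {0<..<T}. \<eta> t * v t)"
    and ab: "0 \<le> a" "a \<le> b" "b \<le> T"
  shows "u b - u a = (LINT t|lebesgue_on {0<..<T}. indicator {a<..<b} t * v t)"
proof -
  let ?I = "lebesgue_on {0<..<T}"
  have vm: "v \<in> borel_measurable ?I" using v by auto
  have um: "u \<in> borel_measurable ?I"
    by (rule continuous_imp_measurable_on_sets_lebesgue[OF continuous_on_subset[OF u]]) auto
  obtain B where "\<forall>y\<in>u ` {0..T}. norm y \<le> B"
    using compact_imp_bounded[OF compact_continuous_image[OF u compact_Icc]] unfolding bounded_iff by blast
  then have B: "\<bar>u x\<bar> \<le> B" if "x \<in> {0..T}" for x using that by simp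
  note ind = indicator_measurable_interval
  have inner: "u b - u a = (LINT t|?I. indicator {a<..<b} t * v t)" if ab: "0 < a" "a < b" "b < T" for a b
  proof -
    define p where "p c n x = ramp (real n * (x - c))" for c n x
    have ps: "smooth (p c n)" for c n
      unfolding p_def
      by (intro ramp_smooth smooth_cmult smooth_diff smooth_const smooth_bounded_linear bounded_linear_ident)
    define \<eta> where "\<eta> n x = p a n x - p b n x" for n x
    have \<eta>s: "smooth (\<eta> n)" for n unfolding \<eta>_def by (intro smooth_diff ps)
    have l1: "(\<lambda>n. LINT t|?I. \<eta> n t * v t) \<longlonglongrightarrow> (LINT t|?I. indicator {a<..<b} t * v t)"
    proof (rule integral_dominated_convergence[where w="\<lambda>t. \<bar>v t\<bar>"])
      show "AE t in ?I. (\<lambda>n. \<eta> n t * v t) \<longlonglongrightarrow> indicator {a<..<b} t * v t"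
      proof -
        have pl: "(\<lambda>n. p c n t) \<longlonglongrightarrow> indicator {c<..} t" if "t \<noteq> c" for t c
        proof -
          obtain n0 :: nat where n0: "1 / \<bar>t - c\<bar> < real n0" using reals_Archimedean2 by blast
          have "p c n t = indicator {c<..} t" if "n \<ge> n0" for n
          proof -
            have "1 / \<bar>t - c\<bar> < real n" using n0 that by linarith
            then have "1 < real n * \<bar>t - c\<bar>" using \<open>t \<noteq> c\<close> by (simp add: field_simps)
            then show ?thesis using \<open>t \<noteq> c\<close>
              by (cases "t > c") (auto simp: p_def intro!: ramp_left ramp_right simp: algebra_simps)
          qed
          then show ?thesis by (intro tendsto_eventually eventually_sequentiallyI[of n0])
        qed
        have "AE t in lebesgue. t \<noteq> a \<and> t \<noteq> b"
          using AE_completion[OF AE_lborel_singleton[of a]] AE_completion[OF AE_lborel_singleton[of b]]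
          by eventually_elim simp
        then have "AE t in ?I. t \<noteq> a \<and> t \<noteq> b" by (subst AE_restrict_space_iff) (auto elim: eventually_mono)
        then show ?thesis
        proof eventually_elim
          fix t assume t: "t \<noteq> a \<and> t \<noteq> b"
          have "(\<lambda>n. \<eta> n t * v t) \<longlonglongrightarrow> (indicator {a<..} t - indicator {b<..} t) * v t"
            unfolding \<eta>_def using t by (intro tendsto_intros pl) auto
          moreover have "indicator {a<..} t - indicator {b<..} t = indicat_real {a<..<b} t"
            using t ab by (auto simp: indicator_def)
          ultimately show "(\<lambda>n. \<eta> n t * v t) \<longlonglongrightarrow> indicator {a<..<b} t * v t" by simp
        qed
      qed
      show "AE t in ?I. norm (\<eta> n t * v t) \<le> \<bar>v t\<bar>" for n
      proof (intro AE_I2)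
        fix t
        have "\<bar>\<eta> n t\<bar> \<le> 1" using ramp_bounds[of "real n * (t - a)"] ramp_bounds[of "real n * (t - b)"]
          by (simp add: \<eta>_def p_def abs_le_iff)
        then show "norm (\<eta> n t * v t) \<le> \<bar>v t\<bar>"
          by (simp add: abs_mult mult_left_le_one_le)
      qed
      have "\<eta> n \<in> borel_measurable ?I" for n
        by (rule continuous_imp_measurable_on_sets_lebesgue[OF smooth_imp_continuous[OF \<eta>s]]) auto
      then show "(\<lambda>t. \<eta> n t * v t) \<in> borel_measurable ?I" for n using vm by auto
      show "(\<lambda>t. indicator {a<..<b} t * v t) \<in> borel_measurable ?I" using vm ind by auto
    qed (use v in auto)
    have pi: "integrable ?I (\<lambda>t. deriv (p c n) t * u t)" for c n
    proof (rule Bochner_Integration.integrable_bound)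
      have i: "integrable ?I (deriv (p c n))" using integral_deriv_interval(2)[OF ps, of T c n] ab by simp
      then show "integrable ?I (\<lambda>t. deriv (p c n) t * B)" by simp
      show "(\<lambda>t. deriv (p c n) t * u t) \<in> borel_measurable ?I" using i um by auto
      show "AE t in ?I. norm (deriv (p c n) t * u t) \<le> norm (deriv (p c n) t * B)"
      proof (intro AE_I2)
        fix t assume "t \<in> space ?I"
        then have "\<bar>u t\<bar> \<le> B" using B by auto
        then show "norm (deriv (p c n) t * u t) \<le> norm (deriv (p c n) t * B)" by (auto simp: abs_mult intro!: mult_left_mono)
      qed
    qed
    have d\<eta>: "deriv (\<eta> n) t = deriv (p a n) t - deriv (p b n) t" for n t
    proof -
      have "((\<lambda>x. p a n x - p b n x) has_real_derivative deriv (p a n) t - deriv (p b n) t) (at t)"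
        by (intro DERIV_diff smooth_real_deriv ps)
      then show ?thesis unfolding \<eta>_def[abs_def] by (rule DERIV_imp_deriv)
    qed
    have "(\<lambda>n. (LINT t|?I. deriv (p a n) t * u t) - (LINT t|?I. deriv (p b n) t * u t)) \<longlonglongrightarrow> u a - u b"
      unfolding p_def using ab by (intro tendsto_diff ramp_derivative_approximates_point_value[OF u]) auto
    moreover have "(LINT t|?I. deriv (p a n) t * u t) - (LINT t|?I. deriv (p b n) t * u t) = (LINT t|?I. deriv (\<eta> n) t * u t)" for n
      using pi by (simp add: d\<eta> left_diff_distrib)
    ultimately have l2: "(\<lambda>n. LINT t|?I. deriv (\<eta> n) t * u t) \<longlonglongrightarrow> u a - u b" by simp
    \<comment> \<open>for large \<open>n\<close> the ramps are constant beyond distance \<open>d\<close> of their centres\<close>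
    define d where "d = min a (T - b) / 2"
    have d: "d > 0" "d < a" "d < T - b" using ab by (auto simp: d_def min_def)
    obtain n0 :: nat where n0: "1 / d < real n0" using reals_Archimedean2 by blast
    have "test_function {0<..<T} (\<eta> n)" if "n \<ge> n0" for n
    proof -
      have "1 / d < real n" using n0 that by linarith
      then have nd: "1 < real n * d" using d by (simp add: field_simps)
      then have n: "real n > 0" by (cases n) auto
      have "\<eta> n x = 0" if "x \<notin> {a - d..b + d}" for x
      proof (cases "x < a - d")
        case True
        then have "real n * (x - a) \<le> real n * (- d)" "real n * (x - b) \<le> real n * (- d)"
          using ab n by (intro mult_left_mono; simp)+
        then show ?thesis using nd by (simp add: \<eta>_def p_def ramp_left)
      next
        case False
        then have "real n * d \<le> real n * (x - a)" "real n * d \<le> real n * (x - b)"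
          using that ab n by (auto intro!: mult_left_mono)
        then show ?thesis using nd by (simp add: \<eta>_def p_def ramp_right)
      qed
      moreover have "{a - d..b + d} \<subseteq> {0<..<T}" using d by auto
      ultimately show ?thesis unfolding test_function_def using \<eta>s compact_Icc by blast
    qed
    then have "\<forall>\<^sub>F n in sequentially. (LINT t|?I. deriv (\<eta> n) t * u t) = - (LINT t|?I. \<eta> n t * v t)"
      using w by (intro eventually_sequentiallyI[of n0]) auto
    then have "(\<lambda>n. - (LINT t|?I. \<eta> n t * v t)) \<longlonglongrightarrow> u a - u b"
      using l2 by (rule Lim_transform_eventually[rotated])
    from LIMSEQ_unique[OF this tendsto_minus[OF l1]] show ?thesis by simp
  qed
  show ?thesis
  proof (cases "a = b")
    case True
    then show ?thesis by simp
  next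
    case False
    then have ab': "a < b" using ab by simp
    define h where "h n = (b - a) / (3 * real (Suc n))" for n
    have h0: "h n > 0" "2 * h n < b - a" for n
    proof -
      show "h n > 0" using ab' by (simp add: h_def)
      have "h n = (b - a) / real (Suc n) / 3" by (simp only: h_def divide_divide_eq_left mult.commute)
      moreover have "3 * (x / 3) = x" for x :: real by simp
      ultimately have "3 * h n = (b - a) / real (Suc n)" by (simp only:)
      also have "\<dots> \<le> (b - a) / 1" using ab' by (intro frac_le) auto
      finally have "3 * h n \<le> b - a" by simp
      then show "2 * h n < b - a" using \<open>h n > 0\<close> by linarith
    qed
    have hl: "h \<longlonglongrightarrow> 0"
    proof -
      have "(\<lambda>n. (b - a) / 3 * (1 / real (Suc n))) \<longlonglongrightarrow> (b - a) / 3 * 0"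
        by (intro tendsto_mult_left LIMSEQ_Suc[OF lim_1_over_n])
      moreover have "h = (\<lambda>n. (b - a) / 3 * (1 / real (Suc n)))"
        unfolding h_def by (rule ext) simp
      ultimately show ?thesis by simp
    qed
    have eq: "u (b - h n) - u (a + h n) = (LINT t|?I. indicator {a + h n<..<b - h n} t * v t)" for n
      using h0[of n] ab by (intro inner) auto
    have lb: "(\<lambda>n. b - h n) \<longlonglongrightarrow> b" using tendsto_diff[OF tendsto_const[of b] hl] by simp
    have la: "(\<lambda>n. a + h n) \<longlonglongrightarrow> a" using tendsto_add[OF tendsto_const[of a] hl] by simp
    have ul: "(\<lambda>n. u (f n)) \<longlonglongrightarrow> u x" if "f \<longlonglongrightarrow> x" "x \<in> {0..T}" "\<And>n. f n \<in> {0..T}" for f :: "nat \<Rightarrow> real" and x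
      using continuous_on_tendsto_compose[OF u that(1,2)] that(3) by simp
    have "(\<lambda>n. u (b - h n) - u (a + h n)) \<longlonglongrightarrow> u b - u a"
    proof (intro tendsto_diff ul lb la)
      fix n show "b - h n \<in> {0..T}" "a + h n \<in> {0..T}" using h0[of n] ab by auto
    qed (use ab in auto)
    moreover have "(\<lambda>n. LINT t|?I. indicator {a + h n<..<b - h n} t * v t) \<longlonglongrightarrow> (LINT t|?I. indicator {a<..<b} t * v t)"
    proof (rule integral_dominated_convergence[where w="\<lambda>t. \<bar>v t\<bar>"])
      show "AE t in ?I. (\<lambda>n. indicator {a + h n<..<b - h n} t * v t) \<longlonglongrightarrow> indicator {a<..<b} t * v t"
      proof (intro AE_I2 tendsto_mult_right)
        fix t
        show "(\<lambda>n. indicat_real {a + h n<..<b - h n} t) \<longlonglongrightarrow> indicator {a<..<b} t"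
        proof (cases "t \<in> {a<..<b}")
          case True
          have "\<forall>\<^sub>F n in sequentially. a + h n < t" "\<forall>\<^sub>F n in sequentially. t < b - h n"
            using True order_tendstoD(2)[OF la, of t] order_tendstoD(1)[OF lb, of t] by auto
          then have "\<forall>\<^sub>F n in sequentially. indicat_real {a + h n<..<b - h n} t = indicator {a<..<b} t"
            by eventually_elim (use True in auto)
          then show ?thesis by (rule tendsto_eventually)
        next
          case False
          have "indicat_real {a + h n<..<b - h n} t = indicator {a<..<b} t" for n
            using False h0(1)[of n] by (auto simp: indicator_def)
          then show ?thesis by simp
        qed
      qed
      show "AE t in ?I. norm (indicator {a + h n<..<b - h n} t * v t) \<le> \<bar>v t\<bar>" for n
        by (intro AE_I2) (auto simp: indicator_def)
      show "(\<lambda>t. indicator {a + h n<..<b - h n} t * v t) \<in> borel_measurable ?I" for n using vm ind by auto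
      show "(\<lambda>t. indicator {a<..<b} t * v t) \<in> borel_measurable ?I" using vm ind by auto
    qed (use v in auto)
    ultimately show ?thesis unfolding eq by (rule LIMSEQ_unique)
  qed
qed

context tested_space
begin

lemma L_H1:
  assumes H: "H1_time T X N u u'"
  shows "integrable I (\<lambda>t. L (u' t))" "continuous_on {0..T} (\<lambda>t. L (u t))"
    "\<And>a b. 0 \<le> a \<Longrightarrow> a \<le> b \<Longrightarrow> b \<le> T \<Longrightarrow>
      L (u b) - L (u a) = (LINT t|I. indicator {a<..<b} t * L (u' t))"
proof -
  have u'2: "L2_time T X N u'" and wd: "weak_time_derivative T X N u u'"
    and uX: "\<And>t. t \<in> {0..T} \<Longrightarrow> u t \<in> X"
    and uc: "\<And>t. t \<in> {0..T} \<Longrightarrow> ((\<lambda>t'. N (u t' - u t)) \<longlongrightarrow> 0) (at t within {0..T})"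
    using H by (auto simp: H1_time_def)
  show i: "integrable I (\<lambda>t. L (u' t))" by (rule L_L2_time[OF u'2])
  have u'X: "AE t in I. u' t \<in> X" using u'2 by (simp add: L2_time_def strongly_measurable_def)
  show c: "continuous_on {0..T} (\<lambda>t. L (u t))"
    unfolding continuous_on_def
  proof
    fix t assume t: "t \<in> {0..T}"
    have "((\<lambda>t'. L (u t') - L (u t)) \<longlongrightarrow> 0) (at t within {0..T})"
    proof (rule tendsto_rabs_zero_cancel, rule tendsto_sandwich[OF _ _ tendsto_const])
      show "((\<lambda>t'. c * N (u t' - u t)) \<longlongrightarrow> 0) (at t within {0..T})"
        using tendsto_mult_left[OF uc[OF t], of c] by simp
      show "\<forall>\<^sub>F t' in at t within {0..T}. \<bar>L (u t') - L (u t)\<bar> \<le> c * N (u t' - u t)"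
        unfolding eventually_at_filter using L_diff_bound[OF uX uX[OF t]] by (intro always_eventually) auto
    qed (intro always_eventually allI abs_ge_zero)
    then show "((\<lambda>t. L (u t)) \<longlongrightarrow> L (u t)) (at t within {0..T})" by (rule LIM_zero_cancel)
  qed
  fix a b assume ab: "0 \<le> a" "a \<le> b" "b \<le> T"
  show "L (u b) - L (u a) = (LINT t|I. indicator {a<..<b} t * L (u' t))"
  proof (rule du_bois_reymond[OF c i _ ab])
    fix \<eta> assume \<eta>: "test_function {0<..<T} \<eta>"
    have s: "smooth \<eta>" using \<eta> by (rule test_function_smooth)
    have dm: "deriv \<eta> \<in> borel_measurable I"
      by (rule continuous_imp_measurable_on_sets_lebesgue[OF continuous_on_subset[OF smooth_real_deriv(2)[OF s]]]) auto
    have \<eta>m: "\<eta> \<in> borel_measurable I"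
      by (rule continuous_imp_measurable_on_sets_lebesgue[OF smooth_imp_continuous[OF s]]) auto
    obtain y where y: "bochner_integral_is T X N (\<lambda>t. deriv \<eta> t *\<^sub>R u t) y"
      "bochner_integral_is T X N (\<lambda>t. \<eta> t *\<^sub>R u' t) (- y)"
      using wd \<eta> unfolding weak_time_derivative_def by blast
    have yX: "y \<in> X" using y(1) by (simp add: bochner_integral_is_def)
    have "(LINT t|I. deriv \<eta> t * L (u t)) = (LINT t|I. L (deriv \<eta> t *\<^sub>R u t))"
      by (rule Bochner_Integration.integral_cong[OF refl]) (simp add: L_scale uX)
    also have "\<dots> = L y" by (rule L_bochner_integral(2)[OF y(1)])
    finally have 1: "(LINT t|I. deriv \<eta> t * L (u t)) = L y" .
    have "(LINT t|I. \<eta> t * L (u' t)) = (LINT t|I. L (\<eta> t *\<^sub>R u' t))"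
    proof (rule integral_cong_AE)
      show "AE t in I. \<eta> t * L (u' t) = L (\<eta> t *\<^sub>R u' t)"
        using u'X by eventually_elim (simp add: L_scale)
      show "(\<lambda>t. \<eta> t * L (u' t)) \<in> borel_measurable I" using \<eta>m i by auto
      show "(\<lambda>t. L (\<eta> t *\<^sub>R u' t)) \<in> borel_measurable I" using L_bochner_integral(1)[OF y(2)] by auto
    qed
    also have "\<dots> = L (- y)" by (rule L_bochner_integral(2)[OF y(2)])
    also have "\<dots> = - L y" using L_scale[OF yX, of "-1"] by simp
    finally show "(LINT t|I. deriv \<eta> t * L (u t)) = - (LINT t|I. \<eta> t * L (u' t))" using 1 by simp
  qed
qed

end

section \<open>Approximation of functionals\<close>

context lipschitz_phase
begin

lemma subspace_W_plus: "subspace (W_plus R)"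
proof (rule subspaceI)
  have comb: "a *\<^sub>R w + b *\<^sub>R w' \<in> W_plus R" if "w \<in> W_plus R" "w' \<in> W_plus R" for a b w w'
  proof -
    have "w \<in> W_space R" "w' \<in> W_space R" and ae: "AE p in D. w (reflect p) = w p" "AE p in D. w' (reflect p) = w' p"
      using that by (auto simp: W_plus_reflect)
    moreover have "AE p in D. (a *\<^sub>R w + b *\<^sub>R w') (reflect p) = (a *\<^sub>R w + b *\<^sub>R w') p"
      using ae by eventually_elim (simp add: scaleR_fun_def)
    ultimately show ?thesis unfolding W_plus_reflect by (intro conjI W_space_comb)
  qed
  show "0 \<in> W_plus R" by (rule W_plus_zero)
  show "x + y \<in> W_plus R" if "x \<in> W_plus R" "y \<in> W_plus R" for x y using comb[OF that, of 1 1] by simp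
  show "c *\<^sub>R x \<in> W_plus R" if "x \<in> W_plus R" for c x
    using comb[OF that that, of c 0] unfolding scaleR_zero_left add_0_right .
qed

lemma subspace_V_minus: "subspace (V_minus R)"
proof (rule subspaceI)
  show "0 \<in> V_minus R" by (rule V_minus_zero)
  fix x y c assume x: "x \<in> V_minus R"
  then have xa: "AE p in D. x (reflect p) = - x p" by (simp add: V_minus_reflect)
  then have "AE p in D. (c *\<^sub>R x) (reflect p) = - (c *\<^sub>R x) p"
    by eventually_elim (simp add: scaleR_fun_def)
  then show "c *\<^sub>R x \<in> V_minus R" unfolding V_minus_reflect using L2_space_scaleR[OF V_minus_L2[OF x]] by blast
  assume y: "y \<in> V_minus R"
  then have "AE p in D. y (reflect p) = - y p" by (simp add: V_minus_reflect)
  with xa have "AE p in D. (x + y) (reflect p) = - (x + y) p" by eventually_elim simp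
  then show "x + y \<in> V_minus R" unfolding V_minus_reflect using L2_space_add[OF V_minus_L2[OF x] V_minus_L2[OF y]] by blast
qed

text \<open>The action on \<open>x\<close> of the pair \<open>(w, v)\<close>. It extends to the dual space and can therefore be
  evaluated at time derivatives.\<close>

definition pairing :: "(phase \<Rightarrow> real) \<Rightarrow> (phase \<Rightarrow> real) \<Rightarrow> (phase \<Rightarrow> real) \<Rightarrow> real" where
  "pairing w v x = L2_inner D (even_part x) w + L2_inner D (odd_part x) v"

text \<open>Functionals in the closure of the pairings, with respect to the norm of functionals on \<open>WV\<close>.\<close>

definition dual_approximable :: "((phase \<Rightarrow> real) \<Rightarrow> real) \<Rightarrow> bool" where
  "dual_approximable l \<longleftrightarrow> (\<forall>\<epsilon>>0. \<exists>w\<in>W_plus R. \<exists>v\<in>V_minus R. \<forall>x\<in>WV. \<bar>l x - pairing w v x\<bar> \<le> \<epsilon> * WV_norm R x)"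

lemma pairing_comb:
  assumes "w \<in> L2_space D" "w' \<in> L2_space D" "v \<in> L2_space D" "v' \<in> L2_space D" "x \<in> L2_space D"
  shows "pairing (a *\<^sub>R w + b *\<^sub>R w') (a *\<^sub>R v + b *\<^sub>R v') x = a * pairing w v x + b * pairing w' v' x"
proof -
  have "L2_inner D (even_part x) (a *\<^sub>R w + b *\<^sub>R w') = a * L2_inner D (even_part x) w + b * L2_inner D (even_part x) w'"
    using L2_inner_comb_left[OF assms(1,2) even_part_L2[OF assms(5)]] by (simp add: L2_inner_commute)
  moreover have "L2_inner D (odd_part x) (a *\<^sub>R v + b *\<^sub>R v') = a * L2_inner D (odd_part x) v + b * L2_inner D (odd_part x) v'"
    using L2_inner_comb_left[OF assms(3,4) odd_part_L2[OF assms(5)]] by (simp add: L2_inner_commute)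
  ultimately show ?thesis by (simp add: pairing_def algebra_simps)
qed

lemma dual_approximable_comb:
  assumes l: "dual_approximable l" "dual_approximable l'"
  shows "dual_approximable (\<lambda>x. a * l x + b * l' x)"
  unfolding dual_approximable_def
proof (intro allI impI)
  fix \<epsilon> :: real assume "\<epsilon> > 0"
  define \<delta> where "\<delta> = \<epsilon> / (\<bar>a\<bar> + \<bar>b\<bar> + 1)"
  have \<delta>: "\<delta> > 0" "(\<bar>a\<bar> + \<bar>b\<bar>) * \<delta> \<le> \<epsilon>"
    using \<open>\<epsilon> > 0\<close> by (auto simp: \<delta>_def field_simps)
  obtain w v where wv: "w \<in> W_plus R" "v \<in> V_minus R" "\<And>x. x \<in> WV \<Longrightarrow> \<bar>l x - pairing w v x\<bar> \<le> \<delta> * WV_norm R x"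
    using l(1) \<delta>(1) unfolding dual_approximable_def by meson
  obtain w' v' where wv': "w' \<in> W_plus R" "v' \<in> V_minus R" "\<And>x. x \<in> WV \<Longrightarrow> \<bar>l' x - pairing w' v' x\<bar> \<le> \<delta> * WV_norm R x"
    using l(2) \<delta>(1) unfolding dual_approximable_def by meson
  show "\<exists>w\<in>W_plus R. \<exists>v\<in>V_minus R. \<forall>x\<in>WV. \<bar>a * l x + b * l' x - pairing w v x\<bar> \<le> \<epsilon> * WV_norm R x"
  proof (intro bexI ballI)
    fix x assume x: "x \<in> WV"
    have "a * l x + b * l' x - pairing (a *\<^sub>R w + b *\<^sub>R w') (a *\<^sub>R v + b *\<^sub>R v') x
        = a * (l x - pairing w v x) + b * (l' x - pairing w' v' x)"
      using pairing_comb[OF W_plus_L2[OF wv(1)] W_plus_L2[OF wv'(1)] V_minus_L2[OF wv(2)] V_minus_L2[OF wv'(2)] WV_L2(1)[OF x]]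
      by (simp add: algebra_simps)
    also have "\<bar>\<dots>\<bar> \<le> \<bar>a\<bar> * \<bar>l x - pairing w v x\<bar> + \<bar>b\<bar> * \<bar>l' x - pairing w' v' x\<bar>"
      by (rule order_trans[OF abs_triangle_ineq]) (simp add: abs_mult)
    also have "\<dots> \<le> \<bar>a\<bar> * (\<delta> * WV_norm R x) + \<bar>b\<bar> * (\<delta> * WV_norm R x)"
      using wv(3)[OF x] wv'(3)[OF x] by (intro add_mono mult_left_mono) auto
    also have "\<dots> = ((\<bar>a\<bar> + \<bar>b\<bar>) * \<delta>) * WV_norm R x" by (simp add: algebra_simps)
    also have "\<dots> \<le> \<epsilon> * WV_norm R x" using \<delta>(2) WV_norm_nonneg by (rule mult_right_mono)
    finally show "\<bar>a * l x + b * l' x - pairing (a *\<^sub>R w + b *\<^sub>R w') (a *\<^sub>R v + b *\<^sub>R v') x\<bar> \<le> \<epsilon> * WV_norm R x" .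
  qed (use wv wv' subspace_W_plus subspace_V_minus in \<open>auto intro!: subspace_add subspace_scale\<close>)
qed

lemma dual_approximable_limit:
  assumes "\<And>\<epsilon>. \<epsilon> > 0 \<Longrightarrow> \<exists>l'. dual_approximable l' \<and> (\<forall>x\<in>WV. \<bar>l x - l' x\<bar> \<le> \<epsilon> * WV_norm R x)"
  shows "dual_approximable l"
  unfolding dual_approximable_def
proof (intro allI impI)
  fix \<epsilon> :: real assume "\<epsilon> > 0"
  then have e: "\<epsilon> / 2 > 0" by simp
  obtain l' where l': "dual_approximable l'" "\<And>x. x \<in> WV \<Longrightarrow> \<bar>l x - l' x\<bar> \<le> \<epsilon> / 2 * WV_norm R x"
    using assms[OF e] by blast
  obtain w v where wv: "w \<in> W_plus R" "v \<in> V_minus R" "\<And>x. x \<in> WV \<Longrightarrow> \<bar>l' x - pairing w v x\<bar> \<le> \<epsilon> / 2 * WV_norm R x"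
    using l'(1) e unfolding dual_approximable_def by meson
  have "\<bar>l x - pairing w v x\<bar> \<le> \<epsilon> * WV_norm R x" if "x \<in> WV" for x
    using l'(2)[OF that] wv(3)[OF that] by linarith
  then show "\<exists>w\<in>W_plus R. \<exists>v\<in>V_minus R. \<forall>x\<in>WV. \<bar>l x - pairing w v x\<bar> \<le> \<epsilon> * WV_norm R x"
    using wv by blast
qed

lemma even_test_function:
  assumes t: "test_function (R \<times> UNIV) \<zeta>"
  shows "even_part \<zeta> \<in> W_plus R"
proof -
  have "test_function (R \<times> UNIV) (\<lambda>p. (1/2) * \<zeta> p + (1/2) * \<zeta> (reflect p))"
    by (intro test_function_add test_function_cmult test_function_reflect t)
  moreover have "(\<lambda>p. (1/2) * \<zeta> p + (1/2) * \<zeta> (reflect p)) = even_part \<zeta>"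
    by (auto simp: even_part_eq fun_eq_iff)
  ultimately have "even_part \<zeta> \<in> W_space R" by (simp only: test_function_in_W)
  then show ?thesis by (simp add: W_plus_reflect even_part_reflect)
qed

lemma inner_close:
  assumes "f \<in> L2_space M" "g \<in> L2_space M" "h \<in> L2_space M" "L2_norm M f \<le> N" "L2_norm M (g - h) \<le> \<epsilon>"
  shows "\<bar>L2_inner M f g - L2_inner M f h\<bar> \<le> \<epsilon> * N"
proof -
  have "\<bar>L2_inner M f g - L2_inner M f h\<bar> = \<bar>L2_inner M f (g - h)\<bar>"
    using assms by (simp add: L2_inner_diff_right)
  also have "\<dots> \<le> L2_norm M f * L2_norm M (g - h)"
    using assms by (intro L2_Cauchy_Schwarz L2_space_diff)
  also have "\<dots> \<le> N * \<epsilon>"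
    using assms(4,5) L2_norm_nonneg[of M f] L2_norm_nonneg[of M "g - h"] by (intro mult_mono) auto
  finally show ?thesis by (simp add: mult.commute)
qed

lemma dual_approximable_even:
  assumes g: "g \<in> L2_space D" shows "dual_approximable (\<lambda>x. L2_inner D (even_part x) g)"
  unfolding dual_approximable_def
proof (intro allI impI)
  fix \<epsilon> :: real assume "\<epsilon> > 0"
  then obtain \<zeta> where z: "test_function (R \<times> UNIV) \<zeta>" "L2_norm D (g - \<zeta>) < \<epsilon>"
    using test_dense_D[OF g] by blast
  have zL: "\<zeta> \<in> L2_space D" by (rule smooth_L2_D[OF test_function_smooth[OF z(1)]])
  show "\<exists>w\<in>W_plus R. \<exists>v\<in>V_minus R. \<forall>x\<in>WV. \<bar>L2_inner D (even_part x) g - pairing w v x\<bar> \<le> \<epsilon> * WV_norm R x"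
  proof (intro bexI ballI)
    fix x assume x: "x \<in> WV"
    have "pairing (even_part \<zeta>) 0 x = L2_inner D (even_part x) \<zeta>"
      using L2_inner_even_left[OF WV_L2(1)[OF x] zL] by (simp add: pairing_def)
    then show "\<bar>L2_inner D (even_part x) g - pairing (even_part \<zeta>) 0 x\<bar> \<le> \<epsilon> * WV_norm R x"
      using inner_close[OF WV_L2(2)[OF x] g zL WV_norm_bounds(1), of \<epsilon>] z(2) by simp
  qed (rule even_test_function[OF z(1)] V_minus_zero)+
qed

lemma dual_approximable_odd:
  assumes g: "g \<in> L2_space D" shows "dual_approximable (\<lambda>x. L2_inner D (odd_part x) g)"
  unfolding dual_approximable_def
proof (intro allI impI bexI ballI)
  fix \<epsilon> :: real and x assume "\<epsilon> > 0" and x: "x \<in> WV"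
  have "pairing 0 (odd_part g) x = L2_inner D (odd_part x) g"
    using L2_inner_odd_left[OF WV_L2(1)[OF x] g] by (simp add: pairing_def)
  then show "\<bar>L2_inner D (odd_part x) g - pairing 0 (odd_part g) x\<bar> \<le> \<epsilon> * WV_norm R x"
    using \<open>\<epsilon> > 0\<close> WV_norm_nonneg[of x] by simp
qed (rule odd_part_V_minus[OF g] W_plus_zero)+

text \<open>Integration by parts moves the derivative to a test function that is close to \<open>g\<close>.\<close>

lemma dual_approximable_St:
  assumes g: "g \<in> L2_space D" shows "dual_approximable (\<lambda>x. L2_inner D (St x) g)"
proof (rule dual_approximable_limit)
  fix \<epsilon> :: real assume "\<epsilon> > 0"
  then obtain \<zeta> where z: "test_function (R \<times> UNIV) \<zeta>" "L2_norm D (g - \<zeta>) < \<epsilon>"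
    using test_dense_D[OF g] by blast
  have s: "smooth \<zeta>" by (rule test_function_smooth[OF z(1)])
  have zL: "\<zeta> \<in> L2_space D" "transport \<zeta> \<in> L2_space D" by (intro smooth_L2_D transport_smooth s)+
  have a: "dual_approximable (\<lambda>x. (-1) * L2_inner D (even_part x) (transport \<zeta>) + 0 * L2_inner D (even_part x) (transport \<zeta>))"
    by (intro dual_approximable_comb dual_approximable_even zL)
  have "\<bar>L2_inner D (St x) g - ((-1) * L2_inner D (even_part x) (transport \<zeta>) + 0 * L2_inner D (even_part x) (transport \<zeta>))\<bar> \<le> \<epsilon> * WV_norm R x"
    if x: "x \<in> WV" for x
  proof -
    have "L2_inner D (even_part x) (transport \<zeta>) = - L2_inner D (St x) \<zeta>"
      using W_spaceD(3)[OF WV_L2(6)[OF x]] z(1) unfolding is_transport_def St_def by blast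
    then show ?thesis
      using inner_close[OF WV_L2(4)[OF x] g zL(1) WV_norm_bounds(2), of \<epsilon>] z(2) by simp
  qed
  then show "\<exists>l'. dual_approximable l' \<and> (\<forall>x\<in>WV. \<bar>L2_inner D (St x) g - l' x\<bar> \<le> \<epsilon> * WV_norm R x)"
    using a by blast
qed

text \<open>Green's formula expresses the trace, tested with a smooth function, through quantities already
  treated.\<close>

lemma dual_approximable_Tr:
  assumes g: "g \<in> L2_space dD" and z: "\<And>p. flux_root p = 0 \<Longrightarrow> g p = 0"
  shows "dual_approximable (\<lambda>x. L2_inner dD (Tr x) g)"
proof (rule dual_approximable_limit)
  fix \<epsilon> :: real assume e: "\<epsilon> > 0"
  obtain \<zeta> where s: "smooth \<zeta>" and l: "L2_norm dD (g - (\<lambda>p. flux_root p * \<zeta> p)) < \<epsilon>"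
    by (rule flux_smooth_dense[OF g z e])
  have zL: "\<zeta> \<in> L2_space D" "transport \<zeta> \<in> L2_space D" "(\<lambda>p. flux_root p * \<zeta> p) \<in> L2_space dD"
    by (intro smooth_L2_D transport_smooth s flux_root_mult_L2)+
  have a: "dual_approximable (\<lambda>x. 1 * L2_inner D (St x) \<zeta> + 1 * L2_inner D (even_part x) (transport \<zeta>))"
    by (intro dual_approximable_comb dual_approximable_even dual_approximable_St zL)
  have "\<bar>L2_inner dD (Tr x) g - (1 * L2_inner D (St x) \<zeta> + 1 * L2_inner D (even_part x) (transport \<zeta>))\<bar> \<le> \<epsilon> * WV_norm R x"
    if x: "x \<in> WV" for x
  proof -
    have "L2_inner D (St x) \<zeta> + L2_inner D (even_part x) (transport \<zeta>) = L2_inner dD (Tr x) (\<lambda>p. flux_root p * \<zeta> p)"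
      using W_Green[OF WV_L2(6)[OF x] s] by (simp add: St_def Tr_def)
    then show ?thesis
      using inner_close[OF WV_L2(5)[OF x] g zL(3) WV_norm_bounds(3), of \<epsilon>] l by simp
  qed
  then show "\<exists>l'. dual_approximable l' \<and> (\<forall>x\<in>WV. \<bar>L2_inner dD (Tr x) g - l' x\<bar> \<le> \<epsilon> * WV_norm R x)"
    using a by blast
qed

lemma dual_approximable_cong:
  assumes "dual_approximable l" "\<And>x. x \<in> WV \<Longrightarrow> l' x = l x" shows "dual_approximable l'"
  using assms unfolding dual_approximable_def by simp

lemma inner_split:
  assumes "x \<in> L2_space D" "h \<in> L2_space D"
  shows "L2_inner D x h = L2_inner D (even_part x) h + L2_inner D (odd_part x) h"
  using L2_inner_add_left[OF even_part_L2[OF assms(1)] odd_part_L2[OF assms(1)] assms(2)] by (simp only: even_plus_odd)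

lemma pairing_self: "x \<in> L2_space D \<Longrightarrow> y \<in> L2_space D \<Longrightarrow> pairing (even_part y) (odd_part y) x = L2_inner D x y"
  using L2_inner_parts by (simp add: pairing_def)

lemma Tr_zero: "flux_root p = 0 \<Longrightarrow> Tr x p = 0"
  by (simp add: Tr_def wtrace_zero)

end

context rte
begin

text \<open>By symmetry of the collision operator, every term of \<open>B x z\<close> is an inner product of a fixed function
  with a part of \<open>x\<close>, its streaming term or its trace.\<close>

lemma dual_approximable_residual:
  assumes y: "y \<in> L2_space D" and z: "z \<in> WV"
  shows "dual_approximable (\<lambda>x. L2_inner D x y - B x z)"
proof -
  note Z = WV_L2[OF z]
  define h where "h = y - C z"
  have hL: "h \<in> L2_space D" unfolding h_def by (intro L2_space_diff y C_L2 Z)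
  define l1 where "l1 x = 1 * L2_inner D (even_part x) h + 1 * L2_inner D (odd_part x) h" for x
  define l2 where "l2 x = 1 * L2_inner D (odd_part x) (St z) + (-1) * L2_inner D (St x) (odd_part z)" for x
  define l3 where "l3 x = 1 * l2 x + (-1) * L2_inner dD (Tr x) (Tr z)" for x
  have "dual_approximable (\<lambda>x. 1 * l1 x + 1 * l3 x)"
    unfolding l1_def l2_def l3_def
    by (intro dual_approximable_comb dual_approximable_even dual_approximable_odd dual_approximable_St
        dual_approximable_Tr hL Z Tr_zero)
  then show ?thesis
  proof (rule dual_approximable_cong)
    fix x assume x: "x \<in> WV"
    note X = WV_L2[OF x]
    have "L2_inner D x h = L2_inner D x y - L2_inner D (C x) z"
      unfolding h_def using L2_inner_diff_right[OF X(1) y C_L2[OF Z(1)]] C_symmetric[OF X(1) Z(1)]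
      by (simp add: L2_inner_commute)
    then show "L2_inner D x y - B x z = 1 * l1 x + 1 * l3 x"
      using inner_split[OF X(1) hL] by (simp add: l1_def l2_def l3_def B_eq)
  qed
qed

end

context galerkin
begin

lemma Xh_zero: "0 \<in> Xh" by (rule subspace_0[OF subspace_Xh])

text \<open>Modulo functions of norm zero, an orthonormal basis of the discrete space has these properties.\<close>

definition frame :: "(phase \<Rightarrow> real) set \<Rightarrow> bool" where
  "frame E \<longleftrightarrow> finite E \<and> E \<subseteq> Xh \<and> (\<forall>e\<in>E. L2_norm D e = 1) \<and>
    (\<forall>x\<in>Xh. L2_norm D (x - (\<Sum>e\<in>E. L2_inner D x e *\<^sub>R e)) = 0)"

lemma frame_exists: obtains E where "frame E"
  using Xh_orthonormal unfolding frame_def by blast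

lemma frameD:
  assumes "frame E"
  shows "finite E" "E \<subseteq> Xh" "e \<in> E \<Longrightarrow> L2_norm D e = 1" "e \<in> E \<Longrightarrow> e \<in> WV" "e \<in> E \<Longrightarrow> e \<in> L2_space D"
    "x \<in> Xh \<Longrightarrow> L2_norm D (x - (\<Sum>e\<in>E. L2_inner D x e *\<^sub>R e)) = 0"
    "(\<Sum>e\<in>E. c e *\<^sub>R e) \<in> Xh"
proof -
  show "finite E" and sub: "E \<subseteq> Xh" and "e \<in> E \<Longrightarrow> L2_norm D e = 1"
    "x \<in> Xh \<Longrightarrow> L2_norm D (x - (\<Sum>e\<in>E. L2_inner D x e *\<^sub>R e)) = 0"
    using assms by (auto simp only: frame_def)
  show "e \<in> E \<Longrightarrow> e \<in> WV" "e \<in> E \<Longrightarrow> e \<in> L2_space D" using sub in_WV WV_L2(1) by blast+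
  show "(\<Sum>e\<in>E. c e *\<^sub>R e) \<in> Xh" using sub by (intro subspace_sum subspace_scale subspace_Xh) auto
qed

lemma frame_inner_le:
  assumes "frame E" "x \<in> L2_space D" "e \<in> E" shows "\<bar>L2_inner D x e\<bar> \<le> L2_norm D x"
  using L2_Cauchy_Schwarz[OF assms(2) frameD(5)[OF assms(1,3)]] frameD(3)[OF assms(1,3)] by simp

lemma frame_norm_le:
  assumes E: "frame E" and x: "x \<in> Xh"
  shows "L2_norm D x \<le> (\<Sum>e\<in>E. \<bar>L2_inner D x e\<bar>)"
proof -
  note E' = frameD[OF E]
  define Q where "Q = (\<Sum>e\<in>E. L2_inner D x e *\<^sub>R e)"
  have QL: "Q \<in> L2_space D" unfolding Q_def using in_WV[OF E'(7)] WV_L2(1) by blast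
  have xL: "x \<in> L2_space D" using in_WV[OF x] WV_L2(1) by blast
  have "L2_norm D (\<Sum>e\<in>F. c e *\<^sub>R e) \<le> (\<Sum>e\<in>F. \<bar>c e\<bar>)" if "finite F" "F \<subseteq> E" for F c
    using that
  proof (induction F rule: finite_induct)
    case empty show ?case by (simp add: L2_norm_def)
  next
    case (insert e F)
    have "L2_norm D (c e *\<^sub>R e + (\<Sum>e\<in>F. c e *\<^sub>R e)) \<le> L2_norm D (c e *\<^sub>R e) + L2_norm D (\<Sum>e\<in>F. c e *\<^sub>R e)"
      using insert.prems E'(5) by (intro L2_norm_triangle L2_space_scaleR L2_space_sum) auto
    also have "\<dots> \<le> \<bar>c e\<bar> + (\<Sum>e\<in>F. \<bar>c e\<bar>)"
      using insert E'(3)[of e] by (simp add: L2_norm_scaleR)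
    finally show ?case by (simp only: sum.insert[OF insert(1,2)])
  qed
  from this[OF E'(1) order_refl] have "L2_norm D Q \<le> (\<Sum>e\<in>E. \<bar>L2_inner D x e\<bar>)" unfolding Q_def .
  moreover have "L2_norm D ((x - Q) + Q) \<le> L2_norm D (x - Q) + L2_norm D Q"
    by (intro L2_norm_triangle L2_space_diff xL QL)
  ultimately show ?thesis using E'(6)[OF x] by (simp add: Q_def)
qed

text \<open>A linear functional that ignores functions of norm zero is determined by its values on the frame.\<close>

lemma frame_expand:
  assumes E: "frame E"
    and L: "\<And>x y a b. x \<in> Xh \<Longrightarrow> y \<in> Xh \<Longrightarrow> L (a *\<^sub>R x + b *\<^sub>R y) = a * L x + b * (L y :: real)"
    and L0: "\<And>x. x \<in> Xh \<Longrightarrow> L2_norm D x = 0 \<Longrightarrow> L x = 0" and x: "x \<in> Xh"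
  shows "L x = (\<Sum>e\<in>E. L2_inner D x e * L e)"
proof -
  note E' = frameD[OF E]
  define Q where "Q = (\<Sum>e\<in>E. L2_inner D x e *\<^sub>R e)"
  have QX: "Q \<in> Xh" unfolding Q_def by (rule E'(7))
  have "L (x - Q) = 0" using E'(6)[OF x] subspace_diff[OF subspace_Xh x QX] unfolding Q_def by (intro L0)
  moreover have "L (1 *\<^sub>R x + (-1) *\<^sub>R Q) = 1 * L x + (-1) * L Q" by (rule L[OF x QX])
  moreover have "1 *\<^sub>R x + (-1) *\<^sub>R Q = x - Q" by simp
  moreover have "L Q = (\<Sum>e\<in>E. L2_inner D x e * L e)"
    unfolding Q_def
  proof (rule linear_on_sum[OF subspace_Xh])
    show "L (a *\<^sub>R x + b *\<^sub>R y) = a * L x + b * L y" if "x \<in> Xh" "y \<in> Xh" for x y a b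
      by (rule L[OF that])
  qed (use E'(1,2) in auto)
  ultimately show ?thesis by simp
qed

text \<open>The error of the projection tested with \<open>y\<close>. Unlike the projection error itself, it is a scalar and
  linear in \<open>x\<close>.\<close>

definition Pi_error :: "(phase \<Rightarrow> real) \<Rightarrow> (phase \<Rightarrow> real) \<Rightarrow> real" where
  "Pi_error y x = L2_inner D (x - Pi_h x) y"

lemma Pi_error_bound:
  assumes y: "y \<in> L2_space D" and x: "x \<in> WV"
  shows "\<bar>Pi_error y x\<bar> \<le> Cq * L2_norm D y * WV_norm R x"
proof -
  have L: "x - Pi_h x \<in> L2_space D" using in_WV[OF Pi_h(1)[OF x]] x by (intro L2_space_diff WV_L2)
  have "\<bar>Pi_error y x\<bar> \<le> L2_norm D (x - Pi_h x) * L2_norm D y"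
    unfolding Pi_error_def by (rule L2_Cauchy_Schwarz[OF L y])
  also have "\<dots> \<le> (Cq * WV_norm R x) * L2_norm D y"
    using Pi_h_quasi_optimal[OF x Xh_zero] by (intro mult_right_mono L2_norm_nonneg) simp
  finally show ?thesis by (simp add: mult_ac)
qed

text \<open>Aubin-Nitsche duality: \<open>z\<close> solves the discrete adjoint problem with right hand side \<open>y\<close>.\<close>

lemma Pi_error_residual:
  assumes y: "y \<in> L2_space D"
  shows "\<exists>z\<in>Xh. (\<forall>x\<in>WV. Pi_error y x = L2_inner D x y - B x z) \<and> (\<forall>x\<in>Xh. L2_inner D x y = B x z)"
proof -
  obtain z where z: "z \<in> Xh" "\<And>x. x \<in> Xh \<Longrightarrow> B x z = L2_inner D x y" using dual_exists[OF y] by blast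
  have "Pi_error y x = L2_inner D x y - B x z" if x: "x \<in> WV" for x
  proof -
    note p = Pi_h[OF x]
    have pL: "Pi_h x \<in> L2_space D" using in_WV[OF p(1)] WV_L2(1) by blast
    show ?thesis unfolding Pi_error_def
      using L2_inner_diff_left[OF WV_L2(1)[OF x] pL y] z(2)[OF p(1)] p(2)[OF z(1)] by simp
  qed
  then show ?thesis using z by auto
qed

text \<open>An approximating pairing is small on the frame, since the functional vanishes on \<open>Xh\<close>. Subtracting
  its part in \<open>Xh\<close> makes it vanish there and costs an error of the same order. The constant \<open>K\<close>
  accounts for the norms of the frame.\<close>

lemma Pi_error_pairing:
  assumes y: "y \<in> L2_space D" and \<epsilon>: "\<epsilon> > 0"
  shows "\<exists>w\<in>W_plus R. \<exists>v\<in>V_minus R. (\<forall>x\<in>WV. \<bar>Pi_error y x - pairing w v x\<bar> \<le> \<epsilon> * WV_norm R x) \<and>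
    (\<forall>x\<in>Xh. pairing w v x = 0)"
proof -
  obtain z where z: "z \<in> Xh" "\<And>x. x \<in> WV \<Longrightarrow> Pi_error y x = L2_inner D x y - B x z"
    "\<And>x. x \<in> Xh \<Longrightarrow> L2_inner D x y = B x z" using Pi_error_residual[OF y] by blast
  obtain E where fE: "frame E" by (rule frame_exists)
  note E = frameD(1,2,3)[OF fE] and eW = frameD(4,5)[OF fE]
  define K where "K = 1 + (\<Sum>e\<in>E. WV_norm R e)"
  have K: "K > 0" using sum_nonneg[of E "WV_norm R"] WV_norm_nonneg by (simp add: K_def)
  define \<delta> where "\<delta> = \<epsilon> / K"
  have \<delta>: "\<delta> > 0" "\<delta> * K = \<epsilon>" using \<epsilon> K by (simp_all add: \<delta>_def)
  have "dual_approximable (Pi_error y)"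
    by (rule dual_approximable_cong[OF dual_approximable_residual[OF y in_WV[OF z(1)]] z(2)])
  then obtain w0 v0 where wv: "w0 \<in> W_plus R" "v0 \<in> V_minus R"
    "\<And>x. x \<in> WV \<Longrightarrow> \<bar>Pi_error y x - pairing w0 v0 x\<bar> \<le> \<delta> * WV_norm R x"
    using \<delta>(1) unfolding dual_approximable_def by meson
  have wL: "w0 \<in> L2_space D" "v0 \<in> L2_space D" using W_plus_L2[OF wv(1)] V_minus_L2[OF wv(2)] .
  define c where "c e = pairing w0 v0 e" for e
  have cb: "\<bar>c e\<bar> \<le> \<delta> * WV_norm R e" if "e \<in> E" for e
  proof -
    have "Pi_error y e = 0" using z(2)[OF eW(1)[OF that]] z(3)[of e] that E(2) by auto
    then show ?thesis using wv(3)[OF eW(1)[OF that]] by (simp add: c_def)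
  qed
  define s where "s = (\<Sum>e\<in>E. c e *\<^sub>R e)"
  have sX: "s \<in> Xh" unfolding s_def using E(2) by (intro subspace_sum subspace_scale subspace_Xh) auto
  have sL: "s \<in> L2_space D" using in_WV[OF sX] WV_L2(1) by blast
  define w where "w = 1 *\<^sub>R w0 + (-1) *\<^sub>R even_part s"
  define v where "v = 1 *\<^sub>R v0 + (-1) *\<^sub>R odd_part s"
  have pw: "pairing w v x = pairing w0 v0 x - (\<Sum>e\<in>E. c e * L2_inner D x e)" if xL: "x \<in> L2_space D" for x
  proof -
    have "pairing w v x = pairing w0 v0 x - L2_inner D x s"
      unfolding w_def v_def pairing_comb[OF wL(1) even_part_L2[OF sL] wL(2) odd_part_L2[OF sL] xL]
      using pairing_self[OF xL sL] by simp
    also have "L2_inner D x s = (\<Sum>e\<in>E. c e * L2_inner D e x)"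
      unfolding s_def L2_inner_commute[of D x]
      by (rule linear_on_sum[OF subspace_L2 L2_inner_comb_left E(1) eW(2)]) (use xL in auto)
    finally show ?thesis by (simp add: L2_inner_commute)
  qed
  have "w \<in> W_plus R" unfolding w_def
    by (intro subspace_add subspace_scale subspace_W_plus wv(1) even_part_W_plus in_WV sX)
  moreover have "v \<in> V_minus R" unfolding v_def
    by (intro subspace_add subspace_scale subspace_V_minus wv(2) odd_part_V_minus sL)
  moreover have "\<bar>Pi_error y x - pairing w v x\<bar> \<le> \<epsilon> * WV_norm R x" if x: "x \<in> WV" for x
  proof -
    note xL = WV_L2(1)[OF x]
    have "\<bar>\<Sum>e\<in>E. c e * L2_inner D x e\<bar> \<le> (\<Sum>e\<in>E. \<bar>c e * L2_inner D x e\<bar>)" by (rule sum_abs)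
    also have "\<dots> \<le> (\<Sum>e\<in>E. (\<delta> * WV_norm R e) * WV_norm R x)"
    proof (rule sum_mono)
      fix e assume e: "e \<in> E"
      have "\<bar>L2_inner D x e\<bar> \<le> L2_norm D x * L2_norm D e" by (rule L2_Cauchy_Schwarz[OF xL eW(2)[OF e]])
      then have "\<bar>L2_inner D x e\<bar> \<le> WV_norm R x" using E(3)[OF e] L2_norm_le_WV_norm[OF xL] by simp
      then show "\<bar>c e * L2_inner D x e\<bar> \<le> (\<delta> * WV_norm R e) * WV_norm R x"
        unfolding abs_mult using cb[OF e] \<delta>(1) WV_norm_nonneg by (intro mult_mono) auto
    qed
    also have "\<dots> = \<delta> * (K - 1) * WV_norm R x"
      by (simp add: K_def sum_distrib_left sum_distrib_right)
    finally have "\<bar>\<Sum>e\<in>E. c e * L2_inner D x e\<bar> \<le> \<delta> * (K - 1) * WV_norm R x" .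
    then have "\<bar>Pi_error y x - pairing w v x\<bar> \<le> \<delta> * WV_norm R x + \<delta> * (K - 1) * WV_norm R x"
      using wv(3)[OF x] unfolding pw[OF xL] by linarith
    also have "\<dots> = \<delta> * K * WV_norm R x" by (simp add: algebra_simps)
    finally show ?thesis by (simp add: \<delta>(2))
  qed
  moreover have "pairing w v x = 0" if x: "x \<in> Xh" for x
  proof -
    have "pairing w0 v0 x = (\<Sum>e\<in>E. L2_inner D x e * pairing w0 v0 e)"
    proof (rule frame_expand[OF fE _ _ x])
      fix x y :: "phase \<Rightarrow> real" and a b assume "x \<in> Xh" "y \<in> Xh"
      then have "x \<in> L2_space D" "y \<in> L2_space D" using in_WV WV_L2(1) by blast+
      then show "pairing w0 v0 (a *\<^sub>R x + b *\<^sub>R y) = a * pairing w0 v0 x + b * pairing w0 v0 y"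
        unfolding pairing_def even_part_comb odd_part_comb
        by (simp add: L2_inner_comb_left even_part_L2 odd_part_L2 wL algebra_simps)
    next
      fix x :: "phase \<Rightarrow> real" assume "x \<in> Xh" and n: "L2_norm D x = 0"
      then have xL: "x \<in> L2_space D" using in_WV WV_L2(1) by blast
      have "pairing w0 v0 x = L2_inner D x (even_part w0 + odd_part v0)"
        using L2_inner_even_left[OF xL wL(1)] L2_inner_odd_left[OF xL wL(2)] inner_split[OF xL L2_space_add[OF even_part_L2[OF wL(1)] odd_part_L2[OF wL(2)]]]
          L2_inner_even_odd[OF xL wL(2)] L2_inner_even_odd[OF wL(1) xL] L2_inner_commute[of D "odd_part x" "even_part w0"]
        by (simp add: pairing_def L2_inner_add_right even_part_L2 odd_part_L2 xL wL)
      then show "pairing w0 v0 x = 0"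
        using L2_Cauchy_Schwarz[OF xL L2_space_add[OF even_part_L2[OF wL(1)] odd_part_L2[OF wL(2)]]] n by simp
    qed
    then show ?thesis using pw[of x] in_WV[OF x] WV_L2(1) by (simp add: c_def mult.commute)
  qed
  ultimately show ?thesis by blast
qed

text \<open>As the pairing vanishes on \<open>Xh\<close>, its value at \<open>p\<close> is that at any representative of
  \<open>p - embed R \<psi>\<close>.\<close>

lemma pairing_best_error_dual:
  assumes w: "w \<in> W_plus R" and v: "v \<in> V_minus R"
    and b: "\<And>x. x \<in> WV \<Longrightarrow> \<bar>pairing w v x\<bar> \<le> c * WV_norm R x" and z: "\<And>x. x \<in> Xh \<Longrightarrow> pairing w v x = 0"
    and c: "c > 0" and p: "snd p \<in> L2_space D"
  shows "ennreal (\<bar>fst p w + L2_inner D (snd p) v\<bar> / c) \<le> best_error_dual R Wh Vh p"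
proof -
  define r where "r = \<bar>fst p w + L2_inner D (snd p) v\<bar>"
  have vL: "v \<in> L2_space D" by (rule V_minus_L2[OF v])
  have "ennreal (r / c) \<le> best_error_dual R Wh Vh p"
    unfolding best_error_dual_def
  proof (rule INF_greatest)
    fix \<psi> assume \<psi>: "\<psi> \<in> Xh"
    have \<psi>L: "\<psi> \<in> L2_space D" using in_WV[OF \<psi>] WV_L2(1) by blast
    show "ennreal (r / c) \<le> WV_enorm_dual R (p - embed R \<psi>)"
      unfolding WV_enorm_dual_def
    proof (rule INF_greatest)
      fix f assume "f \<in> {f \<in> WV_space R. dual_eq R (embed R f) (p - embed R \<psi>)}"
      then have f: "f \<in> WV" and eq: "dual_eq R (embed R f) (p - embed R \<psi>)" by (auto simp: WV_space_eq)
      have 1: "L2_inner D (even_part f) w = fst p w - L2_inner D (even_part \<psi>) w"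
        using eq w unfolding dual_eq_def embed_def by (simp add: minus_prod_def)
      have ae: "AE x in D. odd_part f x = (snd p - odd_part \<psi>) x"
        using eq unfolding dual_eq_def embed_def by (simp add: minus_prod_def)
      have "L2_inner D (odd_part f) v = L2_inner D (snd p - odd_part \<psi>) v"
        using ae WV_L2(3)[OF f] L2_space_diff[OF p odd_part_L2[OF \<psi>L]] vL
        by (intro L2_inner_cong_AE L2_measurable) auto
      also have "\<dots> = L2_inner D (snd p) v - L2_inner D (odd_part \<psi>) v"
        by (rule L2_inner_diff_left[OF p odd_part_L2[OF \<psi>L] vL])
      finally have "pairing w v f + pairing w v \<psi> = fst p w + L2_inner D (snd p) v"
        using 1 by (simp add: pairing_def)
      then have "r \<le> c * WV_norm R f" using b[OF f] z[OF \<psi>] by (simp add: r_def)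
      then show "ennreal (r / c) \<le> ennreal (WV_norm R f)"
        using c by (intro ennreal_leI) (simp add: pos_divide_le_eq mult.commute)
    qed
  qed
  then show ?thesis by (simp only: r_def)
qed

lemma best_error_bound:
  assumes x: "x \<in> WV"
  shows "ennreal (L2_norm D (x - Pi_h x)) \<le> ennreal Cq * best_error R Wh Vh x"
proof -
  have "ennreal (L2_norm D (x - Pi_h x) / Cq) \<le> best_error R Wh Vh x"
    unfolding best_error_def
  proof (rule INF_greatest)
    fix \<psi> assume \<psi>: "\<psi> \<in> Xh"
    have "x - \<psi> \<in> WV" by (rule subspace_diff[OF subspace_WV x in_WV[OF \<psi>]])
    then show "ennreal (L2_norm D (x - Pi_h x) / Cq) \<le> WV_enorm R (x - \<psi>)"
      unfolding WV_enorm_def WV_space_eq using Pi_h_quasi_optimal[OF x \<psi>] Cq_pos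
      by (auto intro!: ennreal_leI simp: pos_divide_le_eq mult.commute)
  qed
  then have "ennreal Cq * ennreal (L2_norm D (x - Pi_h x) / Cq) \<le> ennreal Cq * best_error R Wh Vh x"
    by (rule mult_left_mono) simp
  moreover have "ennreal Cq * ennreal (L2_norm D (x - Pi_h x) / Cq) = ennreal (L2_norm D (x - Pi_h x))"
    using Cq_pos by (simp add: ennreal_mult[symmetric] L2_norm_nonneg)
  ultimately show ?thesis by simp
qed

lemma best_error_infinite:
  assumes "x \<notin> WV" shows "best_error R Wh Vh x = \<infinity>"
proof -
  have "WV_enorm R (x - \<psi>) = \<infinity>" if "\<psi> \<in> Xh" for \<psi>
  proof -
    have "x - \<psi> \<notin> WV"
    proof
      assume "x - \<psi> \<in> WV"
      from subspace_add[OF subspace_WV this in_WV[OF that]] show False using assms by simp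
    qed
    then show ?thesis by (simp add: WV_enorm_def WV_space_eq)
  qed
  then have "best_error R Wh Vh x = (INF \<psi>\<in>Xh. \<infinity>)" unfolding best_error_def by (rule INF_cong[OF refl])
  then show ?thesis using Xh_zero by auto
qed

text \<open>The norms on a finite dimensional space are equivalent, so the streaming term and the trace cause no
  harm here. The constant depends on the discrete space and will disappear in a limit.\<close>

lemma B_bounded_Xh: "\<exists>K\<ge>0. \<forall>x\<in>Xh. \<forall>y\<in>Xh. \<bar>B x y\<bar> \<le> K * L2_norm D x * L2_norm D y"
proof -
  obtain E where fE: "frame E" by (rule frame_exists)
  note E = frameD(1,2,3)[OF fE]
  define K where "K = (\<Sum>e\<in>E. \<Sum>e'\<in>E. \<bar>B e e'\<bar>)"
  have "\<bar>B x y\<bar> \<le> K * L2_norm D x * L2_norm D y" if x: "x \<in> Xh" and y: "y \<in> Xh" for x y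
  proof -
    have in_le: "\<bar>L2_inner D u e\<bar> \<le> L2_norm D u" if "u \<in> Xh" "e \<in> E" for u e
      by (rule frame_inner_le[OF fE WV_L2(1)[OF in_WV[OF that(1)]] that(2)])
    have "B x y = (\<Sum>e\<in>E. L2_inner D x e * B e y)"
      by (rule frame_expand[OF fE _ _ x]) (simp_all add: B_comb_left WV_null in_WV y)
    also have "\<dots> = (\<Sum>e\<in>E. L2_inner D x e * (\<Sum>e'\<in>E. L2_inner D y e' * B e e'))"
    proof (intro sum.cong refl arg_cong2[where f="(*)"])
      fix e assume "e \<in> E"
      then have "e \<in> Xh" using E(2) by auto
      then show "B e y = (\<Sum>e'\<in>E. L2_inner D y e' * B e e')"
        by (intro frame_expand[OF fE _ _ y]) (simp_all add: B_comb_right WV_null in_WV)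
    qed
    also have "\<bar>\<dots>\<bar> \<le> (\<Sum>e\<in>E. \<bar>L2_inner D x e\<bar> * (\<Sum>e'\<in>E. \<bar>L2_inner D y e'\<bar> * \<bar>B e e'\<bar>))"
      by (rule order_trans[OF sum_abs]) (auto intro!: sum_mono mult_left_mono order_trans[OF sum_abs] simp: abs_mult)
    also have "\<dots> \<le> (\<Sum>e\<in>E. L2_norm D x * (\<Sum>e'\<in>E. L2_norm D y * \<bar>B e e'\<bar>))"
      using in_le x y by (intro sum_mono mult_mono) (auto intro!: sum_nonneg simp: L2_norm_nonneg)
    also have "\<dots> = K * L2_norm D x * L2_norm D y"
      by (simp add: K_def sum_distrib_left sum_distrib_right mult_ac)
    finally show ?thesis .
  qed
  moreover have "K \<ge> 0" unfolding K_def by (intro sum_nonneg) auto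
  ultimately show ?thesis by blast
qed

end

section \<open>Lower integrals\<close>

text \<open>For an arbitrary function the integral is the supremum of the integrals of smaller simple
  functions. The pointwise supremum of a maximizing sequence of these attains it.\<close>

lemma nn_integral_maximal_minorant:
  fixes f :: "'a \<Rightarrow> ennreal"
  obtains g where "g \<in> borel_measurable M" "\<And>x. g x \<le> f x" "(\<integral>\<^sup>+x. g x \<partial>M) = (\<integral>\<^sup>+x. f x \<partial>M)"
proof -
  define S where "S = {g. simple_function M g \<and> g \<le> f}"
  have "(\<lambda>x. 0) \<in> S" by (simp add: S_def le_fun_def)
  then have "S \<noteq> {}" by auto
  then obtain h where h: "range h \<subseteq> integral\<^sup>S M ` S" "(SUP g\<in>S. integral\<^sup>S M g) = (SUP n::nat. h n)"
    using ennreal_Sup_countable_SUP[of "integral\<^sup>S M ` S"] by auto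
  then have "\<forall>n. \<exists>g\<in>S. h n = integral\<^sup>S M g" by blast
  then obtain G where G: "\<And>n. G n \<in> S" "\<And>n. h n = integral\<^sup>S M (G n)" by metis
  define g where "g x = (SUP n. G n x)" for x
  have Gs: "simple_function M (G n)" "G n x \<le> f x" for n x using G(1)[of n] by (auto simp: S_def le_fun_def)
  have gm: "g \<in> borel_measurable M"
    unfolding g_def by (intro borel_measurable_SUP borel_measurable_simple_function Gs) auto
  have gf: "g x \<le> f x" for x unfolding g_def by (intro SUP_least Gs)
  have "(\<integral>\<^sup>+x. f x \<partial>M) = (SUP n. h n)" using h(2) by (simp add: nn_integral_def S_def)
  also have "\<dots> \<le> (\<integral>\<^sup>+x. g x \<partial>M)"
  proof (rule SUP_least)
    fix n
    have "h n = (\<integral>\<^sup>+x. G n x \<partial>M)" using G(2) nn_integral_eq_simple_integral[OF Gs(1)] by simp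
    also have "\<dots> \<le> (\<integral>\<^sup>+x. g x \<partial>M)" by (intro nn_integral_mono) (auto simp: g_def intro: SUP_upper)
    finally show "h n \<le> (\<integral>\<^sup>+x. g x \<partial>M)" .
  qed
  finally have "(\<integral>\<^sup>+x. g x \<partial>M) = (\<integral>\<^sup>+x. f x \<partial>M)"
    using nn_integral_mono[of M g f] gf by (intro antisym) auto
  then show ?thesis using that gm gf by blast
qed

text \<open>Otherwise the maximum of \<open>g\<close> and \<open>h\<close> would be a minorant with a larger integral.\<close>

lemma maximal_minorant_absorbs:
  fixes f g h :: "'a \<Rightarrow> ennreal"
  assumes g: "g \<in> borel_measurable M" "\<And>x. g x \<le> f x" "(\<integral>\<^sup>+x. g x \<partial>M) = (\<integral>\<^sup>+x. f x \<partial>M)"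
    and fin: "(\<integral>\<^sup>+x. f x \<partial>M) < \<infinity>"
    and h: "h \<in> borel_measurable M" "AE x in M. h x \<le> f x"
  shows "AE x in M. h x \<le> g x"
proof -
  obtain Z where Z: "Z \<in> null_sets M" "{x \<in> space M. \<not> h x \<le> f x} \<subseteq> Z"
    using h(2) by (auto elim!: AE_E simp: null_sets_def)
  define k where "k x = max (g x) (if x \<in> space M - Z then h x else 0)" for x
  have km: "k \<in> borel_measurable M"
    unfolding k_def using g(1) h(1) Z(1) by (intro borel_measurable_max measurable_If_set) auto
  have kf: "k x \<le> f x" for x using g(2) Z(2) by (auto simp: k_def)
  have gk: "g x \<le> k x" for x by (simp add: k_def)
  have "(\<integral>\<^sup>+x. k x \<partial>M) \<le> (\<integral>\<^sup>+x. g x \<partial>M)" unfolding g(3) by (intro nn_integral_mono kf)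
  then have eq: "(\<integral>\<^sup>+x. k x \<partial>M) = (\<integral>\<^sup>+x. g x \<partial>M)"
    using nn_integral_mono[of M g k] gk by (intro antisym) auto
  have "(\<integral>\<^sup>+x. k x - g x \<partial>M) = (\<integral>\<^sup>+x. k x \<partial>M) - (\<integral>\<^sup>+x. g x \<partial>M)"
    using fin gk by (intro nn_integral_diff km g(1)) (auto simp: g(3))
  also have "\<dots> = 0" unfolding eq using fin by (simp add: g(3) ennreal_diff_self)
  finally have "AE x in M. k x - g x = 0"
    using km g(1) by (subst (asm) nn_integral_0_iff_AE) auto
  moreover have "AE x in M. x \<notin> Z" using Z(1) by (rule AE_not_in)
  ultimately show ?thesis using AE_space
  proof eventually_elim
    fix x assume a: "k x - g x = 0" "x \<notin> Z" "x \<in> space M"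
    then have "k x \<le> g x" by (metis diff_eq_0_iff_ennreal leI order_less_imp_le linear)
    moreover have "h x \<le> k x" using a by (simp add: k_def)
    ultimately show "h x \<le> g x" by simp
  qed
qed

lemma continuous_on_indefinite_integral:
  fixes G :: "real \<Rightarrow> real"
  assumes G: "integrable (lebesgue_on {0<..<T}) G"
  shows "continuous_on UNIV (\<lambda>t. LINT x|lebesgue_on {0<..<T}. indicator {0<..<t} x * G x)"
  unfolding continuous_on_sequentially
proof (intro ballI allI impI)
  fix f :: "nat \<Rightarrow> real" and t assume "(\<forall>n. f n \<in> UNIV) \<and> f \<longlonglongrightarrow> t"
  then have f: "f \<longlonglongrightarrow> t" by simp
  let ?I = "lebesgue_on {0<..<T}"
  note ind = indicator_measurable_interval
  have "(\<lambda>n. LINT x|?I. indicator {0<..<f n} x * G x) \<longlonglongrightarrow> (LINT x|?I. indicator {0<..<t} x * G x)"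
  proof (rule integral_dominated_convergence[where w="\<lambda>x. \<bar>G x\<bar>"])
    have "AE x in lebesgue. x \<noteq> t" by (rule AE_completion[OF AE_lborel_singleton])
    then have "AE x in ?I. x \<noteq> t" by (subst AE_restrict_space_iff) (auto elim: eventually_mono)
    then show "AE x in ?I. (\<lambda>n. indicator {0<..<f n} x * G x) \<longlonglongrightarrow> indicator {0<..<t} x * G x"
    proof eventually_elim
      fix x assume x: "x \<noteq> t"
      have "\<forall>\<^sub>F n in sequentially. indicat_real {0<..<f n} x = indicator {0<..<t} x"
      proof (cases "x < t")
        case True
        have "\<forall>\<^sub>F n in sequentially. x < f n" by (rule order_tendstoD(1)[OF f True])
        then show ?thesis by eventually_elim (use True in \<open>auto simp: indicator_def\<close>)
      next
        case False
        then have "t < x" using x by simp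
        have "\<forall>\<^sub>F n in sequentially. f n < x" by (rule order_tendstoD(2)[OF f \<open>t < x\<close>])
        then show ?thesis by eventually_elim (use \<open>t < x\<close> in \<open>auto simp: indicator_def\<close>)
      qed
      then show "(\<lambda>n. indicator {0<..<f n} x * G x) \<longlonglongrightarrow> indicator {0<..<t} x * G x"
        by (intro tendsto_mult_right tendsto_eventually)
    qed
    show "AE x in ?I. norm (indicator {0<..<f n} x * G x) \<le> \<bar>G x\<bar>" for n
      by (intro AE_I2) (auto simp: indicator_def)
    show "(\<lambda>x. indicator {0<..<f n} x * G x) \<in> borel_measurable ?I" for n using G ind by auto
    show "(\<lambda>x. indicator {0<..<t} x * G x) \<in> borel_measurable ?I" using G ind by auto
  qed (use G in auto)
  then show "((\<lambda>t. LINT x|?I. indicator {0<..<t} x * G x) \<circ> f) \<longlonglongrightarrow> (LINT x|?I. indicator {0<..<t} x * G x)"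
    by (simp add: o_def)
qed

text \<open>Going back from \<open>t\<close> through times in \<open>A\<close> by steps between \<open>d / 2\<close> and \<open>d\<close> leads below \<open>d\<close>
  after finitely many steps, and from there one further step reaches \<open>0\<close>. The errors
  \<open>e * (b - a)\<close> of the steps add up to \<open>e * t\<close>.\<close>

lemma chain_short_steps:
  fixes n G :: "real \<Rightarrow> real"
  assumes d: "d > 0" and A0: "0 \<in> A"
    and dense: "\<And>a b. 0 \<le> a \<Longrightarrow> a < b \<Longrightarrow> b \<le> s \<Longrightarrow> \<exists>t\<in>A. a < t \<and> t < b"
    and step: "\<And>a b. a \<in> A \<Longrightarrow> b \<in> A \<Longrightarrow> 0 \<le> a \<Longrightarrow> a \<le> b \<Longrightarrow> b \<le> s \<Longrightarrow> b - a < d \<Longrightarrow> n b \<le> n a + (G b - G a) + e * (b - a)"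
    and t: "t \<in> A" "0 \<le> t" "t \<le> s"
  shows "n t \<le> n 0 + (G t - G 0) + e * t"
proof -
  have "\<forall>t\<in>A. 0 \<le> t \<longrightarrow> t \<le> s \<longrightarrow> t \<le> real k * (d / 2) \<longrightarrow> n t \<le> n 0 + (G t - G 0) + e * t" for k
  proof (induction k)
    case 0
    show ?case
    proof (intro ballI impI)
      fix t assume "0 \<le> t" "t \<le> real 0 * (d / 2)"
      then have "t = 0" by simp
      then show "n t \<le> n 0 + (G t - G 0) + e * t" by simp
    qed
  next
    case (Suc k)
    show ?case
    proof (intro ballI impI)
      fix t assume t: "t \<in> A" "0 \<le> t" "t \<le> s" "t \<le> real (Suc k) * (d / 2)"
      show "n t \<le> n 0 + (G t - G 0) + e * t"
      proof (cases "t < d")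
        case True
        then show ?thesis using step[OF A0 t(1) order_refl t(2,3)] by simp
      next
        case False
        then obtain r where r: "r \<in> A" "t - d < r" "r < t - d / 2"
          using dense[of "t - d" "t - d / 2"] d t by auto
        have "real (Suc k) * (d / 2) = real k * (d / 2) + d / 2" by (simp add: algebra_simps)
        then have "r \<le> real k * (d / 2)" using r t by linarith
        then have "n r \<le> n 0 + (G r - G 0) + e * r" using Suc.IH r t False d by auto
        moreover have "n t \<le> n r + (G t - G r) + e * (t - r)"
          using r t False d by (intro step) auto
        ultimately show ?thesis by (simp add: algebra_simps)
      qed
    qed
  qed
  moreover obtain k :: nat where "t / (d / 2) < real k" using reals_Archimedean2 by blast
  then have "t \<le> real k * (d / 2)" using d by (simp add: field_simps)
  ultimately show ?thesis using t by blast
qed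

section \<open>Duality and time derivatives\<close>

context lipschitz_phase
begin

lemma subspace_W_plus_dual: "subspace (W_plus_dual R)"
proof (rule subspaceI)
  show "0 \<in> W_plus_dual R" by (auto simp: W_plus_dual_def intro!: exI[of _ 0])
  fix F G c assume F: "F \<in> W_plus_dual R"
  then obtain cF where "\<forall>w\<in>W_plus R. \<bar>F w\<bar> \<le> cF * W_norm R w" unfolding W_plus_dual_def by blast
  then have cF: "\<bar>F w\<bar> \<le> cF * W_norm R w" if "w \<in> W_plus R" for w using that by blast
  have "\<bar>(c *\<^sub>R F) w\<bar> \<le> (\<bar>c\<bar> * cF) * W_norm R w" if "w \<in> W_plus R" for w
    using mult_left_mono[OF cF[OF that], of "\<bar>c\<bar>"] by (simp add: scaleR_fun_def abs_mult mult.assoc)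
  moreover have "\<forall>v\<in>W_plus R. \<forall>w\<in>W_plus R. \<forall>a b. (c *\<^sub>R F) (a *\<^sub>R v + b *\<^sub>R w) = a * (c *\<^sub>R F) v + b * (c *\<^sub>R F) w"
    using F unfolding W_plus_dual_def scaleR_fun_def[of c F] by (auto simp: algebra_simps)
  ultimately show "c *\<^sub>R F \<in> W_plus_dual R" unfolding W_plus_dual_def by blast
  assume G: "G \<in> W_plus_dual R"
  then obtain cG where "\<forall>w\<in>W_plus R. \<bar>G w\<bar> \<le> cG * W_norm R w" unfolding W_plus_dual_def by blast
  then have cG: "\<bar>G w\<bar> \<le> cG * W_norm R w" if "w \<in> W_plus R" for w using that by blast
  have "\<bar>(F + G) w\<bar> \<le> (cF + cG) * W_norm R w" if "w \<in> W_plus R" for w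
    using cF[OF that] cG[OF that] by (simp add: distrib_right)
  moreover have "\<forall>v\<in>W_plus R. \<forall>w\<in>W_plus R. \<forall>a b. (F + G) (a *\<^sub>R v + b *\<^sub>R w) = a * (F + G) v + b * (F + G) w"
    using F G unfolding W_plus_dual_def by (simp add: distrib_left)
  ultimately show "F + G \<in> W_plus_dual R" unfolding W_plus_dual_def by blast
qed

lemma subspace_dual_space: "subspace (dual_space R)"
  unfolding dual_space_def by (intro subspace_Times subspace_W_plus_dual subspace_V_minus)

lemma W_norm_scaleR:
  assumes w: "w \<in> W_space R" shows "W_norm R (c *\<^sub>R w) = \<bar>c\<bar> * W_norm R w"
proof -
  note W = W_spaceD[OF w]
  have e: "c *\<^sub>R f + 0 *\<^sub>R f = c *\<^sub>R f" for f :: "phase \<Rightarrow> real" by simp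
  note W' = W_spaceD[OF W_space_comb[OF w w, of c 0, unfolded e]]
  have 1: "L2_norm D (wt (c *\<^sub>R w)) = \<bar>c\<bar> * L2_norm D (wt w)"
    using L2_norm_cong_AE[OF L2_measurable[OF W'(2)] _ wt_comb[OF w w, of c 0, unfolded e]] W(2)
    by (simp add: L2_norm_scaleR L2_space_scaleR L2_measurable)
  have 2: "L2_norm dD (wtrace (c *\<^sub>R w)) = \<bar>c\<bar> * L2_norm dD (wtrace w)"
    using L2_norm_cong_AE[OF L2_measurable[OF W'(4)] _ wtrace_comb[OF w w, of c 0, unfolded e]] W(4)
    by (simp add: L2_norm_scaleR L2_space_scaleR L2_measurable)
  have "(L2_norm D (c *\<^sub>R w))\<^sup>2 + (L2_norm D (wt (c *\<^sub>R w)))\<^sup>2 + (L2_norm dD (wtrace (c *\<^sub>R w)))\<^sup>2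
      = c\<^sup>2 * ((L2_norm D w)\<^sup>2 + (L2_norm D (wt w))\<^sup>2 + (L2_norm dD (wtrace w))\<^sup>2)"
    unfolding 1 2 L2_norm_scaleR by (simp add: power_mult_distrib distrib_left)
  then show ?thesis unfolding W_norm_eq by (simp add: real_sqrt_mult)
qed

text \<open>The operator norm is a supremum over the unit ball, and \<open>w\<close> is scaled to have norm one. If its norm
  is zero, boundedness of \<open>F\<close> gives \<open>F w = 0\<close>.\<close>

lemma dual_pairing_bound:
  assumes F: "F \<in> W_plus_dual R" and w: "w \<in> W_plus R"
  shows "\<bar>F w\<bar> \<le> W_plus_dual_norm R F * W_norm R w"
proof -
  obtain c where "\<forall>w\<in>W_plus R. \<bar>F w\<bar> \<le> c * W_norm R w" using F unfolding W_plus_dual_def by blast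
  then have c: "\<bar>F w\<bar> \<le> c * W_norm R w" if "w \<in> W_plus R" for w using that by blast
  have lin: "F (a *\<^sub>R w + b *\<^sub>R w) = a * F w + b * F w" for a b using F w by (auto simp: W_plus_dual_def)
  have n0: "W_norm R w \<ge> 0" for w by (simp add: W_norm_def)
  show ?thesis
  proof (cases "W_norm R w = 0")
    case True
    then show ?thesis using c[OF w] by simp
  next
    case False
    then have n: "W_norm R w > 0" using n0[of w] by simp
    define u where "u = (1 / W_norm R w) *\<^sub>R w"
    have uW: "u \<in> W_plus R" unfolding u_def using w subspace_W_plus by (intro subspace_scale)
    have un: "W_norm R u = 1" unfolding u_def using w n by (subst W_norm_scaleR) (auto simp: W_plus_reflect)
    have Fu: "F u = F w / W_norm R w" using lin[of "1 / W_norm R w" 0] by (simp add: u_def)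
    have "\<bar>F u\<bar> \<le> W_plus_dual_norm R F"
      unfolding W_plus_dual_norm_def
    proof (rule cSUP_upper)
      show "u \<in> {w \<in> W_plus R. W_norm R w \<le> 1}" using uW un by simp
      show "bdd_above ((\<lambda>w. \<bar>F w\<bar>) ` {w \<in> W_plus R. W_norm R w \<le> 1})"
      proof (rule bdd_aboveI2[where M="\<bar>c\<bar>"])
        fix w assume "w \<in> {w \<in> W_plus R. W_norm R w \<le> 1}"
        then have "\<bar>F w\<bar> \<le> c * W_norm R w" "W_norm R w \<le> 1" using c by auto
        moreover have "c * W_norm R w \<le> \<bar>c\<bar> * 1"
          using \<open>W_norm R w \<le> 1\<close> n0[of w] by (intro mult_mono) auto
        ultimately show "\<bar>F w\<bar> \<le> \<bar>c\<bar>" by simp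
      qed
    qed
    then show ?thesis using n Fu by (simp add: abs_divide pos_divide_le_eq)
  qed
qed

lemma tested_dual_space:
  assumes w: "w \<in> W_plus R" and v: "v \<in> V_minus R"
  shows "tested_space (dual_space R) (dual_norm R) (\<lambda>p. fst p w + L2_inner D (snd p) v) (W_norm R w + L2_norm D v + 1)"
proof
  show "subspace (dual_space R)" by (rule subspace_dual_space)
  have Wn: "0 \<le> W_norm R w" by (simp add: W_norm_def)
  show "W_norm R w + L2_norm D v + 1 > 0" using Wn L2_norm_nonneg[of D v] by linarith
  have vL: "v \<in> L2_space D" by (rule V_minus_L2[OF v])
  fix p q :: "functional \<times> (phase \<Rightarrow> real)" and a b :: real
  assume p: "p \<in> dual_space R"
  then have p': "fst p \<in> W_plus_dual R" "snd p \<in> L2_space D" by (auto simp: dual_space_def intro: V_minus_L2)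
  have "\<bar>fst p w + L2_inner D (snd p) v\<bar> \<le> W_plus_dual_norm R (fst p) * W_norm R w + L2_norm D (snd p) * L2_norm D v"
    using dual_pairing_bound[OF p'(1) w] L2_Cauchy_Schwarz[OF p'(2) vL] by linarith
  also have "\<dots> \<le> dual_norm R p * W_norm R w + dual_norm R p * L2_norm D v"
  proof (intro add_mono mult_right_mono Wn L2_norm_nonneg)
    have "W_plus_dual_norm R (fst p) \<le> sqrt ((W_plus_dual_norm R (fst p))\<^sup>2 + 0)" by simp
    also have "\<dots> \<le> dual_norm R p" unfolding dual_norm_def by (intro real_sqrt_le_mono add_left_mono) simp
    finally show "W_plus_dual_norm R (fst p) \<le> dual_norm R p" .
    have "L2_norm D (snd p) \<le> sqrt (0 + (L2_norm D (snd p))\<^sup>2)" by simp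
    also have "\<dots> \<le> dual_norm R p" unfolding dual_norm_def V_norm_def by (intro real_sqrt_le_mono add_right_mono) simp
    finally show "L2_norm D (snd p) \<le> dual_norm R p" .
  qed
  also have "\<dots> \<le> (W_norm R w + L2_norm D v + 1) * dual_norm R p"
    by (simp add: algebra_simps dual_norm_def)
  finally show "\<bar>fst p w + L2_inner D (snd p) v\<bar> \<le> (W_norm R w + L2_norm D v + 1) * dual_norm R p" .
  assume q: "q \<in> dual_space R"
  then have q': "snd q \<in> L2_space D" by (auto simp: dual_space_def intro: V_minus_L2)
  have "L2_inner D (a *\<^sub>R snd p + b *\<^sub>R snd q) v = a * L2_inner D (snd p) v + b * L2_inner D (snd q) v"
    by (rule L2_inner_comb_left[OF p'(2) q' vL])
  then show "fst (a *\<^sub>R p + b *\<^sub>R q) w + L2_inner D (snd (a *\<^sub>R p + b *\<^sub>R q)) v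
      = a * (fst p w + L2_inner D (snd p) v) + b * (fst q w + L2_inner D (snd q) v)"
    by (simp only: fst_add snd_add fst_scaleR snd_scaleR) (simp add: scaleR_fun_def algebra_simps)
qed

end

context galerkin
begin

lemma tested_WV_form:
  assumes z: "z \<in> WV"
  shows "tested_space WV (WV_norm R) (\<lambda>x. B x z) ((3 + Mc) * WV_norm R z + 1)"
proof
  show "(3 + Mc) * WV_norm R z + 1 > 0"
    using mult_nonneg_nonneg[of "3 + Mc" "WV_norm R z"] Mc_nonneg WV_norm_nonneg by (simp add: add_nonneg_pos)
  fix x y a b assume x: "x \<in> WV"
  have "\<bar>B x z\<bar> \<le> (3 + Mc) * WV_norm R x * WV_norm R z" by (rule B_bounded[OF x z])
  also have "\<dots> \<le> ((3 + Mc) * WV_norm R z + 1) * WV_norm R x"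
    using WV_norm_nonneg[of x] by (simp add: algebra_simps)
  finally show "\<bar>B x z\<bar> \<le> ((3 + Mc) * WV_norm R z + 1) * WV_norm R x" .
  assume "y \<in> WV"
  then show "B (a *\<^sub>R x + b *\<^sub>R y) z = a * B x z + b * B y z" using x z by (intro B_comb_left)
qed (rule subspace_WV)

lemma tested_Xh:
  assumes L: "tested_space WV (WV_norm R) L c" shows "tested_space Xh (WV_norm R) L c"
proof -
  interpret tested_space WV "WV_norm R" L c by fact
  show ?thesis by standard (use subspace_Xh L c bound in_WV in auto)
qed

lemma tested_WV_inner:
  assumes y: "y \<in> L2_space D"
  shows "tested_space WV (WV_norm R) (\<lambda>x. L2_inner D x y) (L2_norm D y + 1)"
proof
  show "L2_norm D y + 1 > 0" using L2_norm_nonneg[of D y] by linarith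
  fix x x' a b assume x: "x \<in> WV"
  have "\<bar>L2_inner D x y\<bar> \<le> L2_norm D x * L2_norm D y" by (rule L2_Cauchy_Schwarz[OF WV_L2(1)[OF x] y])
  also have "\<dots> \<le> WV_norm R x * L2_norm D y"
    by (rule mult_right_mono[OF L2_norm_le_WV_norm[OF WV_L2(1)[OF x]] L2_norm_nonneg])
  also have "\<dots> \<le> (L2_norm D y + 1) * WV_norm R x" using WV_norm_nonneg[of x] by (simp add: algebra_simps)
  finally show "\<bar>L2_inner D x y\<bar> \<le> (L2_norm D y + 1) * WV_norm R x" .
  assume "x' \<in> WV"
  then show "L2_inner D (a *\<^sub>R x + b *\<^sub>R x') y = a * L2_inner D x y + b * L2_inner D x' y"
    by (intro L2_inner_comb_left WV_L2(1) x y)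
qed (rule subspace_WV)

end

locale semidiscrete = galerkin +
  fixes T :: real and q \<phi> \<phi>h d\<phi>h :: "real \<Rightarrow> phase \<Rightarrow> real" and \<phi>0 :: "phase \<Rightarrow> real"
    and d\<phi> :: "real \<Rightarrow> functional \<times> (phase \<Rightarrow> real)"
  assumes T: "T > 0" and q: "L2_time T (V_space R) (V_norm R) q" and \<phi>0: "\<phi>0 \<in> WV_space R"
    and IP: "solves_IP R T k \<sigma>t q \<phi>0 \<phi> d\<phi>" and SD: "solves_SD R T k \<sigma>t Wh Vh q \<phi>0 \<phi>h d\<phi>h"
begin

abbreviation "I \<equiv> lebesgue_on {0<..<T}"

lemma \<phi>_L2: "t \<in> {0..T} \<Longrightarrow> \<phi> t \<in> L2_space D"
  using IP by (simp add: solves_IP_def V_space_def)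

lemma \<phi>_WV: "AE t in I. \<phi> t \<in> WV"
  using IP by (simp add: solves_IP_def L2_time_def strongly_measurable_def WV_space_eq)

lemma \<phi>h_Xh: "t \<in> {0..T} \<Longrightarrow> \<phi>h t \<in> Xh"
  using SD by (simp add: solves_SD_def H1_time_def)

lemma d\<phi>_dual: "AE t in I. d\<phi> t \<in> dual_space R"
  using IP by (simp add: solves_IP_def H1_time_def L2_time_def strongly_measurable_def)

lemma pairing_\<phi>:
  assumes w: "w \<in> W_plus R" and v: "v \<in> V_minus R"
  shows "integrable I (\<lambda>t. fst (d\<phi> t) w + L2_inner D (snd (d\<phi> t)) v)"
    "continuous_on {0..T} (\<lambda>t. pairing w v (\<phi> t))"
    "\<And>a b. 0 \<le> a \<Longrightarrow> a \<le> b \<Longrightarrow> b \<le> T \<Longrightarrow> pairing w v (\<phi> b) - pairing w v (\<phi> a)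
        = (LINT t|I. indicator {a<..<b} t * (fst (d\<phi> t) w + L2_inner D (snd (d\<phi> t)) v))"
proof -
  interpret Z: tested_space "dual_space R" "dual_norm R" "\<lambda>p. fst p w + L2_inner D (snd p) v" "W_norm R w + L2_norm D v + 1" T
    by (rule tested_dual_space[OF w v])
  have H: "H1_time T (dual_space R) (dual_norm R) (\<lambda>t. embed R (\<phi> t)) d\<phi>"
    using IP by (simp add: solves_IP_def)
  have e: "fst (embed R (\<phi> t)) w + L2_inner D (snd (embed R (\<phi> t))) v = pairing w v (\<phi> t)" for t
    by (simp add: embed_def pairing_def)
  show "integrable I (\<lambda>t. fst (d\<phi> t) w + L2_inner D (snd (d\<phi> t)) v)"
    "continuous_on {0..T} (\<lambda>t. pairing w v (\<phi> t))"
    "\<And>a b. 0 \<le> a \<Longrightarrow> a \<le> b \<Longrightarrow> b \<le> T \<Longrightarrow> pairing w v (\<phi> b) - pairing w v (\<phi> a)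
        = (LINT t|I. indicator {a<..<b} t * (fst (d\<phi> t) w + L2_inner D (snd (d\<phi> t)) v))"
    using Z.L_H1[OF H] unfolding e by auto
qed

lemma inner_\<phi>h:
  assumes y: "y \<in> L2_space D"
  shows "integrable I (\<lambda>t. L2_inner D (d\<phi>h t) y)"
    "continuous_on {0..T} (\<lambda>t. L2_inner D (\<phi>h t) y)"
    "\<And>a b. 0 \<le> a \<Longrightarrow> a \<le> b \<Longrightarrow> b \<le> T \<Longrightarrow> L2_inner D (\<phi>h b) y - L2_inner D (\<phi>h a) y
        = (LINT t|I. indicator {a<..<b} t * L2_inner D (d\<phi>h t) y)"
proof -
  interpret Z: tested_space Xh "WV_norm R" "\<lambda>x. L2_inner D x y" "L2_norm D y + 1" T
    by (rule tested_Xh[OF tested_WV_inner[OF y]])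
  have H: "H1_time T Xh (WV_norm R) \<phi>h d\<phi>h" using SD by (simp add: solves_SD_def)
  show "integrable I (\<lambda>t. L2_inner D (d\<phi>h t) y)"
    "continuous_on {0..T} (\<lambda>t. L2_inner D (\<phi>h t) y)"
    "\<And>a b. 0 \<le> a \<Longrightarrow> a \<le> b \<Longrightarrow> b \<le> T \<Longrightarrow> L2_inner D (\<phi>h b) y - L2_inner D (\<phi>h a) y
        = (LINT t|I. indicator {a<..<b} t * L2_inner D (d\<phi>h t) y)"
    using Z.L_H1[OF H] by auto
qed

lemma B_integrable:
  assumes z: "z \<in> Xh"
  shows "integrable I (\<lambda>t. B (\<phi> t) z)" "integrable I (\<lambda>t. B (\<phi>h t) z)"
proof -
  note zW = in_WV[OF z]
  interpret P: tested_space WV "WV_norm R" "\<lambda>x. B x z" "(3 + Mc) * WV_norm R z + 1" T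
    by (rule tested_WV_form[OF zW])
  show "integrable I (\<lambda>t. B (\<phi> t) z)"
    using IP by (intro P.L_L2_time) (simp add: solves_IP_def WV_space_eq)
  interpret Q: tested_space Xh "WV_norm R" "\<lambda>x. B x z" "(3 + Mc) * WV_norm R z + 1" T
    by (rule tested_Xh[OF tested_WV_form[OF zW]])
  show "integrable I (\<lambda>t. B (\<phi>h t) z)"
    using SD by (intro Q.L_L2_time) (simp add: solves_SD_def H1_time_def)
qed

text \<open>The discrete part of the error. Its values are meaningful at times at which the solution has a
  regular even part.\<close>

definition \<theta> :: "real \<Rightarrow> phase \<Rightarrow> real" where "\<theta> t = Pi_h (\<phi> t) - \<phi>h t"

lemma \<theta>_Xh: "t \<in> {0..T} \<Longrightarrow> \<phi> t \<in> WV \<Longrightarrow> \<theta> t \<in> Xh"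
  unfolding \<theta>_def by (intro subspace_diff subspace_Xh Pi_h \<phi>h_Xh)

text \<open>The elliptic projection is not seen by the form on \<open>Xh\<close>, so the right hand side contains no
  projection and is an integrable function of time.\<close>

lemma B_\<theta>:
  assumes "t \<in> {0..T}" "\<phi> t \<in> WV" "\<psi> \<in> Xh"
  shows "B (\<theta> t) \<psi> = B (\<phi> t) \<psi> - B (\<phi>h t) \<psi>"
  using B_comb_left[of "Pi_h (\<phi> t)" "\<phi>h t" \<psi> 1 "-1"] Pi_h[OF assms(2)] \<phi>h_Xh[OF assms(1)] assms in_WV
  by (simp add: \<theta>_def)

text \<open>The difference of the two evolution equations, tested with an element of \<open>Xh\<close> and integrated in
  time. The pair of equations for the even and the odd part adds up to one equation with the form
  \<open>B\<close>.\<close>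

lemma galerkin_orthogonality:
  assumes \<psi>: "\<psi> \<in> Xh" and ab: "0 \<le> a" "a \<le> b" "b \<le> T"
  shows "(L2_inner D (\<phi> b) \<psi> - L2_inner D (\<phi>h b) \<psi>) - (L2_inner D (\<phi> a) \<psi> - L2_inner D (\<phi>h a) \<psi>)
    = - (LINT t|I. indicator {a<..<b} t * (B (\<phi> t) \<psi> - B (\<phi>h t) \<psi>))"
proof -
  have \<psi>W: "\<psi> \<in> WV" by (rule in_WV[OF \<psi>])
  note \<Psi> = WV_L2[OF \<psi>W]
  define w v where "w = even_part \<psi>" and "v = odd_part \<psi>"
  have wv: "w \<in> W_plus R" "v \<in> V_minus R"
    unfolding w_def v_def using \<psi>W by (auto intro: even_part_W_plus odd_part_V_minus \<Psi>)
  note P = pairing_\<phi>[OF wv] and Q = inner_\<phi>h[OF \<Psi>(1)]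
  have ps: "pairing w v (\<phi> t) = L2_inner D (\<phi> t) \<psi>" if "t \<in> {0..T}" for t
    unfolding w_def v_def by (rule pairing_self[OF \<phi>_L2[OF that] \<Psi>(1)])
  have qV: "AE t in I. q t \<in> L2_space D"
    using q by (simp add: L2_time_def strongly_measurable_def V_space_def)
  have e1: "AE t in I. fst (d\<phi> t) w - L2_inner D (odd_part (\<phi> t)) (wt w) + boundary_form R (even_part (\<phi> t)) w
        + L2_inner D (C (even_part (\<phi> t))) w = L2_inner D (even_part (q t)) w"
    using IP wv unfolding solves_IP_def by blast
  have e2: "AE t in I. L2_inner D (snd (d\<phi> t)) v + L2_inner D (wt (even_part (\<phi> t))) v
        + L2_inner D (C (odd_part (\<phi> t))) v = L2_inner D (odd_part (q t)) v"
    using IP wv unfolding solves_IP_def by blast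
  have e3: "AE t in I. L2_inner D (d\<phi>h t) \<psi> + B (\<phi>h t) \<psi> = L2_inner D (q t) \<psi>"
    using SD \<psi> unfolding solves_SD_def by blast
  have key: "AE t in I. (fst (d\<phi> t) w + L2_inner D (snd (d\<phi> t)) v) - L2_inner D (d\<phi>h t) \<psi>
      = - (B (\<phi> t) \<psi> - B (\<phi>h t) \<psi>)"
    using e1 e2 e3 qV \<phi>_WV
  proof eventually_elim
    fix t
    assume 1: "fst (d\<phi> t) w - L2_inner D (odd_part (\<phi> t)) (wt w) + boundary_form R (even_part (\<phi> t)) w
        + L2_inner D (C (even_part (\<phi> t))) w = L2_inner D (even_part (q t)) w"
      and 2: "L2_inner D (snd (d\<phi> t)) v + L2_inner D (wt (even_part (\<phi> t))) v
        + L2_inner D (C (odd_part (\<phi> t))) v = L2_inner D (odd_part (q t)) v"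
      and 3: "L2_inner D (d\<phi>h t) \<psi> + B (\<phi>h t) \<psi> = L2_inner D (q t) \<psi>"
      and qt: "q t \<in> L2_space D" and pt: "\<phi> t \<in> WV"
    have "L2_inner D (q t) \<psi> = L2_inner D (even_part (q t)) w + L2_inner D (odd_part (q t)) v"
      unfolding w_def v_def by (rule L2_inner_parts[OF qt \<Psi>(1)])
    moreover have "B (\<phi> t) \<psi> = boundary_form R (even_part (\<phi> t)) w + L2_inner D (C (even_part (\<phi> t))) w + L2_inner D (C (odd_part (\<phi> t))) v
        - L2_inner D (odd_part (\<phi> t)) (wt w) + L2_inner D (wt (even_part (\<phi> t))) v"
      unfolding bilinear_B_def w_def v_def C_parts[OF WV_L2(1)[OF pt] \<Psi>(1)] by simp
    ultimately show "(fst (d\<phi> t) w + L2_inner D (snd (d\<phi> t)) v) - L2_inner D (d\<phi>h t) \<psi> = - (B (\<phi> t) \<psi> - B (\<phi>h t) \<psi>)"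
      using 1 2 3 by linarith
  qed
  note indi = indicator_integrable_mult[of T _ a b]
  have "(LINT t|I. indicator {a<..<b} t * (fst (d\<phi> t) w + L2_inner D (snd (d\<phi> t)) v))
      - (LINT t|I. indicator {a<..<b} t * L2_inner D (d\<phi>h t) \<psi>)
      = (LINT t|I. indicator {a<..<b} t * (fst (d\<phi> t) w + L2_inner D (snd (d\<phi> t)) v) - indicator {a<..<b} t * L2_inner D (d\<phi>h t) \<psi>)"
    by (rule Bochner_Integration.integral_diff[OF indi[OF P(1)] indi[OF Q(1)], symmetric])
  also have "\<dots> = (LINT t|I. - (indicator {a<..<b} t * (B (\<phi> t) \<psi> - B (\<phi>h t) \<psi>)))"
  proof (rule integral_cong_AE)
    show "AE t in I. indicator {a<..<b} t * (fst (d\<phi> t) w + L2_inner D (snd (d\<phi> t)) v) - indicator {a<..<b} t * L2_inner D (d\<phi>h t) \<psi>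
        = - (indicator {a<..<b} t * (B (\<phi> t) \<psi> - B (\<phi>h t) \<psi>))"
      using key by eventually_elim (simp only: right_diff_distrib[symmetric] mult_minus_right)
    show "(\<lambda>t. indicator {a<..<b} t * (fst (d\<phi> t) w + L2_inner D (snd (d\<phi> t)) v) - indicator {a<..<b} t * L2_inner D (d\<phi>h t) \<psi>) \<in> borel_measurable I"
      using indi[OF P(1)] indi[OF Q(1)] by (intro borel_measurable_diff) auto
    have "integrable I (\<lambda>t. B (\<phi> t) \<psi> - B (\<phi>h t) \<psi>)" using B_integrable[OF \<psi>] by auto
    then show "(\<lambda>t. - (indicator {a<..<b} t * (B (\<phi> t) \<psi> - B (\<phi>h t) \<psi>))) \<in> borel_measurable I"
      using indi by (intro borel_measurable_uminus) auto
  qed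
  also have "\<dots> = - (LINT t|I. indicator {a<..<b} t * (B (\<phi> t) \<psi> - B (\<phi>h t) \<psi>))" by simp
  finally show ?thesis
    using P(3)[OF ab] Q(3)[OF ab] ps[of a] ps[of b] ab by simp
qed

end

section \<open>The error estimate\<close>

lemma le_of_le_epsilon_mult:
  fixes X Y Z :: real
  assumes "\<And>\<epsilon>. \<epsilon> > 0 \<Longrightarrow> X \<le> Y + \<epsilon> * Z" "Z \<ge> 0"
  shows "X \<le> Y"
proof (rule ccontr)
  assume "\<not> X \<le> Y"
  then have p: "(X - Y) / (2 * (Z + 1)) > 0" using assms(2) by simp
  have "(X - Y) / (2 * (Z + 1)) * Z \<le> (X - Y) / (2 * (Z + 1)) * (Z + 1)"
    using p by (intro mult_left_mono) auto
  also have "\<dots> = (X - Y) / 2" using assms(2) by (simp add: field_simps)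
  finally have "X \<le> Y + (X - Y) / 2" using assms(1)[OF p] by linarith
  with \<open>\<not> X \<le> Y\<close> show False by (simp add: field_simps)
qed

context galerkin
begin

lemma Pi_error_diff:
  assumes y: "y \<in> L2_space D" and x: "x \<in> WV" "x' \<in> WV"
  shows "Pi_error y (x - x') = Pi_error y x - Pi_error y x'"
proof -
  obtain z where z: "z \<in> Xh" "\<And>x. x \<in> WV \<Longrightarrow> Pi_error y x = L2_inner D x y - B x z"
    using Pi_error_residual[OF y] by blast
  show ?thesis
    using z(2)[OF x(1)] z(2)[OF x(2)] z(2)[OF subspace_diff[OF subspace_WV x]]
      B_comb_left[OF x in_WV[OF z(1)], of 1 "-1"] L2_inner_diff_left[OF WV_L2(1)[OF x(1)] WV_L2(1)[OF x(2)] y]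
    by simp
qed

end

context semidiscrete
begin

abbreviation "E t \<equiv> best_error_dual R Wh Vh (d\<phi> t)"

text \<open>The function \<open>G\<close> is a maximal measurable minorant of the best errors, and does not depend on \<open>y\<close>.
  Given \<open>y\<close>, an approximating pairing is absolutely continuous along \<open>\<phi>\<close>, and its derivative, being
  measurable and below a multiple of the best errors, is below the same multiple of \<open>G\<close>.\<close>

lemma projection_error_control:
  assumes s: "0 \<le> s" "s \<le> T" and fin: "(\<integral>\<^sup>+t. E t \<partial>lebesgue_on {0..s}) < \<infinity>"
  obtains G where "integrable I G"
    "(\<integral>\<^sup>+t. E t \<partial>lebesgue_on {0..s}) = ennreal (LINT t|I. indicator {0<..<s} t * G t)"
    "\<And>t. 0 \<le> G t"
    "\<And>y a b. y \<in> L2_space D \<Longrightarrow> 0 \<le> a \<Longrightarrow> a \<le> b \<Longrightarrow> b \<le> s \<Longrightarrow> \<phi> a \<in> WV \<Longrightarrow> \<phi> b \<in> WV \<Longrightarrow>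
      \<bar>Pi_error y (\<phi> b) - Pi_error y (\<phi> a)\<bar> \<le> Cq * L2_norm D y * (LINT t|I. indicator {a<..<b} t * G t)"
proof -
  define f where "f t = E t * indicator {0<..<s} t" for t
  have fE: "(\<integral>\<^sup>+t. f t \<partial>I) = (\<integral>\<^sup>+t. E t \<partial>lebesgue_on {0..s})"
  proof -
    have "(\<integral>\<^sup>+t. f t \<partial>I) = (\<integral>\<^sup>+t. f t * indicator {0<..<T} t \<partial>lebesgue)"
      by (rule nn_integral_restrict_space) simp
    also have "\<dots> = (\<integral>\<^sup>+t. E t * indicator {0..s} t \<partial>lebesgue)"
    proof (rule nn_integral_cong_AE)
      have "AE t in lebesgue. t \<noteq> 0 \<and> t \<noteq> s"
        using AE_completion[OF AE_lborel_singleton[of 0]] AE_completion[OF AE_lborel_singleton[of s]]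
        by eventually_elim simp
      then show "AE t in lebesgue. f t * indicator {0<..<T} t = E t * indicator {0..s} t"
        by eventually_elim (use s in \<open>auto simp: f_def indicator_def\<close>)
    qed
    also have "\<dots> = (\<integral>\<^sup>+t. E t \<partial>lebesgue_on {0..s})"
      by (rule nn_integral_restrict_space[symmetric]) simp
    finally show ?thesis .
  qed
  obtain g where g: "g \<in> borel_measurable I" "\<And>t. g t \<le> f t" "(\<integral>\<^sup>+t. g t \<partial>I) = (\<integral>\<^sup>+t. f t \<partial>I)"
    using nn_integral_maximal_minorant[of I f] by blast
  have gfin: "(\<integral>\<^sup>+t. g t \<partial>I) < \<infinity>" using fin by (simp add: g(3) fE)
  have gtop: "AE t in I. g t \<noteq> \<infinity>" by (rule nn_integral_PInf_AE) (use g(1) gfin in auto)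
  define G where "G t = enn2real (g t)" for t
  have Gm: "G \<in> borel_measurable I" unfolding G_def using g(1) by measurable
  have G0: "0 \<le> G t" for t by (simp add: G_def)
  have gG: "AE t in I. ennreal (G t) = g t"
    using gtop by eventually_elim (simp add: G_def less_top)
  have intG: "(\<integral>\<^sup>+t. ennreal (G t) \<partial>I) = (\<integral>\<^sup>+t. g t \<partial>I)" by (rule nn_integral_cong_AE[OF gG])
  have Gi: "integrable I G"
    using Gm gfin intG G0 by (intro integrableI_nonneg) auto
  have Gind: "indicator {0<..<s} t * G t = G t" for t
    using g(2)[of t] by (cases "t \<in> {0<..<s}") (auto simp: f_def G_def)
  have eqG: "(\<integral>\<^sup>+t. E t \<partial>lebesgue_on {0..s}) = ennreal (LINT t|I. indicator {0<..<s} t * G t)"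
    unfolding Gind fE[symmetric] g(3)[symmetric] intG[symmetric]
    by (rule nn_integral_eq_integral[OF Gi]) (simp add: G0)
  have ctrl: "\<bar>Pi_error y (\<phi> b) - Pi_error y (\<phi> a)\<bar> \<le> Cq * L2_norm D y * (LINT t|I. indicator {a<..<b} t * G t)"
    if y: "y \<in> L2_space D" and ab: "0 \<le> a" "a \<le> b" "b \<le> s" and ph: "\<phi> a \<in> WV" "\<phi> b \<in> WV" for y a b
  proof -
    define J where "J = (LINT t|I. indicator {a<..<b} t * G t)"
    have J0: "0 \<le> J" unfolding J_def by (intro integral_nonneg_AE) (simp add: G0)
    define x where "x = \<phi> b - \<phi> a"
    have xW: "x \<in> WV" unfolding x_def using subspace_diff[OF subspace_WV] ph by blast
    have bound: "\<bar>Pi_error y x\<bar> \<le> Cq * L2_norm D y * J + \<epsilon> * (J + WV_norm R x)" if \<epsilon>: "\<epsilon> > 0" for \<epsilon>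
    proof -
      define c where "c = Cq * L2_norm D y + \<epsilon>"
      have c: "c > 0" using \<epsilon> Cq_pos L2_norm_nonneg[of D y] unfolding c_def
        by (intro add_nonneg_pos mult_nonneg_nonneg) auto
      obtain w v where wv: "w \<in> W_plus R" "v \<in> V_minus R"
        "\<And>x. x \<in> WV \<Longrightarrow> \<bar>Pi_error y x - pairing w v x\<bar> \<le> \<epsilon> * WV_norm R x"
        "\<And>x. x \<in> Xh \<Longrightarrow> pairing w v x = 0"
        using Pi_error_pairing[OF y \<epsilon>] by blast
      have pb: "\<bar>pairing w v x\<bar> \<le> c * WV_norm R x" if "x \<in> WV" for x
      proof -
        have "\<bar>pairing w v x\<bar> \<le> Cq * L2_norm D y * WV_norm R x + \<epsilon> * WV_norm R x"
          using wv(3)[OF that] Pi_error_bound[OF y that] by linarith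
        then show ?thesis by (simp add: c_def distrib_right)
      qed
      define P where "P t = fst (d\<phi> t) w + L2_inner D (snd (d\<phi> t)) v" for t
      note pp = pairing_\<phi>[OF wv(1,2), folded P_def]
      define h where "h t = ennreal (indicator {0<..<s} t * \<bar>P t\<bar> / c)" for t
      have hm: "h \<in> borel_measurable I"
      proof -
        have "(\<lambda>t. indicator {0<..<s} t * \<bar>P t\<bar>) \<in> borel_measurable I"
          using indicator_integrable_mult[OF integrable_abs[OF pp(1)]] by auto
        then show ?thesis unfolding h_def by measurable
      qed
      have hf: "AE t in I. h t \<le> f t"
        using d\<phi>_dual
      proof eventually_elim
        fix t assume "d\<phi> t \<in> dual_space R"
        then have "snd (d\<phi> t) \<in> L2_space D" by (auto simp: dual_space_def intro: V_minus_L2)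
        from pairing_best_error_dual[OF wv(1,2) pb wv(4) c this]
        show "h t \<le> f t" by (cases "t \<in> {0<..<s}") (auto simp: h_def f_def P_def)
      qed
      have hG: "AE t in I. indicator {0<..<s} t * \<bar>P t\<bar> \<le> c * G t"
        using maximal_minorant_absorbs[OF g _ hm hf] gG fin unfolding fE
      proof (elim meta_impE)
        show "AE t in I. indicator {0<..<s} t * \<bar>P t\<bar> \<le> c * G t" if hg: "AE t in I. h t \<le> g t"
          using hg gG
        proof eventually_elim
          fix t assume "h t \<le> g t" "ennreal (G t) = g t"
          then have "ennreal (indicator {0<..<s} t * \<bar>P t\<bar> / c) \<le> ennreal (G t)" by (simp add: h_def)
          then have "indicator {0<..<s} t * \<bar>P t\<bar> / c \<le> G t" using G0 by (simp add: ennreal_le_iff)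
          then show "indicator {0<..<s} t * \<bar>P t\<bar> \<le> c * G t" using c by (simp add: pos_divide_le_eq mult.commute)
        qed
      qed auto
      have "pairing w v x = pairing w v (\<phi> b) - pairing w v (\<phi> a)"
      proof -
        have "pairing w v (1 *\<^sub>R \<phi> b + (-1) *\<^sub>R \<phi> a) = 1 * pairing w v (\<phi> b) + (-1) * pairing w v (\<phi> a)"
          unfolding pairing_def even_part_comb odd_part_comb
          using L2_inner_comb_left[OF WV_L2(2)[OF ph(2)] WV_L2(2)[OF ph(1)] W_plus_L2[OF wv(1)], of 1 "-1"]
            L2_inner_comb_left[OF WV_L2(3)[OF ph(2)] WV_L2(3)[OF ph(1)] V_minus_L2[OF wv(2)], of 1 "-1"]
          by (simp only: algebra_simps)
        moreover have "1 *\<^sub>R \<phi> b + (-1) *\<^sub>R \<phi> a = x" by (simp add: x_def)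
        ultimately show ?thesis by simp
      qed
      also have "\<dots> = (LINT t|I. indicator {a<..<b} t * P t)" using ab s by (intro pp(3)) auto
      also have "\<bar>\<dots>\<bar> \<le> (LINT t|I. \<bar>indicator {a<..<b} t * P t\<bar>)" by (rule integral_abs_bound)
      also have "\<dots> \<le> (LINT t|I. c * (indicator {a<..<b} t * G t))"
      proof (rule integral_mono_AE)
        show "integrable I (\<lambda>t. \<bar>indicator {a<..<b} t * P t\<bar>)"
          by (intro integrable_abs indicator_integrable_mult pp(1))
        show "integrable I (\<lambda>t. c * (indicator {a<..<b} t * G t))"
          by (intro integrable_mult_right indicator_integrable_mult Gi)
        show "AE t in I. \<bar>indicator {a<..<b} t * P t\<bar> \<le> c * (indicator {a<..<b} t * G t)"
          using hG by eventually_elim (use ab in \<open>auto simp: indicator_def\<close>)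
      qed
      also have "\<dots> = c * J" by (simp add: J_def)
      finally have "\<bar>pairing w v x\<bar> \<le> c * J" .
      then have "\<bar>Pi_error y x\<bar> \<le> c * J + \<epsilon> * WV_norm R x" using wv(3)[OF xW] by linarith
      then show ?thesis by (simp add: c_def algebra_simps)
    qed
    have "\<bar>Pi_error y x\<bar> \<le> Cq * L2_norm D y * J"
      by (rule le_of_le_epsilon_mult[OF bound]) (use J0 WV_norm_nonneg[of x] in auto)
    then show ?thesis unfolding J_def x_def using Pi_error_diff[OF y ph(2,1)] by simp
  qed
  show ?thesis by (rule that[OF Gi eqG G0 ctrl])
qed

lemma \<theta>_increment:
  assumes y: "y \<in> L2_space D" and ab: "a \<in> {0..T}" "b \<in> {0..T}" and ph: "\<phi> a \<in> WV" "\<phi> b \<in> WV"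
  shows "L2_inner D (\<theta> b - \<theta> a) y = (L2_inner D (\<phi> b) y - L2_inner D (\<phi>h b) y) - (L2_inner D (\<phi> a) y - L2_inner D (\<phi>h a) y)
    - (Pi_error y (\<phi> b) - Pi_error y (\<phi> a))"
proof -
  have e: "L2_inner D (\<theta> t) y = L2_inner D (\<phi> t) y - L2_inner D (\<phi>h t) y - Pi_error y (\<phi> t)"
    if "t \<in> {0..T}" "\<phi> t \<in> WV" for t
  proof -
    have L: "Pi_h (\<phi> t) \<in> L2_space D" "\<phi>h t \<in> L2_space D"
      using in_WV[OF Pi_h(1)[OF that(2)]] in_WV[OF \<phi>h_Xh[OF that(1)]] WV_L2(1) by blast+
    show ?thesis unfolding \<theta>_def Pi_error_def
      using L2_inner_diff_left[OF L y] L2_inner_diff_left[OF WV_L2(1)[OF that(2)] L(1) y] by simp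
  qed
  have "\<theta> a \<in> L2_space D" "\<theta> b \<in> L2_space D"
    using in_WV[OF \<theta>_Xh[OF ab(1) ph(1)]] in_WV[OF \<theta>_Xh[OF ab(2) ph(2)]] WV_L2(1) by blast+
  then show ?thesis using e[OF ab(1) ph(1)] e[OF ab(2) ph(2)] L2_inner_diff_left[of "\<theta> b" D "\<theta> a" y] y by simp
qed

text \<open>The discrete initial value is the projection of \<open>\<phi>0\<close>, which agrees with \<open>\<phi> 0\<close> almost everywhere.\<close>

lemma \<phi>_initial: "\<phi> 0 \<in> WV" "L2_norm D (\<theta> 0) = 0"
proof -
  have L: "\<phi> 0 \<in> L2_space D" using T by (intro \<phi>_L2) simp
  have 0: "\<phi>0 \<in> WV" using \<phi>0 by (simp add: WV_space_eq)
  have ae: "AE x in D. \<phi> 0 x = \<phi>0 x" using IP by (simp add: solves_IP_def)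
  have "AE x in D. even_part \<phi>0 x = even_part (\<phi> 0) x"
    using ae AE_reflect[OF ae] by eventually_elim (simp add: even_part_eq)
  from W_space_cong(1)[OF WV_L2(6)[OF 0] L2_measurable[OF even_part_L2[OF L]] this]
  show W: "\<phi> 0 \<in> WV" using L by (simp add: WV_def)
  have t0: "0 \<in> {0..T}" using T by simp
  have n: "L2_norm D (\<phi> 0 - \<phi>0) = 0"
    unfolding L2_norm_eq_0_iff[OF L2_space_diff[OF L WV_L2(1)[OF 0]]]
    using ae by eventually_elim (simp add: fun_diff_def)
  have th: "\<theta> 0 \<in> Xh" by (rule \<theta>_Xh[OF t0 W])
  have "B (\<theta> 0) (\<theta> 0) = B (\<phi> 0) (\<theta> 0) - B (\<phi>h 0) (\<theta> 0)" by (rule B_\<theta>[OF t0 W th])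
  also have "B (\<phi>h 0) (\<theta> 0) = B \<phi>0 (\<theta> 0)"
    using SD th unfolding solves_SD_def is_elliptic_projection_def by blast
  also have "B (\<phi> 0) (\<theta> 0) - B \<phi>0 (\<theta> 0) = B (\<phi> 0 - \<phi>0) (\<theta> 0)"
    using B_comb_left[OF W 0 in_WV[OF th], of 1 "-1"] by simp
  also have "\<dots> = 0" by (rule WV_null(1)[OF subspace_diff[OF subspace_WV W 0] n in_WV[OF th]])
  finally show "L2_norm D (\<theta> 0) = 0" by (rule B_null[OF in_WV[OF th]])
qed

text \<open>A set of full measure meets every interval.\<close>

lemma \<phi>_WV_dense:
  assumes "0 \<le> a" "a < b" "b \<le> T"
  shows "\<exists>t. \<phi> t \<in> WV \<and> a < t \<and> t < b"
proof (rule ccontr)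
  assume n: "\<not> (\<exists>t. \<phi> t \<in> WV \<and> a < t \<and> t < b)"
  have "AE t in lebesgue. t \<in> {0<..<T} \<longrightarrow> \<phi> t \<in> WV"
    using \<phi>_WV by (subst (asm) AE_restrict_space_iff) auto
  then have "AE t in lebesgue. t \<notin> {a<..<b}"
    by eventually_elim (use n assms in auto)
  then have "{a<..<b} \<in> null_sets lebesgue"
    by (subst (asm) AE_iff_null_sets[symmetric]) auto
  then have "emeasure lebesgue {a<..<b} = 0" by (simp add: null_sets_def)
  then show False using assms by simp
qed

text \<open>Tested with an element of the frame, the increments of \<open>\<theta>\<close> consist of increments of continuous
  functions of time and of an increment of the projection error, which is controlled by the absolute
  continuity of the integral of \<open>G\<close>. The frame is finite.\<close>

lemma \<theta>_uniformly_continuous: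
  assumes s: "0 \<le> s" "s \<le> T" and G: "integrable I G"
    and ctrl: "\<And>y a b. y \<in> L2_space D \<Longrightarrow> 0 \<le> a \<Longrightarrow> a \<le> b \<Longrightarrow> b \<le> s \<Longrightarrow> \<phi> a \<in> WV \<Longrightarrow> \<phi> b \<in> WV \<Longrightarrow>
      \<bar>Pi_error y (\<phi> b) - Pi_error y (\<phi> a)\<bar> \<le> Cq * L2_norm D y * (LINT t|I. indicator {a<..<b} t * G t)"
    and \<epsilon>: "\<epsilon> > 0"
  shows "\<exists>d>0. \<forall>a b. 0 \<le> a \<longrightarrow> a \<le> b \<longrightarrow> b \<le> s \<longrightarrow> b - a < d \<longrightarrow> \<phi> a \<in> WV \<longrightarrow> \<phi> b \<in> WV \<longrightarrow> L2_norm D (\<theta> b - \<theta> a) \<le> \<epsilon>"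
proof -
  obtain F where F: "frame F" by (rule frame_exists)
  note F' = frameD[OF F]
  define \<Gamma> where "\<Gamma> t = (LINT x|I. indicator {0<..<t} x * G x)" for t
  have \<Gamma>c: "continuous_on {0..T} \<Gamma>"
    unfolding \<Gamma>_def by (rule continuous_on_subset[OF continuous_on_indefinite_integral[OF G]]) simp
  have \<Gamma>d: "(LINT t|I. indicator {a<..<b} t * G t) = \<Gamma> b - \<Gamma> a" if "0 \<le> a" "a \<le> b" for a b
    unfolding \<Gamma>_def by (rule indicator_integral_diff[OF G that])
  define N where "N = real (card F) + 1"
  have N: "N > 0" by (simp add: N_def)
  \<comment> \<open>each component of the increment has three parts below \<open>\<eta>\<close>\<close>
  define \<eta> where "\<eta> = \<epsilon> / (3 * N)"
  have \<eta>: "\<eta> > 0" "3 * N * \<eta> = \<epsilon>" using \<epsilon> N by (simp_all add: \<eta>_def)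
  have uc: "\<exists>d>0. \<forall>a\<in>{0..T}. \<forall>b\<in>{0..T}. \<bar>b - a\<bar> < d \<longrightarrow> \<bar>f b - f a\<bar> < r"
    if f: "continuous_on {0..T} f" and "r > 0" for f :: "real \<Rightarrow> real" and r
    using compact_uniformly_continuous[OF f compact_Icc] \<open>r > 0\<close>
    unfolding uniformly_continuous_on_def dist_real_def by metis
  have "\<forall>e\<in>F. \<exists>d>0. \<forall>a b. 0 \<le> a \<longrightarrow> a \<le> b \<longrightarrow> b \<le> s \<longrightarrow> b - a < d \<longrightarrow> \<phi> a \<in> WV \<longrightarrow> \<phi> b \<in> WV \<longrightarrow>
      \<bar>L2_inner D (\<theta> b - \<theta> a) e\<bar> \<le> 3 * \<eta>"
  proof
    fix e assume e: "e \<in> F"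
    note eL = F'(5)[OF e]
    have wv: "even_part e \<in> W_plus R" "odd_part e \<in> V_minus R"
      using F'(4)[OF e] eL by (auto intro: even_part_W_plus odd_part_V_minus)
    define f1 where "f1 t = pairing (even_part e) (odd_part e) (\<phi> t)" for t
    define f2 where "f2 t = L2_inner D (\<phi>h t) e" for t
    obtain d1 where d1: "d1 > 0" "\<And>a b. a \<in> {0..T} \<Longrightarrow> b \<in> {0..T} \<Longrightarrow> \<bar>b - a\<bar> < d1 \<Longrightarrow> \<bar>f1 b - f1 a\<bar> < \<eta>"
      using uc[OF pairing_\<phi>(2)[OF wv] \<eta>(1)] unfolding f1_def by blast
    obtain d2 where d2: "d2 > 0" "\<And>a b. a \<in> {0..T} \<Longrightarrow> b \<in> {0..T} \<Longrightarrow> \<bar>b - a\<bar> < d2 \<Longrightarrow> \<bar>f2 b - f2 a\<bar> < \<eta>"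
      using uc[OF inner_\<phi>h(2)[OF eL] \<eta>(1)] unfolding f2_def by blast
    have "\<eta> / Cq > 0" using \<eta> Cq_pos by simp
    then obtain d3 where d3: "d3 > 0" "\<And>a b. a \<in> {0..T} \<Longrightarrow> b \<in> {0..T} \<Longrightarrow> \<bar>b - a\<bar> < d3 \<Longrightarrow> \<bar>\<Gamma> b - \<Gamma> a\<bar> < \<eta> / Cq"
      using uc[OF \<Gamma>c] by blast
    show "\<exists>d>0. \<forall>a b. 0 \<le> a \<longrightarrow> a \<le> b \<longrightarrow> b \<le> s \<longrightarrow> b - a < d \<longrightarrow> \<phi> a \<in> WV \<longrightarrow> \<phi> b \<in> WV \<longrightarrow>
      \<bar>L2_inner D (\<theta> b - \<theta> a) e\<bar> \<le> 3 * \<eta>"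
    proof (intro exI[of _ "min d1 (min d2 d3)"] conjI allI impI)
      show "min d1 (min d2 d3) > 0" using d1 d2 d3 by simp
      fix a b assume ab: "0 \<le> a" "a \<le> b" "b \<le> s" "b - a < min d1 (min d2 d3)" and ph: "\<phi> a \<in> WV" "\<phi> b \<in> WV"
      have abT: "a \<in> {0..T}" "b \<in> {0..T}" using ab s by auto
      have "\<bar>b - a\<bar> < d1" "\<bar>b - a\<bar> < d2" "\<bar>b - a\<bar> < d3" using ab by auto
      note b1 = d1(2)[OF abT this(1)] and b2 = d2(2)[OF abT this(2)] and b3 = d3(2)[OF abT this(3)]
      have "\<bar>Pi_error e (\<phi> b) - Pi_error e (\<phi> a)\<bar> \<le> Cq * (\<Gamma> b - \<Gamma> a)"
        using ctrl[OF eL ab(1,2,3) ph] F'(3)[OF e] by (simp add: \<Gamma>d[OF ab(1,2)])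
      also have "\<dots> \<le> Cq * (\<eta> / Cq)" using b3 Cq_pos by (intro mult_left_mono) auto
      also have "\<dots> = \<eta>" using Cq_pos by simp
      finally have b3': "\<bar>Pi_error e (\<phi> b) - Pi_error e (\<phi> a)\<bar> \<le> \<eta>" .
      have f1: "f1 a = L2_inner D (\<phi> a) e" "f1 b = L2_inner D (\<phi> b) e"
        unfolding f1_def by (intro pairing_self \<phi>_L2 abT eL)+
      show "\<bar>L2_inner D (\<theta> b - \<theta> a) e\<bar> \<le> 3 * \<eta>"
        using b1 b2 b3' unfolding \<theta>_increment[OF eL abT ph] f1 f2_def by linarith
    qed
  qed
  then obtain d where d: "\<And>e. e \<in> F \<Longrightarrow> d e > 0" "\<And>e a b. e \<in> F \<Longrightarrow> 0 \<le> a \<Longrightarrow> a \<le> b \<Longrightarrow> b \<le> s \<Longrightarrow> b - a < d e \<Longrightarrow>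
      \<phi> a \<in> WV \<Longrightarrow> \<phi> b \<in> WV \<Longrightarrow> \<bar>L2_inner D (\<theta> b - \<theta> a) e\<bar> \<le> 3 * \<eta>"
    by (metis (no_types))
  define d0 where "d0 = Min (insert 1 (d ` F))"
  have d0: "d0 > 0" "\<And>e. e \<in> F \<Longrightarrow> d0 \<le> d e" unfolding d0_def using F'(1) d(1) by auto
  show ?thesis
  proof (intro exI[of _ d0] conjI allI impI d0(1))
    fix a b assume ab: "0 \<le> a" "a \<le> b" "b \<le> s" "b - a < d0" and ph: "\<phi> a \<in> WV" "\<phi> b \<in> WV"
    have "\<theta> b - \<theta> a \<in> Xh" using ab s ph by (intro subspace_diff subspace_Xh \<theta>_Xh) auto
    from frame_norm_le[OF F this]
    have "L2_norm D (\<theta> b - \<theta> a) \<le> (\<Sum>e\<in>F. \<bar>L2_inner D (\<theta> b - \<theta> a) e\<bar>)" .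
    also have "\<dots> \<le> (\<Sum>e\<in>F. 3 * \<eta>)"
    proof (rule sum_mono)
      fix e assume e: "e \<in> F"
      have "b - a < d e" using ab(4) d0(2)[OF e] by linarith
      from d(2)[OF e ab(1,2,3) this ph] show "\<bar>L2_inner D (\<theta> b - \<theta> a) e\<bar> \<le> 3 * \<eta>" .
    qed
    also have "\<dots> = real (card F) * (3 * \<eta>)" by simp
    also have "\<dots> \<le> N * (3 * \<eta>)" unfolding N_def using \<eta>(1) by (intro mult_right_mono) auto
    also have "\<dots> = \<epsilon>" using \<eta>(2) by (simp add: mult_ac)
    finally show "L2_norm D (\<theta> b - \<theta> a) \<le> \<epsilon>" .
  qed
qed

text \<open>Over a step from \<open>a\<close> to \<open>b\<close>, test with \<open>\<theta> b\<close>. The integrated form differs from \<open>(b - a)\<close> times the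
  nonnegative \<open>B (\<theta> b) (\<theta> b)\<close> by an amount that the uniform continuity makes small. Dividing by the
  norm of \<open>\<theta> b\<close> bounds the increase of the norm by that of \<open>\<Gamma>\<close> and an error proportional to the
  length of the step.\<close>

lemma \<theta>_bound:
  assumes s: "s \<in> {0..T}" "\<phi> s \<in> WV" and fin: "(\<integral>\<^sup>+t. E t \<partial>lebesgue_on {0..s}) < \<infinity>"
  shows "ennreal (L2_norm D (\<theta> s)) \<le> ennreal Cq * (\<integral>\<^sup>+t. E t \<partial>lebesgue_on {0..s})"
proof -
  have s': "0 \<le> s" "s \<le> T" using s by auto
  obtain G where Gi: "integrable I G"
    and eqG: "(\<integral>\<^sup>+t. E t \<partial>lebesgue_on {0..s}) = ennreal (LINT t|I. indicator {0<..<s} t * G t)"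
    and G0: "\<And>t. 0 \<le> G t"
    and ctrl: "\<And>y a b. y \<in> L2_space D \<Longrightarrow> 0 \<le> a \<Longrightarrow> a \<le> b \<Longrightarrow> b \<le> s \<Longrightarrow> \<phi> a \<in> WV \<Longrightarrow> \<phi> b \<in> WV \<Longrightarrow>
      \<bar>Pi_error y (\<phi> b) - Pi_error y (\<phi> a)\<bar> \<le> Cq * L2_norm D y * (LINT t|I. indicator {a<..<b} t * G t)"
    using projection_error_control[OF s' fin] by blast
  define \<Gamma> where "\<Gamma> t = Cq * (LINT x|I. indicator {0<..<t} x * G x)" for t
  have \<Gamma>d: "Cq * (LINT t|I. indicator {a<..<b} t * G t) = \<Gamma> b - \<Gamma> a" if "0 \<le> a" "a \<le> b" for a b
    by (simp only: \<Gamma>_def indicator_integral_diff[OF Gi that] right_diff_distrib)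
  obtain K where K: "K \<ge> 0" "\<And>x y. x \<in> Xh \<Longrightarrow> y \<in> Xh \<Longrightarrow> \<bar>B x y\<bar> \<le> K * L2_norm D x * L2_norm D y"
    using B_bounded_Xh by blast
  define n where "n t = L2_norm D (\<theta> t)" for t
  have n0: "0 \<le> n t" for t by (simp add: n_def L2_norm_nonneg)
  have main: "n s \<le> (\<Gamma> s - \<Gamma> 0) + \<epsilon> * (K * s)" if \<epsilon>: "\<epsilon> > 0" for \<epsilon>
  proof -
    obtain d where d: "d > 0" "\<And>a b. 0 \<le> a \<Longrightarrow> a \<le> b \<Longrightarrow> b \<le> s \<Longrightarrow> b - a < d \<Longrightarrow> \<phi> a \<in> WV \<Longrightarrow> \<phi> b \<in> WV \<Longrightarrow>
        L2_norm D (\<theta> b - \<theta> a) \<le> \<epsilon>"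
      using \<theta>_uniformly_continuous[OF s' Gi ctrl \<epsilon>] by blast
    have "n s \<le> n 0 + (\<Gamma> s - \<Gamma> 0) + (K * \<epsilon>) * s"
    proof (rule chain_short_steps[OF d(1), where A="{t. \<phi> t \<in> WV}" and s=s])
      show "0 \<in> {t. \<phi> t \<in> WV}" using \<phi>_initial by simp
      show "\<exists>t\<in>{t. \<phi> t \<in> WV}. a < t \<and> t < b" if "0 \<le> a" "a < b" "b \<le> s" for a b
        using \<phi>_WV_dense[of a b] that s' by auto
      fix a b assume ph': "a \<in> {t. \<phi> t \<in> WV}" "b \<in> {t. \<phi> t \<in> WV}" and ab: "0 \<le> a" "a \<le> b" "b \<le> s" "b - a < d"
      have ph: "\<phi> a \<in> WV" "\<phi> b \<in> WV" using ph' by auto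
      have abT: "a \<in> {0..T}" "b \<in> {0..T}" using ab s' by auto
      have \<theta>X: "\<theta> a \<in> Xh" "\<theta> b \<in> Xh" using \<theta>_Xh abT ph by auto
      have \<theta>L: "\<theta> a \<in> L2_space D" "\<theta> b \<in> L2_space D" using \<theta>X in_WV WV_L2(1) by blast+
      define \<psi> where "\<psi> = \<theta> b"
      have \<psi>: "\<psi> \<in> Xh" "\<psi> \<in> L2_space D" "L2_norm D \<psi> = n b" using \<theta>X \<theta>L by (auto simp: \<psi>_def n_def)
      have Bi: "integrable I (\<lambda>t. B (\<phi> t) \<psi> - B (\<phi>h t) \<psi>)" using B_integrable[OF \<psi>(1)] by auto
      \<comment> \<open>on a short step the form evaluated at the end point is nonnegative up to the modulus of continuity\<close>
      have "AE t in I. indicator {a<..<b} t * (- (K * \<epsilon> * n b)) \<le> indicator {a<..<b} t * (B (\<phi> t) \<psi> - B (\<phi>h t) \<psi>)"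
        using \<phi>_WV
      proof eventually_elim
        fix t assume pt: "\<phi> t \<in> WV"
        have "- (K * \<epsilon> * n b) \<le> B (\<phi> t) \<psi> - B (\<phi>h t) \<psi>" if t: "t \<in> {a<..<b}"
        proof -
          have tT: "t \<in> {0..T}" using t ab s' by auto
          note tX = \<theta>_Xh[OF tT pt]
          have "L2_norm D (\<theta> b - \<theta> t) \<le> \<epsilon>" using t ab by (intro d(2) pt ph) auto
          then have c: "L2_norm D (\<theta> t - \<theta> b) \<le> \<epsilon>" by (simp only: L2_norm_minus_commute)
          have "\<bar>B (\<theta> t - \<theta> b) \<psi>\<bar> \<le> K * L2_norm D (\<theta> t - \<theta> b) * L2_norm D \<psi>"
            by (rule K(2)[OF subspace_diff[OF subspace_Xh tX \<theta>X(2)] \<psi>(1)])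
          also have "\<dots> \<le> K * \<epsilon> * n b" unfolding \<psi>(3) using c K(1) n0 by (intro mult_right_mono mult_left_mono) auto
          finally have "\<bar>B (\<theta> t - \<theta> b) \<psi>\<bar> \<le> K * \<epsilon> * n b" .
          moreover have "B (\<theta> t - \<theta> b) \<psi> = B (\<theta> t) \<psi> - B (\<theta> b) \<psi>"
            using B_comb_left[OF in_WV[OF tX] in_WV[OF \<theta>X(2)] in_WV[OF \<psi>(1)], of 1 "-1"] by simp
          moreover have "0 \<le> B (\<theta> b) \<psi>"
          proof -
            have "0 \<le> a_lo * (L2_norm D (\<theta> b))\<^sup>2 + (L2_norm dD (Tr (\<theta> b)))\<^sup>2" using a_lo_pos by simp
            then show ?thesis unfolding \<psi>_def using B_diagonal[OF in_WV[OF \<theta>X(2)]] by linarith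
          qed
          ultimately show ?thesis using B_\<theta>[OF tT pt \<psi>(1)] by linarith
        qed
        then show "indicator {a<..<b} t * (- (K * \<epsilon> * n b)) \<le> indicator {a<..<b} t * (B (\<phi> t) \<psi> - B (\<phi>h t) \<psi>)"
          by (cases "t \<in> {a<..<b}") auto
      qed
      then have "(LINT t|I. indicator {a<..<b} t * (- (K * \<epsilon> * n b))) \<le> (LINT t|I. indicator {a<..<b} t * (B (\<phi> t) \<psi> - B (\<phi>h t) \<psi>))"
        using finite_measure.integrable_const[OF finite_interval_measure]
        by (intro integral_mono_AE indicator_integrable_mult Bi) auto
      moreover have "(LINT t|I. indicator {a<..<b} t * (- (K * \<epsilon> * n b))) = (b - a) * (- (K * \<epsilon> * n b))"
      proof -
        have "{max a 0<..<min b T} = {a<..<b}" using ab s' by auto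
        moreover have "measure I {a<..<b} = b - a"
          using ab s' by (subst measure_restrict_space) auto
        ultimately show ?thesis by simp
      qed
      ultimately have form: "- (LINT t|I. indicator {a<..<b} t * (B (\<phi> t) \<psi> - B (\<phi>h t) \<psi>)) \<le> (b - a) * (K * \<epsilon> * n b)"
        by linarith
      have "n b * n b = L2_inner D (\<theta> b) \<psi>"
        using L2_norm_power2[of D "\<theta> b"] by (simp add: n_def \<psi>_def power2_eq_square)
      also have "\<dots> = L2_inner D (\<theta> b - \<theta> a) \<psi> + L2_inner D (\<theta> a) \<psi>"
        using L2_inner_diff_left[OF \<theta>L(2,1) \<psi>(2)] by simp
      also have "L2_inner D (\<theta> b - \<theta> a) \<psi> = - (LINT t|I. indicator {a<..<b} t * (B (\<phi> t) \<psi> - B (\<phi>h t) \<psi>))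
          - (Pi_error \<psi> (\<phi> b) - Pi_error \<psi> (\<phi> a))"
        unfolding \<theta>_increment[OF \<psi>(2) abT ph] using galerkin_orthogonality[OF \<psi>(1) ab(1,2)] abT by simp
      finally have "n b * n b \<le> (b - a) * (K * \<epsilon> * n b) + \<bar>Pi_error \<psi> (\<phi> b) - Pi_error \<psi> (\<phi> a)\<bar> + L2_inner D (\<theta> a) \<psi>"
        using form by linarith
      also have "\<dots> \<le> (b - a) * (K * \<epsilon> * n b) + (\<Gamma> b - \<Gamma> a) * n b + n a * n b"
      proof (intro add_mono order_refl)
        have "L2_inner D (\<theta> a) \<psi> \<le> L2_norm D (\<theta> a) * L2_norm D \<psi>"
          using L2_Cauchy_Schwarz[OF \<theta>L(1) \<psi>(2)] by linarith
        then show "L2_inner D (\<theta> a) \<psi> \<le> n a * n b" by (simp add: \<psi>(3) n_def)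
        have "\<bar>Pi_error \<psi> (\<phi> b) - Pi_error \<psi> (\<phi> a)\<bar> \<le> (Cq * (LINT t|I. indicator {a<..<b} t * G t)) * n b"
          using ctrl[OF \<psi>(2) ab(1,2,3) ph] by (simp add: \<psi>(3) mult_ac)
        also have "\<dots> = (\<Gamma> b - \<Gamma> a) * n b" by (simp only: \<Gamma>d[OF ab(1,2)])
        finally show "\<bar>Pi_error \<psi> (\<phi> b) - Pi_error \<psi> (\<phi> a)\<bar> \<le> (\<Gamma> b - \<Gamma> a) * n b" .
      qed
      finally have q: "n b * n b \<le> (n a + (\<Gamma> b - \<Gamma> a) + (K * \<epsilon>) * (b - a)) * n b"
        by (simp add: algebra_simps)
      show "n b \<le> n a + (\<Gamma> b - \<Gamma> a) + (K * \<epsilon>) * (b - a)"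
      proof (cases "n b = 0")
        case True
        have "0 \<le> Cq * (LINT t|I. indicator {a<..<b} t * G t)"
          using Cq_pos G0 by (intro mult_nonneg_nonneg integral_nonneg_AE) auto
        then have "0 \<le> \<Gamma> b - \<Gamma> a" using \<Gamma>d[OF ab(1,2)] by linarith
        moreover have "0 \<le> (K * \<epsilon>) * (b - a)" using K(1) \<epsilon> ab by simp
        ultimately show ?thesis using True n0[of a] by linarith
      next
        case False
        then have "n b > 0" using n0[of b] by simp
        then show ?thesis using q by simp
      qed
    qed (use s s' in auto)
    then show ?thesis using \<phi>_initial(2) by (simp add: n_def mult_ac)
  qed
  have "n s \<le> \<Gamma> s - \<Gamma> 0" by (rule le_of_le_epsilon_mult[OF main]) (use K(1) s' in auto)
  also have "\<dots> = Cq * (LINT t|I. indicator {0<..<s} t * G t)" by (simp add: \<Gamma>_def)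
  finally have "ennreal (n s) \<le> ennreal (Cq * (LINT t|I. indicator {0<..<s} t * G t))" by (rule ennreal_leI)
  also have "\<dots> = ennreal Cq * ennreal (LINT t|I. indicator {0<..<s} t * G t)"
    using Cq_pos G0 by (intro ennreal_mult integral_nonneg_AE) auto
  finally show ?thesis unfolding eqG n_def .
qed

text \<open>If \<open>\<phi> s\<close> has no regular even part, or the integral diverges, the right hand side is infinite.\<close>

lemma error_estimate:
  assumes s: "s \<in> {0..T}"
  shows "ennreal (V_norm R (\<phi> s - \<phi>h s)) \<le>
    ennreal Cq * (best_error R Wh Vh \<phi>0 + best_error R Wh Vh (\<phi> s) + (\<integral>\<^sup>+t. E t \<partial>lebesgue_on {0..s}))"
proof -
  define b where "b = best_error R Wh Vh (\<phi> s)"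
  define J where "J = (\<integral>\<^sup>+t. E t \<partial>lebesgue_on {0..s})"
  have "ennreal (V_norm R (\<phi> s - \<phi>h s)) \<le> ennreal Cq * (b + J)"
  proof (cases "\<phi> s \<in> WV \<and> J < \<infinity>")
    case False
    then have "b + J = \<infinity>" using best_error_infinite[of "\<phi> s"] by (auto simp: b_def less_top)
    then show ?thesis using Cq_pos by (simp only: infinity_ennreal_def) (simp add: ennreal_mult_top del: ennreal_add_eq_top)
  next
    case True
    then have W: "\<phi> s \<in> WV" and J: "J < \<infinity>" by auto
    have L: "Pi_h (\<phi> s) \<in> L2_space D" "\<phi>h s \<in> L2_space D"
      using in_WV[OF Pi_h(1)[OF W]] in_WV[OF \<phi>h_Xh[OF s]] WV_L2(1) by blast+
    have "V_norm R (\<phi> s - \<phi>h s) \<le> L2_norm D (\<phi> s - Pi_h (\<phi> s)) + L2_norm D (\<theta> s)"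
      unfolding V_norm_def \<theta>_def by (rule L2_norm_triangle_diff[OF WV_L2(1)[OF W] L])
    then have "ennreal (V_norm R (\<phi> s - \<phi>h s)) \<le> ennreal (L2_norm D (\<phi> s - Pi_h (\<phi> s)) + L2_norm D (\<theta> s))"
      by (rule ennreal_leI)
    also have "\<dots> = ennreal (L2_norm D (\<phi> s - Pi_h (\<phi> s))) + ennreal (L2_norm D (\<theta> s))"
      by (rule ennreal_plus) (rule L2_norm_nonneg)+
    also have "\<dots> \<le> ennreal Cq * b + ennreal Cq * J"
      unfolding b_def J_def by (intro add_mono best_error_bound W \<theta>_bound s J[unfolded J_def])
    finally show ?thesis by (simp add: distrib_left)
  qed
  also have "\<dots> \<le> ennreal Cq * (best_error R Wh Vh \<phi>0 + b + J)"
    by (intro mult_left_mono add_right_mono) auto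
  finally show ?thesis unfolding b_def J_def .
qed

end

text \<open>The constant is \<open>Cq\<close> written in terms of the bounds of the coefficients. For nonpositive \<open>a_lo\<close>
  there are no admissible coefficients, and any positive constant will do.\<close>

theorem theorem6p5:
  fixes R :: "point set" and T kbar a_lo a_up :: real
  assumes "lipschitz_domain R" and "T > 0"
  shows "\<exists>C::real. C > 0 \<and>
    (\<forall>k \<sigma>t Wh Vh q \<phi>0 \<phi> d\<phi> \<phi>h d\<phi>h.
       coefficients R k \<sigma>t \<and> assumption_A1 R k kbar \<and> assumption_A2 R k \<sigma>t a_lo a_up \<and>
       assumption_A3 R Wh Vh \<and> assumption_A4 R Wh Vh \<and>
       L2_time T (V_space R) (V_norm R) q \<and> \<phi>0 \<in> WV_space R \<and>
       solves_IP R T k \<sigma>t q \<phi>0 \<phi> d\<phi> \<and> solves_SD R T k \<sigma>t Wh Vh q \<phi>0 \<phi>h d\<phi>h \<longrightarrow>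
       (\<forall>t\<in>{0..T}.
          ennreal (V_norm R (\<phi> t - \<phi>h t)) \<le>
            ennreal C * (best_error R Wh Vh \<phi>0 + best_error R Wh Vh (\<phi> t)
              + (\<integral>\<^sup>+ t'. best_error_dual R Wh Vh (d\<phi> t') \<partial>lebesgue_on {0..t}))))"
proof -
  define m where "m = \<bar>a_up\<bar> + 2 * \<bar>kbar\<bar> * measure (surface_measure S2) S2"
  define C where "C = (if a_lo > 0 then 1 + sqrt ((2 * m + 1)\<^sup>2 / a_lo\<^sup>2 + (2 * m + 3) / a_lo) else 1)"
  have "0 \<le> m" by (simp add: m_def)
  then have "C > 0" by (auto simp: C_def intro!: add_pos_nonneg)
  moreover have "ennreal (V_norm R (\<phi> t - \<phi>h t)) \<le>
            ennreal C * (best_error R Wh Vh \<phi>0 + best_error R Wh Vh (\<phi> t)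
              + (\<integral>\<^sup>+ t'. best_error_dual R Wh Vh (d\<phi> t') \<partial>lebesgue_on {0..t}))"
    if "coefficients R k \<sigma>t \<and> assumption_A1 R k kbar \<and> assumption_A2 R k \<sigma>t a_lo a_up \<and>
       assumption_A3 R Wh Vh \<and> assumption_A4 R Wh Vh \<and>
       L2_time T (V_space R) (V_norm R) q \<and> \<phi>0 \<in> WV_space R \<and>
       solves_IP R T k \<sigma>t q \<phi>0 \<phi> d\<phi> \<and> solves_SD R T k \<sigma>t Wh Vh q \<phi>0 \<phi>h d\<phi>h" and "t \<in> {0..T}"
    for k \<sigma>t Wh Vh q \<phi>0 \<phi> d\<phi> \<phi>h d\<phi>h t
  proof -
    interpret semidiscrete R k \<sigma>t kbar a_lo a_up Wh Vh T q \<phi> \<phi>h d\<phi>h \<phi>0 d\<phi>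
      by unfold_locales (use assms that(1) in auto)
    have "C = Cq" using a_lo_pos by (simp add: C_def Cq_def stab_def Mc_def area_def m_def)
    then show ?thesis using error_estimate[OF that(2)] by simp
  qed
  ultimately show ?thesis by blast
qed

end
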